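(* Let $K$ be a compact set with $$K\subset(\alpha_-,\alpha_+)\setminus[\beta_-,\beta_+],$$ and suppose that $$\{(\lambda(\alpha),\mu(\alpha)):\ \alpha\in K\}\subset \operatorname{int}\mathcal A_1 .$$ Suppose in addition that, if $0\in K$, then $$\mathbf P(\tau_1\ge n)=o\Big(\tfrac{1}{\sqrt n}e^{-nD(0)}\Big)\quad\text{as } n\to\infty .$$ Then for $x\in\mathbb Z$ and positive integers $n$ such that $\alpha:=\frac{x}{n}\in K$, $$\mathbf P(Z(n)=x)=\psi_1(\lambda(\alpha),\mu(\alpha))\,\frac{C(\alpha)}{\sqrt n}\,e^{-nD(\alpha)}\,I(\alpha)\,(1+\varepsilon_n(x)),$$ where the remainder satisfies $$\lim_{n\to\infty}\ \sup_{x\in\mathbb Z,\ \frac{x}{n}\in K}|\varepsilon_n(x)|=0 .$$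
   Context: **The process.** Let $\xi=(\tau,\zeta)$ and $\xi_1=(\tau_1,\zeta_1)$ be random vectors in $\mathbb R^2$ with $\tau>0$, $\tau_1\ge 0$. Let $\xi_k=(\tau_k,\zeta_k)$, $k\ge1$, be independent, where $\xi_1$ is the given vector and each $\xi_k$, $k\ge2$, has the law of $\xi$; put $\tau_0=\zeta_0=0$, $T_n=\sum_{k=0}^n\tau_k$, $Z_n=\sum_{k=0}^n\zeta_k$. Put $\nu(0)=0$, $\nu(t)=\max\{k\ge0: T_k<t\}$ for $t>0$, and $Z(t)=Z_{\nu(t)}$ (compound renewal process). **Standing assumptions.** Cramér: $\mathbf E e^{\delta|\xi_1|}<\infty$ and $\mathbf E e^{\delta|\xi|}<\infty$ for some $\delta>0$. Arithmetic: $\mathbf P(\xi_1\in\mathbb Z^2)=1$, and the characteristic function $f(u)=\mathbf E e^{i\langle u,\xi\rangle}$ satisfies $f(2\pi u)=1$ for all $u\in\mathbb Z^2$ and $|f(2\pi u)|<1$ for all $u\in\mathbb R^2\setminus\mathbb Z^2$. **Transforms.** $\psi(\lambda,\mu)=\mathbf E e^{\lambda\tau+\mu\zeta}$, $\psi_1(\lambda,\mu)=\mathbf E e^{\lambda\tau_1+\mu\zeta_1}$, $A(\lambda,\mu)=\ln\psi(\lambda,\mu)$, $\mathcal A=\{(\lambda,\mu):\psi(\lambda,\mu)<\infty\}$, $\mathcal A_1=\{(\lambda,\mu):\psi_1(\lambda,\mu)<\infty\}$; $\operatorname{int}$ denotes interior. $A'$ is the gradient of $A(\lambda,\mu)$.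 $$\Lambda(\theta,\alpha)=\sup_{(\lambda,\mu)}\{\lambda\theta+\mu\alpha-A(\lambda,\mu)\},$$ which is analytic on $\mathcal L=\{A'(\lambda,\mu):(\lambda,\mu)\in\operatorname{int}\mathcal A\}$; $\Lambda''$ is its Hessian matrix, $|\Lambda''|$ its determinant. **One-variable functions.** Let $\mathcal A_\mu=\{\lambda:(\lambda,\mu)\in\mathcal A\}$, $\mu^+=\sup\{\mu:\mathcal A_\mu\ne\emptyset\}$, $\mu^-=\inf\{\mu:\mathcal A_\mu\neq\emptyset\}$. For $\mu\in(\mu^-,\mu^+)$ define (the one-variable function $A(\mu)$ is distinguished from $A(\lambda,\mu)$ by its number of arguments) $$A(\mu)=-\sup\{\lambda: A(\lambda,\mu)\le0\},\qquad A^\infty(\mu)=-\sup\{\lambda:A(\lambda,\mu)<\infty\},$$ and set $A(\mu)=\infty$ for $\mu\notin[\mu^-,\mu^+]$ and $A(\mu^\pm)=\lim A(\mu)$ as $\mu\to\mu^\pm$ from inside. Let $\mu_-=\max\{\mu<0:A(\mu)=A^\infty(\mu)\}$, $\mu_+=\min\{\mu>0:A(\mu)=A^\infty(\mu)\}$, with the convention that $(\mu_-,\mu_+)$ is the largest open interval containing $0$, contained in $(\mu^-,\mu^+)$, on which $A^\infty(\mu)<A(\mu)$ (so $\mu_\pm=\pm\infty$ is possible). On $(\mu_-,\mu_+)$ the function $A(\mu)$ is analytic and $A'(\mu)$ is strictly increasing. Let $\alpha_\pm=\lim A'(\mu)$ as $\mu\to\mu_\pm$ from inside $(\mu_-,\mu_+)$.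 For $\alpha\in(\alpha_-,\alpha_+)$ let $\mu(\alpha)$ be the unique solution in $(\mu_-,\mu_+)$ of $A'(\mu(\alpha))=\alpha$ and $\lambda(\alpha)=-A(\mu(\alpha))$. For $\alpha\in\mathbb R$ let $D(\alpha)=\sup_\mu\{\mu\alpha-A(\mu)\}$; for $\alpha\in(\alpha_-,\alpha_+)$, $D(\alpha)=\lambda(\alpha)+\alpha\mu(\alpha)$. **Excluded interval.** Let $\lambda_+=\sup\{\lambda:\mathbf E e^{\lambda\tau}<\infty\}$. $\beta_-$ and $\beta_+$ are the minimal and maximal solutions $\beta$ of $\lambda(\beta)=\lambda_+$; $[\beta_-,\beta_+]$ is empty if $\lambda_+>D(0)$, and $\beta_\pm=0$ if $\lambda_+=D(0)$ and $0\in(\alpha_-,\alpha_+)$. In all cases $(\alpha_-,\alpha_+)\setminus[\beta_-,\beta_+]$ is understood as $\{\alpha\in(\alpha_-,\alpha_+):\lambda(\alpha)<\lambda_+\}$. **Constants.** For $\theta>0$ with $\alpha/\theta\in(\alpha_-,\alpha_+)$ put $(\widehat\lambda,\widehat\mu)=(\lambda(\alpha/\theta),\mu(\alpha/\theta))$, $(\widehat\theta,\widehat\alpha)=A'(\widehat\lambda,\widehat\mu)$ (gradient of the two-variable $A$), $r_{\theta,\alpha}=\theta/\widehat\theta$, $\widehat\Lambda''=\Lambda''(\widehat\theta,\widehat\alpha)$, and $$C_H(\theta,\alpha)=\sqrt{\frac{r_{\theta,\alpha}}{2\pi}\,\frac{|\widehat\Lambda''|}{(\theta,\alpha)\widehat\Lambda''(\theta,\alpha)^\top}}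 .$$ Put $C(\alpha)=C_H(1,\alpha)$ and $I(\alpha)=\sum_{m=1}^\infty e^{\lambda(\alpha)m}\,\mathbf P(\tau\ge m)$. *)

theory Defs
  imports "HOL-Probability.Probability" "HOL-Library.Landau_Symbols"
begin

text \<open>Vectors of the plane are elements of \<open>real ^ 2\<close>: component 1 is the time coordinate
  (\<open>\<tau>\<close>, \<open>\<theta>\<close>, \<open>\<lambda>\<close>), component 2 the space coordinate (\<open>\<zeta>\<close>, \<open>\<alpha>\<close>, \<open>\<mu>\<close>).\<close>

abbreviation vec2 :: "real \<Rightarrow> real \<Rightarrow> real ^ 2" where
  "vec2 a b \<equiv> vector [a, b]"

definition int_lattice :: "(real ^ 2) set" where
  "int_lattice = {u. \<forall>i. u $ i \<in> \<int>}"


section \<open>The compound renewal process\<close>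

text \<open>\<open>X k\<close> is the vector \<open>\<xi>\<^sub>k\<close> for \<open>k \<ge> 1\<close>.  Since \<open>\<xi>\<^sub>0 = 0\<close>, the sums start at 1 and \<open>X 0\<close>
  is never used.\<close>

definition T_sum :: "(nat \<Rightarrow> 'a \<Rightarrow> real ^ 2) \<Rightarrow> nat \<Rightarrow> 'a \<Rightarrow> real" where
  "T_sum X n \<omega> = (\<Sum>k=1..n. X k \<omega> $ 1)"

definition Z_sum :: "(nat \<Rightarrow> 'a \<Rightarrow> real ^ 2) \<Rightarrow> nat \<Rightarrow> 'a \<Rightarrow> real" where
  "Z_sum X n \<omega> = (\<Sum>k=1..n. X k \<omega> $ 2)"

text \<open>For \<open>t > 0\<close> the set below contains 0, and it is almost surely finite.\<close>

definition renewal_count :: "(nat \<Rightarrow> 'a \<Rightarrow> real ^ 2) \<Rightarrow> real \<Rightarrow> 'a \<Rightarrow> nat" where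
  "renewal_count X t \<omega> = (if t > 0 then Max {k. T_sum X k \<omega> < t} else 0)"

definition Z_process :: "(nat \<Rightarrow> 'a \<Rightarrow> real ^ 2) \<Rightarrow> real \<Rightarrow> 'a \<Rightarrow> real" where
  "Z_process X t \<omega> = Z_sum X (renewal_count X t \<omega>) \<omega>"

definition char_fun2 :: "'a measure \<Rightarrow> ('a \<Rightarrow> real ^ 2) \<Rightarrow> real ^ 2 \<Rightarrow> complex" where
  "char_fun2 M Y u = (CLINT \<omega>|M. iexp (u \<bullet> Y \<omega>))"

locale arithmetic_compound_renewal = prob_space M
  for M :: "'a measure" +
  fixes \<xi> :: "'a \<Rightarrow> real ^ 2" and X :: "nat \<Rightarrow> 'a \<Rightarrow> real ^ 2"
  assumes xi_measurable: "\<xi> \<in> borel_measurable M"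
    and indep: "indep_vars (\<lambda>_. borel) X {1..}"
    and same_law: "\<And>k. k \<ge> 2 \<Longrightarrow> distr M borel (X k) = distr M borel \<xi>"
    and tau_pos: "AE \<omega> in M. \<xi> \<omega> $ 1 > 0"
    and tau1_nonneg: "AE \<omega> in M. X 1 \<omega> $ 1 \<ge> 0"
    and cramer: "\<exists>\<delta>>0. integrable M (\<lambda>\<omega>. exp (\<delta> * norm (X 1 \<omega>)))
                      \<and> integrable M (\<lambda>\<omega>. exp (\<delta> * norm (\<xi> \<omega>)))"
    and xi1_lattice: "AE \<omega> in M. X 1 \<omega> \<in> int_lattice"
    and char_eq_1: "\<And>u. u \<in> int_lattice \<Longrightarrow> char_fun2 M \<xi> ((2 * pi) *\<^sub>R u) = 1"
    and char_less_1: "\<And>u. u \<notin> int_lattice \<Longrightarrow> cmod (char_fun2 M \<xi> ((2 * pi) *\<^sub>R u)) < 1"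


section \<open>Transforms\<close>

definition psi :: "'a measure \<Rightarrow> ('a \<Rightarrow> real ^ 2) \<Rightarrow> real ^ 2 \<Rightarrow> ennreal" where
  "psi M Y w = (\<integral>\<^sup>+ \<omega>. ennreal (exp (w $ 1 * Y \<omega> $ 1 + w $ 2 * Y \<omega> $ 2)) \<partial>M)"

definition psi_dom :: "'a measure \<Rightarrow> ('a \<Rightarrow> real ^ 2) \<Rightarrow> (real ^ 2) set" where
  "psi_dom M Y = {w. psi M Y w < \<infinity>}"

text \<open>The function \<open>A = ln \<psi>\<close> of two variables, with \<open>ln \<infinity> = \<infinity>\<close> (and \<open>\<psi> > 0\<close> always).\<close>

definition A2 :: "'a measure \<Rightarrow> ('a \<Rightarrow> real ^ 2) \<Rightarrow> real ^ 2 \<Rightarrow> ereal" where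
  "A2 M \<xi> w = (if psi M \<xi> w < \<infinity> then ereal (ln (enn2real (psi M \<xi> w))) else \<infinity>)"

definition Lambda :: "'a measure \<Rightarrow> ('a \<Rightarrow> real ^ 2) \<Rightarrow> real ^ 2 \<Rightarrow> ereal" where
  "Lambda M \<xi> y = (SUP w. ereal (w $ 1 * y $ 1 + w $ 2 * y $ 2) - A2 M \<xi> w)"

definition gradient :: "(real ^ 2 \<Rightarrow> real) \<Rightarrow> real ^ 2 \<Rightarrow> real ^ 2" where
  "gradient f x = (THE g. GDERIV f x :> g)"

definition hessian :: "(real ^ 2 \<Rightarrow> real) \<Rightarrow> real ^ 2 \<Rightarrow> real ^ 2 ^ 2" where
  "hessian f x = jacobian (gradient f) (at x)"


section \<open>One-variable functions\<close>

definition A_section :: "'a measure \<Rightarrow> ('a \<Rightarrow> real ^ 2) \<Rightarrow> real \<Rightarrow> real set" where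
  "A_section M \<xi> \<mu> = {l. vec2 l \<mu> \<in> psi_dom M \<xi>}"

text \<open>\<open>mu_sup\<close>, \<open>mu_inf\<close> are \<open>\<mu>\<^sup>+\<close>, \<open>\<mu>\<^sup>-\<close>; \<open>mu_plus\<close>, \<open>mu_minus\<close> below are \<open>\<mu>\<^sub>+\<close>, \<open>\<mu>\<^sub>-\<close>.\<close>

definition mu_sup :: "'a measure \<Rightarrow> ('a \<Rightarrow> real ^ 2) \<Rightarrow> ereal" where
  "mu_sup M \<xi> = (SUP \<mu>\<in>{\<mu>. A_section M \<xi> \<mu> \<noteq> {}}. ereal \<mu>)"

definition mu_inf :: "'a measure \<Rightarrow> ('a \<Rightarrow> real ^ 2) \<Rightarrow> ereal" where
  "mu_inf M \<xi> = (INF \<mu>\<in>{\<mu>. A_section M \<xi> \<mu> \<noteq> {}}. ereal \<mu>)"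

definition A1_inner :: "'a measure \<Rightarrow> ('a \<Rightarrow> real ^ 2) \<Rightarrow> real \<Rightarrow> ereal" where
  "A1_inner M \<xi> \<mu> = - (SUP l\<in>{l. A2 M \<xi> (vec2 l \<mu>) \<le> 0}. ereal l)"

text \<open>The function \<open>A\<close> of one variable on the whole line.\<close>

definition A1 :: "'a measure \<Rightarrow> ('a \<Rightarrow> real ^ 2) \<Rightarrow> real \<Rightarrow> ereal" where
  "A1 M \<xi> \<mu> =
    (if mu_inf M \<xi> < ereal \<mu> \<and> ereal \<mu> < mu_sup M \<xi> then A1_inner M \<xi> \<mu>
     else if ereal \<mu> = mu_sup M \<xi> then Lim (at_left \<mu>) (A1_inner M \<xi>)
     else if ereal \<mu> = mu_inf M \<xi> then Lim (at_right \<mu>) (A1_inner M \<xi>)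
     else \<infinity>)"

definition A1_infty :: "'a measure \<Rightarrow> ('a \<Rightarrow> real ^ 2) \<Rightarrow> real \<Rightarrow> ereal" where
  "A1_infty M \<xi> \<mu> = - (SUP l\<in>{l. A2 M \<xi> (vec2 l \<mu>) < \<infinity>}. ereal l)"

text \<open>The interval \<open>(\<mu>\<^sub>-, \<mu>\<^sub>+)\<close>: the largest open interval around 0 inside \<open>(\<mu>\<^sup>-, \<mu>\<^sup>+)\<close> on which
  \<open>A\<^sup>\<infinity> < A\<close>.\<close>

definition mu_interval :: "'a measure \<Rightarrow> ('a \<Rightarrow> real ^ 2) \<Rightarrow> real set" where
  "mu_interval M \<xi> = \<Union>{J. open J \<and> is_interval J \<and> 0 \<in> J \<and>
      (\<forall>\<mu>\<in>J. mu_inf M \<xi> < ereal \<mu> \<and> ereal \<mu> < mu_sup M \<xi> \<and> A1_infty M \<xi> \<mu> < A1 M \<xi> \<mu>)}"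

definition mu_plus :: "'a measure \<Rightarrow> ('a \<Rightarrow> real ^ 2) \<Rightarrow> ereal" where
  "mu_plus M \<xi> = (SUP \<mu>\<in>mu_interval M \<xi>. ereal \<mu>)"

definition mu_minus :: "'a measure \<Rightarrow> ('a \<Rightarrow> real ^ 2) \<Rightarrow> ereal" where
  "mu_minus M \<xi> = (INF \<mu>\<in>mu_interval M \<xi>. ereal \<mu>)"

definition A1_deriv :: "'a measure \<Rightarrow> ('a \<Rightarrow> real ^ 2) \<Rightarrow> real \<Rightarrow> real" where
  "A1_deriv M \<xi> = deriv (\<lambda>\<mu>. real_of_ereal (A1 M \<xi> \<mu>))"

text \<open>Both the end points \<open>\<mu>\<^sub>\<plusminus>\<close> and the limits of \<open>A'\<close> there may be infinite, so the limits are
  taken in the extended reals.\<close>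

definition alpha_plus :: "'a measure \<Rightarrow> ('a \<Rightarrow> real ^ 2) \<Rightarrow> ereal" where
  "alpha_plus M \<xi> = Lim (at_left (mu_plus M \<xi>)) (\<lambda>m. ereal (A1_deriv M \<xi> (real_of_ereal m)))"

definition alpha_minus :: "'a measure \<Rightarrow> ('a \<Rightarrow> real ^ 2) \<Rightarrow> ereal" where
  "alpha_minus M \<xi> = Lim (at_right (mu_minus M \<xi>)) (\<lambda>m. ereal (A1_deriv M \<xi> (real_of_ereal m)))"

definition mu_of :: "'a measure \<Rightarrow> ('a \<Rightarrow> real ^ 2) \<Rightarrow> real \<Rightarrow> real" where
  "mu_of M \<xi> \<alpha> = (THE \<mu>. \<mu> \<in> mu_interval M \<xi> \<and> A1_deriv M \<xi> \<mu> = \<alpha>)"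

definition lambda_of :: "'a measure \<Rightarrow> ('a \<Rightarrow> real ^ 2) \<Rightarrow> real \<Rightarrow> real" where
  "lambda_of M \<xi> \<alpha> = - real_of_ereal (A1 M \<xi> (mu_of M \<xi> \<alpha>))"

definition D_fun :: "'a measure \<Rightarrow> ('a \<Rightarrow> real ^ 2) \<Rightarrow> real \<Rightarrow> ereal" where
  "D_fun M \<xi> \<alpha> = (SUP \<mu>. ereal (\<mu> * \<alpha>) - A1 M \<xi> \<mu>)"

definition lambda_plus :: "'a measure \<Rightarrow> ('a \<Rightarrow> real ^ 2) \<Rightarrow> ereal" where
  "lambda_plus M \<xi> = (SUP l\<in>{l. (\<integral>\<^sup>+ \<omega>. ennreal (exp (l * \<xi> \<omega> $ 1)) \<partial>M) < \<infinity>}. ereal l)"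

text \<open>The set \<open>(\<alpha>\<^sub>-, \<alpha>\<^sub>+) - [\<beta>\<^sub>-, \<beta>\<^sub>+]\<close>, which by convention stands for the set of those
  \<open>\<alpha> \<in> (\<alpha>\<^sub>-, \<alpha>\<^sub>+)\<close> with \<open>\<lambda>(\<alpha>) < \<lambda>\<^sub>+\<close>.\<close>

definition regular_range :: "'a measure \<Rightarrow> ('a \<Rightarrow> real ^ 2) \<Rightarrow> real set" where
  "regular_range M \<xi> = {\<alpha>. alpha_minus M \<xi> < ereal \<alpha> \<and> ereal \<alpha> < alpha_plus M \<xi>
      \<and> ereal (lambda_of M \<xi> \<alpha>) < lambda_plus M \<xi>}"


section \<open>Constants\<close>

definition C_H :: "'a measure \<Rightarrow> ('a \<Rightarrow> real ^ 2) \<Rightarrow> real \<Rightarrow> real \<Rightarrow> real" where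
  "C_H M \<xi> \<theta> \<alpha> =
    (let w = vec2 (lambda_of M \<xi> (\<alpha> / \<theta>)) (mu_of M \<xi> (\<alpha> / \<theta>));
         y = gradient (\<lambda>w. real_of_ereal (A2 M \<xi> w)) w;
         r = \<theta> / y $ 1;
         H = hessian (\<lambda>y. real_of_ereal (Lambda M \<xi> y)) y;
         v = vec2 \<theta> \<alpha>
     in sqrt (r / (2 * pi) * (det H / (v \<bullet> (H *v v)))))"

definition C_fun :: "'a measure \<Rightarrow> ('a \<Rightarrow> real ^ 2) \<Rightarrow> real \<Rightarrow> real" where
  "C_fun M \<xi> \<alpha> = C_H M \<xi> 1 \<alpha>"

definition I_fun :: "'a measure \<Rightarrow> ('a \<Rightarrow> real ^ 2) \<Rightarrow> real \<Rightarrow> real" where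
  "I_fun M \<xi> \<alpha> = (\<Sum>m. exp (lambda_of M \<xi> \<alpha> * real (Suc m)) * \<P>(\<omega> in M. \<xi> \<omega> $ 1 \<ge> real (Suc m)))"

end

theory Submission
  imports Defs
begin

text \<open>
  Write \<open>Z(n) = x\<close> as a sum over the number of renewals before \<open>n\<close> and over the time \<open>m\<close> from the last
  of them to \<open>n\<close>. For \<open>p = (\<lambda>(\<alpha>), \<mu>(\<alpha>))\<close>, which lies on the curve \<open>\<psi> = 1\<close>, multiplying by
  \<open>exp (\<lambda>(\<alpha>) n + \<mu>(\<alpha>) x)\<close> turns the probability into
  \<open>\<Sum>m. exp (\<lambda>(\<alpha>) m) P(\<tau> \<ge> m) R(n - m, x)\<close>, where \<open>R(y) = \<Sum>N. exp (p \<bullet> y) P(\<xi>_1 + \<dots> + \<xi>_(N+1) = y)\<close>,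
  plus the event that there was no renewal, which matters only for \<open>x = 0\<close>.

  The exponentially tilted point masses are Fourier integrals over the square \<open>[-pi, pi]^2\<close> of Laplace
  transforms at complex arguments, so no change of measure is needed. They satisfy a local limit theorem, and
  a further tilting by \<open>\<plusminus> \<eta> / sqrt (N + 1)\<close> gives an exponential majorant. The sum over \<open>N\<close> is then a
  Riemann sum of a Gaussian density restricted to a line. As \<open>\<lambda>(\<alpha>) < \<lambda>_+\<close>, the sum over \<open>m\<close> is dominated
  and yields \<open>I(\<alpha>)\<close>.

  That \<open>p\<close> depends continuously on \<open>\<alpha>\<close>, and that the gradient of \<open>A\<close> at \<open>p\<close> is parallel to \<open>(1, \<alpha>)\<close>,
  comes from the convexity of \<open>\<psi> \<le> 1\<close> and its supporting lines; the Hessian of \<open>\<Lambda>\<close> is the inverse of the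
  tilted covariance matrix. Uniformity over a compact \<open>K\<close> follows because all these limits hold along
  arbitrary convergent sequences \<open>\<alpha>_j = x_j / n_j\<close> in \<open>K\<close>.
\<close>

text \<open>The Fourier bound alone gives point masses of order 1/(N+1), whose sum over N diverges;
  the extra tilt in the time direction supplies the missing decay. On the scale N = n/a + s sqrt n,
  with a the tilted mean of \<tau>, this decay is exponential only in sqrt |s|, because N itself may
  be as large as n |s|; that is still integrable in s. Since x/n is the slope of the tilted mean,
  (n, x) lies on the ray of that mean, so its deviation from N mean steps is a multiple of the mean,
  and a single number of the covariance survives, \<open>line_var\<close>. About sqrt n terms of
  order 1/n contribute, hence the rate 1/sqrt n. The factor sqrt n is shared between the two sums
  through n \<le> (n - m + 1)(m + 1): the renewal mass takes the first factor, the tail of \<tau>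
  the second. All estimates are made around a fixed point \<open>p\<^sub>0\<close> and are uniform
  in a ball around it, so that they can be used along a sequence of tilts converging to
  \<open>p\<^sub>0\<close>.\<close>

section \<open>Exponential moments and their dependence on the tilt\<close>

text \<open>Unnormalised, because the transform need not be 1 at the points where it is used. Values
  in a Banach space let one set of lemmas serve the transform, its complex version and the vector of
  first moments.\<close>

definition mom :: "'a measure \<Rightarrow> ('a \<Rightarrow> 'v::euclidean_space) \<Rightarrow> ('a \<Rightarrow> 'b::{banach,second_countable_topology}) \<Rightarrow> 'v \<Rightarrow> 'b"
  where "mom M Y F w = (\<integral>\<omega>. exp (w \<bullet> Y \<omega>) *\<^sub>R F \<omega> \<partial>M)"

text \<open>For positive \<rho> a quantitative way to say that \<open>w\<close> is interior to the
  domain of the transform: the slack \<rho> pays both for moving \<open>w\<close> and for polynomial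
  factors in Y.\<close>

definition exp_int :: "'a measure \<Rightarrow> ('a \<Rightarrow> 'v::euclidean_space) \<Rightarrow> 'v \<Rightarrow> real \<Rightarrow> bool"
  where "exp_int M Y w \<rho> \<longleftrightarrow> integrable M (\<lambda>\<omega>. exp (w \<bullet> Y \<omega> + \<rho> * norm (Y \<omega>)))"

lemma norm_integral_le_integral:
  fixes f :: "'a \<Rightarrow> 'b::{banach,second_countable_topology}"
  assumes "integrable M f" "integrable M g" "\<And>x. x \<in> space M \<Longrightarrow> norm (f x) \<le> g x"
  shows "norm (\<integral>x. f x \<partial>M) \<le> (\<integral>x. g x \<partial>M)"
  by (rule order_trans[OF integral_norm_bound integral_mono]) (use assms in auto)

text \<open>The norm is at most the dimension times the largest coordinate in modulus, so its
  exponential is dominated by one of the summands. Thus integrability at finitely many points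
  controls the exponential of the whole norm.\<close>

lemma exp_norm_le_sum_Basis:
  fixes y :: "'v::euclidean_space"
  assumes "c \<ge> 0"
  shows "exp (c * norm y) \<le> (\<Sum>b\<in>Basis. exp ((c * DIM('v)) * (y \<bullet> b)) + exp (- (c * DIM('v)) * (y \<bullet> b)))"
proof -
  obtain b where b: "b \<in> Basis" "\<And>i. i \<in> Basis \<Longrightarrow> \<bar>y \<bullet> i\<bar> \<le> \<bar>y \<bullet> b\<bar>"
  proof -
    define m where "m = Max ((\<lambda>i. \<bar>y \<bullet> i\<bar>) ` Basis)"
    have "m \<in> (\<lambda>i. \<bar>y \<bullet> i\<bar>) ` Basis" unfolding m_def by (rule Max_in) auto
    then obtain b where "b \<in> Basis" "m = \<bar>y \<bullet> b\<bar>" by auto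
    moreover have "\<bar>y \<bullet> i\<bar> \<le> m" if "i \<in> Basis" for i
      unfolding m_def using that by (intro Max_ge) auto
    ultimately show ?thesis using that by auto
  qed
  have "norm y \<le> (\<Sum>i\<in>Basis. \<bar>y \<bullet> i\<bar>)" by (rule norm_le_l1)
  also have "\<dots> \<le> (\<Sum>i\<in>(Basis::'v set). \<bar>y \<bullet> b\<bar>)" by (rule sum_mono) (rule b)
  finally have "norm y \<le> DIM('v) * \<bar>y \<bullet> b\<bar>" by simp
  then have "c * norm y \<le> c * DIM('v) * \<bar>y \<bullet> b\<bar>" using assms
    by (simp add: mult_left_mono mult.assoc)
  then have "exp (c * norm y) \<le> exp (c * DIM('v) * \<bar>y \<bullet> b\<bar>)" by simp
  also have "\<dots> \<le> exp ((c * DIM('v)) * (y \<bullet> b)) + exp (- (c * DIM('v)) * (y \<bullet> b))"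
    by (cases "y \<bullet> b \<ge> 0") (auto simp: abs_if)
  also have "\<dots> \<le> (\<Sum>b\<in>Basis. exp ((c * DIM('v)) * (y \<bullet> b)) + exp (- (c * DIM('v)) * (y \<bullet> b)))"
    by (rule member_le_sum) (use b in \<open>auto intro: add_nonneg_nonneg\<close>)
  finally show ?thesis .
qed

text \<open>By Cauchy-Schwarz, moving the tilt by a distance d costs at most d of the slack.\<close>

lemma exp_int_mono:
  assumes [measurable]: "Y \<in> borel_measurable M" and "exp_int M Y w \<rho>" "dist w' w + \<sigma> \<le> \<rho>"
  shows "exp_int M Y w' \<sigma>"
  unfolding exp_int_def
proof (rule Bochner_Integration.integrable_bound)
  show "integrable M (\<lambda>\<omega>. exp (w \<bullet> Y \<omega> + \<rho> * norm (Y \<omega>)))" using assms by (simp add: exp_int_def)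
  have "w' \<bullet> y + \<sigma> * norm y \<le> w \<bullet> y + \<rho> * norm y" for y
  proof -
    have "(w' - w) \<bullet> y \<le> dist w' w * norm y" by (metis dist_norm norm_cauchy_schwarz)
    moreover have "(dist w' w + \<sigma>) * norm y \<le> \<rho> * norm y" using assms by (intro mult_right_mono) auto
    ultimately show ?thesis by (simp add: inner_diff_left algebra_simps)
  qed
  then show "AE x in M. norm (exp (w' \<bullet> Y x + \<sigma> * norm (Y x))) \<le> norm (exp (w \<bullet> Y x + \<rho> * norm (Y x)))"
    by simp
qed simp

lemma exp_int_interior:
  fixes Y :: "'a \<Rightarrow> 'v::euclidean_space"
  assumes [measurable]: "Y \<in> borel_measurable M"
    and "w \<in> interior {w. integrable M (\<lambda>\<omega>. exp (w \<bullet> Y \<omega>))}"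
  shows "\<exists>\<rho>>0. exp_int M Y w \<rho>"
proof -
  obtain r where r: "r > 0" "cball w r \<subseteq> {w. integrable M (\<lambda>\<omega>. exp (w \<bullet> Y \<omega>))}"
    using assms(2) by (auto simp: mem_interior_cball)
  \<comment> \<open>The dimension factor of \<open>exp_norm_le_sum_Basis\<close> turns \<rho> back
    into r, so the bounding terms are transforms at w + r b and w - r b, which still lie in the
    ball.\<close>
  define \<rho> where "\<rho> = r / DIM('v)"
  have \<rho>: "\<rho> > 0" "\<rho> * DIM('v) = r" using r by (auto simp: \<rho>_def)
  have int: "integrable M (\<lambda>\<omega>. exp ((w + s *\<^sub>R b) \<bullet> Y \<omega>))" if "b \<in> Basis" "\<bar>s\<bar> = r" for b s
  proof -
    have "w + s *\<^sub>R b \<in> cball w r" using that by (auto simp: dist_norm)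
    then show ?thesis using r by auto
  qed
  have "exp_int M Y w \<rho>" unfolding exp_int_def
  proof (rule Bochner_Integration.integrable_bound)
    show "integrable M (\<lambda>\<omega>. \<Sum>b\<in>Basis. exp ((w + r *\<^sub>R b) \<bullet> Y \<omega>) + exp ((w + (- r) *\<^sub>R b) \<bullet> Y \<omega>))"
      using r by (intro Bochner_Integration.integrable_sum Bochner_Integration.integrable_add int) auto
    have "exp (w \<bullet> Y x + \<rho> * norm (Y x)) \<le> (\<Sum>b\<in>Basis. exp ((w + r *\<^sub>R b) \<bullet> Y x) + exp ((w + (- r) *\<^sub>R b) \<bullet> Y x))" for x
    proof -
      have "exp (w \<bullet> Y x + \<rho> * norm (Y x)) \<le> exp (w \<bullet> Y x) * (\<Sum>b\<in>Basis. exp (r * (Y x \<bullet> b)) + exp (- r * (Y x \<bullet> b)))"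
        using exp_norm_le_sum_Basis[of \<rho> "Y x"] \<rho> by (simp add: exp_add)
      also have "\<dots> = (\<Sum>b\<in>Basis. exp ((w + r *\<^sub>R b) \<bullet> Y x) + exp ((w + (- r) *\<^sub>R b) \<bullet> Y x))"
        unfolding sum_distrib_left
        by (intro sum.cong refl) (simp add: distrib_left exp_add[symmetric] inner_add_right inner_diff_right inner_commute[of _ "Y x"])
      finally show ?thesis .
    qed
    then show "AE x in M. norm (exp (w \<bullet> Y x + \<rho> * norm (Y x))) \<le> norm (\<Sum>b\<in>Basis. exp ((w + r *\<^sub>R b) \<bullet> Y x) + exp ((w + (- r) *\<^sub>R b) \<bullet> Y x))"
      by (intro AE_I2) (simp, smt (verit) sum_nonneg exp_ge_zero)
  qed simp
  with \<rho> show ?thesis by blast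
qed

lemma exp_int_imp_interior:
  assumes [measurable]: "Y \<in> borel_measurable M" and "exp_int M Y w \<rho>" "\<rho> > 0"
  shows "w \<in> interior {w. integrable M (\<lambda>\<omega>. exp (w \<bullet> Y \<omega>))}"
  unfolding mem_interior
proof (intro exI conjI subsetI)
  fix w' assume "w' \<in> ball w \<rho>"
  then have "exp_int M Y w' 0" using assms by (intro exp_int_mono[OF assms(1,2)]) (auto simp: dist_commute)
  then show "w' \<in> {w. integrable M (\<lambda>\<omega>. exp (w \<bullet> Y \<omega>))}" by (simp add: exp_int_def)
qed fact

lemma mom_integrable:
  fixes F :: "'a \<Rightarrow> 'b::{banach,second_countable_topology}"
  assumes [measurable]: "Y \<in> borel_measurable M" "F \<in> borel_measurable M"
    and "exp_int M Y w \<rho>" "\<And>\<omega>. norm (F \<omega>) \<le> C * exp (\<rho> * norm (Y \<omega>))"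
  shows "integrable M (\<lambda>\<omega>. exp (w \<bullet> Y \<omega>) *\<^sub>R F \<omega>)"
proof (rule Bochner_Integration.integrable_bound)
  show "integrable M (\<lambda>\<omega>. C * exp (w \<bullet> Y \<omega> + \<rho> * norm (Y \<omega>)))" using assms by (simp add: exp_int_def)
  have "exp (w \<bullet> Y x) * norm (F x) \<le> \<bar>C * exp (w \<bullet> Y x + \<rho> * norm (Y x))\<bar>" for x
    using mult_left_mono[OF assms(4)[of x], of "exp (w \<bullet> Y x)"]
    by (intro order_trans[OF _ abs_ge_self]) (simp add: exp_add mult_ac)
  then show "AE x in M. norm (exp (w \<bullet> Y x) *\<^sub>R F x) \<le> norm (C * exp (w \<bullet> Y x + \<rho> * norm (Y x)))"
    by simp
qed simp

text \<open>Dominated convergence with both the tilt and the integrand varying; the gap between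
  \<sigma> and \<rho> absorbs the movement of the tilt. \<open>F\<close> depends on the index
  because later integrands are centred at a moving mean.\<close>

lemma mom_tendsto:
  fixes F :: "nat \<Rightarrow> 'a \<Rightarrow> 'b::{banach,second_countable_topology}"
  assumes Y[measurable]: "Y \<in> borel_measurable M" and F[measurable]: "\<And>j. F j \<in> borel_measurable M" "G \<in> borel_measurable M"
    and "exp_int M Y w \<rho>" "\<sigma> < \<rho>"
    and bd: "\<And>j \<omega>. norm (F j \<omega>) \<le> C * exp (\<sigma> * norm (Y \<omega>))"
    and lim: "\<And>\<omega>. (\<lambda>j. F j \<omega>) \<longlonglongrightarrow> G \<omega>" and w: "v \<longlonglongrightarrow> w"
  shows "(\<lambda>j. mom M Y (F j) (v j)) \<longlonglongrightarrow> mom M Y G w"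
proof -
  have "eventually (\<lambda>j. dist (v j) w < \<rho> - \<sigma>) sequentially" using w assms by (simp add: tendsto_iff)
  then obtain n where n: "\<And>j. j \<ge> n \<Longrightarrow> dist (v j) w < \<rho> - \<sigma>" by (auto simp: eventually_sequentially)
  have "(\<lambda>j. mom M Y (F (j+n)) (v (j+n))) \<longlonglongrightarrow> mom M Y G w"
    unfolding mom_def
  proof (rule integral_dominated_convergence)
    show "integrable M (\<lambda>\<omega>. C * exp (w \<bullet> Y \<omega> + \<rho> * norm (Y \<omega>)))" using assms by (simp add: exp_int_def)
    show "AE x in M. (\<lambda>i. exp (v (i + n) \<bullet> Y x) *\<^sub>R F (i + n) x) \<longlonglongrightarrow> exp (w \<bullet> Y x) *\<^sub>R G x"
      by (intro AE_I2 tendsto_intros LIMSEQ_ignore_initial_segment[OF lim] LIMSEQ_ignore_initial_segment[OF w])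
    show "AE x in M. norm (exp (v (i + n) \<bullet> Y x) *\<^sub>R F (i + n) x) \<le> C * exp (w \<bullet> Y x + \<rho> * norm (Y x))" for i
    proof (rule AE_I2)
      fix x
      have C: "C \<ge> 0" using order_trans[OF norm_ge_zero bd[of 0 x]] by (simp add: zero_le_mult_iff)
      have "(v (i+n) - w) \<bullet> Y x \<le> dist (v (i+n)) w * norm (Y x)" by (metis dist_norm norm_cauchy_schwarz)
      also have "\<dots> \<le> (\<rho> - \<sigma>) * norm (Y x)" using n[of "i+n"] by (intro mult_right_mono) auto
      finally have *: "v (i+n) \<bullet> Y x + \<sigma> * norm (Y x) \<le> w \<bullet> Y x + \<rho> * norm (Y x)"
        by (simp add: inner_diff_left algebra_simps)
      have "norm (exp (v (i + n) \<bullet> Y x) *\<^sub>R F (i + n) x) \<le> exp (v (i + n) \<bullet> Y x) * (C * exp (\<sigma> * norm (Y x)))"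
        using mult_left_mono[OF bd] by simp
      also have "\<dots> = C * exp (v (i+n) \<bullet> Y x + \<sigma> * norm (Y x))" by (simp add: exp_add)
      also have "\<dots> \<le> C * exp (w \<bullet> Y x + \<rho> * norm (Y x))" using * C by (intro mult_left_mono) auto
      finally show "norm (exp (v (i + n) \<bullet> Y x) *\<^sub>R F (i + n) x) \<le> C * exp (w \<bullet> Y x + \<rho> * norm (Y x))" .
    qed
  qed simp_all
  then show ?thesis by (rule LIMSEQ_offset)
qed

lemma mom_isCont:
  assumes "Y \<in> borel_measurable M" and "F \<in> borel_measurable M"
    and "exp_int M Y w \<rho>" "\<sigma> < \<rho>" "\<And>\<omega>. norm (F \<omega>) \<le> C * exp (\<sigma> * norm (Y \<omega>))"
  shows "isCont (mom M Y F) w"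
  unfolding continuous_at_sequentially comp_def
  using mom_tendsto[OF assms(1,2,2,3,4), of C] assms(5) by auto

lemma exp_remainder: "\<bar>exp x - 1 - x\<bar> \<le> x\<^sup>2 * exp \<bar>x\<bar>" for x :: real
proof -
  have "\<exists>t. \<bar>t\<bar> \<le> \<bar>x\<bar> \<and> exp x = (\<Sum>m<2. x ^ m / fact m) + exp t / fact 2 * x ^ 2"
    using Maclaurin_exp_le[of x 2] by simp
  then obtain t where t: "\<bar>t\<bar> \<le> \<bar>x\<bar>" "exp x = 1 + x + exp t / 2 * x\<^sup>2"
    by (auto simp: numeral_2_eq_2)
  have "exp t \<le> exp \<bar>x\<bar>" using t by simp
  then have "exp t / 2 * x\<^sup>2 \<le> x\<^sup>2 * exp \<bar>x\<bar>"
    by (smt (verit) mult.commute mult_right_mono zero_le_power2 field_sum_of_halves exp_gt_zero)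
  then show ?thesis using t(2) by simp
qed

text \<open>The device by which powers of a norm are absorbed into a little exponential
  slack.\<close>

lemma le_exp_div: "c > 0 \<Longrightarrow> x \<le> exp (c * x) / c" for x c :: real
  using exp_ge_add_one_self[of "c*x"] by (simp add: pos_le_divide_eq mult.commute del: exp_ge_add_one_self)

text \<open>Differentiation under the integral: the second-order remainder is at most |h|^2 times an
  integrable majorant, so the error of the difference quotient is of order |h|.\<close>

lemma mom_deriv:
  fixes F :: "'a \<Rightarrow> 'b::{banach,second_countable_topology}" and Y :: "'a \<Rightarrow> 'v::euclidean_space"
  assumes Y[measurable]: "Y \<in> borel_measurable M" and F[measurable]: "F \<in> borel_measurable M"
    and E: "exp_int M Y w \<rho>" "\<sigma> < \<rho>" and bd: "\<And>\<omega>. norm (F \<omega>) \<le> C * exp (\<sigma> * norm (Y \<omega>))"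
  shows "(mom M Y F has_derivative (\<lambda>h. mom M Y (\<lambda>\<omega>. (h \<bullet> Y \<omega>) *\<^sub>R F \<omega>) w)) (at w)"
proof -
  \<comment> \<open>The gap is split into three equal parts: two absorb the square of the norm of Y,
    the third absorbs the exponential factor of the remainder.\<close>
  define \<delta> where "\<delta> = (\<rho> - \<sigma>) / 3"
  have \<delta>: "\<delta> > 0" "\<sigma> + 3 * \<delta> = \<rho>" using E(2) by (simp_all add: \<delta>_def field_simps)
  have C: "C \<ge> 0" if "\<omega> \<in> space M" for \<omega> using order_trans[OF norm_ge_zero bd[of \<omega>]] by (simp add: zero_le_mult_iff)
  \<comment> \<open>The bound \<open>bd\<close> holds at every element of the type, so any one of
    them shows that \<open>C\<close> is nonnegative.\<close>
  have Cg: "C * exp z \<ge> 0" for z using order_trans[OF norm_ge_zero bd[of undefined]] by (simp add: zero_le_mult_iff)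
  have inth: "integrable M (\<lambda>\<omega>. exp (w \<bullet> Y \<omega>) *\<^sub>R (h \<bullet> Y \<omega>) *\<^sub>R F \<omega>)" for h
  proof (rule mom_integrable[OF Y _ E(1)])
    fix \<omega>
    have "norm ((h \<bullet> Y \<omega>) *\<^sub>R F \<omega>) \<le> (norm h * norm (Y \<omega>)) * (C * exp (\<sigma> * norm (Y \<omega>)))"
      unfolding norm_scaleR by (intro mult_mono bd) (auto simp: Cauchy_Schwarz_ineq2)
    also have "\<dots> \<le> (norm h * (exp ((3*\<delta>) * norm (Y \<omega>)) / (3*\<delta>))) * (C * exp (\<sigma> * norm (Y \<omega>)))"
      using \<delta> by (intro mult_right_mono mult_left_mono le_exp_div Cg) auto
    also have "\<dots> = (norm h / (3*\<delta>) * C) * exp (\<rho> * norm (Y \<omega>))"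
      unfolding \<delta>(2)[symmetric] by (simp add: exp_add algebra_simps)
    finally show "norm ((h \<bullet> Y \<omega>) *\<^sub>R F \<omega>) \<le> (norm h / (3*\<delta>) * C) * exp (\<rho> * norm (Y \<omega>))" .
  qed simp
  have int0: "integrable M (\<lambda>\<omega>. exp (v \<bullet> Y \<omega>) *\<^sub>R F \<omega>)" if "dist v w \<le> \<delta>" for v
    by (rule mom_integrable[OF Y F exp_int_mono[OF Y E(1), of v \<sigma>] bd]) (use that \<delta> in auto)
  define N where "N = (\<integral>\<omega>. exp (w \<bullet> Y \<omega> + \<rho> * norm (Y \<omega>)) \<partial>M)"
  have intN: "integrable M (\<lambda>\<omega>. exp (w \<bullet> Y \<omega> + \<rho> * norm (Y \<omega>)))" using E(1) by (simp add: exp_int_def)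
  show ?thesis
  proof (rule has_derivativeI_sandwich[OF \<delta>(1)])
    show "bounded_linear (\<lambda>h. mom M Y (\<lambda>\<omega>. (h \<bullet> Y \<omega>) *\<^sub>R F \<omega>) w)"
    proof (rule linear_conv_bounded_linear[THEN iffD1], rule linearI)
      fix h h' show "mom M Y (\<lambda>\<omega>. ((h + h') \<bullet> Y \<omega>) *\<^sub>R F \<omega>) w = mom M Y (\<lambda>\<omega>. (h \<bullet> Y \<omega>) *\<^sub>R F \<omega>) w + mom M Y (\<lambda>\<omega>. (h' \<bullet> Y \<omega>) *\<^sub>R F \<omega>) w"
        unfolding mom_def Bochner_Integration.integral_add[OF inth inth, symmetric]
        by (simp add: inner_add_left scaleR_add_left scaleR_add_right)
    next
      fix r h show "mom M Y (\<lambda>\<omega>. ((r *\<^sub>R h) \<bullet> Y \<omega>) *\<^sub>R F \<omega>) w = r *\<^sub>R mom M Y (\<lambda>\<omega>. (h \<bullet> Y \<omega>) *\<^sub>R F \<omega>) w"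
        unfolding mom_def integral_scaleR_right[symmetric] by (simp add: mult_ac)
    qed
  next
    fix v assume v: "v \<noteq> w" "dist v w < \<delta>"
    define h where "h = v - w"
    have h: "norm h > 0" "norm h < \<delta>" using v by (auto simp: h_def dist_norm)
    have "mom M Y F v - mom M Y F w - mom M Y (\<lambda>\<omega>. (h \<bullet> Y \<omega>) *\<^sub>R F \<omega>) w
      = (\<integral>\<omega>. exp (v \<bullet> Y \<omega>) *\<^sub>R F \<omega> - exp (w \<bullet> Y \<omega>) *\<^sub>R F \<omega> - exp (w \<bullet> Y \<omega>) *\<^sub>R (h \<bullet> Y \<omega>) *\<^sub>R F \<omega> \<partial>M)"
      unfolding mom_def using v int0[of v] int0[of w] inth[of h] \<delta> by simp
    also have "norm \<dots> \<le> (\<integral>\<omega>. ((norm h)\<^sup>2 * C / \<delta>\<^sup>2) * exp (w \<bullet> Y \<omega> + \<rho> * norm (Y \<omega>)) \<partial>M)"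
    proof (rule norm_integral_le_integral)
      fix \<omega> assume \<omega>: "\<omega> \<in> space M"
      define x y where "x = h \<bullet> Y \<omega>" and "y = norm (Y \<omega>)"
      have x: "\<bar>x\<bar> \<le> norm h * y" unfolding x_def y_def by (rule Cauchy_Schwarz_ineq2)
      have y: "y \<ge> 0" by (simp add: y_def)
      have "exp (v \<bullet> Y \<omega>) *\<^sub>R F \<omega> - exp (w \<bullet> Y \<omega>) *\<^sub>R F \<omega> - exp (w \<bullet> Y \<omega>) *\<^sub>R (h \<bullet> Y \<omega>) *\<^sub>R F \<omega>
        = (exp (w \<bullet> Y \<omega>) * (exp x - 1 - x)) *\<^sub>R F \<omega>"
        unfolding x_def h_def by (simp add: inner_diff_left algebra_simps exp_diff)
      then have "norm (exp (v \<bullet> Y \<omega>) *\<^sub>R F \<omega> - exp (w \<bullet> Y \<omega>) *\<^sub>R F \<omega> - exp (w \<bullet> Y \<omega>) *\<^sub>R (h \<bullet> Y \<omega>) *\<^sub>R F \<omega>)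
        = exp (w \<bullet> Y \<omega>) * \<bar>exp x - 1 - x\<bar> * norm (F \<omega>)" by (simp add: abs_mult)
      also have "\<dots> \<le> exp (w \<bullet> Y \<omega>) * ((norm h)\<^sup>2 * (exp (2 * \<delta> * y) / \<delta>\<^sup>2) * exp (\<delta> * y)) * (C * exp (\<sigma> * y))"
      proof (intro mult_mono mult_left_mono bd[of \<omega>, folded y_def])
        have "\<bar>exp x - 1 - x\<bar> \<le> x\<^sup>2 * exp \<bar>x\<bar>" by (rule exp_remainder)
        also have "\<dots> \<le> ((norm h)\<^sup>2 * (exp (2 * \<delta> * y) / \<delta>\<^sup>2)) * exp (\<delta> * y)"
        proof (rule mult_mono)
          have "x\<^sup>2 \<le> (norm h * y)\<^sup>2" using x by (metis abs_le_square_iff abs_of_nonneg norm_ge_zero mult_nonneg_nonneg y)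
          also have "\<dots> \<le> (norm h * (exp (\<delta> * y) / \<delta>))\<^sup>2"
            using y \<delta> by (intro power_mono mult_left_mono le_exp_div) auto
          also have "\<dots> = (norm h)\<^sup>2 * (exp (2 * \<delta> * y) / \<delta>\<^sup>2)"
            by (simp add: power_mult_distrib power_divide exp_double[symmetric] mult.assoc)
          finally show "x\<^sup>2 \<le> (norm h)\<^sup>2 * (exp (2 * \<delta> * y) / \<delta>\<^sup>2)" .
          have "norm h * y \<le> \<delta> * y" using h y by (intro mult_right_mono) auto
          then show "exp \<bar>x\<bar> \<le> exp (\<delta> * y)" using x by simp
        qed auto
        finally show "\<bar>exp x - 1 - x\<bar> \<le> (norm h)\<^sup>2 * (exp (2 * \<delta> * y) / \<delta>\<^sup>2) * exp (\<delta> * y)" .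
      qed auto
      also have "\<dots> = ((norm h)\<^sup>2 * C / \<delta>\<^sup>2) * exp (w \<bullet> Y \<omega> + \<rho> * y)"
        unfolding \<delta>(2)[symmetric] by (simp add: algebra_simps flip: exp_add)
      finally show "norm (exp (v \<bullet> Y \<omega>) *\<^sub>R F \<omega> - exp (w \<bullet> Y \<omega>) *\<^sub>R F \<omega> - exp (w \<bullet> Y \<omega>) *\<^sub>R (h \<bullet> Y \<omega>) *\<^sub>R F \<omega>)
         \<le> (norm h)\<^sup>2 * C / \<delta>\<^sup>2 * exp (w \<bullet> Y \<omega> + \<rho> * norm (Y \<omega>))" by (simp add: y_def)
    qed (use int0[of v] int0[of w] inth[of h] v \<delta> intN in auto)
    also have "\<dots> = (norm h)\<^sup>2 * C / \<delta>\<^sup>2 * N" by (simp add: N_def)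
    finally have "norm (mom M Y F v - mom M Y F w - mom M Y (\<lambda>\<omega>. (h \<bullet> Y \<omega>) *\<^sub>R F \<omega>) w) / norm h \<le> norm h * (C / \<delta>\<^sup>2 * N)"
      using h by (simp add: pos_divide_le_eq power2_eq_square mult_ac)
    then show "norm (mom M Y F v - mom M Y F w - mom M Y (\<lambda>\<omega>. ((v - w) \<bullet> Y \<omega>) *\<^sub>R F \<omega>) w) / norm (v - w) \<le> norm (v - w) * (C / \<delta>\<^sup>2 * N)"
      by (simp add: h_def)
  next
    have "((\<lambda>v. norm (v - w) * (C / \<delta>\<^sup>2 * N)) \<longlongrightarrow> norm (w - w) * (C / \<delta>\<^sup>2 * N)) (at w)" by (intro tendsto_intros)
    then show "((\<lambda>v. norm (v - w) * (C / \<delta>\<^sup>2 * N)) \<longlongrightarrow> 0) (at w)" by simp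
  qed
qed

section \<open>Weighted characteristic functions and aperiodicity\<close>

text \<open>The first-order term vanishes by \<open>mean\<close>, and the third absolute moment
  controls the error. The weight may have any total mass, which makes the expansion usable directly
  for exponential weights.\<close>

lemma weighted_iexp_taylor2:
  fixes W X :: "'a \<Rightarrow> real"
  assumes [measurable]: "W \<in> borel_measurable M" "X \<in> borel_measurable M"
    and W: "\<And>\<omega>. W \<omega> \<ge> 0" "integrable M W" "integrable M (\<lambda>\<omega>. W \<omega> * X \<omega>)"
      "integrable M (\<lambda>\<omega>. W \<omega> * (X \<omega>)\<^sup>2)" "integrable M (\<lambda>\<omega>. W \<omega> * \<bar>X \<omega>\<bar> ^ 3)"
    and mean: "(\<integral>\<omega>. W \<omega> * X \<omega> \<partial>M) = 0"
  shows "cmod ((CLINT \<omega>|M. W \<omega> *\<^sub>R iexp (X \<omega>)) - of_real ((\<integral>\<omega>. W \<omega> \<partial>M) - (\<integral>\<omega>. W \<omega> * (X \<omega>)\<^sup>2 \<partial>M) / 2))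
     \<le> (\<integral>\<omega>. W \<omega> * \<bar>X \<omega>\<bar> ^ 3 \<partial>M) / 6"
proof -
  have i: "integrable M (\<lambda>\<omega>. W \<omega> *\<^sub>R iexp (X \<omega>))"
    by (rule Bochner_Integration.integrable_bound[OF W(2)]) (auto simp: W)
  have ci: "integrable M (\<lambda>\<omega>. complex_of_real (W \<omega>))" "integrable M (\<lambda>\<omega>. complex_of_real (W \<omega> * X \<omega>))"
    "integrable M (\<lambda>\<omega>. complex_of_real (W \<omega> * (X \<omega>)\<^sup>2))"
    using W by (auto intro!: integrable_of_real simp del: of_real_mult)
  have eq: "(CLINT \<omega>|M. W \<omega> *\<^sub>R iexp (X \<omega>)) - of_real ((\<integral>\<omega>. W \<omega> \<partial>M) - (\<integral>\<omega>. W \<omega> * (X \<omega>)\<^sup>2 \<partial>M) / 2)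
     = (CLINT \<omega>|M. W \<omega> *\<^sub>R iexp (X \<omega>) - (of_real (W \<omega>) + \<i> * of_real (W \<omega> * X \<omega>) - of_real (W \<omega> * (X \<omega>)\<^sup>2) / 2))"
    using i ci mean by (simp add: integral_complex_of_real del: of_real_mult)
  also have "cmod \<dots> \<le> (\<integral>\<omega>. (W \<omega> * \<bar>X \<omega>\<bar> ^ 3) / 6 \<partial>M)"
  proof (rule norm_integral_le_integral)
    fix \<omega>
    have "W \<omega> *\<^sub>R iexp (X \<omega>) - (of_real (W \<omega>) + \<i> * of_real (W \<omega> * X \<omega>) - of_real (W \<omega> * (X \<omega>)\<^sup>2) / 2)
      = W \<omega> *\<^sub>R (iexp (X \<omega>) - (\<Sum>k\<le>2. (\<i> * X \<omega>) ^ k / fact k))"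
      by (simp add: scaleR_conv_of_real numeral_2_eq_2 power2_eq_square algebra_simps)
    also have "norm \<dots> = W \<omega> * cmod (iexp (X \<omega>) - (\<Sum>k\<le>2. (\<i> * X \<omega>) ^ k / fact k))" by (simp add: W)
    also have "\<dots> \<le> W \<omega> * (\<bar>X \<omega>\<bar> ^ Suc 2 / fact (Suc 2))"
      by (rule mult_left_mono[OF iexp_approx1 W(1)])
    also have "\<dots> = (W \<omega> * \<bar>X \<omega>\<bar> ^ 3) / 6" by (simp add: fact_numeral eval_nat_numeral)
    finally show "norm (W \<omega> *\<^sub>R iexp (X \<omega>) - (of_real (W \<omega>) + \<i> * of_real (W \<omega> * X \<omega>) - of_real (W \<omega> * (X \<omega>)\<^sup>2) / 2))
      \<le> (W \<omega> * \<bar>X \<omega>\<bar> ^ 3) / 6" .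
  qed (use i ci W in auto)
  finally show ?thesis by simp
qed

text \<open>The equality case of the triangle inequality: after rotation of the integral to the
  positive axis, G (1 - Re (z e^(i X))) is nonnegative with integral at most 0, hence zero almost
  everywhere, and a unit complex number with real part 1 is 1.\<close>

lemma weighted_iexp_norm_eq:
  fixes G X :: "'a \<Rightarrow> real"
  assumes [measurable]: "X \<in> borel_measurable M"
    and G: "\<And>\<omega>. G \<omega> > 0" "integrable M G" and pos: "(\<integral>\<omega>. G \<omega> \<partial>M) > 0"
    and eq: "cmod (CLINT \<omega>|M. G \<omega> *\<^sub>R iexp (X \<omega>)) \<ge> (\<integral>\<omega>. G \<omega> \<partial>M)"
  shows "\<exists>z. AE \<omega> in M. iexp (X \<omega>) = z"
proof -
  have [measurable]: "G \<in> borel_measurable M" using G by auto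
  define g where "g = (CLINT \<omega>|M. G \<omega> *\<^sub>R iexp (X \<omega>))"
  have g: "cmod g > 0" using less_le_trans[OF pos eq] by (simp only: g_def)
  define z where "z = cnj g / cmod g"
  have z: "cmod z = 1" using g by (simp add: z_def norm_divide)
  have zg: "z * g = cmod g" using g
    by (simp add: z_def complex_norm_square[symmetric] mult.commute[of "cnj g"] power2_eq_square)
  have i: "integrable M (\<lambda>\<omega>. G \<omega> *\<^sub>R iexp (X \<omega>))"
    by (rule Bochner_Integration.integrable_bound[OF G(2)]) (use G in \<open>auto simp: less_imp_le\<close>)
  have i2: "integrable M (\<lambda>\<omega>. z * G \<omega> *\<^sub>R iexp (X \<omega>))" using integrable_mult_right[OF i, of z] by simp
  have i3: "integrable M (\<lambda>\<omega>. Re (z * G \<omega> *\<^sub>R iexp (X \<omega>)))" using i2 by (rule integrable_Re)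
  have le1: "Re (z * iexp (X \<omega>)) \<le> 1" for \<omega>
    using complex_Re_le_cmod[of "z * iexp (X \<omega>)"] z by (simp add: norm_mult)
  have nn: "G \<omega> - Re (z * G \<omega> *\<^sub>R iexp (X \<omega>)) \<ge> 0" for \<omega>
    using mult_left_mono[OF le1, of "G \<omega>" \<omega>] G(1)[of \<omega>] by (simp add: algebra_simps)
  have "(\<integral>\<omega>. G \<omega> - Re (z * G \<omega> *\<^sub>R iexp (X \<omega>)) \<partial>M) = (\<integral>\<omega>. G \<omega> \<partial>M) - Re (z * g)"
    unfolding g_def integral_mult_right_zero[symmetric]
    by (simp only: integral_Re[OF i2] Bochner_Integration.integral_diff[OF G(2) i3])
  also have "\<dots> \<le> 0" using eq by (simp add: zg g_def[symmetric])
  finally have "(\<integral>\<omega>. G \<omega> - Re (z * G \<omega> *\<^sub>R iexp (X \<omega>)) \<partial>M) = 0"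
    by (intro antisym Bochner_Integration.integral_nonneg nn) auto
  then have "AE \<omega> in M. G \<omega> - Re (z * G \<omega> *\<^sub>R iexp (X \<omega>)) = 0"
    by (subst (asm) integral_nonneg_eq_0_iff_AE) (use nn i3 G in auto)
  then have "AE \<omega> in M. iexp (X \<omega>) = cnj z"
  proof (rule AE_mp, intro AE_I2 impI)
    fix \<omega> assume "G \<omega> - Re (z * G \<omega> *\<^sub>R iexp (X \<omega>)) = 0"
    then have "G \<omega> * Re (z * iexp (X \<omega>)) = G \<omega> * 1" by (simp add: algebra_simps)
    then have re: "Re (z * iexp (X \<omega>)) = 1" using G(1)[of \<omega>] by (metis mult_cancel_left less_irrefl)
    moreover have "cmod (z * iexp (X \<omega>)) = 1" by (simp add: norm_mult z)
    ultimately have "z * iexp (X \<omega>) = 1"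
      by (metis complex_eq_iff cmod_power2 one_complex.simps add_cancel_right_right power_one power_eq_0_iff zero_neq_numeral)
    then have "(cnj z * z) * iexp (X \<omega>) = cnj z" by (simp add: mult.assoc)
    moreover have "cnj z * z = 1" using z by (simp add: complex_norm_square[symmetric] mult.commute[of "cnj z"])
    ultimately show "iexp (X \<omega>) = cnj z" by simp
  qed
  then show ?thesis by blast
qed

context prob_space begin

lemma char_fun2_AE_const:
  assumes "AE \<omega> in M. iexp (u \<bullet> Y \<omega>) = z" and [measurable]: "Y \<in> borel_measurable M"
  shows "cmod (char_fun2 M Y u) = 1"
proof -
  have "char_fun2 M Y u = (CLINT \<omega>|M. z)" unfolding char_fun2_def
    by (rule integral_cong_AE) (use assms in auto)
  also have "\<dots> = z" by (simp add: prob_space)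
  finally have "char_fun2 M Y u = z" .
  moreover obtain \<omega> where "iexp (u \<bullet> Y \<omega>) = z"
  proof (rule ccontr)
    assume *: "\<not> thesis"
    have "AE \<omega> in M. False" using assms(1) by eventually_elim (use * that in blast)
    then show False by simp
  qed
  ultimately show ?thesis by (metis norm_exp_i_times)
qed

text \<open>If \<open>e \<bullet> Y\<close> were constant, the characteristic function would have
  modulus 1 along the whole line through \<open>e\<close>, which also contains points outside the
  lattice.\<close>

lemma aperiodic_nondegenerate:
  fixes Y :: "'a \<Rightarrow> real ^ 2"
  assumes [measurable]: "Y \<in> borel_measurable M"
    and less: "\<And>u. u \<notin> int_lattice \<Longrightarrow> cmod (char_fun2 M Y ((2 * pi) *\<^sub>R u)) < 1"
    and e: "e \<noteq> 0"
  shows "\<not> (AE \<omega> in M. e \<bullet> Y \<omega> = c)"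
proof
  assume *: "AE \<omega> in M. e \<bullet> Y \<omega> = c"
  obtain i where i: "e $ i \<noteq> 0" using e by (metis vec_eq_iff zero_index)
  \<comment> \<open>Scaled so that one coordinate is 1/2, which keeps \<open>u\<close> off the
    lattice.\<close>
  define u where "u = (1 / (2 * e $ i)) *\<^sub>R e"
  have "u $ i = 1 / 2" using i by (simp add: u_def)
  have u: "u \<notin> int_lattice"
  proof
    assume "u \<in> int_lattice"
    then have "u $ i \<in> \<int>" by (auto simp: int_lattice_def)
    then obtain k :: int where "u $ i = of_int k" by (auto elim: Ints_cases)
    then have "real_of_int (2 * k) = of_int 1" using \<open>u $ i = 1 / 2\<close> by simp
    then have "2 * k = 1" by (rule of_int_eq_iff[THEN iffD1])
    then show False by presburger
  qed
  define t where "t = 2 * pi / (2 * e $ i)"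
  have ue: "(2 * pi) *\<^sub>R u = t *\<^sub>R e" by (simp add: u_def t_def)
  have "AE \<omega> in M. iexp (((2 * pi) *\<^sub>R u) \<bullet> Y \<omega>) = iexp (t * c)"
    using * unfolding ue by eventually_elim simp
  then have "cmod (char_fun2 M Y ((2 * pi) *\<^sub>R u)) = 1" by (rule char_fun2_AE_const) simp
  then show False using less[OF u] by simp
qed

text \<open>Equality would force e^(i u Y) to be almost surely constant; this does not depend on the
  positive weight, so the unweighted modulus would be 1 as well. On the square a nonzero
  \<open>u\<close> is 2 pi times a vector with coordinates of modulus at most 1/2, never a lattice
  point.\<close>

lemma aperiodic_weighted_strict:
  fixes Y :: "'a \<Rightarrow> real ^ 2"
  assumes [measurable]: "Y \<in> borel_measurable M"
    and less: "\<And>u. u \<notin> int_lattice \<Longrightarrow> cmod (char_fun2 M Y ((2 * pi) *\<^sub>R u)) < 1"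
    and G: "\<And>\<omega>. G \<omega> > 0" "integrable M G" "(\<integral>\<omega>. G \<omega> \<partial>M) > 0"
    and u: "u \<noteq> 0" "\<And>i. \<bar>u $ i\<bar> \<le> pi"
  shows "cmod (CLINT \<omega>|M. G \<omega> *\<^sub>R iexp (u \<bullet> Y \<omega>)) < (\<integral>\<omega>. G \<omega> \<partial>M)"
proof (rule ccontr)
  assume "\<not> ?thesis"
  then obtain z where z: "AE \<omega> in M. iexp (u \<bullet> Y \<omega>) = z"
    using weighted_iexp_norm_eq[of "\<lambda>\<omega>. u \<bullet> Y \<omega>" M G] G by auto
  then have 1: "cmod (char_fun2 M Y u) = 1" by (rule char_fun2_AE_const) simp
  define v where "v = (1 / (2 * pi)) *\<^sub>R u"
  have uv: "u = (2 * pi) *\<^sub>R v" by (simp add: v_def)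
  obtain i where i: "u $ i \<noteq> 0" using u(1) by (metis vec_eq_iff zero_index)
  have "v $ i \<notin> \<int>"
  proof
    assume "v $ i \<in> \<int>"
    then obtain k where k: "v $ i = of_int k" by (auto elim: Ints_cases)
    have "\<bar>v $ i\<bar> \<le> 1 / 2" using u(2)[of i] by (simp add: v_def abs_mult field_simps)
    then have "\<bar>k\<bar> < 1" using k by linarith
    then show False using k i by (simp add: v_def)
  qed
  then have "v \<notin> int_lattice" by (auto simp: int_lattice_def)
  from less[OF this] 1 show False by (simp add: uv)
qed

text \<open>Under the weight exp (- R |y|) every moment about every centre has a bounded integrand,
  hence is finite for any law of Y. \<open>Suc k\<close> keeps the division legitimate at k =
  0.\<close>

lemma exp_weight_bound:
  fixes y a :: "'v::euclidean_space"
  assumes "R > 0"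
  shows "exp (- R * norm y) * norm (y - a) ^ k \<le> exp (R * norm a) * (real (Suc k) / R) ^ k"
proof -
  define \<delta> where "\<delta> = R / real (Suc k)"
  have \<delta>: "\<delta> > 0" "real k * \<delta> \<le> R" using assms by (auto simp: \<delta>_def field_simps)
  have "norm (y - a) ^ k \<le> (exp (\<delta> * norm (y - a)) / \<delta>) ^ k"
    by (intro power_mono le_exp_div \<delta>) auto
  also have "\<dots> = exp (real k * \<delta> * norm (y - a)) * (real (Suc k) / R) ^ k"
  proof -
    have "(exp (\<delta> * norm (y - a)) / \<delta>) ^ k = exp (\<delta> * norm (y - a)) ^ k * (1 / \<delta>) ^ k" by (simp add: power_divide)
    also have "exp (\<delta> * norm (y - a)) ^ k = exp (real k * \<delta> * norm (y - a))" by (simp add: exp_of_nat_mult[symmetric] mult.assoc)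
    also have "1 / \<delta> = real (Suc k) / R" using assms by (simp add: \<delta>_def)
    finally show ?thesis .
  qed
  also have "\<dots> \<le> exp (R * (norm y + norm a)) * (real (Suc k) / R) ^ k"
    using assms \<delta> by (intro mult_right_mono iffD2[OF exp_le_cancel_iff] mult_mono norm_triangle_ineq4) auto
  finally have "exp (- R * norm y) * norm (y - a) ^ k \<le> exp (- R * norm y) * (exp (R * (norm y + norm a)) * (real (Suc k) / R) ^ k)"
    by (rule mult_left_mono) simp
  also have "\<dots> = exp (R * norm a) * (real (Suc k) / R) ^ k"
    by (simp add: mult.assoc[symmetric] exp_add[symmetric] algebra_simps)
  finally show ?thesis .
qed


text \<open>Lower bounds for the weights \<open>exp (p \<bullet> Y)\<close> that are uniform in \<open>p\<close> are obtained by comparing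
  them with the single weight \<open>exp (- R |Y|)\<close>.\<close>

lemma aperiodic_quadratic_near_0:
  fixes Y :: "'a \<Rightarrow> real ^ 2"
  assumes [measurable]: "Y \<in> borel_measurable M"
    and less: "\<And>u. u \<notin> int_lattice \<Longrightarrow> cmod (char_fun2 M Y ((2 * pi) *\<^sub>R u)) < 1"
    and R: "R > 0"
  defines "G \<equiv> \<lambda>\<omega>. exp (- R * norm (Y \<omega>))"
  shows "\<exists>c r. c > 0 \<and> r > 0 \<and> (\<forall>u. norm u \<le> r \<longrightarrow>
      cmod (CLINT \<omega>|M. G \<omega> *\<^sub>R iexp (u \<bullet> Y \<omega>)) \<le> (\<integral>\<omega>. G \<omega> \<partial>M) - c * (norm u)\<^sup>2)"
proof -
  have [measurable]: "G \<in> borel_measurable M" by (simp add: G_def)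
  have G: "G \<omega> > 0" for \<omega> by (simp add: G_def)
  have intb: "integrable M (\<lambda>\<omega>. G \<omega> * norm (Y \<omega> - a) ^ k)" for a k
    by (rule integrable_const_bound[where B = "exp (R * norm a) * (real (Suc k) / R) ^ k"])
      (use exp_weight_bound[OF R] in \<open>auto simp: G_def\<close>)
  have G_int: "integrable M G" using intb[of 0 0] by simp
  define g0 where "g0 = (\<integral>\<omega>. G \<omega> \<partial>M)"
  have g0: "g0 > 0"
  proof -
    have "g0 \<noteq> 0" unfolding g0_def
      by (subst integral_nonneg_eq_0_iff_AE[OF G_int]) (use G in \<open>auto simp: less_imp_le G_def\<close>)
    moreover have "g0 \<ge> 0" unfolding g0_def using G by (intro Bochner_Integration.integral_nonneg) (auto intro: less_imp_le)
    ultimately show ?thesis by simp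
  qed
  have GY_int: "integrable M (\<lambda>\<omega>. G \<omega> *\<^sub>R Y \<omega>)"
    by (rule Bochner_Integration.integrable_bound[OF intb[of 0 1]]) (use G in \<open>auto simp: less_imp_le\<close>)
  \<comment> \<open>The mean of Y under the normalised weight; centring there changes the integral
    only by a phase and removes the linear term.\<close>
  define a where "a = (1 / g0) *\<^sub>R (\<integral>\<omega>. G \<omega> *\<^sub>R Y \<omega> \<partial>M)"
  define Z where "Z \<omega> = Y \<omega> - a" for \<omega>
  have [measurable]: "Z \<in> borel_measurable M" unfolding Z_def by simp
  have GZ_int: "integrable M (\<lambda>\<omega>. G \<omega> *\<^sub>R Z \<omega>)"
    using GY_int G_int by (simp add: Z_def scaleR_diff_right)
  have mean0: "(\<integral>\<omega>. G \<omega> *\<^sub>R Z \<omega> \<partial>M) = 0"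
    using GY_int G_int g0 by (simp add: Z_def scaleR_diff_right a_def g0_def[symmetric])
  have int1: "integrable M (\<lambda>\<omega>. G \<omega> * (u \<bullet> Z \<omega>))" for u
    using integrable_inner_right[OF GZ_int, of u] by simp
  have mean1: "(\<integral>\<omega>. G \<omega> * (u \<bullet> Z \<omega>) \<partial>M) = 0" for u
    using integral_inner_right[OF GZ_int, of u] mean0 by simp
  have intk: "integrable M (\<lambda>\<omega>. G \<omega> * \<bar>u \<bullet> Z \<omega>\<bar> ^ k)" for u k
  proof (rule Bochner_Integration.integrable_bound)
    show "integrable M (\<lambda>\<omega>. norm u ^ k * (G \<omega> * norm (Y \<omega> - a) ^ k))" using intb by auto
    have "\<bar>u \<bullet> Z \<omega>\<bar> ^ k \<le> (norm u * norm (Y \<omega> - a)) ^ k" for \<omega>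
      unfolding Z_def by (intro power_mono Cauchy_Schwarz_ineq2) auto
    then show "AE \<omega> in M. norm (G \<omega> * \<bar>u \<bullet> Z \<omega>\<bar> ^ k) \<le> norm (norm u ^ k * (G \<omega> * norm (Y \<omega> - a) ^ k))"
      using G by (intro AE_I2) (auto simp: abs_mult power_mult_distrib mult.left_commute less_imp_le intro!: mult_left_mono)
  qed simp
  have bndk: "(\<integral>\<omega>. G \<omega> * \<bar>u \<bullet> Z \<omega>\<bar> ^ k \<partial>M) \<le> norm u ^ k * (\<integral>\<omega>. G \<omega> * norm (Y \<omega> - a) ^ k \<partial>M)" for u k
    unfolding integral_mult_right_zero[symmetric]
  proof (rule integral_mono[OF intk integrable_mult_right[OF intb]])
    fix \<omega>
    have "\<bar>u \<bullet> Z \<omega>\<bar> ^ k \<le> (norm u * norm (Y \<omega> - a)) ^ k"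
      unfolding Z_def by (intro power_mono Cauchy_Schwarz_ineq2) auto
    then show "G \<omega> * \<bar>u \<bullet> Z \<omega>\<bar> ^ k \<le> norm u ^ k * (G \<omega> * norm (Y \<omega> - a) ^ k)"
      using mult_left_mono[of _ _ "G \<omega>"] G[of \<omega>] by (fastforce simp: power_mult_distrib mult_ac)
  qed
  \<comment> \<open>The weighted variance form; aperiodicity makes it positive definite, and its
    minimum on the unit circle gives the quadratic constant.\<close>
  define q where "q u = (\<integral>\<omega>. G \<omega> * (u \<bullet> Z \<omega>)\<^sup>2 \<partial>M)" for u
  have int2: "integrable M (\<lambda>\<omega>. G \<omega> * (u \<bullet> Z \<omega>)\<^sup>2)" for u using intk[of u 2] by simp
  have q_pos: "q u > 0" if "u \<noteq> 0" for u
  proof -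
    have "q u \<noteq> 0"
    proof
      assume "q u = 0"
      then have "AE \<omega> in M. G \<omega> * (u \<bullet> Z \<omega>)\<^sup>2 = 0"
        unfolding q_def by (subst (asm) integral_nonneg_eq_0_iff_AE[OF int2]) (use G in \<open>auto simp: less_imp_le\<close>)
      then have "AE \<omega> in M. u \<bullet> Y \<omega> = u \<bullet> a"
        by eventually_elim (use G in \<open>auto simp: Z_def inner_diff_right less_le\<close>)
      then show False using aperiodic_nondegenerate[OF assms(1,2) that] by blast
    qed
    moreover have "q u \<ge> 0" unfolding q_def using G by (intro Bochner_Integration.integral_nonneg) (auto simp: less_imp_le)
    ultimately show ?thesis by simp
  qed
  have q_scale: "q (t *\<^sub>R u) = t\<^sup>2 * q u" for t u
    unfolding q_def integral_mult_right_zero[symmetric] by (simp add: power_mult_distrib mult.left_commute)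
  have q_cont: "continuous_on (sphere 0 1) q"
  proof -
    have i: "integrable M (\<lambda>\<omega>. G \<omega> *\<^sub>R (u \<bullet> Z \<omega>) *\<^sub>R Z \<omega>)" for u
    proof (rule Bochner_Integration.integrable_bound)
      show "integrable M (\<lambda>\<omega>. norm u * (G \<omega> * norm (Y \<omega> - a) ^ 2))" using intb by auto
      have "\<bar>u \<bullet> Z \<omega>\<bar> * norm (Z \<omega>) \<le> norm u * norm (Y \<omega> - a) * norm (Y \<omega> - a)" for \<omega>
        unfolding Z_def by (intro mult_right_mono Cauchy_Schwarz_ineq2) auto
      then show "AE \<omega> in M. norm (G \<omega> *\<^sub>R (u \<bullet> Z \<omega>) *\<^sub>R Z \<omega>) \<le> norm (norm u * (G \<omega> * norm (Y \<omega> - a) ^ 2))"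
        using G by (intro AE_I2) (auto simp: abs_mult power2_eq_square mult.left_commute mult.assoc less_imp_le intro!: mult_left_mono)
    qed simp
    have "q u = u \<bullet> (\<integral>\<omega>. G \<omega> *\<^sub>R (u \<bullet> Z \<omega>) *\<^sub>R Z \<omega> \<partial>M)" for u
      using integral_inner_right[OF i, of u u] by (simp add: q_def power2_eq_square mult.assoc)
    moreover have "linear (\<lambda>u. \<integral>\<omega>. G \<omega> *\<^sub>R (u \<bullet> Z \<omega>) *\<^sub>R Z \<omega> \<partial>M)"
    proof (rule linearI)
      fix r u
      have "G \<omega> *\<^sub>R ((r *\<^sub>R u) \<bullet> Z \<omega>) *\<^sub>R Z \<omega> = r *\<^sub>R (G \<omega> *\<^sub>R (u \<bullet> Z \<omega>) *\<^sub>R Z \<omega>)" for \<omega>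
        by (simp add: mult_ac)
      then show "(\<integral>\<omega>. G \<omega> *\<^sub>R ((r *\<^sub>R u) \<bullet> Z \<omega>) *\<^sub>R Z \<omega> \<partial>M) = r *\<^sub>R (\<integral>\<omega>. G \<omega> *\<^sub>R (u \<bullet> Z \<omega>) *\<^sub>R Z \<omega> \<partial>M)"
        by (simp only: integral_scaleR_right)
    qed (simp add: inner_add_left scaleR_add_left scaleR_add_right Bochner_Integration.integral_add[OF i i] del: scaleR_scaleR)
    ultimately show ?thesis
      by (simp only: cong: continuous_on_cong) (intro continuous_intros linear_continuous_on linear_conv_bounded_linear[THEN iffD1])
  qed
  obtain u0 where u0: "u0 \<in> sphere 0 1" "\<And>u. u \<in> sphere 0 1 \<Longrightarrow> q u0 \<le> q u"
    using continuous_attains_inf[OF compact_sphere _ q_cont] by (metis sphere_eq_empty not_one_less_zero)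
  define b where "b = q u0 / 4"
  have "u0 \<noteq> 0" using u0(1) by auto
  then have b: "b > 0" using q_pos[of u0] by (simp add: b_def)
  have q_ge: "q u \<ge> 4 * b * (norm u)\<^sup>2" for u
  proof (cases "u = 0")
    case False
    have "q u = (norm u)\<^sup>2 * q (u /\<^sub>R norm u)" using q_scale[of "norm u" "u /\<^sub>R norm u"] False by simp
    moreover have "q (u /\<^sub>R norm u) \<ge> 4 * b" using u0(2)[of "u /\<^sub>R norm u"] False by (simp add: b_def)
    ultimately show ?thesis using mult_right_mono[of "4 * b" "q (u /\<^sub>R norm u)" "(norm u)\<^sup>2"] by (simp add: mult.commute)
  qed (simp add: q_def)
  define K2 where "K2 = (\<integral>\<omega>. G \<omega> * norm (Y \<omega> - a) ^ 2 \<partial>M)"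
  define K3 where "K3 = (\<integral>\<omega>. G \<omega> * norm (Y \<omega> - a) ^ 3 \<partial>M)"
  have K: "K2 \<ge> 0" "K3 \<ge> 0" unfolding K2_def K3_def using G by (auto intro!: Bochner_Integration.integral_nonneg simp: less_imp_le)
  \<comment> \<open>The first bound keeps \<open>g0 - q u / 2\<close> nonnegative, so that it equals
    its modulus; the second keeps the cubic error below b |u|^2.\<close>
  define r where "r = min (sqrt (g0 / (K2 + 1))) (b / (K3 + 1))"
  have r: "r > 0" using g0 b K by (auto simp: r_def)
  show ?thesis
  proof (intro exI conjI allI impI)
    fix u :: "real^2" assume u: "norm u \<le> r"
    have "norm u \<le> sqrt (g0 / (K2 + 1))" using u by (simp add: r_def)
    then have "(norm u)\<^sup>2 \<le> (sqrt (g0 / (K2 + 1)))\<^sup>2" by (intro power_mono) auto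
    also have "\<dots> = g0 / (K2 + 1)" using g0 K by (intro real_sqrt_pow2) auto
    finally have "(norm u)\<^sup>2 * (K2 + 1) \<le> g0" using K by (simp add: pos_le_divide_eq)
    then have u2: "(norm u)\<^sup>2 * K2 \<le> g0" by (simp add: distrib_left) (smt (verit) zero_le_power2)
    have "norm u \<le> b / (K3 + 1)" using u by (simp add: r_def)
    then have "norm u * (K3 + 1) \<le> b" using K by (simp add: pos_le_divide_eq)
    then have "norm u * K3 \<le> b" by (simp add: distrib_left) (smt (verit) norm_ge_zero)
    then have u3: "norm u ^ 3 * K3 \<le> b * (norm u)\<^sup>2"
      using mult_right_mono[of "norm u * K3" b "(norm u)\<^sup>2"] by (simp add: power2_eq_square power3_eq_cube mult_ac)
    have "G \<omega> *\<^sub>R iexp (u \<bullet> Y \<omega>) = iexp (u \<bullet> a) * (G \<omega> *\<^sub>R iexp (u \<bullet> Z \<omega>))" for \<omega>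
      by (simp add: Z_def inner_diff_right exp_add[symmetric] algebra_simps)
    then have "cmod (CLINT \<omega>|M. G \<omega> *\<^sub>R iexp (u \<bullet> Y \<omega>)) = cmod (CLINT \<omega>|M. G \<omega> *\<^sub>R iexp (u \<bullet> Z \<omega>))"
      by (simp add: norm_mult del: mult_scaleR_right)
    also have "\<dots> \<le> cmod (of_real (g0 - q u / 2)) + (\<integral>\<omega>. G \<omega> * \<bar>u \<bullet> Z \<omega>\<bar> ^ 3 \<partial>M) / 6"
    proof -
      have "cmod ((CLINT \<omega>|M. G \<omega> *\<^sub>R iexp (u \<bullet> Z \<omega>)) - of_real (g0 - q u / 2)) \<le> (\<integral>\<omega>. G \<omega> * \<bar>u \<bullet> Z \<omega>\<bar> ^ 3 \<partial>M) / 6"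
        unfolding g0_def q_def
        by (rule weighted_iexp_taylor2[of G M "\<lambda>\<omega>. u \<bullet> Z \<omega>"]) (use G G_int int1 int2 intk[of u 3] mean1 in \<open>auto simp: less_imp_le\<close>)
      then show ?thesis using norm_triangle_sub[of "CLINT \<omega>|M. G \<omega> *\<^sub>R iexp (u \<bullet> Z \<omega>)" "of_real (g0 - q u / 2)"] by linarith
    qed
    also have "\<dots> \<le> (g0 - 2 * b * (norm u)\<^sup>2) + b * (norm u)\<^sup>2"
    proof (rule add_mono)
      have "q u \<le> (norm u)\<^sup>2 * K2" using bndk[of u 2] by (simp add: q_def K2_def)
      then have "g0 - q u / 2 \<ge> 0" using u2 g0 by simp
      then show "cmod (of_real (g0 - q u / 2)) \<le> g0 - 2 * b * (norm u)\<^sup>2" using q_ge[of u] by (simp del: of_real_diff)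
      have "(\<integral>\<omega>. G \<omega> * \<bar>u \<bullet> Z \<omega>\<bar> ^ 3 \<partial>M) \<le> norm u ^ 3 * K3" using bndk[of u 3] by (simp add: K3_def)
      moreover have "(\<integral>\<omega>. G \<omega> * \<bar>u \<bullet> Z \<omega>\<bar> ^ 3 \<partial>M) \<ge> 0" using G by (intro Bochner_Integration.integral_nonneg) (auto simp: less_imp_le)
      ultimately show "(\<integral>\<omega>. G \<omega> * \<bar>u \<bullet> Z \<omega>\<bar> ^ 3 \<partial>M) / 6 \<le> b * (norm u)\<^sup>2" using u3 by simp
    qed
    finally show "cmod (CLINT \<omega>|M. G \<omega> *\<^sub>R iexp (u \<bullet> Y \<omega>)) \<le> (\<integral>\<omega>. G \<omega> \<partial>M) - b * (norm u)\<^sup>2"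
      by (simp add: g0_def)
  qed (use b r in auto)
qed

text \<open>Near 0 the quadratic expansion applies; on the compact rest of the square the strict
  inequality gives a fixed gap, which also dominates a multiple of |u|^2 because the square is
  bounded.\<close>

lemma aperiodic_quadratic_bound_weight:
  fixes Y :: "'a \<Rightarrow> real ^ 2"
  assumes [measurable]: "Y \<in> borel_measurable M"
    and less: "\<And>u. u \<notin> int_lattice \<Longrightarrow> cmod (char_fun2 M Y ((2 * pi) *\<^sub>R u)) < 1"
    and R: "R > 0"
  defines "G \<equiv> \<lambda>\<omega>. exp (- R * norm (Y \<omega>))"
  shows "\<exists>c. c > 0 \<and> (\<forall>u. (\<forall>i. \<bar>u $ i\<bar> \<le> pi) \<longrightarrow>
      cmod (CLINT \<omega>|M. G \<omega> *\<^sub>R iexp (u \<bullet> Y \<omega>)) \<le> (\<integral>\<omega>. G \<omega> \<partial>M) - c * (norm u)\<^sup>2)"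
proof -
  have [measurable]: "G \<in> borel_measurable M" by (simp add: G_def)
  have G: "G \<omega> > 0" "G \<omega> \<le> 1" for \<omega> using R by (auto simp: G_def)
  have G_int: "integrable M G" by (rule integrable_const_bound[where B = 1]) (use G in \<open>auto simp: less_imp_le\<close>)
  define g0 where "g0 = (\<integral>\<omega>. G \<omega> \<partial>M)"
  define g where "g u = (CLINT \<omega>|M. G \<omega> *\<^sub>R iexp (u \<bullet> Y \<omega>))" for u
  have g0: "g0 > 0"
  proof -
    have "g0 \<noteq> 0" unfolding g0_def
      by (subst integral_nonneg_eq_0_iff_AE[OF G_int]) (use G in \<open>auto simp: less_imp_le G_def\<close>)
    moreover have "g0 \<ge> 0" unfolding g0_def using G by (intro Bochner_Integration.integral_nonneg) (auto intro: less_imp_le)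
    ultimately show ?thesis by simp
  qed
  obtain c1 r where c1: "c1 > 0" "r > 0" "\<And>u. norm u \<le> r \<Longrightarrow> cmod (g u) \<le> g0 - c1 * (norm u)\<^sup>2"
    using aperiodic_quadratic_near_0[OF assms(1,2) R] unfolding g_def g0_def G_def by blast
  define S where "S = {u :: real^2. (\<forall>i. \<bar>u $ i\<bar> \<le> pi)} \<inter> {u. norm u \<ge> r}"
  have Sbox: "{u :: real^2. (\<forall>i. \<bar>u $ i\<bar> \<le> pi)} = cbox (\<chi> i. - pi) (\<chi> i. pi)"
    by (auto simp: mem_box_cart abs_le_iff) (smt (verit))+
  have S: "compact S" unfolding S_def Sbox
    by (intro compact_Int_closed compact_cbox closed_Collect_le continuous_intros)
  have S_bd: "norm u \<le> 2 * pi" if "\<forall>i. \<bar>u $ i\<bar> \<le> pi" for u :: "real^2"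
    using order_trans[OF norm_le_l1_cart sum_mono[of UNIV "\<lambda>i. \<bar>u $ i\<bar>" "\<lambda>_. pi"]] that by simp
  have g_cont: "continuous_on UNIV g"
    unfolding continuous_on_eq_continuous_at[OF open_UNIV] continuous_at_sequentially comp_def
  proof (intro ballI allI impI)
    fix u :: "real^2" and v assume "v \<longlonglongrightarrow> u"
    then show "(\<lambda>n. g (v n)) \<longlonglongrightarrow> g u"
      unfolding g_def by (intro integral_dominated_convergence[where w = G] G_int)
        (use G in \<open>auto intro!: tendsto_intros AE_I2 simp: less_imp_le\<close>)
  qed
  have "\<exists>c. c > 0 \<and> (\<forall>u\<in>S. cmod (g u) \<le> g0 - c)"
  proof (cases "S = {}")
    case False
    have "continuous_on S (\<lambda>u. cmod (g u))" using g_cont by (intro continuous_intros) (auto intro: continuous_on_subset)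
    then obtain u0 where u0: "u0 \<in> S" "\<And>u. u \<in> S \<Longrightarrow> cmod (g u) \<le> cmod (g u0)"
      using continuous_attains_sup[OF S False] by blast
    have "cmod (g u0) < g0" unfolding g_def g0_def
      by (rule aperiodic_weighted_strict[OF assms(1,2)]) (use G G_int g0 u0(1) c1(2) in \<open>auto simp: S_def g0_def\<close>)
    then show ?thesis using u0 by (intro exI[of _ "g0 - cmod (g u0)"]) auto
  qed (auto intro: exI[of _ 1])
  then obtain c2 where c2: "c2 > 0" "\<And>u. u \<in> S \<Longrightarrow> cmod (g u) \<le> g0 - c2" by blast
  \<comment> \<open>4 pi^2 bounds the squared norm on the square, so the second entry turns the gap
    \<open>c2\<close> into a quadratic bound.\<close>
  define c where "c = min c1 (c2 / (4 * pi\<^sup>2))"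
  show ?thesis
  proof (intro exI conjI allI impI)
    show "c > 0" using c1 c2 by (simp add: c_def)
    fix u :: "real^2" assume u: "\<forall>i. \<bar>u $ i\<bar> \<le> pi"
    have "cmod (g u) \<le> g0 - c * (norm u)\<^sup>2"
    proof (cases "norm u \<le> r")
      case True
      have "c * (norm u)\<^sup>2 \<le> c1 * (norm u)\<^sup>2" by (intro mult_right_mono) (auto simp: c_def)
      then show ?thesis using c1(3)[OF True] by simp
    next
      case False
      have "(norm u)\<^sup>2 \<le> (2 * pi)\<^sup>2" using S_bd[OF u] by (intro power_mono) auto
      then have "c * (norm u)\<^sup>2 \<le> c2 / (4 * pi\<^sup>2) * (2 * pi)\<^sup>2" using c2 by (intro mult_mono) (auto simp: c_def)
      also have "\<dots> = c2" by (simp add: power_mult_distrib)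
      finally show ?thesis using c2(2)[of u] False u by (auto simp: S_def)
    qed
    then show "cmod (CLINT \<omega>|M. G \<omega> *\<^sub>R iexp (u \<bullet> Y \<omega>)) \<le> (\<integral>\<omega>. G \<omega> \<partial>M) - c * (norm u)\<^sup>2"
      by (simp add: g_def g0_def)
  qed
qed

text \<open>The deficit W (1 - Re (z e^(i u Y))) is monotone in the weight W, and for |p| \<le> R
  every weight exp (p Y) dominates exp (- R' |Y|). The deficit of the fixed weight is therefore a
  lower bound, and one \<open>c\<close> serves all p in the ball.\<close>

lemma aperiodic_quadratic_bound:
  fixes Y :: "'a \<Rightarrow> real ^ 2"
  assumes [measurable]: "Y \<in> borel_measurable M"
    and less: "\<And>u. u \<notin> int_lattice \<Longrightarrow> cmod (char_fun2 M Y ((2 * pi) *\<^sub>R u)) < 1"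
  shows "\<exists>c. c > 0 \<and> (\<forall>p u. norm p \<le> R \<longrightarrow> exp_int M Y p 0 \<longrightarrow> (\<forall>i. \<bar>u $ i\<bar> \<le> pi) \<longrightarrow>
      cmod (mom M Y (\<lambda>\<omega>. iexp (u \<bullet> Y \<omega>)) p) \<le> mom M Y (\<lambda>\<omega>. 1) p - c * (norm u)\<^sup>2)"
proof -
  define R' where "R' = max R 1"
  define G where "G \<omega> = exp (- R' * norm (Y \<omega>))" for \<omega>
  have R': "R' > 0" by (simp add: R'_def)
  have [measurable]: "G \<in> borel_measurable M" by (simp add: G_def[abs_def])
  have G: "G \<omega> > 0" "G \<omega> \<le> 1" for \<omega> using R' by (auto simp: G_def)
  have G_int: "integrable M G" by (rule integrable_const_bound[where B = 1]) (use G in \<open>auto simp: less_imp_le\<close>)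
  obtain c where c: "c > 0" "\<And>u. \<forall>i. \<bar>u $ i\<bar> \<le> pi \<Longrightarrow>
      cmod (CLINT \<omega>|M. G \<omega> *\<^sub>R iexp (u \<bullet> Y \<omega>)) \<le> (\<integral>\<omega>. G \<omega> \<partial>M) - c * (norm u)\<^sup>2"
    using aperiodic_quadratic_bound_weight[OF assms R'] unfolding G_def by blast
  show ?thesis
  proof (intro exI conjI allI impI)
    show "c > 0" by fact
    fix p u :: "real^2" assume p: "norm p \<le> R" and E: "exp_int M Y p 0" and u: "\<forall>i. \<bar>u $ i\<bar> \<le> pi"
    define W where "W \<omega> = exp (p \<bullet> Y \<omega>)" for \<omega>
    have [measurable]: "W \<in> borel_measurable M" by (simp add: W_def[abs_def])
    have W: "W \<omega> > 0" "integrable M W" for \<omega> using E by (auto simp: W_def[abs_def] exp_int_def)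
    have GW: "G \<omega> \<le> W \<omega>" for \<omega>
    proof -
      have "- (R' * norm (Y \<omega>)) \<le> - (norm p * norm (Y \<omega>))" using p by (auto simp: R'_def intro!: mult_right_mono)
      also have "\<dots> \<le> p \<bullet> Y \<omega>" using Cauchy_Schwarz_ineq2[of p "Y \<omega>"] by linarith
      finally show ?thesis by (simp add: G_def W_def)
    qed
    define L where "L = (CLINT \<omega>|M. W \<omega> *\<^sub>R iexp (u \<bullet> Y \<omega>))"
    define g where "g = (CLINT \<omega>|M. G \<omega> *\<^sub>R iexp (u \<bullet> Y \<omega>))"
    \<comment> \<open>\<open>z\<close> rotates the transform for \<open>W\<close> to the positive
      axis; the same \<open>z\<close> is used for \<open>G\<close>, so that the two deficits can be
      compared pointwise.\<close>
    obtain z where z: "cmod z = 1" "z * L = cmod L"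
    proof (cases "L = 0")
      case False
      show ?thesis
        by (rule that[of "cnj L / cmod L"]) (use False in \<open>auto simp: norm_divide complex_norm_square[symmetric] mult.commute[of "cnj L"] power2_eq_square\<close>)
    qed (use that[of 1] in auto)
    have iW: "integrable M (\<lambda>\<omega>. z * W \<omega> *\<^sub>R iexp (u \<bullet> Y \<omega>))" and iG: "integrable M (\<lambda>\<omega>. z * G \<omega> *\<^sub>R iexp (u \<bullet> Y \<omega>))"
      by (rule Bochner_Integration.integrable_bound[OF W(2)], use W z in \<open>auto simp: norm_mult less_imp_le\<close>)
        (rule Bochner_Integration.integrable_bound[OF G_int], use G z in \<open>auto simp: norm_mult less_imp_le\<close>)
    have le1: "Re (z * iexp (u \<bullet> Y \<omega>)) \<le> 1" for \<omega>
      using complex_Re_le_cmod[of "z * iexp (u \<bullet> Y \<omega>)"] z by (simp add: norm_mult)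
    have "(\<integral>\<omega>. G \<omega> - Re (z * G \<omega> *\<^sub>R iexp (u \<bullet> Y \<omega>)) \<partial>M) \<le> (\<integral>\<omega>. W \<omega> - Re (z * W \<omega> *\<^sub>R iexp (u \<bullet> Y \<omega>)) \<partial>M)"
    proof (rule integral_mono)
      fix \<omega>
      have "G \<omega> * (1 - Re (z * iexp (u \<bullet> Y \<omega>))) \<le> W \<omega> * (1 - Re (z * iexp (u \<bullet> Y \<omega>)))"
        using le1[of \<omega>] by (intro mult_right_mono GW) auto
      then show "G \<omega> - Re (z * G \<omega> *\<^sub>R iexp (u \<bullet> Y \<omega>)) \<le> W \<omega> - Re (z * W \<omega> *\<^sub>R iexp (u \<bullet> Y \<omega>))"
        by (simp add: algebra_simps)
    qed (intro Bochner_Integration.integrable_diff integrable_Re iW iG G_int W)+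
    also have "(\<integral>\<omega>. W \<omega> - Re (z * W \<omega> *\<^sub>R iexp (u \<bullet> Y \<omega>)) \<partial>M) = (\<integral>\<omega>. W \<omega> \<partial>M) - Re (z * L)"
      unfolding L_def integral_mult_right_zero[symmetric]
      by (simp only: integral_Re[OF iW] Bochner_Integration.integral_diff[OF W(2) integrable_Re[OF iW]])
    also have "(\<integral>\<omega>. G \<omega> - Re (z * G \<omega> *\<^sub>R iexp (u \<bullet> Y \<omega>)) \<partial>M) = (\<integral>\<omega>. G \<omega> \<partial>M) - Re (z * g)"
      unfolding g_def integral_mult_right_zero[symmetric]
      by (simp only: integral_Re[OF iG] Bochner_Integration.integral_diff[OF G_int integrable_Re[OF iG]])
    finally have "(\<integral>\<omega>. G \<omega> \<partial>M) - Re (z * g) \<le> (\<integral>\<omega>. W \<omega> \<partial>M) - cmod L" using z by simp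
    moreover have "Re (z * g) \<le> cmod g" using complex_Re_le_cmod[of "z * g"] z by (simp add: norm_mult)
    ultimately have "cmod L \<le> (\<integral>\<omega>. W \<omega> \<partial>M) - c * (norm u)\<^sup>2" using c(2)[OF u] by (simp add: g_def)
    then show "cmod (mom M Y (\<lambda>\<omega>. iexp (u \<bullet> Y \<omega>)) p) \<le> mom M Y (\<lambda>\<omega>. 1) p - c * (norm u)\<^sup>2"
      by (simp add: mom_def L_def W_def)
  qed
qed

end

section \<open>Fourier integrals over the square and Gaussian integrals\<close>

lemma gauss_integrable:
  assumes "b > (0::real)"
  shows "integrable lborel (\<lambda>x. exp (- (b * x\<^sup>2) / 2))"
proof -
  have "integrable lborel (\<lambda>x. sqrt (2 * pi) * std_normal_density x)" by simp
  then have "integrable lborel (\<lambda>x::real. exp (- x\<^sup>2 / 2))" by (simp add: std_normal_density_def del: integrable_mult_right_iff)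
  from lborel_integrable_real_affine[OF this, of "sqrt b" 0] show ?thesis
    using assms by (simp add: power_mult_distrib)
qed

text \<open>The characteristic function of the standard normal law, rescaled by sqrt b.\<close>

lemma gauss_char:
  assumes b: "b > (0::real)"
  shows "(CLINT x|lborel. exp (- (b * x\<^sup>2) / 2) *\<^sub>R iexp (t * x)) = of_real (sqrt (2 * pi / b) * exp (- t\<^sup>2 / (2 * b)))"
proof -
  define s where "s = t / sqrt b"
  have "char std_normal_distribution s = (CLINT x|lborel. std_normal_density x *\<^sub>R iexp (s * x))"
    unfolding char_def by (subst integral_density) auto
  also have "\<dots> = (1 / sqrt (2 * pi)) *\<^sub>R (CLINT x|lborel. exp (- x\<^sup>2 / 2) *\<^sub>R iexp (s * x))"
    by (simp add: std_normal_density_def integral_scaleR_right[symmetric] del: integral_scaleR_right)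
  also have "(CLINT x|lborel. exp (- x\<^sup>2 / 2) *\<^sub>R iexp (s * x)) = sqrt b *\<^sub>R (CLINT x|lborel. exp (- (b * x\<^sup>2) / 2) *\<^sub>R iexp (t * x))"
    using b by (subst lborel_integral_real_affine[where c = "sqrt b" and t = 0]) (auto simp: power_mult_distrib s_def)
  finally have "complex_of_real (exp (- s\<^sup>2 / 2)) = (sqrt b / sqrt (2 * pi)) *\<^sub>R (CLINT x|lborel. exp (- (b * x\<^sup>2) / 2) *\<^sub>R iexp (t * x))"
    unfolding char_std_normal_distribution by simp
  then have "(sqrt (2 * pi) / sqrt b) *\<^sub>R complex_of_real (exp (- s\<^sup>2 / 2)) = (CLINT x|lborel. exp (- (b * x\<^sup>2) / 2) *\<^sub>R iexp (t * x))"
    using b by (simp only: scaleR_scaleR) simp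
  moreover have "s\<^sup>2 / 2 = t\<^sup>2 / (2 * b)" using b by (simp add: s_def power_divide)
  ultimately show ?thesis using b by (simp add: real_sqrt_divide scaleR_conv_of_real)
qed

lemma gauss_total:
  assumes b: "b > (0::real)"
  shows "(\<integral>x. exp (- (b * x\<^sup>2) / 2) \<partial>lborel) = sqrt (2 * pi / b)"
proof -
  have "complex_of_real (\<integral>x. exp (- (b * x\<^sup>2) / 2) \<partial>lborel) = complex_of_real (sqrt (2 * pi / b))"
    using gauss_char[OF b, of 0] by (simp add: integral_complex_of_real scaleR_conv_of_real)
  then show ?thesis by (simp only: of_real_eq_iff)
qed

lemma integrable_lborel_prod_mult:
  fixes f g :: "real \<Rightarrow> 'b::{real_normed_field,banach,second_countable_topology}"
  assumes "integrable lborel f" "integrable lborel g"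
  shows "integrable lborel (\<lambda>z :: real \<times> real. f (fst z) * g (snd z))"
    and "(\<integral>z. f (fst z) * g (snd z) \<partial>(lborel :: (real \<times> real) measure)) = (\<integral>x. f x \<partial>lborel) * (\<integral>x. g x \<partial>lborel)"
proof -
  have [measurable]: "f \<in> borel_measurable borel" "g \<in> borel_measurable borel" using assms by auto
  have "integrable (lborel \<Otimes>\<^sub>M lborel) (\<lambda>z. f (fst z) * g (snd z))"
    by (rule lborel_pair.Fubini_integrable) (use assms in \<open>auto simp: norm_mult\<close>)
  from this lborel_pair.integral_fst'[OF this]
  show "integrable lborel (\<lambda>z :: real \<times> real. f (fst z) * g (snd z))"
    and "(\<integral>z. f (fst z) * g (snd z) \<partial>(lborel :: (real \<times> real) measure)) = (\<integral>x. f x \<partial>lborel) * (\<integral>x. g x \<partial>lborel)"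
    by (simp_all add: lborel_prod)
qed

lemma norm_prod_power2: "(norm z)\<^sup>2 = (fst z)\<^sup>2 + (snd z)\<^sup>2" for z :: "real \<times> real"
  by (cases z) (simp add: norm_Pair)

lemma gauss2_total:
  assumes "c > (0::real)"
  shows "integrable lborel (\<lambda>z :: real \<times> real. exp (- c * (norm z)\<^sup>2))"
    and "(\<integral>z. exp (- c * (norm z)\<^sup>2) \<partial>(lborel :: (real \<times> real) measure)) = pi / c"
proof -
  have eq: "exp (- c * (norm z)\<^sup>2) = exp (- ((2 * c) * (fst z)\<^sup>2) / 2) * exp (- ((2 * c) * (snd z)\<^sup>2) / 2)" for z :: "real \<times> real"
    by (simp add: norm_prod_power2 exp_add[symmetric] algebra_simps)
  have i: "integrable lborel (\<lambda>x::real. exp (- ((2 * c) * x\<^sup>2) / 2))" using assms by (intro gauss_integrable) auto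
  note p = integrable_lborel_prod_mult[OF i i]
  show "integrable lborel (\<lambda>z :: real \<times> real. exp (- c * (norm z)\<^sup>2))" unfolding eq by (rule p(1))
  show "(\<integral>z. exp (- c * (norm z)\<^sup>2) \<partial>(lborel :: (real \<times> real) measure)) = pi / c"
    unfolding eq p(2) using assms by (subst (1 2) gauss_total) (auto simp: real_sqrt_mult_self)
qed

text \<open>Completing the square in the first variable makes the integrand a product.\<close>

lemma gauss2_char:
  fixes b11 b12 b22 v1 v2 :: real
  defines "D \<equiv> b11 * b22 - b12\<^sup>2"
  assumes b: "b11 > 0" "D > 0"
  shows "(CLINT z|(lborel :: (real \<times> real) measure).
      exp (- (b11 * (fst z)\<^sup>2 + 2 * b12 * fst z * snd z + b22 * (snd z)\<^sup>2) / 2) *\<^sub>R iexp (- (fst z * v1 + snd z * v2)))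
    = of_real (2 * pi / sqrt D * exp (- (b22 * v1\<^sup>2 - 2 * b12 * v1 * v2 + b11 * v2\<^sup>2) / (2 * D)))" (is "?I = _")
    and "integrable (lborel :: (real \<times> real) measure) (\<lambda>z.
      exp (- (b11 * (fst z)\<^sup>2 + 2 * b12 * fst z * snd z + b22 * (snd z)\<^sup>2) / 2) *\<^sub>R iexp (- (fst z * v1 + snd z * v2)))"
proof -
  define h where "h x y = exp (- (b11 * x\<^sup>2 + 2 * b12 * x * y + b22 * y\<^sup>2) / 2) *\<^sub>R iexp (- (x * v1 + y * v2))" for x y
  \<comment> \<open>- k y minimises the quadratic form in x for fixed y; after the shift by it the
    phase leaves the frequency \<open>- w\<close> in y.\<close>
  define k where "k = b12 / b11"
  define w where "w = v2 - k * v1"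
  have meas: "(\<lambda>z. h (fst z) (snd z)) \<in> borel_measurable (lborel \<Otimes>\<^sub>M lborel)" unfolding h_def by measurable
  have shift: "h (- (k * y) + 1 * x) y = (exp (- ((D / b11) * y\<^sup>2) / 2) *\<^sub>R iexp ((- w) * y)) * (exp (- (b11 * x\<^sup>2) / 2) *\<^sub>R iexp ((- v1) * x))" for x y
  proof -
    have kk: "b12 = k * b11" using b by (simp add: k_def)
    have "b11 * (- (k * y) + 1 * x)\<^sup>2 + 2 * b12 * (- (k * y) + 1 * x) * y + b22 * y\<^sup>2 = b11 * x\<^sup>2 + (D / b11) * y\<^sup>2"
      using b unfolding D_def kk by (simp add: field_simps power2_eq_square)
    then have 1: "exp (- (b11 * (- (k * y) + 1 * x)\<^sup>2 + 2 * b12 * (- (k * y) + 1 * x) * y + b22 * y\<^sup>2) / 2)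
      = exp (- ((D / b11) * y\<^sup>2) / 2) * exp (- (b11 * x\<^sup>2) / 2)"
      by (simp only: exp_add[symmetric]) (simp add: field_simps)
    have "- ((- (k * y) + 1 * x) * v1 + y * v2) = (- w) * y + (- v1) * x" by (simp add: w_def algebra_simps)
    then have 2: "iexp (- ((- (k * y) + 1 * x) * v1 + y * v2)) = iexp ((- w) * y) * iexp ((- v1) * x)"
      by (simp only: exp_add[symmetric] of_real_add distrib_left)
    show ?thesis unfolding h_def 1 2 by simp
  qed
  have i1: "integrable lborel (\<lambda>x. exp (- (b11 * x\<^sup>2) / 2) *\<^sub>R iexp ((- v1) * x))"
    by (rule Bochner_Integration.integrable_bound[OF gauss_integrable[OF b(1)]]) auto
  have Db: "D / b11 > 0" using b by simp
  have i2: "integrable lborel (\<lambda>x. exp (- ((D / b11) * x\<^sup>2) / 2) *\<^sub>R iexp ((- w) * x))"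
    by (rule Bochner_Integration.integrable_bound[OF gauss_integrable[OF Db]]) auto
  have inner: "(\<integral>x. h x y \<partial>lborel) = (exp (- ((D / b11) * y\<^sup>2) / 2) *\<^sub>R iexp ((- w) * y)) * (CLINT x|lborel. exp (- (b11 * x\<^sup>2) / 2) *\<^sub>R iexp ((- v1) * x))" for y
    using lborel_integral_real_affine[of 1 "\<lambda>x. h x y" "- (k * y)"]
    unfolding shift integral_mult_right_zero by simp
  have inn_int: "integrable lborel (\<lambda>x. h x y)" for y
  proof -
    have "integrable lborel (\<lambda>x. h (- (k * y) + 1 * x) y)" unfolding shift by (rule integrable_mult_right[OF i1])
    then show ?thesis by (subst (asm) lborel_integrable_real_affine_iff) auto
  qed
  have normh: "cmod (h x y) = Re (exp (- (b11 * x\<^sup>2 + 2 * b12 * x * y + b22 * y\<^sup>2) / 2))" for x y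
    unfolding h_def by simp
  have normshift: "cmod (h (- (k * y) + 1 * x) y) = exp (- ((D / b11) * y\<^sup>2) / 2) * exp (- (b11 * x\<^sup>2) / 2)" for x y
    unfolding shift by (simp add: norm_mult)
  have inner_norm: "(\<integral>x. cmod (h x y) \<partial>lborel) = exp (- ((D / b11) * y\<^sup>2) / 2) * (\<integral>x. exp (- (b11 * x\<^sup>2) / 2) \<partial>lborel)" for y
    using lborel_integral_real_affine[of 1 "\<lambda>x. cmod (h x y)" "- (k * y)"]
    unfolding normshift integral_mult_right_zero by simp
  \<comment> \<open>The coordinates are swapped so that Fubini integrates x first, the variable in
    which the square was completed.\<close>
  have int: "integrable (lborel \<Otimes>\<^sub>M lborel) (\<lambda>z. h (snd z) (fst z))"
  proof (rule lborel_pair.Fubini_integrable)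
    show "(\<lambda>z. h (snd z) (fst z)) \<in> borel_measurable (lborel \<Otimes>\<^sub>M lborel)" unfolding h_def by measurable
    show "integrable lborel (\<lambda>x. \<integral>y. cmod (h (snd (x, y)) (fst (x, y))) \<partial>lborel)"
      using gauss_integrable[OF Db] by (simp add: inner_norm)
  qed (use inn_int in auto)
  have int': "integrable (lborel \<Otimes>\<^sub>M lborel) (\<lambda>z. h (fst z) (snd z))"
    using lborel_pair.integrable_product_swap[OF int] by (simp add: case_prod_beta')
  then show "integrable (lborel :: (real \<times> real) measure) (\<lambda>z.
      exp (- (b11 * (fst z)\<^sup>2 + 2 * b12 * fst z * snd z + b22 * (snd z)\<^sup>2) / 2) *\<^sub>R iexp (- (fst z * v1 + snd z * v2)))"
    by (simp add: h_def lborel_prod)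
  have "?I = (\<integral>z. h (fst z) (snd z) \<partial>(lborel \<Otimes>\<^sub>M lborel))" by (simp add: h_def lborel_prod)
  also have "\<dots> = (\<integral>y. (\<integral>x. h x y \<partial>lborel) \<partial>lborel)"
    using lborel_pair.integral_snd[of "\<lambda>x y. h x y"] int' by (simp add: case_prod_beta')
  also have "\<dots> = (CLINT x|lborel. exp (- ((D / b11) * x\<^sup>2) / 2) *\<^sub>R iexp ((- w) * x)) * (CLINT x|lborel. exp (- (b11 * x\<^sup>2) / 2) *\<^sub>R iexp ((- v1) * x))"
    unfolding inner by (rule integral_mult_left_zero)
  also have "\<dots> = of_real (sqrt (2 * pi / (D / b11)) * exp (- (- w)\<^sup>2 / (2 * (D / b11)))) * of_real (sqrt (2 * pi / b11) * exp (- (- v1)\<^sup>2 / (2 * b11)))"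
    unfolding gauss_char[OF b(1)] gauss_char[OF Db] ..
  also have "\<dots> = of_real ((sqrt (2 * pi / (D / b11)) * sqrt (2 * pi / b11)) * (exp (- (- w)\<^sup>2 / (2 * (D / b11))) * exp (- (- v1)\<^sup>2 / (2 * b11))))"
    by simp
  also have "sqrt (2 * pi / (D / b11)) * sqrt (2 * pi / b11) = 2 * pi / sqrt D"
  proof -
    have "2 * pi / (D / b11) * (2 * pi / b11) = (2 * pi)\<^sup>2 / D" using b by (simp add: power2_eq_square)
    then show ?thesis using b by (simp only: real_sqrt_mult[symmetric] real_sqrt_divide real_sqrt_abs) simp
  qed
  also have "exp (- (- w)\<^sup>2 / (2 * (D / b11))) * exp (- (- v1)\<^sup>2 / (2 * b11)) = exp (- (b22 * v1\<^sup>2 - 2 * b12 * v1 * v2 + b11 * v2\<^sup>2) / (2 * D))"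
  proof -
    have "w\<^sup>2 / (2 * (D / b11)) + v1\<^sup>2 / (2 * b11) = (b11 * b11 * w\<^sup>2 + D * v1\<^sup>2) / (2 * D * b11)" 
      using b by (simp add: field_simps)
    also have "b11 * b11 * w\<^sup>2 = (b11 * v2 - b12 * v1)\<^sup>2" using b by (simp add: w_def k_def field_simps power2_eq_square)
    also have "(b11 * v2 - b12 * v1)\<^sup>2 + D * v1\<^sup>2 = b11 * (b22 * v1\<^sup>2 - 2 * b12 * v1 * v2 + b11 * v2\<^sup>2)"
      by (simp add: D_def power2_eq_square algebra_simps)
    finally have "w\<^sup>2 / (2 * (D / b11)) + v1\<^sup>2 / (2 * b11) = (b22 * v1\<^sup>2 - 2 * b12 * v1 * v2 + b11 * v2\<^sup>2) / (2 * D)"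
      using b by simp
    then have "- (- w)\<^sup>2 / (2 * (D / b11)) + - (- v1)\<^sup>2 / (2 * b11) = - (b22 * v1\<^sup>2 - 2 * b12 * v1 * v2 + b11 * v2\<^sup>2) / (2 * D)"
      by (simp only: power2_minus minus_divide_left[symmetric])
    then show ?thesis by (simp only: exp_add[symmetric])
  qed
  finally show "?I = of_real (2 * pi / sqrt D * exp (- (b22 * v1\<^sup>2 - 2 * b12 * v1 * v2 + b11 * v2\<^sup>2) / (2 * D)))" .
qed

text \<open>Pairs rather than vectors, because \<open>lborel\<close> on pairs is a product measure
  and Fubini applies directly; \<open>pvec\<close> carries the points over to the vector
  type.\<close>

definition torus :: "(real \<times> real) set" where "torus = {- pi..pi} \<times> {- pi..pi}"

lemma torus_sets [measurable]: "torus \<in> sets borel"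
  unfolding torus_def by (rule borel_Times) auto

lemma indicator_torus: "indicator torus z = (indicator {- pi..pi} (fst z) * indicator {- pi..pi} (snd z) :: 'a::semiring_1)"
  by (auto simp: torus_def indicator_def mem_Times_iff)

lemma fourier_int:
  "(CLINT x|lborel. indicator {- pi..pi} x *\<^sub>R iexp (x * of_int k)) = (if k = 0 then of_real (2 * pi) else 0)"
proof (cases "k = 0")
  case False
  have "(CLINT x|lborel. indicator {- pi..pi} x *\<^sub>R iexp (x * of_int k))
      = iexp (pi * of_int k) / (\<i> * of_int k) - iexp (- pi * of_int k) / (\<i> * of_int k)"
  proof (rule integral_FTC_atLeastAtMost)
    fix x :: real
    show "((\<lambda>x. iexp (x * of_int k) / (\<i> * of_int k)) has_vector_derivative iexp (x * of_int k)) (at x within {- pi..pi})"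
      using False by (auto intro!: derivative_eq_intros has_vector_derivative_real_field simp: has_vector_derivative_complex_iff field_simps)
  qed (auto intro!: continuous_intros)
  moreover have "iexp (pi * of_int k) = iexp (- pi * of_int k)"
    using exp_eq[of "\<i> * complex_of_real (pi * of_int k)" "\<i> * complex_of_real (- pi * of_int k)"]
    by (auto intro!: exI[of _ "k"] simp: algebra_simps)
  ultimately show ?thesis using False by simp
qed (simp add: scaleR_conv_of_real)

text \<open>Orthogonality of characters: the integral detects the zero lattice point, which is how
  point masses are recovered from transforms.\<close>

lemma fourier_int_torus:
  "(CLINT z|(lborel :: (real \<times> real) measure). indicator torus z *\<^sub>R iexp (fst z * of_int k + snd z * of_int l))
    = (if k = 0 \<and> l = 0 then of_real ((2 * pi)\<^sup>2) else 0)"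
proof -
  have i: "integrable lborel (\<lambda>x. indicator {- pi..pi} x *\<^sub>R iexp (x * of_int k))" for k
    by (rule Bochner_Integration.integrable_bound[of _ "indicator {- pi..pi} :: real \<Rightarrow> real"]) (auto simp: indicator_def)
  have "indicator torus z *\<^sub>R iexp (fst z * of_int k + snd z * of_int l)
      = (indicator {- pi..pi} (fst z) *\<^sub>R iexp (fst z * of_int k)) * (indicator {- pi..pi} (snd z) *\<^sub>R iexp (snd z * of_int l))" for z
    by (simp add: indicator_torus exp_add[symmetric] distrib_left)
  then show ?thesis
    by (simp only: integrable_lborel_prod_mult(2)[OF i i] fourier_int) (auto simp: power2_eq_square)
qed


section \<open>Local limit theorem in Fourier form\<close>

lemma torus_norm: "z \<in> torus \<Longrightarrow> (norm z)\<^sup>2 \<le> 2 * pi\<^sup>2"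
proof -
  assume "z \<in> torus"
  then have "\<bar>fst z\<bar> \<le> pi" "\<bar>snd z\<bar> \<le> pi" by (auto simp: torus_def)
  then have "(fst z)\<^sup>2 \<le> pi\<^sup>2" "(snd z)\<^sup>2 \<le> pi\<^sup>2" by (simp_all add: abs_le_square_iff[symmetric])
  then show ?thesis by (simp add: norm_prod_power2)
qed

text \<open>Only moduli are used, so the bound is uniform in \<open>y\<close>. In the plane the N-th
  power of the Gaussian factor has an integral of order 1/N.\<close>

lemma torus_power_bound:
  fixes L1 L :: "real \<times> real \<Rightarrow> complex"
  assumes [measurable]: "L1 \<in> borel_measurable borel" "L \<in> borel_measurable borel"
    and c: "c > 0" "h \<ge> 0" and L1: "\<And>z. z \<in> torus \<Longrightarrow> cmod (L1 z) \<le> c1"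
    and L: "\<And>z. z \<in> torus \<Longrightarrow> cmod (L z) \<le> h * exp (- c * (norm z)\<^sup>2)"
  shows "cmod (CLINT z|lborel. indicator torus z *\<^sub>R (L1 z * L z ^ N * iexp (- (z \<bullet> y))))
    \<le> c1 * h ^ N * (exp (2 * c * pi\<^sup>2) * pi / c) / (N + 1)"
proof -
  have c1: "c1 \<ge> 0" using order_trans[OF norm_ge_zero L1[of "(0, 0)"]] by (simp add: torus_def)
  define K where "K = c1 * h ^ N * exp (2 * c * pi\<^sup>2)"
  have bd: "cmod (indicator torus z *\<^sub>R (L1 z * L z ^ N * iexp (- (z \<bullet> y)))) \<le> K * exp (- (c * (N + 1)) * (norm z)\<^sup>2)" for z
  proof (cases "z \<in> torus")
    case True
    have "cmod (indicator torus z *\<^sub>R (L1 z * L z ^ N * iexp (- (z \<bullet> y)))) = cmod (L1 z) * cmod (L z) ^ N"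
      using True by (simp add: norm_mult norm_power)
    also have "\<dots> \<le> c1 * (h * exp (- c * (norm z)\<^sup>2)) ^ N"
      by (intro mult_mono power_mono L1 L True c1) auto
    \<comment> \<open>One more Gaussian factor is inserted at the bounded price exp (2 c pi^2); it
      replaces N by N + 1 and so covers N = 0.\<close>
    also have "\<dots> = c1 * h ^ N * exp (c * (norm z)\<^sup>2) * exp (- (c * (N + 1)) * (norm z)\<^sup>2)"
      by (simp add: power_mult_distrib algebra_simps flip: exp_add exp_of_nat_mult)
    also have "\<dots> \<le> c1 * h ^ N * exp (2 * c * pi\<^sup>2) * exp (- (c * (N + 1)) * (norm z)\<^sup>2)"
      using torus_norm[OF True] c c1 by (intro mult_right_mono mult_left_mono) auto
    finally show ?thesis by (simp add: K_def)
  qed (use c c1 in \<open>simp add: K_def\<close>)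
  have cN: "c * (N + 1) > 0" using c by (intro mult_pos_pos) auto
  have i: "integrable lborel (\<lambda>z :: real \<times> real. K * exp (- (c * (N + 1)) * (norm z)\<^sup>2))"
    by (intro integrable_mult_right gauss2_total cN)
  have "cmod (CLINT z|lborel. indicator torus z *\<^sub>R (L1 z * L z ^ N * iexp (- (z \<bullet> y))))
      \<le> (\<integral>z. K * exp (- (c * (N + 1)) * (norm z)\<^sup>2) \<partial>(lborel :: (real \<times> real) measure))"
  proof (rule norm_integral_le_integral[OF _ i bd])
    show "complex_integrable lborel (\<lambda>z. indicator torus z *\<^sub>R (L1 z * L z ^ N * iexp (- (z \<bullet> y))))"
      by (rule Bochner_Integration.integrable_bound[OF i]) (use bd in \<open>auto intro!: AE_I2 order_trans[OF _ abs_ge_self] simp del: norm_scaleR\<close>)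
  qed
  also have "\<dots> = K * (pi / (c * (N + 1)))"
    unfolding integral_mult_right_zero by (subst gauss2_total(2)[OF cN]) auto
  finally show ?thesis by (simp add: K_def)
qed

lemma lborel_integral_scaleR:
  fixes f :: "'v::euclidean_space \<Rightarrow> 'b::{banach,second_countable_topology}"
  assumes "c \<noteq> 0" and [measurable]: "f \<in> borel_measurable borel"
  shows "(\<integral>x. f x \<partial>lborel) = \<bar>c\<bar> ^ DIM('v) *\<^sub>R (\<integral>x. f (c *\<^sub>R x) \<partial>lborel)"
proof -
  have "lborel = density (distr lborel borel (\<lambda>x::'v. c *\<^sub>R x)) (\<lambda>_. ennreal (\<bar>c\<bar> ^ DIM('v)))"
    using lborel_affine[OF assms(1), of 0] by (simp add: ennreal_power)
  then have "(\<integral>x. f x \<partial>lborel) = (\<integral>x. f x \<partial>density (distr lborel borel (\<lambda>x::'v. c *\<^sub>R x)) (\<lambda>_. ennreal (\<bar>c\<bar> ^ DIM('v))))"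
    by simp
  also have "\<dots> = \<bar>c\<bar> ^ DIM('v) *\<^sub>R (\<integral>x. f (c *\<^sub>R x) \<partial>lborel)"
    by (subst integral_density) (auto simp: integral_distr)
  finally show ?thesis .
qed

text \<open>Compares z^N with the N-th power of exp (- b / N): both bases lie in the closed unit
  disc, where N-th powers differ by at most N times the difference of the bases. This avoids
  branches of a complex logarithm.\<close>

lemma tendsto_power_exp:
  fixes z :: "nat \<Rightarrow> complex" and N :: "nat \<Rightarrow> nat"
  assumes N: "filterlim N at_top sequentially" and b: "b \<ge> (0::real)"
    and z: "eventually (\<lambda>j. cmod (z j) \<le> 1) sequentially"
    and lim: "(\<lambda>j. of_nat (N j) * (z j - 1)) \<longlonglongrightarrow> of_real (- b)"
  shows "(\<lambda>j. z j ^ N j) \<longlonglongrightarrow> of_real (exp (- b))"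
proof -
  have NR: "filterlim (\<lambda>j. real (N j)) at_top sequentially" by (rule filterlim_compose[OF filterlim_real_sequentially N])
  have pos: "eventually (\<lambda>j. N j > 0) sequentially" by (rule eventually_compose_filterlim[OF eventually_gt_at_top N])
  define e where "e j = exp (- b / N j)" for j
  have e1: "\<bar>real (N j) * (e j - 1) + b\<bar> \<le> b\<^sup>2 * exp b / N j" if "N j > 0" for j
  proof -
    have N1: "real (N j) \<ge> 1" using that by simp
    have "\<bar>e j - 1 - (- b / N j)\<bar> \<le> (- b / N j)\<^sup>2 * exp \<bar>- b / N j\<bar>" unfolding e_def by (rule exp_remainder)
    also have "\<dots> \<le> (b\<^sup>2 / (N j)\<^sup>2) * exp b"
    proof (rule mult_mono)
      have "b / N j \<le> b / 1" using b N1 by (intro divide_left_mono) auto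
      then show "exp \<bar>- b / real (N j)\<bar> \<le> exp b" using b by simp
    qed (auto simp: power_divide)
    finally have "real (N j) * \<bar>e j - 1 - (- b / N j)\<bar> \<le> real (N j) * ((b\<^sup>2 / (N j)\<^sup>2) * exp b)"
      by (intro mult_left_mono) auto
    also have "\<dots> = b\<^sup>2 * exp b / N j" using N1 by (simp add: power2_eq_square)
    also have "real (N j) * \<bar>e j - 1 - (- b / N j)\<bar> = \<bar>real (N j) * (e j - 1 - (- b / N j))\<bar>" by (simp add: abs_mult)
    also have "real (N j) * (e j - 1 - (- b / N j)) = real (N j) * (e j - 1) + b" using N1 by (simp add: field_simps)
    finally show ?thesis .
  qed
  have "(\<lambda>j. b\<^sup>2 * exp b / N j) \<longlonglongrightarrow> 0"
    by (rule tendsto_divide_0[OF tendsto_const]) (rule filterlim_at_top_imp_at_infinity[OF NR])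
  moreover have "(\<lambda>j. cmod (of_nat (N j) * (z j - 1) - of_real (- b))) \<longlonglongrightarrow> 0"
    using lim by (simp only: tendsto_norm_zero LIM_zero)
  ultimately have lim0: "(\<lambda>j. cmod (of_nat (N j) * (z j - 1) - of_real (- b)) + b\<^sup>2 * exp b / N j) \<longlonglongrightarrow> 0"
    by (auto intro: tendsto_add_zero)
  have "(\<lambda>j. z j ^ N j - of_real (exp (- b))) \<longlonglongrightarrow> 0"
  proof (rule Lim_null_comparison[OF _ lim0])
    show "\<forall>\<^sub>F j in sequentially. cmod (z j ^ N j - of_real (exp (- b))) \<le> cmod (of_nat (N j) * (z j - 1) - of_real (- b)) + b\<^sup>2 * exp b / N j"
      using pos z
    proof eventually_elim
      case (elim j)
      have ee: "complex_of_real (exp (- b)) = of_real (e j) ^ N j" using elim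
        by (simp add: e_def of_real_power[symmetric] exp_of_nat_mult[symmetric] del: of_real_power)
      have "cmod (z j ^ N j - of_real (exp (- b))) \<le> N j * cmod (z j - of_real (e j))"
        unfolding ee by (rule norm_power_diff) (use elim b in \<open>auto simp: e_def\<close>)
      also have "\<dots> = cmod (of_nat (N j) * (z j - of_real (e j)))" by (simp add: norm_mult)
      also have "of_nat (N j) * (z j - of_real (e j)) = (of_nat (N j) * (z j - 1) - of_real (- b)) - of_real (real (N j) * (e j - 1) + b)"
        by (simp add: algebra_simps)
      also have "cmod \<dots> \<le> cmod (of_nat (N j) * (z j - 1) - of_real (- b)) + \<bar>real (N j) * (e j - 1) + b\<bar>"
        by (rule order_trans[OF norm_triangle_ineq4]) (simp only: norm_of_real)
      also have "\<dots> \<le> cmod (of_nat (N j) * (z j - 1) - of_real (- b)) + b\<^sup>2 * exp b / N j" using e1[OF elim(1)] by simp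
      finally show ?case .
    qed
  qed
  then show ?thesis by (simp add: LIM_zero_iff)
qed

text \<open>Substituting z = w / sqrt N in the plane has Jacobian 1/N, which the factor N cancels.
  \<open>A\<close> plays the role of the mean of one step: its phase is split off so that the N-th
  powers converge by \<open>tendsto_power_exp\<close>. The factor \<open>L1\<close>, coming from the
  single first step, survives only through its limit near 0.\<close>

lemma fourier_local_limit:
  fixes L1 L :: "nat \<Rightarrow> real \<times> real \<Rightarrow> complex" and N :: "nat \<Rightarrow> nat" and y A :: "nat \<Rightarrow> real \<times> real"
  assumes [measurable]: "\<And>j. L1 j \<in> borel_measurable borel" "\<And>j. L j \<in> borel_measurable borel"
      "\<beta> \<in> borel_measurable borel"
    and c: "c > 0" and L1: "\<And>j z. z \<in> torus \<Longrightarrow> cmod (L1 j z) \<le> c1"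
    and L: "\<And>j z. z \<in> torus \<Longrightarrow> cmod (L j z) \<le> exp (- c * (norm z)\<^sup>2)"
    and N: "filterlim N at_top sequentially"
    and L1_lim: "\<And>w. (\<lambda>j. L1 j ((1 / sqrt (N j)) *\<^sub>R w)) \<longlonglongrightarrow> l1"
    and \<beta>: "\<And>w. \<beta> w \<ge> 0"
    and L_lim: "\<And>w. (\<lambda>j. of_nat (N j) * (L j ((1 / sqrt (N j)) *\<^sub>R w) * iexp (- (((1 / sqrt (N j)) *\<^sub>R w) \<bullet> A j)) - 1)) \<longlonglongrightarrow> of_real (- \<beta> w / 2)"
    and v: "(\<lambda>j. (1 / sqrt (N j)) *\<^sub>R (y j - real (N j) *\<^sub>R A j)) \<longlonglongrightarrow> v"
  shows "(\<lambda>j. real (N j) *\<^sub>R (CLINT z|lborel. indicator torus z *\<^sub>R (L1 j z * L j z ^ N j * iexp (- (z \<bullet> y j)))))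
    \<longlonglongrightarrow> (CLINT w|lborel. l1 * (exp (- \<beta> w / 2) *\<^sub>R iexp (- (w \<bullet> v))))"
proof -
  have NR: "filterlim (\<lambda>j. real (N j)) at_top sequentially" by (rule filterlim_compose[OF filterlim_real_sequentially N])
  have c1: "c1 \<ge> 0" using order_trans[OF norm_ge_zero L1[of "(0, 0)"]] by (simp add: torus_def)
  define s where "s j = 1 / sqrt (N j)" for j
  have s0: "s \<longlonglongrightarrow> 0" unfolding s_def
    by (rule tendsto_divide_0[OF tendsto_const]) (rule filterlim_at_top_imp_at_infinity[OF filterlim_compose[OF sqrt_at_top NR]])
  have pos: "eventually (\<lambda>j. N j > 0) sequentially" by (rule eventually_compose_filterlim[OF eventually_gt_at_top N])
  \<comment> \<open>The scaling relation N s^2 = 1 needs N j > 0, so the sequence is started at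
    \<open>j0\<close>.\<close>
  then obtain j0 where j0: "\<And>j. j \<ge> j0 \<Longrightarrow> N j > 0" by (auto simp: eventually_sequentially)
  have s: "s j > 0" "real (N j) * (s j)\<^sup>2 = 1" if "N j > 0" for j using that by (auto simp: s_def power_divide)
  define F where "F j z = indicator torus z *\<^sub>R (L1 j z * L j z ^ N j * iexp (- (z \<bullet> y j)))" for j z
  have [measurable]: "F j \<in> borel_measurable borel" for j unfolding F_def by measurable
  have "(\<lambda>j. CLINT w|lborel. F (j + j0) (s (j + j0) *\<^sub>R w)) \<longlonglongrightarrow> (CLINT w|lborel. l1 * (exp (- \<beta> w / 2) *\<^sub>R iexp (- (w \<bullet> v))))"
  proof (rule integral_dominated_convergence)
    show "integrable lborel (\<lambda>w :: real \<times> real. c1 * exp (- c * (norm w)\<^sup>2))"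
      by (intro integrable_mult_right gauss2_total c)
    show "AE w in lborel. norm (F (j + j0) (s (j + j0) *\<^sub>R w)) \<le> c1 * exp (- c * (norm w)\<^sup>2)" for j
    proof (rule AE_I2)
      fix w
      let ?j = "j + j0"
      show "norm (F ?j (s ?j *\<^sub>R w)) \<le> c1 * exp (- c * (norm w)\<^sup>2)"
      proof (cases "s ?j *\<^sub>R w \<in> torus")
        case True
        have "norm (F ?j (s ?j *\<^sub>R w)) = cmod (L1 ?j (s ?j *\<^sub>R w)) * cmod (L ?j (s ?j *\<^sub>R w)) ^ N ?j"
          using True by (simp add: F_def norm_mult norm_power)
        also have "\<dots> \<le> c1 * (exp (- c * (norm (s ?j *\<^sub>R w))\<^sup>2)) ^ N ?j"
          by (intro mult_mono power_mono L1 L True c1) auto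
        \<comment> \<open>Here N s^2 = 1 makes the majorant independent of j.\<close>
        also have "(exp (- c * (norm (s ?j *\<^sub>R w))\<^sup>2)) ^ N ?j = exp (- c * (real (N ?j) * (s ?j)\<^sup>2) * (norm w)\<^sup>2)"
          by (simp add: exp_of_nat_mult[symmetric] power_mult_distrib algebra_simps)
        finally show ?thesis using s[OF j0[of ?j]] by simp
      qed (use c1 in \<open>simp add: F_def\<close>)
    qed
    have "(\<lambda>j. F j (s j *\<^sub>R w)) \<longlonglongrightarrow> l1 * (exp (- \<beta> w / 2) *\<^sub>R iexp (- (w \<bullet> v)))" for w
    proof -
      have "(\<lambda>j. s j *\<^sub>R w) \<longlonglongrightarrow> 0 *\<^sub>R w" by (intro tendsto_intros s0)
      moreover have "open ({- pi<..<pi} \<times> {- pi<..<pi})" by (intro open_Times) auto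
      moreover have "0 *\<^sub>R w \<in> {- pi<..<pi} \<times> {- pi<..<pi}" by (simp add: zero_prod_def)
      ultimately have "eventually (\<lambda>j. s j *\<^sub>R w \<in> {- pi<..<pi} \<times> {- pi<..<pi}) sequentially"
        by (rule topological_tendstoD)
      then have ev: "eventually (\<lambda>j. s j *\<^sub>R w \<in> torus) sequentially"
        by eventually_elim (auto simp: torus_def)
      have pw: "(\<lambda>j. (L j (s j *\<^sub>R w) * iexp (- ((s j *\<^sub>R w) \<bullet> A j))) ^ N j) \<longlonglongrightarrow> of_real (exp (- (\<beta> w / 2)))"
      proof (rule tendsto_power_exp[OF N])
        show "\<forall>\<^sub>F j in sequentially. cmod (L j (s j *\<^sub>R w) * iexp (- ((s j *\<^sub>R w) \<bullet> A j))) \<le> 1"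
          using ev
        proof eventually_elim
          case (elim j)
          have "cmod (L j (s j *\<^sub>R w)) \<le> exp (- c * (norm (s j *\<^sub>R w))\<^sup>2)" by (rule L[OF elim])
          also have "\<dots> \<le> 1" using c by simp
          finally show ?case by (simp add: norm_mult)
        qed
      qed (use L_lim[of w] \<beta>[of w] in \<open>simp_all add: s_def\<close>)
      have ph: "(\<lambda>j. iexp (- (w \<bullet> (s j *\<^sub>R (y j - real (N j) *\<^sub>R A j))))) \<longlonglongrightarrow> iexp (- (w \<bullet> v))"
        using v unfolding s_def by (intro tendsto_intros)
      have "(\<lambda>j. L1 j (s j *\<^sub>R w) * ((L j (s j *\<^sub>R w) * iexp (- ((s j *\<^sub>R w) \<bullet> A j))) ^ N j * iexp (- (w \<bullet> (s j *\<^sub>R (y j - real (N j) *\<^sub>R A j))))))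
        \<longlonglongrightarrow> l1 * (of_real (exp (- (\<beta> w / 2))) * iexp (- (w \<bullet> v)))"
        by (intro tendsto_mult pw ph) (use L1_lim[of w] in \<open>simp add: s_def\<close>)
      moreover have "eventually (\<lambda>j. L1 j (s j *\<^sub>R w) * ((L j (s j *\<^sub>R w) * iexp (- ((s j *\<^sub>R w) \<bullet> A j))) ^ N j * iexp (- (w \<bullet> (s j *\<^sub>R (y j - real (N j) *\<^sub>R A j)))))
          = F j (s j *\<^sub>R w)) sequentially"
        using ev
      proof eventually_elim
        case (elim j)
        have "iexp (- ((s j *\<^sub>R w) \<bullet> A j)) ^ N j * iexp (- (w \<bullet> (s j *\<^sub>R (y j - real (N j) *\<^sub>R A j)))) = iexp (- ((s j *\<^sub>R w) \<bullet> y j))"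
          by (simp add: exp_of_nat_mult[symmetric] exp_add[symmetric] inner_diff_right algebra_simps)
        then show ?case using elim by (simp add: F_def power_mult_distrib mult.assoc)
      qed
      ultimately show ?thesis using Lim_transform_eventually by (fastforce simp: scaleR_conv_of_real)
    qed
    then show "AE w in lborel. (\<lambda>j. F (j + j0) (s (j + j0) *\<^sub>R w)) \<longlonglongrightarrow> l1 * (exp (- \<beta> w / 2) *\<^sub>R iexp (- (w \<bullet> v)))"
      by (intro AE_I2 LIMSEQ_ignore_initial_segment)
  qed measurable
  then have "(\<lambda>j. CLINT w|lborel. F j (s j *\<^sub>R w)) \<longlonglongrightarrow> (CLINT w|lborel. l1 * (exp (- \<beta> w / 2) *\<^sub>R iexp (- (w \<bullet> v))))"
    by (rule LIMSEQ_offset)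
  moreover have "eventually (\<lambda>j. (CLINT w|lborel. F j (s j *\<^sub>R w)) = real (N j) *\<^sub>R (CLINT z|lborel. F j z)) sequentially"
    using pos
  proof eventually_elim
    case (elim j)
    have "real (N j) *\<^sub>R (CLINT z|lborel. F j z) = (real (N j) * (s j)\<^sup>2) *\<^sub>R (CLINT w|lborel. F j (s j *\<^sub>R w))"
      by (subst lborel_integral_scaleR[where c = "s j"]) (use s(1)[OF elim] in \<open>auto simp: power2_eq_square\<close>)
    then show ?case using s[OF elim] by simp
  qed
  ultimately show ?thesis unfolding F_def by (rule Lim_transform_eventually)
qed

section \<open>Renewal sums as Riemann sums\<close>

text \<open>Writes the series exactly as the integral of its step function, so that the limit of a
  Riemann sum becomes an instance of dominated convergence.\<close>

lemma suminf_eq_floor_integral: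
  fixes q :: "nat \<Rightarrow> real"
  assumes q: "\<And>k. q k \<ge> 0" and int: "integrable lborel (\<lambda>r::real. if r \<ge> 0 then q (nat \<lfloor>r\<rfloor>) else 0)"
  shows "summable q" and "suminf q = (\<integral>r. (if (r::real) \<ge> 0 then q (nat \<lfloor>r\<rfloor>) else 0) \<partial>lborel)"
proof -
  define g where "g r = (if r \<ge> 0 then q (nat \<lfloor>r\<rfloor>) else 0)" for r :: real
  have g0: "g r \<ge> 0" for r by (simp add: g_def q)
  have "ennreal (g r) = (\<Sum>k. ennreal (q k) * indicator {real k..<real k + 1} r)" for r
  proof (cases "r \<ge> 0")
    case True
    have iff: "indicator {real k..<real k + 1} r = (if k = nat \<lfloor>r\<rfloor> then 1 else (0::ennreal))" for k
      using True by (auto simp: indicator_def) linarith+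
    have "(\<Sum>k. ennreal (q k) * indicator {real k..<real k + 1} r) = (\<Sum>k\<in>{nat \<lfloor>r\<rfloor>}. ennreal (q k) * indicator {real k..<real k + 1} r)"
      by (rule suminf_finite) (auto simp: iff)
    then show ?thesis using True by (simp add: iff g_def)
  next
    case False
    then have "indicator {real k..<real k + 1} r = (0::ennreal)" for k by (auto simp: indicator_def)
    then show ?thesis using False by (simp add: g_def)
  qed
  then have "(\<integral>\<^sup>+r. ennreal (g r) \<partial>lborel) = (\<Sum>k. \<integral>\<^sup>+r. ennreal (q k) * indicator {real k..<real k + 1} r \<partial>lborel)"
    by (simp add: nn_integral_suminf)
  also have "\<dots> = (\<Sum>k. ennreal (q k))" by (simp add: nn_integral_cmult_indicator)
  finally have fin: "(\<integral>\<^sup>+r. ennreal (g r) \<partial>lborel) = (\<Sum>k. ennreal (q k))" .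
  have "integrable lborel g" using int by (simp add: g_def[abs_def])
  from nn_integral_eq_integral[OF this] have eq: "(\<Sum>k. ennreal (q k)) = ennreal (\<integral>r. g r \<partial>lborel)"
    using g0 fin by simp
  then show s: "summable q" using q by (intro summable_suminf_not_top) auto
  show "suminf q = (\<integral>r. (if (r::real) \<ge> 0 then q (nat \<lfloor>r\<rfloor>) else 0) \<partial>lborel)"
  proof -
    have "ennreal (suminf q) = ennreal (\<integral>r. g r \<partial>lborel)" using eq suminf_ennreal2[OF q s] by simp
    then have "suminf q = (\<integral>r. g r \<partial>lborel)" using suminf_nonneg[OF s q] g0
      by (subst (asm) ennreal_inj) (auto intro: Bochner_Integration.integral_nonneg)
    then show ?thesis by (simp add: g_def[abs_def])
  qed
qed

lemma integrable_inverse_1_plus_square: "integrable lborel (\<lambda>s::real. 1 / (1 + s\<^sup>2))"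
proof -
  have "set_integrable lborel {0<..} (\<lambda>x::real. 1 / (1 + x\<^sup>2))"
    using integrable_I0i_1_div_plus_square by (simp add: set_integrable_def divide_inverse zero_ereal_def interval_lebesgue_integrable_def einterval_def greaterThan_def)
  then have i: "integrable lborel (\<lambda>x::real. indicator {0<..} x * (1 / (1 + x\<^sup>2)))" by (simp add: set_integrable_def)
  have i2: "integrable lborel (\<lambda>x::real. indicator {0<..} (- x) * (1 / (1 + x\<^sup>2)))"
    using lborel_integrable_real_affine[OF i, of "-1" 0] by simp
  show ?thesis
  proof (rule integrable_cong_AE_imp[OF Bochner_Integration.integrable_add[OF i i2]])
    show "AE x::real in lborel. indicator {0<..} x * (1 / (1 + x\<^sup>2)) + indicator {0<..} (- x) * (1 / (1 + x\<^sup>2)) = 1 / (1 + x\<^sup>2)"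
      using AE_lborel_singleton[of "0::real"] by eventually_elim (auto simp: indicator_def)
  qed simp
qed

text \<open>Bounds the rescaled position s of an index k by its normalised deviation |n - k a| /
  sqrt k. Since k can be of order n |s|, a displacement s sqrt n is divided by as much as sqrt (n
  |s|); therefore only sqrt |s| appears on the left.\<close>

lemma sqrt_le_renewal_deviation:
  fixes n a s k :: real
  assumes n: "n \<ge> 1" and a: "0 < l" "l \<le> a" and r: "0 \<le> n / a + s * sqrt n"
    and k: "n / a + s * sqrt n < k" "k \<le> n / a + s * sqrt n + 1"
  shows "sqrt \<bar>s\<bar> \<le> sqrt (1 / l + 1) + 2 + (2 / l) * (\<bar>n - k * a\<bar> / sqrt k)"
proof -
  have a0: "a > 0" using a by simp
  have k0: "k > 0" using k r by linarith
  define y where "y = \<bar>n - k * a\<bar> / sqrt k"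
  have y: "y \<ge> 0" "\<bar>n - k * a\<bar> = sqrt k * y" using k0 by (auto simp: y_def)
  define \<kappa> where "\<kappa> = 1 / l + 1"
  have \<kappa>: "\<kappa> \<ge> 1 / a + 1" "\<kappa> > 0" using a by (auto simp: \<kappa>_def frac_le add_pos_pos)
  show ?thesis
  proof (cases "\<bar>s\<bar> \<le> \<kappa>")
    case True
    then have "sqrt \<bar>s\<bar> \<le> sqrt \<kappa>" by simp
    moreover have "0 \<le> (2 / l) * y" using a y by simp
    ultimately show ?thesis unfolding \<kappa>_def[symmetric] y_def[symmetric] by linarith
  next
    \<comment> \<open>For |s| beyond 1/l + 1 all terms of k are absorbed into 2 n |s|. The deviation
      is at least a |s| sqrt n - a, and division by sqrt n sqrt |s| leaves the claim.\<close>
    case False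
    have sn: "sqrt n \<le> n" "sqrt n \<ge> 1" using n by (auto intro: sqrt_le_D real_le_lsqrt simp: power2_eq_square mult_le_cancel_left1)
    have "k \<le> n * (1 / a) + \<bar>s\<bar> * sqrt n + 1"
    proof -
      have "s * sqrt n \<le> \<bar>s\<bar> * sqrt n" using n by (intro mult_right_mono) auto
      then show ?thesis using k(2) by (simp add: divide_inverse)
    qed
    also have "\<dots> \<le> n * (1 / a) + \<bar>s\<bar> * n + n" using sn n by (intro add_mono mult_left_mono) auto
    also have "\<dots> = n * (1 / a + 1 + \<bar>s\<bar>)" by (simp add: algebra_simps)
    also have "\<dots> \<le> n * (2 * \<bar>s\<bar>)" using \<kappa> False n by (intro mult_left_mono) auto
    finally have kn: "k \<le> n * (2 * \<bar>s\<bar>)" .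
    have skn: "sqrt k \<le> sqrt n * (2 * sqrt \<bar>s\<bar>)"
    proof -
      have "k \<le> n * (4 * \<bar>s\<bar>)" using kn n by (smt (verit) mult_left_mono abs_ge_zero)
      then have "sqrt k \<le> sqrt (n * (4 * \<bar>s\<bar>))" by simp
      then show ?thesis by (simp add: real_sqrt_mult)
    qed
    have "a * (k - (n / a + s * sqrt n)) = k * a - n - a * (s * sqrt n)" using a0 by (simp add: field_simps)
    moreover have "a * (k - (n / a + s * sqrt n)) \<le> a * 1" "a * (k - (n / a + s * sqrt n)) \<ge> 0"
      using k a0 by (intro mult_left_mono mult_nonneg_nonneg; simp)+
    ultimately have "\<bar>a * (s * sqrt n)\<bar> \<le> \<bar>n - k * a\<bar> + a" by linarith
    then have "a * \<bar>s\<bar> * sqrt n \<le> sqrt k * y + a" using a0 n y by (simp add: abs_mult mult.assoc)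
    also have "\<dots> \<le> (sqrt n * (2 * sqrt \<bar>s\<bar>)) * y + a * \<bar>s\<bar> * 0 + a" using skn y by (auto intro: mult_right_mono)
    finally have "a * \<bar>s\<bar> * sqrt n \<le> (sqrt n * (2 * sqrt \<bar>s\<bar>)) * y + a" by simp
    also have "\<dots> \<le> (sqrt n * (2 * sqrt \<bar>s\<bar>)) * y + a * (sqrt n * sqrt \<bar>s\<bar>)"
    proof -
      have "\<bar>s\<bar> \<ge> 1" using False \<kappa> a0 by (smt (verit) divide_pos_pos)
      then have "sqrt n * sqrt \<bar>s\<bar> \<ge> 1 * 1" using sn by (intro mult_mono) auto
      then show ?thesis using a0 by simp
    qed
    also have "\<dots> = (sqrt n * sqrt \<bar>s\<bar>) * (2 * y + a)" by (simp add: algebra_simps)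
    finally have "(sqrt n * sqrt \<bar>s\<bar>) * (a * sqrt \<bar>s\<bar>) \<le> (sqrt n * sqrt \<bar>s\<bar>) * (2 * y + a)"
      by (simp add: algebra_simps)
    moreover have "sqrt n * sqrt \<bar>s\<bar> > 0" using n False \<kappa> by (intro mult_pos_pos) auto
    ultimately have "a * sqrt \<bar>s\<bar> \<le> 2 * y + a" by (simp add: mult_le_cancel_left_pos)
    then have "sqrt \<bar>s\<bar> \<le> (2 * y + a) / a" using a0 by (simp add: field_simps)
    also have "\<dots> = (2 / a) * y + 1" using a0 by (simp add: field_simps)
    also have "\<dots> \<le> (2 / l) * y + 1" using a y by (intro add_mono mult_right_mono divide_left_mono) auto
    also have "\<dots> \<le> sqrt \<kappa> + 2 + (2 / l) * y" using \<kappa> by (smt (verit) real_sqrt_ge_zero)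
    finally show ?thesis by (simp add: \<kappa>_def y_def)
  qed
qed

text \<open>With x = sqrt |s| one has x^4 = s^2, and an exponential in x dominates the fourth power.
  The majorant 1/(1 + s^2) is chosen because it is integrable over the line.\<close>

lemma exp_dominated_by_inverse_square:
  fixes \<eta> \<kappa> b :: real
  assumes "\<eta> > 0" "\<kappa> \<ge> 0" "b > 0"
  obtains K where "K > 0" "\<And>s y. y \<ge> 0 \<Longrightarrow> sqrt \<bar>s\<bar> \<le> \<kappa> + b * y \<Longrightarrow> exp (- \<eta> * y) \<le> K * (1 / (1 + s\<^sup>2))"
proof -
  define c where "c = \<eta> / b"
  have c: "c > 0" using assms by (simp add: c_def)
  define K where "K = exp (c * \<kappa>) * (1 + (4 / c) ^ 4)"
  show ?thesis
  proof (rule that)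
    show "K > 0" by (simp add: K_def add_pos_nonneg)
    fix s y :: real assume y: "y \<ge> 0" "sqrt \<bar>s\<bar> \<le> \<kappa> + b * y"
    define x where "x = sqrt \<bar>s\<bar>"
    have x: "x \<ge> 0" "x ^ 4 = s\<^sup>2"
    proof -
      have "x ^ 4 = (x\<^sup>2)\<^sup>2" by simp
      then show "x ^ 4 = s\<^sup>2" by (simp add: x_def)
    qed (simp add: x_def)
    have "x ^ 4 \<le> (exp ((c / 4) * x) / (c / 4)) ^ 4" using c x by (intro power_mono le_exp_div) auto
    also have "\<dots> = (4 / c) ^ 4 * exp (c * x)"
      using exp_of_nat_mult[of 4 "(c / 4) * x"] by (simp add: power_divide)
    finally have x4: "1 + s\<^sup>2 \<le> (1 + (4 / c) ^ 4) * exp (c * x)" using x c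
      by (simp add: distrib_right) (smt (verit) one_le_exp_iff mult_nonneg_nonneg)
    have "c * x \<le> c * \<kappa> + \<eta> * y" using mult_left_mono[OF y(2), of c] c assms by (simp add: x_def c_def field_simps)
    then have "exp (c * x) \<le> exp (c * \<kappa>) * exp (\<eta> * y)" by (simp add: exp_add[symmetric])
    then have "1 + s\<^sup>2 \<le> (1 + (4 / c) ^ 4) * (exp (c * \<kappa>) * exp (\<eta> * y))"
      by (intro order_trans[OF x4] mult_left_mono) (auto simp: add_nonneg_nonneg)
    also have "\<dots> = K * exp (\<eta> * y)" by (simp add: K_def)
    finally have "(1 + s\<^sup>2) * exp (- \<eta> * y) \<le> K * exp (\<eta> * y) * exp (- \<eta> * y)" by (rule mult_right_mono) simp
    then have "(1 + s\<^sup>2) * exp (- \<eta> * y) \<le> K" by (simp add: mult.assoc exp_add[symmetric])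
    then show "exp (- \<eta> * y) \<le> K * (1 / (1 + s\<^sup>2))" by (simp add: pos_le_divide_eq add_pos_nonneg mult.commute)
  qed
qed

text \<open>The index \<open>k\<close> is centred at \<open>n / a\<close> and rescaled by \<open>sqrt n\<close>.\<close>

definition centred_term :: "(nat \<Rightarrow> real) \<Rightarrow> real \<Rightarrow> real \<Rightarrow> real \<Rightarrow> real" where
  "centred_term q n a s = (if n / a + s * sqrt n \<ge> 0 then n * q (nat \<lfloor>n / a + s * sqrt n\<rfloor>) else 0)"

lemma centred_term_measurable [measurable]: "centred_term q n a \<in> borel_measurable borel"
  unfolding centred_term_def[abs_def] by measurable

text \<open>K depends only on \<eta> and l. The hypothesis is stated with \<open>Suc k\<close>
  because index k will stand for a sum of k + 1 vectors; for k the floor of the real position r, the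
  number k + 1 lies in (r, r + 1], as \<open>sqrt_le_renewal_deviation\<close> wants.\<close>

lemma centred_term_bound:
  assumes "\<eta> > 0" "l > (0::real)"
  obtains K where "K > 0" "\<And>q n a C s. \<lbrakk>n \<ge> 1; l \<le> a; C \<ge> 0; \<And>k. q k \<ge> 0;
      \<And>k. n * q k \<le> C * exp (- \<eta> * (\<bar>n - real (Suc k) * a\<bar> / sqrt (Suc k)))\<rbrakk>
      \<Longrightarrow> \<bar>centred_term q n a s\<bar> \<le> C * (K * (1 / (1 + s\<^sup>2)))"
proof -
  obtain K where K: "K > 0" "\<And>s y. y \<ge> 0 \<Longrightarrow> sqrt \<bar>s\<bar> \<le> (sqrt (1 / l + 1) + 2) + (2 / l) * y \<Longrightarrow> exp (- \<eta> * y) \<le> K * (1 / (1 + s\<^sup>2))"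
    using exp_dominated_by_inverse_square[of \<eta> "sqrt (1 / l + 1) + 2" "2 / l"] assms by (auto simp: add_nonneg_nonneg)
  show ?thesis
  proof (rule that[OF K(1)])
    fix q n a C s assume n: "n \<ge> 1" "l \<le> a" "C \<ge> (0::real)" "\<And>k. q k \<ge> 0"
      and q: "\<And>k. n * q k \<le> C * exp (- \<eta> * (\<bar>n - real (Suc k) * a\<bar> / sqrt (Suc k)))"
    show "\<bar>centred_term q n a s\<bar> \<le> C * (K * (1 / (1 + s\<^sup>2)))"
    proof (cases "n / a + s * sqrt n \<ge> 0")
      case True
      define k where "k = nat \<lfloor>n / a + s * sqrt n\<rfloor>"
      have k: "n / a + s * sqrt n < real (Suc k)" "real (Suc k) \<le> n / a + s * sqrt n + 1"
        using True unfolding k_def by linarith+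
      have "\<bar>centred_term q n a s\<bar> = n * q k" using True n by (simp add: centred_term_def k_def)
      also have "\<dots> \<le> C * exp (- \<eta> * (\<bar>n - real (Suc k) * a\<bar> / sqrt (Suc k)))" by (rule q)
      also have "\<dots> \<le> C * (K * (1 / (1 + s\<^sup>2)))"
        by (intro mult_left_mono K n sqrt_le_renewal_deviation[OF n(1) assms(2) n(2) True k]) auto
      finally show ?thesis .
    next
      case False
      then show ?thesis using n K by (simp add: centred_term_def)
    qed
  qed
qed

text \<open>The substitution r = n / a + s sqrt n: its Jacobian and the factor n built into
  \<open>centred_term\<close> together leave sqrt n in front of the series.\<close>

lemma suminf_eq_centred_integral:
  assumes n: "n > (0::real)" and q: "\<And>k. q k \<ge> 0" and int: "integrable lborel (centred_term q n a)"
  shows "summable q" and "sqrt n * suminf q = (\<integral>s. centred_term q n a s \<partial>lborel)"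
proof -
  define g where "g r = (if r \<ge> 0 then q (nat \<lfloor>r\<rfloor>) else 0)" for r :: real
  have c: "centred_term q n a s = n * g (n / a + sqrt n * s)" for s
    by (simp add: centred_term_def g_def mult.commute)
  have "integrable lborel (\<lambda>s. (1 / n) * centred_term q n a s)" using int by auto
  then have "integrable lborel (\<lambda>s. g (n / a + sqrt n * s))" using n by (simp add: c)
  then have g: "integrable lborel g" using n by (subst (asm) lborel_integrable_real_affine_iff) auto
  show "summable q" by (rule suminf_eq_floor_integral(1)[OF q g[unfolded g_def[abs_def]]])
  have "suminf q = (\<integral>r. g r \<partial>lborel)"
    unfolding g_def by (rule suminf_eq_floor_integral(2)[OF q g[unfolded g_def[abs_def]]])
  also have "\<dots> = sqrt n * (\<integral>s. g (n / a + sqrt n * s) \<partial>lborel)"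
    using n by (subst lborel_integral_real_affine[where c = "sqrt n" and t = "n / a"]) auto
  finally have "sqrt n * suminf q = (sqrt n * sqrt n) * (\<integral>s. g (n / a + sqrt n * s) \<partial>lborel)" by simp
  then show "sqrt n * suminf q = (\<integral>s. centred_term q n a s \<partial>lborel)" using n by (simp add: c)
qed

text \<open>The constant depends on \<eta> and l alone, which later makes the bound uniform in the
  tilt and in the end point.\<close>

lemma renewal_sum_bound:
  assumes "\<eta> > 0" "l > (0::real)"
  shows "\<exists>K. K > 0 \<and> (\<forall>q n a C. n \<ge> 1 \<longrightarrow> l \<le> a \<longrightarrow> C \<ge> 0 \<longrightarrow> (\<forall>k. q k \<ge> 0) \<longrightarrow>
      (\<forall>k. n * q k \<le> C * exp (- \<eta> * (\<bar>n - real (Suc k) * a\<bar> / sqrt (Suc k)))) \<longrightarrow>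
      summable q \<and> sqrt n * suminf q \<le> C * K)"
proof -
  obtain K where K: "K > 0" and b: "\<And>q n a C s. \<lbrakk>n \<ge> 1; l \<le> a; C \<ge> 0; \<And>k. q k \<ge> 0;
      \<And>k. n * q k \<le> C * exp (- \<eta> * (\<bar>n - real (Suc k) * a\<bar> / sqrt (Suc k)))\<rbrakk>
      \<Longrightarrow> \<bar>centred_term q n a s\<bar> \<le> C * (K * (1 / (1 + s\<^sup>2)))"
    using centred_term_bound[OF assms] by blast
  define J where "J = (\<integral>s. 1 / (1 + s\<^sup>2) \<partial>(lborel :: real measure))"
  have J: "J \<ge> 0" unfolding J_def by (intro Bochner_Integration.integral_nonneg) (auto simp: add_nonneg_nonneg)
  show ?thesis
  proof (intro exI[of _ "K * (J + 1)"] conjI allI impI)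
    show "K * (J + 1) > 0" using K J by simp
    fix q n a C assume n: "n \<ge> 1" "l \<le> a" "C \<ge> (0::real)" and q0': "\<forall>k. q k \<ge> 0"
      and q': "\<forall>k. n * q k \<le> C * exp (- \<eta> * (\<bar>n - real (Suc k) * a\<bar> / sqrt (Suc k)))"
    note q0 = q0'[rule_format] and q = q'[rule_format]
    have bb: "\<bar>centred_term q n a s\<bar> \<le> C * (K * (1 / (1 + s\<^sup>2)))" for s by (rule b[OF n q0 q])
    have i: "integrable lborel (\<lambda>s::real. C * (K * (1 / (1 + s\<^sup>2))))"
      using integrable_inverse_1_plus_square by (intro integrable_mult_right)
    have int: "integrable lborel (centred_term q n a)"
      by (rule Bochner_Integration.integrable_bound[OF i]) (simp, intro AE_I2, simp only: real_norm_def, rule order_trans[OF bb abs_ge_self])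
    note s = suminf_eq_centred_integral[OF _ q0 int]
    have "sqrt n * suminf q = (\<integral>s. centred_term q n a s \<partial>lborel)" using s(2) n by simp
    also have "\<dots> \<le> (\<integral>s. C * (K * (1 / (1 + s\<^sup>2))) \<partial>lborel)"
      by (rule integral_mono[OF int i]) (use bb in \<open>auto intro: order_trans[OF abs_ge_self]\<close>)
    also have "\<dots> = C * (K * J)" unfolding integral_mult_right_zero J_def ..
    also have "\<dots> \<le> C * (K * (J + 1))" using n K by (intro mult_left_mono) auto
    finally show "sqrt n * suminf q \<le> C * (K * (J + 1))" .
    show "summable q" using s(1) n by simp
  qed
qed

text \<open>The limit is taken under the integral in s with the majorant of
  \<open>centred_term_bound\<close>, while the terms, the time and the mean all vary with j.\<close>

lemma renewal_sum_tendsto: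
  fixes q :: "nat \<Rightarrow> nat \<Rightarrow> real" and n a :: "nat \<Rightarrow> real" and G :: "real \<Rightarrow> real"
  assumes \<eta>: "\<eta> > 0" and l: "l > 0" and C: "C \<ge> 0" and n: "\<And>j. n j \<ge> 1" and a: "\<And>j. l \<le> a j"
    and q0: "\<And>j k. q j k \<ge> 0"
    and q: "\<And>j k. n j * q j k \<le> C * exp (- \<eta> * (\<bar>n j - real (Suc k) * a j\<bar> / sqrt (Suc k)))"
    and [measurable]: "G \<in> borel_measurable borel"
    and lim: "\<And>s. (\<lambda>j. centred_term (q j) (n j) (a j) s) \<longlonglongrightarrow> G s"
  shows "(\<lambda>j. sqrt (n j) * suminf (q j)) \<longlonglongrightarrow> (\<integral>s. G s \<partial>lborel)"
proof -
  obtain K where K: "K > 0" and b: "\<And>q n a C s. \<lbrakk>n \<ge> 1; l \<le> a; C \<ge> 0; \<And>k. q k \<ge> 0;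
      \<And>k. n * q k \<le> C * exp (- \<eta> * (\<bar>n - real (Suc k) * a\<bar> / sqrt (Suc k)))\<rbrakk>
      \<Longrightarrow> \<bar>centred_term q n a s\<bar> \<le> C * (K * (1 / (1 + s\<^sup>2)))"
    using centred_term_bound[OF \<eta> l] by blast
  have bb: "\<bar>centred_term (q j) (n j) (a j) s\<bar> \<le> C * (K * (1 / (1 + s\<^sup>2)))" for j s by (rule b[OF n a C q0 q])
  have i: "integrable lborel (\<lambda>s::real. C * (K * (1 / (1 + s\<^sup>2))))"
    using integrable_inverse_1_plus_square by (intro integrable_mult_right)
  have int: "integrable lborel (centred_term (q j) (n j) (a j))" for j
    by (rule Bochner_Integration.integrable_bound[OF i]) (simp, intro AE_I2, simp only: real_norm_def, rule order_trans[OF bb abs_ge_self])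
  have "(\<lambda>j. \<integral>s. centred_term (q j) (n j) (a j) s \<partial>lborel) \<longlonglongrightarrow> (\<integral>s. G s \<partial>lborel)"
    by (rule integral_dominated_convergence[OF _ _ i]) (use lim bb in auto)
  moreover have "n j > 0" for j using n[of j] by linarith
  ultimately show ?thesis using suminf_eq_centred_integral(2)[OF _ q0 int] by simp
qed

section \<open>Sums of independent lattice vectors\<close>

definition V_sum :: "(nat \<Rightarrow> 'a \<Rightarrow> real ^ 2) \<Rightarrow> nat \<Rightarrow> 'a \<Rightarrow> real ^ 2" where
  "V_sum X n \<omega> = (\<Sum>k=1..n. X k \<omega>)"

abbreviation pvec :: "real \<times> real \<Rightarrow> real ^ 2" where "pvec z \<equiv> vec2 (fst z) (snd z)"

lemma vec2_inner: "vec2 a b \<bullet> v = a * v $ 1 + b * v $ 2"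
  by (simp add: inner_vec_def UNIV_2)

lemma inner_real2: "u \<bullet> v = u $ 1 * v $ 1 + u $ 2 * v $ 2" for u v :: "real^2"
  by (simp add: inner_vec_def UNIV_2)

lemma pvec_norm: "norm (pvec z) = norm z"
proof -
  have "(norm (pvec z))\<^sup>2 = (norm z)\<^sup>2"
    unfolding power2_norm_eq_inner by (simp add: vec2_inner inner_prod_def)
  then show ?thesis by (rule power2_eq_imp_eq) auto
qed

lemma pvec_scaleR: "pvec (r *\<^sub>R z) = r *\<^sub>R pvec z"
  by (simp add: vec_eq_iff forall_2)

lemma pvec_inner: "pvec z \<bullet> v = z \<bullet> (v $ 1, v $ 2)"
  by (simp add: vec2_inner inner_prod_def)

lemma pvec_eq_sum: "pvec z = fst z *\<^sub>R axis 1 1 + snd z *\<^sub>R axis 2 1"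
  by (simp add: vec_eq_iff forall_2 axis_def)

lemma pvec_measurable [measurable]: "pvec \<in> borel_measurable borel"
  unfolding pvec_eq_sum[abs_def] by (intro borel_measurable_continuous_onI continuous_intros)

lemma borel_measurable_nth_real2 [measurable (raw)]:
  fixes f :: "'a \<Rightarrow> real ^ 2"
  shows "f \<in> borel_measurable M \<Longrightarrow> (\<lambda>x. f x $ i) \<in> borel_measurable M"
  by (rule measurable_compose[of _ M borel "\<lambda>x. x $ i"]) (auto intro!: borel_measurable_continuous_onI continuous_intros)

lemma exp_int_imp_integrable: "exp_int M Y p 0 \<Longrightarrow> integrable M (\<lambda>\<omega>. exp (p \<bullet> Y \<omega>))"
  by (simp add: exp_int_def)

lemma cos_eq_1_Ints: "cos (2 * pi * x) = 1 \<Longrightarrow> x \<in> \<int>"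
proof -
  assume "cos (2 * pi * x) = 1"
  then obtain n :: int where "2 * pi * x = of_int n * 2 * pi" by (auto simp: cos_one_2pi_int)
  then have "x = of_int n" by simp
  then show ?thesis by simp
qed

context arithmetic_compound_renewal begin

lemma X_measurable [measurable]: "k \<ge> 1 \<Longrightarrow> X k \<in> borel_measurable M"
  using indep by (auto simp: indep_vars_def)

lemma V_sum_measurable [measurable]: "V_sum X n \<in> borel_measurable M"
  unfolding V_sum_def[abs_def] by (intro borel_measurable_sum) (auto intro: X_measurable)

lemma xi_meas [measurable]: "\<xi> \<in> borel_measurable M" by (rule xi_measurable)

lemma law_transfer:
  assumes "k \<ge> 2"
  shows "P \<in> borel_measurable borel \<Longrightarrow> (\<integral>\<omega>. P (X k \<omega>) \<partial>M) = (\<integral>\<omega>. (P (\<xi> \<omega>) :: 'b::{banach,second_countable_topology}) \<partial>M)"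
    and "P \<in> borel_measurable borel \<Longrightarrow> integrable M (\<lambda>\<omega>. P (X k \<omega>)) \<longleftrightarrow> integrable M (\<lambda>\<omega>. P (\<xi> \<omega>))"
    and "B \<in> sets borel \<Longrightarrow> prob {\<omega>\<in>space M. X k \<omega> \<in> B} = prob {\<omega>\<in>space M. \<xi> \<omega> \<in> B}"
proof -
  have [measurable]: "X k \<in> borel_measurable M" using assms by simp
  show "P \<in> borel_measurable borel \<Longrightarrow> (\<integral>\<omega>. P (X k \<omega>) \<partial>M) = (\<integral>\<omega>. P (\<xi> \<omega>) \<partial>M)"
    using integral_distr[of "X k" M borel P] integral_distr[of \<xi> M borel P] same_law[OF assms] by simp
  show "P \<in> borel_measurable borel \<Longrightarrow> integrable M (\<lambda>\<omega>. P (X k \<omega>)) \<longleftrightarrow> integrable M (\<lambda>\<omega>. P (\<xi> \<omega>))"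
    using integrable_distr_eq[of "X k" M borel P] integrable_distr_eq[of \<xi> M borel P] same_law[OF assms] by simp
  assume B: "B \<in> sets borel"
  have "measure (distr M borel (X k)) B = measure (distr M borel \<xi>) B" by (simp only: same_law[OF assms])
  then show "prob {\<omega>\<in>space M. X k \<omega> \<in> B} = prob {\<omega>\<in>space M. \<xi> \<omega> \<in> B}"
    using B by (simp add: measure_distr vimage_def Int_def conj_commute)
qed

lemma AE_law_transfer:
  assumes "k \<ge> 2" "{x. P x} \<in> sets borel" "AE \<omega> in M. P (\<xi> \<omega>)"
  shows "AE \<omega> in M. P (X k \<omega>)"
proof -
  have [measurable]: "X k \<in> borel_measurable M" using assms by simp
  have "AE x in distr M borel \<xi>. P x" using assms by (subst AE_distr_iff) auto
  then have "AE x in distr M borel (X k). P x" by (simp only: same_law[OF assms(1)])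
  then show ?thesis using assms by (subst (asm) AE_distr_iff) auto
qed

lemma int_lattice_sets [measurable]: "int_lattice \<in> sets borel"
proof -
  have "{x :: real^2. x $ i \<in> \<int>} \<in> sets borel" for i
    using closed_vimage[OF closed_Ints, of "\<lambda>x :: real^2. x $ i"] by (intro borel_closed) (simp add: vimage_def continuous_intros)
  from sets.Int[OF this[of 1] this[of 2]] show ?thesis
    by (simp add: int_lattice_def forall_2 Collect_conj_eq)
qed

text \<open>At the two unit vectors \<open>char_eq_1\<close> gives expectation 1 to cos (2 pi
  \<xi>_i), which never exceeds 1, so it equals 1 almost surely.\<close>

lemma xi_lattice: "AE \<omega> in M. \<xi> \<omega> \<in> int_lattice"
proof -
  have "AE \<omega> in M. \<xi> \<omega> $ i \<in> \<int>" for i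
  proof -
    define e :: "real^2" where "e = axis i 1"
    have e: "e \<in> int_lattice" by (auto simp: int_lattice_def e_def axis_def)
    have inner: "((2 * pi) *\<^sub>R e) \<bullet> \<xi> \<omega> = 2 * pi * \<xi> \<omega> $ i" for \<omega>
      by (simp add: e_def inner_axis' )
    have int: "integrable M (\<lambda>\<omega>. iexp (2 * pi * \<xi> \<omega> $ i))"
      by (rule integrable_const_bound[of _ 1]) auto
    have "(CLINT \<omega>|M. iexp (2 * pi * \<xi> \<omega> $ i)) = 1" using char_eq_1[OF e] unfolding char_fun2_def inner .
    then have "Re (CLINT \<omega>|M. iexp (2 * pi * \<xi> \<omega> $ i)) = 1" by simp
    then have "(\<integral>\<omega>. cos (2 * pi * \<xi> \<omega> $ i) \<partial>M) = 1"
      by (subst (asm) integral_Re[OF int, symmetric]) (simp add: Re_exp)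
    moreover have ic: "integrable M (\<lambda>\<omega>. cos (2 * pi * \<xi> \<omega> $ i))"
      by (rule integrable_const_bound[of _ 1]) auto
    ultimately have "(\<integral>\<omega>. 1 - cos (2 * pi * \<xi> \<omega> $ i) \<partial>M) = 0" by (simp add: prob_space)
    then have "AE \<omega> in M. 1 - cos (2 * pi * \<xi> \<omega> $ i) = 0"
      by (subst (asm) integral_nonneg_eq_0_iff_AE) (use ic in auto)
    then show ?thesis by eventually_elim (auto intro: cos_eq_1_Ints)
  qed
  then have "AE \<omega> in M. \<forall>i. \<xi> \<omega> $ i \<in> \<int>" by (simp add: forall_2)
  then show ?thesis by (simp add: int_lattice_def)
qed

lemma X_lattice: "k \<ge> 1 \<Longrightarrow> AE \<omega> in M. X k \<omega> \<in> int_lattice"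
proof (cases "k = 1")
  case False
  assume "k \<ge> 1"
  with False have "k \<ge> 2" by simp
  then show ?thesis by (rule AE_law_transfer) (use xi_lattice int_lattice_sets in auto)
qed (use xi1_lattice in simp)

lemma V_sum_lattice: "AE \<omega> in M. V_sum X n \<omega> \<in> int_lattice"
proof -
  have "AE \<omega> in M. \<forall>k\<in>{1..n}. X k \<omega> \<in> int_lattice"
    by (rule AE_finite_allI) (auto intro: X_lattice)
  then show ?thesis
    by eventually_elim (auto simp: V_sum_def int_lattice_def intro!: Ints_sum)
qed

text \<open>\<open>L\<^sub>0\<close> and \<open>L\<^sub>1\<close> are the Laplace transforms of
  \<xi> and \<xi>_1 at the complex argument p + i u.\<close>

definition L\<^sub>0 :: "real^2 \<Rightarrow> real^2 \<Rightarrow> complex" where "L\<^sub>0 p u = mom M \<xi> (\<lambda>\<omega>. iexp (u \<bullet> \<xi> \<omega>)) p"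
definition L\<^sub>1 :: "real^2 \<Rightarrow> real^2 \<Rightarrow> complex" where "L\<^sub>1 p u = mom M (X 1) (\<lambda>\<omega>. iexp (u \<bullet> X 1 \<omega>)) p"
text \<open>A Bochner integral, so its value off the domain is 0; a condition such as
  \<open>psi0 w \<le> 1\<close> has content only together with membership in the domain.\<close>

definition psi0 :: "real^2 \<Rightarrow> real" where "psi0 = mom M \<xi> (\<lambda>_. 1)"
definition psi1 :: "real^2 \<Rightarrow> real" where "psi1 = mom M (X 1) (\<lambda>_. 1)"
text \<open>Index N stands for N + 1 summands: the first step with its own law and N copies of
  \<xi>, so that the transform is \<open>L\<^sub>1\<close> times the N-th power of
  \<open>L\<^sub>0\<close>.\<close>

definition point_mass :: "real^2 \<Rightarrow> nat \<Rightarrow> real^2 \<Rightarrow> real" where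
  "point_mass p N y = exp (p \<bullet> y) * prob {\<omega>\<in>space M. V_sum X (Suc N) \<omega> = y}"

text \<open>The first moment under the unnormalised weight, that is, the gradient of
  \<open>psi0\<close>. At points where \<open>psi0\<close> is 1 it is the mean of the tilted law and
  the gradient of A, and \<open>cov\<close> is the tilted covariance.\<close>

definition mean :: "real^2 \<Rightarrow> real^2" where "mean = mom M \<xi> \<xi>"

definition cov :: "real^2 \<Rightarrow> 2 \<Rightarrow> 2 \<Rightarrow> real" where
  "cov p i k = mom M \<xi> (\<lambda>\<omega>. (\<xi> \<omega> - mean p) $ i * (\<xi> \<omega> - mean p) $ k) p"

definition var_form :: "real^2 \<Rightarrow> real^2 \<Rightarrow> real" where
  "var_form p w = mom M \<xi> (\<lambda>\<omega>. (w \<bullet> (\<xi> \<omega> - mean p))\<^sup>2) p"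

definition cov_det :: "real^2 \<Rightarrow> real" where "cov_det p = cov p 1 1 * cov p 2 2 - (cov p 1 2)\<^sup>2"

definition renewal_mass :: "real^2 \<Rightarrow> real^2 \<Rightarrow> real" where
  "renewal_mass p y = (\<Sum>N. point_mass p N y)"

text \<open>The variance form at the vector orthogonal to the mean; equivalently the determinant
  times the inverse covariance form at the mean, which is how it enters a Gaussian density along the
  ray of the mean.\<close>

definition line_var :: "real^2 \<Rightarrow> real" where
  "line_var p = cov p 2 2 * (mean p $ 1)\<^sup>2 - 2 * cov p 1 2 * mean p $ 1 * mean p $ 2 + cov p 1 1 * (mean p $ 2)\<^sup>2"

text \<open>Independence turns the transform of the sum into a product, from which the first factor
  is split off because \<xi>_1 has its own law.\<close>

lemma laplace_V_sum:
  assumes E: "exp_int M \<xi> p 0" "exp_int M (X 1) p 0"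
  shows "integrable M (\<lambda>\<omega>. exp (p \<bullet> V_sum X (Suc N) \<omega>) *\<^sub>R iexp (u \<bullet> V_sum X (Suc N) \<omega>))"
    and "(CLINT \<omega>|M. exp (p \<bullet> V_sum X (Suc N) \<omega>) *\<^sub>R iexp (u \<bullet> V_sum X (Suc N) \<omega>)) = L\<^sub>1 p u * L\<^sub>0 p u ^ N"
proof -
  define f where "f x = exp (p \<bullet> x) *\<^sub>R iexp (u \<bullet> x)" for x :: "real^2"
  have [measurable]: "f \<in> borel_measurable borel" unfolding f_def[abs_def] by measurable
  have ind: "indep_vars (\<lambda>_. borel) (\<lambda>k \<omega>. f (X k \<omega>)) {1..Suc N}"
    by (rule indep_vars_compose2[OF indep_vars_subset[OF indep]]) auto
  have i1: "integrable M (\<lambda>\<omega>. f (X 1 \<omega>))"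
    by (rule Bochner_Integration.integrable_bound[OF exp_int_imp_integrable[OF E(2)]]) (auto simp: f_def)
  have i2: "integrable M (\<lambda>\<omega>. f (\<xi> \<omega>))"
    by (rule Bochner_Integration.integrable_bound[OF exp_int_imp_integrable[OF E(1)]]) (auto simp: f_def)
  have int: "integrable M (\<lambda>\<omega>. f (X k \<omega>))" if "k \<in> {1..Suc N}" for k
    using i1 i2 law_transfer(2)[of k f] that by (cases "k = 1") auto
  have prod: "(\<Prod>k\<in>{1..n}. f (X k \<omega>)) = exp (p \<bullet> V_sum X n \<omega>) *\<^sub>R iexp (u \<bullet> V_sum X n \<omega>)" for \<omega> n
    by (induction n) (simp_all add: f_def V_sum_def inner_add_right exp_add distrib_left scaleR_conv_of_real mult_ac)
  show "integrable M (\<lambda>\<omega>. exp (p \<bullet> V_sum X (Suc N) \<omega>) *\<^sub>R iexp (u \<bullet> V_sum X (Suc N) \<omega>))"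
    using indep_vars_integrable[OF _ ind int] unfolding prod by simp
  have "(CLINT \<omega>|M. exp (p \<bullet> V_sum X (Suc N) \<omega>) *\<^sub>R iexp (u \<bullet> V_sum X (Suc N) \<omega>)) = (\<Prod>k\<in>{1..Suc N}. CLINT \<omega>|M. f (X k \<omega>))"
    using indep_vars_lebesgue_integral[OF _ ind int] unfolding prod by simp
  also have "\<dots> = (CLINT \<omega>|M. f (X 1 \<omega>)) * (\<Prod>k\<in>{2..Suc N}. CLINT \<omega>|M. f (X k \<omega>))"
    by (subst prod.atLeast_Suc_atMost) (auto simp: numeral_2_eq_2)
  also have "(\<Prod>k\<in>{2..Suc N}. CLINT \<omega>|M. f (X k \<omega>)) = (\<Prod>k\<in>{2..Suc N}. CLINT \<omega>|M. f (\<xi> \<omega>))"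
    by (intro prod.cong refl law_transfer(1)) auto
  finally show "(CLINT \<omega>|M. exp (p \<bullet> V_sum X (Suc N) \<omega>) *\<^sub>R iexp (u \<bullet> V_sum X (Suc N) \<omega>)) = L\<^sub>1 p u * L\<^sub>0 p u ^ N"
    by (simp add: L\<^sub>0_def L\<^sub>1_def mom_def f_def)
qed

text \<open>Inversion formula: Fubini exchanges the expectation with the integral over the square,
  and as the sum is almost surely a lattice point the inner integral yields (2 pi)^2 or 0. On the
  event that the sum is y the weight is the constant \<open>exp (p \<bullet> y)\<close>.\<close>

lemma point_mass_fourier:
  assumes E: "exp_int M \<xi> p 0" "exp_int M (X 1) p 0" and y: "y \<in> int_lattice"
  shows "of_real ((2 * pi)\<^sup>2 * point_mass p N y)
    = (CLINT z|lborel. indicator torus z *\<^sub>R (L\<^sub>1 p (pvec z) * L\<^sub>0 p (pvec z) ^ N * iexp (- (z \<bullet> (y $ 1, y $ 2)))))"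
proof -
  define S where "S = V_sum X (Suc N)"
  have [measurable]: "S \<in> borel_measurable M" by (simp add: S_def)
  interpret P: pair_sigma_finite M "lborel :: (real \<times> real) measure" ..
  define f where "f \<omega> z = indicator torus z *\<^sub>R (exp (p \<bullet> S \<omega>) *\<^sub>R iexp (z \<bullet> ((S \<omega> - y) $ 1, (S \<omega> - y) $ 2)))" for \<omega> and z :: "real \<times> real"
  have Sint: "integrable M (\<lambda>\<omega>. exp (p \<bullet> S \<omega>) *\<^sub>R iexp (u \<bullet> S \<omega>))" for u
    using laplace_V_sum(1)[OF E] by (simp add: S_def)
  have Sexp: "integrable M (\<lambda>\<omega>. exp (p \<bullet> S \<omega>))" using integrable_norm[OF Sint[of 0]] by simp
  have tor: "integrable lborel (indicator torus :: real \<times> real \<Rightarrow> real)"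
  proof -
    have "bounded torus" unfolding torus_def by (intro bounded_Times) auto
    then show ?thesis by (intro integrable_real_indicator) (use emeasure_bounded_finite[of torus] in auto)
  qed
  have normf: "norm (f \<omega> z) = exp (p \<bullet> S \<omega>) * indicator torus z" for \<omega> z by (auto simp: f_def indicator_def)
  have meas: "case_prod f \<in> borel_measurable (M \<Otimes>\<^sub>M lborel)"
  proof -
    have [measurable]: "indicator torus \<in> borel_measurable (borel :: (real \<times> real) measure)" by measurable
    have "(\<lambda>x. (S (fst x) - y) $ i) \<in> borel_measurable (M \<Otimes>\<^sub>M (lborel :: (real \<times> real) measure))" for i by measurable
    note [measurable] = this
    show ?thesis unfolding f_def case_prod_beta' by measurable
  qed
  have "integrable (M \<Otimes>\<^sub>M lborel) (case_prod f)"
  proof (rule P.Fubini_integrable[OF meas])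
    show "integrable M (\<lambda>x. \<integral>y. norm (case_prod f (x, y)) \<partial>lborel)"
      using Sexp by (simp add: normf)
    show "AE x in M. integrable lborel (\<lambda>y. case_prod f (x, y))"
    proof (rule AE_I2)
      fix \<omega> assume "\<omega> \<in> space M"
      have "f \<omega> \<in> borel_measurable lborel" unfolding f_def by measurable
      then show "integrable lborel (\<lambda>z. case_prod f (\<omega>, z))"
        by (intro Bochner_Integration.integrable_bound[OF integrable_mult_right[OF tor, of "exp (p \<bullet> S \<omega>)"]]) (auto simp: normf)
    qed
  qed
  from P.Fubini_integral[OF this]
  have fub: "(\<integral>z. (\<integral>\<omega>. f \<omega> z \<partial>M) \<partial>lborel) = (\<integral>\<omega>. (\<integral>z. f \<omega> z \<partial>lborel) \<partial>M)" .
  have left: "(\<integral>\<omega>. f \<omega> z \<partial>M) = indicator torus z *\<^sub>R (L\<^sub>1 p (pvec z) * L\<^sub>0 p (pvec z) ^ N * iexp (- (z \<bullet> (y $ 1, y $ 2))))" for z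
  proof -
    have "f \<omega> z = indicator torus z *\<^sub>R ((exp (p \<bullet> S \<omega>) *\<^sub>R iexp (pvec z \<bullet> S \<omega>)) * iexp (- (z \<bullet> (y $ 1, y $ 2))))" for \<omega>
      unfolding f_def pvec_inner by (simp add: exp_add[symmetric] inner_prod_def algebra_simps)
    then have "(\<integral>\<omega>. f \<omega> z \<partial>M) = indicator torus z *\<^sub>R ((\<integral>\<omega>. exp (p \<bullet> S \<omega>) *\<^sub>R iexp (pvec z \<bullet> S \<omega>) \<partial>M) * iexp (- (z \<bullet> (y $ 1, y $ 2))))"
      by (simp only: integral_scaleR_right integral_mult_left_zero)
    then show ?thesis using laplace_V_sum(2)[OF E, of N "pvec z"] by (simp add: S_def)
  qed
  have right: "AE \<omega> in M. (\<integral>z. f \<omega> z \<partial>lborel) = of_real ((2 * pi)\<^sup>2 * (exp (p \<bullet> y) * indicator {\<omega>\<in>space M. S \<omega> = y} \<omega>))"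
    using V_sum_lattice[of "Suc N"] AE_space
  proof eventually_elim
    case (elim \<omega>)
    have "(S \<omega> - y) $ i \<in> \<int>" for i using elim y by (auto simp: S_def int_lattice_def)
    then obtain k l :: int where kl: "(S \<omega> - y) $ 1 = of_int k" "(S \<omega> - y) $ 2 = of_int l"
      by (metis Ints_cases)
    have iff: "S \<omega> = y \<longleftrightarrow> k = 0 \<and> l = 0" using kl by (auto simp: vec_eq_iff forall_2)
    have "(\<integral>z. f \<omega> z \<partial>lborel) = exp (p \<bullet> S \<omega>) *\<^sub>R (CLINT z|lborel. indicator torus z *\<^sub>R iexp (fst z * of_int k + snd z * of_int l))"
      unfolding f_def kl integral_scaleR_right[symmetric] by (simp add: inner_prod_def mult_ac)
    also have "\<dots> = of_real ((2 * pi)\<^sup>2 * (exp (p \<bullet> y) * indicator {\<omega>\<in>space M. S \<omega> = y} \<omega>))"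
      unfolding fourier_int_torus using elim iff by (auto simp: scaleR_conv_of_real)
    finally show ?case .
  qed
  have "(\<integral>\<omega>. (\<integral>z. f \<omega> z \<partial>lborel) \<partial>M) = (CLINT \<omega>|M. of_real ((2 * pi)\<^sup>2 * (exp (p \<bullet> y) * indicator {\<omega>\<in>space M. S \<omega> = y} \<omega>)))"
  proof (rule integral_cong_AE[OF _ _ right])
    show "(\<lambda>\<omega>. \<integral>z. f \<omega> z \<partial>lborel) \<in> borel_measurable M"
      using lborel.borel_measurable_lebesgue_integral[OF meas] by simp
  qed measurable
  also have "\<dots> = of_real ((2 * pi)\<^sup>2 * point_mass p N y)"
    by (simp add: integral_complex_of_real point_mass_def S_def del: of_real_mult)
  finally show ?thesis using fub left by simp
qed

end

section \<open>Uniform bounds and the local limit theorem under exponential tilting\<close>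

lemma norm_power_growth:
  assumes "\<sigma> > 0" "A \<ge> 0"
  obtains C where "C \<ge> 0" "\<And>y :: 'v::real_normed_vector. (norm y + A) ^ k \<le> C * exp (\<sigma> * norm y)"
proof -
  define \<delta> where "\<delta> = \<sigma> / real (Suc k)"
  have \<delta>: "\<delta> > 0" "real k * \<delta> \<le> \<sigma>" using assms by (auto simp: \<delta>_def field_simps)
  show ?thesis
  proof (rule that[of "exp (\<sigma> * A) / \<delta> ^ k"])
    fix y :: 'v
    have "(norm y + A) ^ k \<le> (exp (\<delta> * (norm y + A)) / \<delta>) ^ k" using assms by (intro power_mono le_exp_div \<delta>) auto
    also have "\<dots> = exp (real k * \<delta> * (norm y + A)) / \<delta> ^ k"
      by (simp add: power_divide exp_of_nat_mult[symmetric] mult.assoc)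
    also have "\<dots> \<le> exp (\<sigma> * (norm y + A)) / \<delta> ^ k"
      using \<delta> assms by (intro divide_right_mono) (auto intro: mult_right_mono)
    also have "\<dots> = exp (\<sigma> * A) / \<delta> ^ k * exp (\<sigma> * norm y)" by (simp add: exp_add distrib_left)
    finally show "(norm y + A) ^ k \<le> exp (\<sigma> * A) / \<delta> ^ k * exp (\<sigma> * norm y)" .
  qed (use \<delta> in auto)
qed

text \<open>Collects what is needed around one base point: \<rho> is the slack available there to
  both laws. The estimates hold for all tilts within \<rho> or \<rho>/4 of \<open>p\<^sub>0\<close>,
  so they apply along sequences converging to it.\<close>

locale tilted_renewal = arithmetic_compound_renewal M \<xi> X for M :: "'a measure" and \<xi> X +
  fixes p\<^sub>0 :: "real^2" and \<rho> :: real
  assumes rho_pos: "\<rho> > 0" and exp_int_xi: "exp_int M \<xi> p\<^sub>0 \<rho>" and exp_int_X1: "exp_int M (X 1) p\<^sub>0 \<rho>"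
begin

lemma X1_measurable [measurable]: "X 1 \<in> borel_measurable M" "X (Suc 0) \<in> borel_measurable M"
  using X_measurable[of 1] by auto

lemma exp_int_near:
  assumes "dist p p\<^sub>0 + \<sigma> \<le> \<rho>"
  shows "exp_int M \<xi> p \<sigma>" "exp_int M (X 1) p \<sigma>"
  by (rule exp_int_mono[OF xi_meas exp_int_xi assms]) (rule exp_int_mono[OF X1_measurable(1) exp_int_X1 assms])

text \<open>One majorant for the transforms of both laws on the ball of radius \<rho>.\<close>

definition psi_max :: real where
  "psi_max = (\<integral>\<omega>. exp (p\<^sub>0 \<bullet> \<xi> \<omega> + \<rho> * norm (\<xi> \<omega>)) \<partial>M) + (\<integral>\<omega>. exp (p\<^sub>0 \<bullet> X 1 \<omega> + \<rho> * norm (X 1 \<omega>)) \<partial>M)"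

lemma mom_le_psi_max:
  fixes F :: "'a \<Rightarrow> 'b::{banach,second_countable_topology}"
  assumes [measurable]: "F \<in> borel_measurable M" and d: "dist p p\<^sub>0 + \<sigma> \<le> \<rho>"
    and C: "C \<ge> 0" "\<And>\<omega>. norm (F \<omega>) \<le> C * exp (\<sigma> * norm (\<xi> \<omega>))"
  shows "norm (mom M \<xi> F p) \<le> C * psi_max"
proof -
  have "norm (mom M \<xi> F p) \<le> (\<integral>\<omega>. C * exp (p\<^sub>0 \<bullet> \<xi> \<omega> + \<rho> * norm (\<xi> \<omega>)) \<partial>M)"
    unfolding mom_def
  proof (rule norm_integral_le_integral)
    show "integrable M (\<lambda>\<omega>. exp (p \<bullet> \<xi> \<omega>) *\<^sub>R F \<omega>)"
      by (rule mom_integrable[OF _ _ exp_int_near(1)[OF d]]) (use C in auto)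
    show "integrable M (\<lambda>\<omega>. C * exp (p\<^sub>0 \<bullet> \<xi> \<omega> + \<rho> * norm (\<xi> \<omega>)))" using exp_int_xi by (auto simp: exp_int_def)
    fix \<omega>
    have "(p - p\<^sub>0) \<bullet> \<xi> \<omega> \<le> dist p p\<^sub>0 * norm (\<xi> \<omega>)" by (metis dist_norm norm_cauchy_schwarz)
    moreover have "(dist p p\<^sub>0 + \<sigma>) * norm (\<xi> \<omega>) \<le> \<rho> * norm (\<xi> \<omega>)" using d by (intro mult_right_mono) auto
    ultimately have *: "p \<bullet> \<xi> \<omega> + \<sigma> * norm (\<xi> \<omega>) \<le> p\<^sub>0 \<bullet> \<xi> \<omega> + \<rho> * norm (\<xi> \<omega>)"
      by (simp add: inner_diff_left algebra_simps)
    have "norm (exp (p \<bullet> \<xi> \<omega>) *\<^sub>R F \<omega>) \<le> exp (p \<bullet> \<xi> \<omega>) * (C * exp (\<sigma> * norm (\<xi> \<omega>)))"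
      using mult_left_mono[OF C(2)] by simp
    also have "\<dots> = C * exp (p \<bullet> \<xi> \<omega> + \<sigma> * norm (\<xi> \<omega>))" by (simp add: exp_add)
    also have "\<dots> \<le> C * exp (p\<^sub>0 \<bullet> \<xi> \<omega> + \<rho> * norm (\<xi> \<omega>))" using * C by (intro mult_left_mono) auto
    finally show "norm (exp (p \<bullet> \<xi> \<omega>) *\<^sub>R F \<omega>) \<le> C * exp (p\<^sub>0 \<bullet> \<xi> \<omega> + \<rho> * norm (\<xi> \<omega>))" .
  qed
  also have "\<dots> = C * (\<integral>\<omega>. exp (p\<^sub>0 \<bullet> \<xi> \<omega> + \<rho> * norm (\<xi> \<omega>)) \<partial>M)" by simp
  also have "\<dots> \<le> C * psi_max" unfolding psi_max_def using C(1)
    by (intro mult_left_mono) (auto intro: Bochner_Integration.integral_nonneg)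
  finally show ?thesis .
qed

lemma psi0_le: "dist p p\<^sub>0 \<le> \<rho> \<Longrightarrow> psi0 p \<le> psi_max"
  using mom_le_psi_max[of "\<lambda>_. 1::real" p 0 1] by (simp add: psi0_def abs_le_iff)

lemma cmod_L1_le: "dist p p\<^sub>0 \<le> \<rho> \<Longrightarrow> cmod (L\<^sub>1 p u) \<le> psi_max"
proof -
  assume d: "dist p p\<^sub>0 \<le> \<rho>"
  have "cmod (L\<^sub>1 p u) \<le> (\<integral>\<omega>. exp (p\<^sub>0 \<bullet> X 1 \<omega> + \<rho> * norm (X 1 \<omega>)) \<partial>M)"
    unfolding L\<^sub>1_def mom_def
  proof (rule norm_integral_le_integral)
    show "integrable M (\<lambda>\<omega>. exp (p \<bullet> X 1 \<omega>) *\<^sub>R iexp (u \<bullet> X 1 \<omega>))"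
      by (rule mom_integrable[OF _ _ exp_int_near(2)[of p 0], of _ 1]) (use d in auto)
    show "integrable M (\<lambda>\<omega>. exp (p\<^sub>0 \<bullet> X 1 \<omega> + \<rho> * norm (X 1 \<omega>)))" using exp_int_X1 by (auto simp: exp_int_def)
    fix \<omega>
    have "(p - p\<^sub>0) \<bullet> X 1 \<omega> \<le> dist p p\<^sub>0 * norm (X 1 \<omega>)" by (metis dist_norm norm_cauchy_schwarz)
    also have "\<dots> \<le> \<rho> * norm (X 1 \<omega>)" using d by (intro mult_right_mono) auto
    finally show "norm (exp (p \<bullet> X 1 \<omega>) *\<^sub>R iexp (u \<bullet> X 1 \<omega>)) \<le> exp (p\<^sub>0 \<bullet> X 1 \<omega> + \<rho> * norm (X 1 \<omega>))"
      by (simp add: inner_diff_left)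
  qed
  also have "\<dots> \<le> psi_max" unfolding psi_max_def
    by (auto intro: Bochner_Integration.integral_nonneg)
  finally show ?thesis .
qed

lemma psi0_pos: "dist p p\<^sub>0 \<le> \<rho> \<Longrightarrow> psi0 p > 0"
proof -
  assume d: "dist p p\<^sub>0 \<le> \<rho>"
  have i: "integrable M (\<lambda>\<omega>. exp (p \<bullet> \<xi> \<omega>))" using exp_int_near(1)[of p 0] d by (simp add: exp_int_def)
  have "psi0 p \<noteq> 0" unfolding psi0_def mom_def
    using integral_nonneg_eq_0_iff_AE[OF i] by auto
  moreover have "psi0 p \<ge> 0" unfolding psi0_def mom_def by (auto intro: Bochner_Integration.integral_nonneg)
  ultimately show ?thesis by simp
qed

lemma psi_max_pos: "psi_max > 0"
  using psi0_le[of p\<^sub>0] psi0_pos[of p\<^sub>0] rho_pos by simp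

text \<open>The inequality 1 - t \<le> exp (- t) turns the quadratic deficit into a Gaussian factor
  relative to \<open>psi0 p\<close>; dividing by \<open>psi_max\<close> instead of
  \<open>psi0 p\<close> makes the rate the same on the whole ball.\<close>

lemma L0_bound:
  obtains c where "c > 0" "\<And>p z. dist p p\<^sub>0 \<le> \<rho> \<Longrightarrow> z \<in> torus \<Longrightarrow> cmod (L\<^sub>0 p (pvec z)) \<le> psi0 p * exp (- c * (norm z)\<^sup>2)"
proof -
  obtain c where c: "c > 0" "\<And>p u. norm p \<le> norm p\<^sub>0 + \<rho> \<Longrightarrow> exp_int M \<xi> p 0 \<Longrightarrow> (\<forall>i. \<bar>u $ i\<bar> \<le> pi) \<Longrightarrow>
      cmod (mom M \<xi> (\<lambda>\<omega>. iexp (u \<bullet> \<xi> \<omega>)) p) \<le> mom M \<xi> (\<lambda>\<omega>. 1) p - c * (norm u)\<^sup>2"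
    using aperiodic_quadratic_bound[OF xi_meas char_less_1, of "norm p\<^sub>0 + \<rho>"] by blast
  show ?thesis
  proof (rule that)
    show "c / psi_max > 0" using c psi_max_pos by simp
    fix p z assume d: "dist p p\<^sub>0 \<le> \<rho>" and z: "z \<in> torus"
    have "norm p \<le> norm p\<^sub>0 + \<rho>" using d norm_triangle_sub[of p p\<^sub>0] by (simp add: dist_norm)
    then have "cmod (L\<^sub>0 p (pvec z)) \<le> psi0 p - c * (norm (pvec z))\<^sup>2"
      unfolding L\<^sub>0_def psi0_def using z d by (intro c(2) exp_int_near(1)) (auto simp: forall_2 torus_def)
    also have "\<dots> = psi0 p * (1 + (- c / psi0 p * (norm z)\<^sup>2))" using psi0_pos[OF d] by (simp add: pvec_norm field_simps)
    also have "\<dots> \<le> psi0 p * exp (- c / psi0 p * (norm z)\<^sup>2)" using psi0_pos[OF d] by (intro mult_left_mono exp_ge_add_one_self) auto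
    also have "\<dots> \<le> psi0 p * exp (- (c / psi_max) * (norm z)\<^sup>2)"
    proof -
      have "c / psi_max \<le> c / psi0 p" using c psi0_pos[OF d] psi0_le[OF d] by (intro divide_left_mono) auto
      then have "(c / psi_max) * (norm z)\<^sup>2 \<le> (c / psi0 p) * (norm z)\<^sup>2" by (rule mult_right_mono) simp
      then show ?thesis using psi0_pos[OF d] by (intro mult_left_mono) auto
    qed
    finally show "cmod (L\<^sub>0 p (pvec z)) \<le> psi0 p * exp (- (c / psi_max) * (norm z)\<^sup>2)" .
  qed
qed

lemma L_pvec_measurable:
  shows "(\<lambda>z. L\<^sub>0 p (pvec z)) \<in> borel_measurable borel" "(\<lambda>z. L\<^sub>1 p (pvec z)) \<in> borel_measurable borel"
proof -
  have "(\<lambda>x. exp (p \<bullet> \<xi> (snd x)) *\<^sub>R iexp (pvec (fst x) \<bullet> \<xi> (snd x))) \<in> borel_measurable ((borel :: (real \<times> real) measure) \<Otimes>\<^sub>M M)"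
    unfolding vec2_inner borel_prod[symmetric] by measurable
  then show "(\<lambda>z. L\<^sub>0 p (pvec z)) \<in> borel_measurable borel"
    unfolding L\<^sub>0_def mom_def by (intro borel_measurable_lebesgue_integral) (simp add: case_prod_beta')
  have "(\<lambda>x. exp (p \<bullet> X 1 (snd x)) *\<^sub>R iexp (pvec (fst x) \<bullet> X 1 (snd x))) \<in> borel_measurable ((borel :: (real \<times> real) measure) \<Otimes>\<^sub>M M)"
    unfolding vec2_inner borel_prod[symmetric] by measurable
  then show "(\<lambda>z. L\<^sub>1 p (pvec z)) \<in> borel_measurable borel"
    unfolding L\<^sub>1_def mom_def by (intro borel_measurable_lebesgue_integral) (simp add: case_prod_beta')
qed

lemma point_mass_nonneg: "point_mass p N y \<ge> 0" by (simp add: point_mass_def)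

text \<open>The planar rate 1/(N + 1), uniform in the end point but not summable over N when
  \<open>psi0 p\<close> is 1. The power of \<open>psi0 p\<close> is kept because the bound is
  applied below to tilts off the curve.\<close>

lemma point_mass_bound:
  obtains C where "C \<ge> 0" "\<And>p N y. dist p p\<^sub>0 \<le> \<rho> \<Longrightarrow> y \<in> int_lattice \<Longrightarrow> point_mass p N y \<le> C * psi0 p ^ N / (N + 1)"
proof -
  obtain c where c: "c > 0" "\<And>p z. dist p p\<^sub>0 \<le> \<rho> \<Longrightarrow> z \<in> torus \<Longrightarrow> cmod (L\<^sub>0 p (pvec z)) \<le> psi0 p * exp (- c * (norm z)\<^sup>2)"
    by (rule L0_bound) (rule that)
  define B where "B = psi_max * (exp (2 * c * pi\<^sup>2) * pi / c)"
  have B: "B \<ge> 0" using psi_max_pos c by (simp add: B_def)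
  show ?thesis
  proof (rule that[of "B / (2 * pi)\<^sup>2"])
    fix p N y assume d: "dist p p\<^sub>0 \<le> \<rho>" and y: "y \<in> int_lattice"
    have "(2 * pi)\<^sup>2 * point_mass p N y = cmod (of_real ((2 * pi)\<^sup>2 * point_mass p N y))"
      unfolding norm_of_real by (simp add: point_mass_nonneg)
    also have "\<dots> \<le> psi_max * psi0 p ^ N * (exp (2 * c * pi\<^sup>2) * pi / c) / (N + 1)"
      unfolding point_mass_fourier[OF exp_int_near(1)[of p 0, unfolded add_0_right, OF d] exp_int_near(2)[of p 0, unfolded add_0_right, OF d] y]
      using d by (intro torus_power_bound L_pvec_measurable c cmod_L1_le) (auto intro: less_imp_le psi0_pos)
    also have "\<dots> = B * psi0 p ^ N / (N + 1)" by (simp add: B_def)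
    finally have "(2 * pi)\<^sup>2 * point_mass p N y / (2 * pi)\<^sup>2 \<le> (B * psi0 p ^ N / (N + 1)) / (2 * pi)\<^sup>2"
      by (rule divide_right_mono) simp
    then have "point_mass p N y \<le> (B * psi0 p ^ N / (N + 1)) / (2 * pi)\<^sup>2" by simp
    then show "point_mass p N y \<le> B / (2 * pi)\<^sup>2 * psi0 p ^ N / (N + 1)" by (simp add: mult_ac)
  qed (use B in simp)
qed

text \<open>Second-order expansion from above with a constant uniform in p. Of the slack \<rho>, one
  quarter is used for the distance of p from the base point, two for the square of |\<xi>| and one
  for the exponential factor of the remainder.\<close>

lemma psi0_quadratic:
  obtains K where "K \<ge> 0" "\<And>p s. dist p p\<^sub>0 \<le> \<rho> / 4 \<Longrightarrow> norm s \<le> \<rho> / 4 \<Longrightarrow> psi0 (p + s) \<le> psi0 p + s \<bullet> mean p + K * (norm s)\<^sup>2"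
    "\<And>p. dist p p\<^sub>0 \<le> \<rho> / 4 \<Longrightarrow> norm (mean p) \<le> K"
proof -
  have r4: "\<rho> / 4 > 0" using rho_pos by simp
  have nb: "norm (\<xi> \<omega>) \<le> 1 / (\<rho> / 4) * exp (\<rho> / 4 * norm (\<xi> \<omega>))" for \<omega>
    using le_exp_div[OF r4, of "norm (\<xi> \<omega>)"] by (simp add: mult.commute)
  define K1 where "K1 = 1 / (\<rho> / 4)\<^sup>2"
  define K where "K = (K1 + 1 / (\<rho> / 4)) * psi_max"
  have K1: "K1 \<ge> 0" by (simp add: K1_def)
  have Kle: "K1 * psi_max \<le> K" "(1 / (\<rho> / 4)) * psi_max \<le> K" "K \<ge> 0" 
    unfolding K_def using K1 psi_max_pos rho_pos by (auto simp: distrib_right)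
  show ?thesis
  proof (rule that[OF Kle(3)])
    fix p assume d: "dist p p\<^sub>0 \<le> \<rho> / 4"
    show "norm (mean p) \<le> K"
      unfolding mean_def using d rho_pos r4
      by (intro order_trans[OF mom_le_psi_max[of \<xi> p "\<rho> / 4" "1 / (\<rho> / 4)"] Kle(2)]) (use nb in auto)
  next
    fix p s assume d: "dist p p\<^sub>0 \<le> \<rho> / 4" and s: "norm (s::real^2) \<le> \<rho> / 4"
    have dps: "dist (p + s) p\<^sub>0 \<le> \<rho> / 2" using d s norm_triangle_ineq[of "p - p\<^sub>0" s] by (simp add: dist_norm algebra_simps)
    have i1: "integrable M (\<lambda>\<omega>. exp ((p + s) \<bullet> \<xi> \<omega>))" "integrable M (\<lambda>\<omega>. exp (p \<bullet> \<xi> \<omega>))"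
      using exp_int_near(1)[of "p + s" 0] exp_int_near(1)[of p 0] d dps rho_pos by (auto simp: exp_int_def)
    have i2: "integrable M (\<lambda>\<omega>. exp (p \<bullet> \<xi> \<omega>) *\<^sub>R \<xi> \<omega>)"
      by (rule mom_integrable[OF _ _ exp_int_near(1)[of p "\<rho> / 4"], of _ "1 / (\<rho> / 4)"]) (use d rho_pos nb in auto)
    have i3: "integrable M (\<lambda>\<omega>. exp (p \<bullet> \<xi> \<omega>) * (s \<bullet> \<xi> \<omega>))" using integrable_inner_right[OF i2, of s] by simp
    have "psi0 (p + s) - psi0 p - s \<bullet> mean p = mom M \<xi> (\<lambda>\<omega>. exp (s \<bullet> \<xi> \<omega>) - 1 - s \<bullet> \<xi> \<omega>) p"
      using i1 i3 integral_inner_right[OF i2, of s]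
      by (simp add: psi0_def mean_def mom_def inner_add_left exp_add right_diff_distrib)
    also have "\<dots> \<le> norm (mom M \<xi> (\<lambda>\<omega>. exp (s \<bullet> \<xi> \<omega>) - 1 - s \<bullet> \<xi> \<omega>) p)" by simp
    also have "\<dots> \<le> ((norm s)\<^sup>2 * K1) * psi_max"
    proof (rule mom_le_psi_max)
      show "dist p p\<^sub>0 + 3 * (\<rho> / 4) \<le> \<rho>" using d by simp
      fix \<omega>
      define y where "y = norm (\<xi> \<omega>)"
      have x: "\<bar>s \<bullet> \<xi> \<omega>\<bar> \<le> norm s * y" unfolding y_def by (rule Cauchy_Schwarz_ineq2)
      have y0: "y \<ge> 0" by (simp add: y_def)
      have "\<bar>exp (s \<bullet> \<xi> \<omega>) - 1 - s \<bullet> \<xi> \<omega>\<bar> \<le> (s \<bullet> \<xi> \<omega>)\<^sup>2 * exp \<bar>s \<bullet> \<xi> \<omega>\<bar>" by (rule exp_remainder)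
      also have "\<dots> \<le> ((norm s)\<^sup>2 * (exp (2 * (\<rho> / 4) * y) * K1)) * exp (\<rho> / 4 * y)"
      proof (rule mult_mono)
        have "(s \<bullet> \<xi> \<omega>)\<^sup>2 \<le> (norm s * y)\<^sup>2" using x by (metis abs_le_square_iff abs_of_nonneg norm_ge_zero mult_nonneg_nonneg y0)
        also have "\<dots> \<le> (norm s * (exp (\<rho> / 4 * y) / (\<rho> / 4)))\<^sup>2" using y0 r4 by (intro power_mono mult_left_mono le_exp_div) auto
        also have "\<dots> = (norm s)\<^sup>2 * (exp (2 * (\<rho> / 4) * y) * K1)"
          unfolding K1_def by (simp add: power_mult_distrib power_divide exp_double[symmetric] mult.assoc)
        finally show "(s \<bullet> \<xi> \<omega>)\<^sup>2 \<le> (norm s)\<^sup>2 * (exp (2 * (\<rho> / 4) * y) * K1)" .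
        have "norm s * y \<le> \<rho> / 4 * y" using s y0 by (rule mult_right_mono)
        then show "exp \<bar>s \<bullet> \<xi> \<omega>\<bar> \<le> exp (\<rho> / 4 * y)" using x by simp
      qed (use K1 in auto)
      also have "\<dots> = (norm s)\<^sup>2 * K1 * (exp (2 * (\<rho> / 4) * y) * exp (\<rho> / 4 * y))" by simp
      also have "exp (2 * (\<rho> / 4) * y) * exp (\<rho> / 4 * y) = exp (3 * (\<rho> / 4) * y)"
        unfolding exp_add[symmetric] by (simp add: algebra_simps)
      finally show "norm (exp (s \<bullet> \<xi> \<omega>) - 1 - s \<bullet> \<xi> \<omega>) \<le> (norm s)\<^sup>2 * K1 * exp (3 * (\<rho> / 4) * norm (\<xi> \<omega>))"
        by (simp add: y_def)
    qed (use K1 in auto)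
    also have "\<dots> \<le> K * (norm s)\<^sup>2" using mult_left_mono[OF Kle(1), of "(norm s)\<^sup>2"] by (simp add: mult_ac)
    finally show "psi0 (p + s) \<le> psi0 p + s \<bullet> mean p + K * (norm s)\<^sup>2" by simp
  qed
qed

text \<open>Tilting further by \<open>(\<plusminus> \<eta> / sqrt (N + 1), 0)\<close> costs only a bounded factor and yields
  exponential decay in the time coordinate.\<close>

lemma point_mass_exp_bound:
  obtains C \<eta> where "C \<ge> 0" "\<eta> > 0" "\<And>p N y. dist p p\<^sub>0 \<le> \<rho> / 4 \<Longrightarrow> psi0 p = 1 \<Longrightarrow> y \<in> int_lattice \<Longrightarrow>
     point_mass p N y \<le> C / real (Suc N) * exp (- \<eta> * (\<bar>y $ 1 - real (Suc N) * mean p $ 1\<bar> / sqrt (Suc N)))"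
proof -
  obtain C0 where C0: "C0 \<ge> 0" "\<And>p N y. dist p p\<^sub>0 \<le> \<rho> \<Longrightarrow> y \<in> int_lattice \<Longrightarrow> point_mass p N y \<le> C0 * psi0 p ^ N / (N + 1)"
    by (rule point_mass_bound) (rule that)
  obtain K where K: "K \<ge> 0" "\<And>p s. dist p p\<^sub>0 \<le> \<rho> / 4 \<Longrightarrow> norm s \<le> \<rho> / 4 \<Longrightarrow> psi0 (p + s) \<le> psi0 p + s \<bullet> mean p + K * (norm s)\<^sup>2"
    "\<And>p. dist p p\<^sub>0 \<le> \<rho> / 4 \<Longrightarrow> norm (mean p) \<le> K"
    by (rule psi0_quadratic) (rule that)
  define \<eta> where "\<eta> = \<rho> / 4"
  have \<eta>: "\<eta> > 0" using rho_pos by (simp add: \<eta>_def)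
  define C where "C = C0 * exp (K * \<eta>\<^sup>2 + \<eta> * K)"
  show ?thesis
  proof (rule that)
    show "C \<ge> 0" using C0 by (simp add: C_def)
    show "\<eta> > 0" by fact
    fix p N y assume d: "dist p p\<^sub>0 \<le> \<rho> / 4" and p1: "psi0 p = 1" and y: "y \<in> int_lattice"
    define k where "k = real (Suc N)"
    have k: "k \<ge> 1" "sqrt k \<ge> 1" by (auto simp: k_def)
    define a where "a = mean p $ 1"
    have a: "\<bar>a\<bar> \<le> K" using component_le_norm_cart[of "mean p" 1] K(3)[OF d] by (simp add: a_def)
    \<comment> \<open>The sign makes the gained factor decay on the side where \<open>y $ 1\<close>
      lies; the size \<eta> / sqrt k keeps k r^2, the quadratic cost over k steps, bounded.\<close>
    define r where "r = sgn (y $ 1 - k * a) * (\<eta> / sqrt k)"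
    define s :: "real^2" where "s = axis 1 r"
    have r: "\<bar>r\<bar> \<le> \<eta> / sqrt k" using \<eta> k by (auto simp: r_def abs_mult abs_sgn_eq)
    also have r\<eta>: "\<eta> / sqrt k \<le> \<eta>" using \<eta> k by (simp add: divide_le_eq mult_le_cancel_left1)
    finally have "\<bar>r\<bar> \<le> \<eta>" .
    moreover have norm_s: "norm s = \<bar>r\<bar>" unfolding norm_eq_sqrt_inner by (simp add: s_def inner_axis_axis)
    ultimately have ns: "norm s \<le> \<rho> / 4" by (simp add: \<eta>_def)
    have r2: "k * r\<^sup>2 \<le> \<eta>\<^sup>2"
    proof -
      have "r\<^sup>2 \<le> (\<eta> / sqrt k)\<^sup>2" using r by (metis abs_le_square_iff abs_of_nonneg abs_ge_zero order_trans)
      also have "\<dots> = \<eta>\<^sup>2 / k" using k by (simp add: power_divide)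
      finally show ?thesis using k by (simp add: field_simps)
    qed
    have si: "s \<bullet> v = r * v $ 1" for v by (simp add: s_def inner_real2 axis_def)
    have dps: "dist (p + s) p\<^sub>0 \<le> \<rho>" using d ns rho_pos norm_triangle_ineq[of "p - p\<^sub>0" s] by (simp add: dist_norm algebra_simps)
    have "psi0 (p + s) \<le> 1 + (r * a + K * r\<^sup>2)"
      using K(2)[OF d ns] by (simp add: p1 si a_def norm_s)
    also have "\<dots> \<le> exp (r * a + K * r\<^sup>2)" by (rule exp_ge_add_one_self)
    finally have ps: "psi0 (p + s) \<le> exp (r * a + K * r\<^sup>2)" .
    \<comment> \<open>Retilting by s only redistributes exponential factors at the fixed point y;
      the probability in \<open>point_mass\<close> is the same on both sides.\<close>
    have "point_mass p N y = exp (- (r * y $ 1)) * point_mass (p + s) N y"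
      by (simp add: point_mass_def inner_add_left si exp_add[symmetric] mult.assoc[symmetric])
    also have "\<dots> \<le> exp (- (r * y $ 1)) * (C0 * exp (r * a + K * r\<^sup>2) ^ N / (N + 1))"
    proof -
      have "C0 * psi0 (p + s) ^ N / (N + 1) \<le> C0 * exp (r * a + K * r\<^sup>2) ^ N / (N + 1)"
        using C0 ps psi0_pos[OF dps] by (intro divide_right_mono mult_left_mono power_mono) (auto simp: less_imp_le)
      from order_trans[OF C0(2)[OF dps y] this] show ?thesis by (rule mult_left_mono) simp
    qed
    also have "\<dots> = C0 / k * exp (- (r * y $ 1) + real N * (r * a + K * r\<^sup>2))"
    proof -
      have "exp (- (r * y $ 1)) * exp (r * a + K * r\<^sup>2) ^ N = exp (- (r * y $ 1) + real N * (r * a + K * r\<^sup>2))"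
        by (simp only: exp_add[of "- (r * y $ 1)"] exp_of_nat_mult)
      then show ?thesis by (simp add: k_def)
    qed
    \<comment> \<open>The tilt acts on N factors while the centring uses k = N + 1; the one missing
      factor costs at most \<eta> K in the exponent.\<close>
    also have "\<dots> \<le> C0 / k * exp (- (r * (y $ 1 - k * a)) + (K * \<eta>\<^sup>2 + \<eta> * K))"
    proof -
      have "real N * (K * r\<^sup>2) \<le> k * (K * r\<^sup>2)" using K(1) by (intro mult_right_mono) (auto simp: k_def)
      also have "\<dots> \<le> K * \<eta>\<^sup>2" using mult_left_mono[OF r2 K(1)] by (simp add: mult_ac)
      finally have 1: "real N * (K * r\<^sup>2) \<le> K * \<eta>\<^sup>2" .
      have "\<bar>r * a\<bar> \<le> \<eta> * K" unfolding abs_mult using r r\<eta> a \<eta> by (intro mult_mono) auto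
      moreover have "real N * (r * a) = k * (r * a) - r * a" by (simp add: k_def algebra_simps)
      ultimately have "real N * (r * a) \<le> r * (k * a) + \<eta> * K" by (simp add: mult.left_commute)
      then have "- (r * y $ 1) + real N * (r * a + K * r\<^sup>2) \<le> - (r * (y $ 1 - k * a)) + (K * \<eta>\<^sup>2 + \<eta> * K)"
        using 1 by (simp add: algebra_simps)
      then show ?thesis using C0 k by (intro mult_left_mono) auto
    qed
    also have "r * (y $ 1 - k * a) = \<eta> * (\<bar>y $ 1 - k * a\<bar> / sqrt k)"
      by (simp add: r_def sgn_if abs_if)
    also have "C0 / k * exp (- (\<eta> * (\<bar>y $ 1 - k * a\<bar> / sqrt k)) + (K * \<eta>\<^sup>2 + \<eta> * K)) = C / k * exp (- \<eta> * (\<bar>y $ 1 - k * a\<bar> / sqrt k))"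
      by (simp only: C_def exp_add) simp
    finally show "point_mass p N y \<le> C / real (Suc N) * exp (- \<eta> * (\<bar>y $ 1 - real (Suc N) * mean p $ 1\<bar> / sqrt (Suc N)))"
      by (simp add: k_def a_def)
  qed
qed

end

section \<open>Tilted second moments and the local limit\<close>

context tilted_renewal begin

text \<open>Uniform over all centres of norm at most A, as needed when the centre is the moving mean
  of a sequence of tilts.\<close>

lemma growth_xi:
  assumes "\<sigma> > 0" "A \<ge> 0"
  obtains C where "C \<ge> 0" "\<And>\<omega> (w::real^2) a. norm a \<le> A \<Longrightarrow> \<bar>w \<bullet> (\<xi> \<omega> - a)\<bar> ^ k \<le> norm w ^ k * C * exp (\<sigma> * norm (\<xi> \<omega>))"
proof -
  obtain C where C: "C \<ge> 0" "\<And>y :: real^2. (norm y + A) ^ k \<le> C * exp (\<sigma> * norm y)"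
    by (rule norm_power_growth[OF assms]) (rule that)
  show ?thesis
  proof (rule that[OF C(1)])
    fix \<omega> and w a :: "real^2" assume a: "norm a \<le> A"
    have "\<bar>w \<bullet> (\<xi> \<omega> - a)\<bar> \<le> norm w * norm (\<xi> \<omega> - a)" by (rule Cauchy_Schwarz_ineq2)
    also have "\<dots> \<le> norm w * (norm (\<xi> \<omega>) + A)" using a norm_triangle_ineq4[of "\<xi> \<omega>" a] by (intro mult_left_mono) auto
    finally have "\<bar>w \<bullet> (\<xi> \<omega> - a)\<bar> ^ k \<le> (norm w * (norm (\<xi> \<omega>) + A)) ^ k" by (rule power_mono) simp
    also have "\<dots> = norm w ^ k * (norm (\<xi> \<omega>) + A) ^ k" by (rule power_mult_distrib)
    also have "\<dots> \<le> norm w ^ k * (C * exp (\<sigma> * norm (\<xi> \<omega>)))" by (intro mult_left_mono C) auto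
    finally show "\<bar>w \<bullet> (\<xi> \<omega> - a)\<bar> ^ k \<le> norm w ^ k * C * exp (\<sigma> * norm (\<xi> \<omega>))" by (simp add: mult.assoc)
  qed
qed

lemma xi_growth:
  assumes "\<sigma> > 0"
  obtains C where "C \<ge> 0" "\<And>\<omega>. norm (\<xi> \<omega>) \<le> C * exp (\<sigma> * norm (\<xi> \<omega>))"
  using that[of "1 / \<sigma>"] le_exp_div[OF assms] assms by simp

lemma mean_tendsto:
  assumes "p \<longlonglongrightarrow> p\<^sub>0"
  shows "(\<lambda>j. mean (p j)) \<longlonglongrightarrow> mean p\<^sub>0"
proof -
  have r: "\<rho> / 2 > 0" using rho_pos by simp
  obtain C where "\<And>\<omega>. norm (\<xi> \<omega>) \<le> C * exp (\<rho> / 2 * norm (\<xi> \<omega>))" by (rule xi_growth[OF r]) (rule that)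
  then show ?thesis unfolding mean_def using rho_pos assms
    by (intro mom_tendsto[OF xi_meas _ _ exp_int_xi, where \<sigma> = "\<rho> / 2" and C = C]) auto
qed

lemma integrable_power_form:
  assumes "dist p p\<^sub>0 \<le> \<rho> / 4"
  shows "integrable M (\<lambda>\<omega>. exp (p \<bullet> \<xi> \<omega>) * \<bar>w \<bullet> (\<xi> \<omega> - a)\<bar> ^ k)"
proof -
  have r: "\<rho> / 2 > 0" using rho_pos by simp
  obtain C where C: "\<And>\<omega> (w::real^2) a'. norm a' \<le> norm a \<Longrightarrow> \<bar>w \<bullet> (\<xi> \<omega> - a')\<bar> ^ k \<le> norm w ^ k * C * exp (\<rho> / 2 * norm (\<xi> \<omega>))"
    using growth_xi[OF r norm_ge_zero[of a], of k] by metis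
  have "integrable M (\<lambda>\<omega>. exp (p \<bullet> \<xi> \<omega>) *\<^sub>R \<bar>w \<bullet> (\<xi> \<omega> - a)\<bar> ^ k)"
    by (rule mom_integrable[OF _ _ exp_int_near(1)[of p "\<rho> / 2"], of _ "norm w ^ k * C"]) (use assms C rho_pos in auto)
  then show ?thesis by simp
qed

lemma integrable_linear_form:
  assumes "dist p p\<^sub>0 \<le> \<rho> / 4"
  shows "integrable M (\<lambda>\<omega>. exp (p \<bullet> \<xi> \<omega>) * (w \<bullet> (\<xi> \<omega> - a)))"
  by (rule Bochner_Integration.integrable_bound[OF integrable_power_form[OF assms, of w a 1]]) (auto simp: abs_mult)

lemma integrable_exp_xi: "dist p p\<^sub>0 \<le> \<rho> / 4 \<Longrightarrow> integrable M (\<lambda>\<omega>. exp (p \<bullet> \<xi> \<omega>))"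
  using exp_int_near(1)[of p 0] rho_pos by (simp add: exp_int_def)

lemma mean_zero:
  assumes d: "dist p p\<^sub>0 \<le> \<rho> / 4" and p1: "psi0 p = 1"
  shows "(\<integral>\<omega>. exp (p \<bullet> \<xi> \<omega>) * (w \<bullet> (\<xi> \<omega> - mean p)) \<partial>M) = 0"
proof -
  have r: "\<rho> / 2 > 0" using rho_pos by simp
  obtain C where C: "\<And>\<omega>. norm (\<xi> \<omega>) \<le> C * exp (\<rho> / 2 * norm (\<xi> \<omega>))" by (rule xi_growth[OF r]) (rule that)
  have i: "integrable M (\<lambda>\<omega>. exp (p \<bullet> \<xi> \<omega>) *\<^sub>R \<xi> \<omega>)"
    by (rule mom_integrable[OF _ _ exp_int_near(1)[of p "\<rho> / 2"] C]) (use d rho_pos in auto)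
  have i1: "integrable M (\<lambda>\<omega>. exp (p \<bullet> \<xi> \<omega>) * (w \<bullet> \<xi> \<omega>))" using integrable_inner_right[OF i, of w] by simp
  have "(\<integral>\<omega>. exp (p \<bullet> \<xi> \<omega>) * (w \<bullet> (\<xi> \<omega> - mean p)) \<partial>M)
    = (\<integral>\<omega>. exp (p \<bullet> \<xi> \<omega>) * (w \<bullet> \<xi> \<omega>) - exp (p \<bullet> \<xi> \<omega>) * (w \<bullet> mean p) \<partial>M)"
    by (simp add: inner_diff_right right_diff_distrib)
  also have "\<dots> = (\<integral>\<omega>. exp (p \<bullet> \<xi> \<omega>) * (w \<bullet> \<xi> \<omega>) \<partial>M) - psi0 p * (w \<bullet> mean p)"
    using i1 integrable_exp_xi[OF d] by (simp add: psi0_def mom_def)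
  also have "(\<integral>\<omega>. exp (p \<bullet> \<xi> \<omega>) * (w \<bullet> \<xi> \<omega>) \<partial>M) = w \<bullet> mean p"
    using integral_inner_right[OF i, of w] by (simp add: mean_def mom_def)
  finally show ?thesis by (simp add: p1)
qed

lemma integrable_cov:
  assumes "dist p p\<^sub>0 \<le> \<rho> / 4"
  shows "integrable M (\<lambda>\<omega>. exp (p \<bullet> \<xi> \<omega>) * ((\<xi> \<omega> - a) $ i * (\<xi> \<omega> - a) $ k))"
proof -
  have sq: "integrable M (\<lambda>\<omega>. exp (p \<bullet> \<xi> \<omega>) * ((\<xi> \<omega> - a) $ i)\<^sup>2)" for i
    using integrable_power_form[OF assms, of "axis i 1" a 2] by (simp add: inner_axis')
  show ?thesis
  proof (rule Bochner_Integration.integrable_bound[OF Bochner_Integration.integrable_add[OF sq[of i] sq[of k]]])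
    have "\<bar>x * y\<bar> \<le> x\<^sup>2 + y\<^sup>2" for x y :: real
    proof -
      have "2 * \<bar>x\<bar> * \<bar>y\<bar> \<le> \<bar>x\<bar>\<^sup>2 + \<bar>y\<bar>\<^sup>2" by (rule sum_squares_bound)
      moreover have "0 \<le> \<bar>x\<bar> * \<bar>y\<bar>" by simp
      ultimately show ?thesis unfolding abs_mult power2_abs by linarith
    qed
    then show "AE \<omega> in M. norm (exp (p \<bullet> \<xi> \<omega>) * ((\<xi> \<omega> - a) $ i * (\<xi> \<omega> - a) $ k))
      \<le> norm (exp (p \<bullet> \<xi> \<omega>) * ((\<xi> \<omega> - a) $ i)\<^sup>2 + exp (p \<bullet> \<xi> \<omega>) * ((\<xi> \<omega> - a) $ k)\<^sup>2)"
      by (intro AE_I2) (simp add: abs_mult[of "exp _"] flip: distrib_left)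
  qed measurable
qed

lemma var_form_eq:
  assumes "dist p p\<^sub>0 \<le> \<rho> / 4"
  shows "var_form p w = cov p 1 1 * (w $ 1)\<^sup>2 + 2 * cov p 1 2 * w $ 1 * w $ 2 + cov p 2 2 * (w $ 2)\<^sup>2"
proof -
  let ?f = "\<lambda>i k \<omega>. exp (p \<bullet> \<xi> \<omega>) * ((\<xi> \<omega> - mean p) $ i * (\<xi> \<omega> - mean p) $ k)"
  have "var_form p w = (\<integral>\<omega>. (w $ 1)\<^sup>2 * ?f 1 1 \<omega> + (2 * w $ 1 * w $ 2) * ?f 1 2 \<omega> + (w $ 2)\<^sup>2 * ?f 2 2 \<omega> \<partial>M)"
    unfolding var_form_def mom_def
    by (intro Bochner_Integration.integral_cong refl) (simp add: inner_real2 power2_eq_square algebra_simps)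
  also have "\<dots> = (w $ 1)\<^sup>2 * (\<integral>\<omega>. ?f 1 1 \<omega> \<partial>M) + (2 * w $ 1 * w $ 2) * (\<integral>\<omega>. ?f 1 2 \<omega> \<partial>M) + (w $ 2)\<^sup>2 * (\<integral>\<omega>. ?f 2 2 \<omega> \<partial>M)"
  proof -
    note i = integrable_cov[OF assms, of "mean p"]
    have i1: "integrable M (\<lambda>\<omega>. (w $ 1)\<^sup>2 * ?f 1 1 \<omega>)" and i2: "integrable M (\<lambda>\<omega>. (2 * w $ 1 * w $ 2) * ?f 1 2 \<omega>)"
      and i3: "integrable M (\<lambda>\<omega>. (w $ 2)\<^sup>2 * ?f 2 2 \<omega>)" by (rule integrable_mult_right[OF i])+
    show ?thesis
      by (simp only: Bochner_Integration.integral_add[OF Bochner_Integration.integrable_add[OF i1 i2] i3]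
          Bochner_Integration.integral_add[OF i1 i2] integral_mult_right_zero)
  qed
  finally show ?thesis by (simp add: cov_def mom_def mult_ac)
qed

text \<open>Zero variance in a direction would make that component of \<xi> almost surely constant,
  against aperiodicity.\<close>

lemma var_form_pos:
  assumes d: "dist p p\<^sub>0 \<le> \<rho> / 4" and w: "w \<noteq> 0"
  shows "var_form p w > 0"
proof -
  have i: "integrable M (\<lambda>\<omega>. exp (p \<bullet> \<xi> \<omega>) *\<^sub>R (w \<bullet> (\<xi> \<omega> - mean p))\<^sup>2)"
    using integrable_power_form[OF d, of w "mean p" 2] by simp
  have "var_form p w \<noteq> 0"
  proof
    assume "var_form p w = 0"
    then have "AE \<omega> in M. exp (p \<bullet> \<xi> \<omega>) *\<^sub>R (w \<bullet> (\<xi> \<omega> - mean p))\<^sup>2 = 0"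
      unfolding var_form_def mom_def by (subst (asm) integral_nonneg_eq_0_iff_AE[OF i]) auto
    then have "AE \<omega> in M. w \<bullet> \<xi> \<omega> = w \<bullet> mean p" by eventually_elim (simp add: inner_diff_right)
    then show False using aperiodic_nondegenerate[OF xi_meas char_less_1 w] by blast
  qed
  moreover have "var_form p w \<ge> 0" unfolding var_form_def mom_def by (auto intro: Bochner_Integration.integral_nonneg)
  ultimately show ?thesis by simp
qed

lemma cov_pos:
  assumes d: "dist p p\<^sub>0 \<le> \<rho> / 4"
  shows "cov p 1 1 > 0" "cov_det p > 0"
proof -
  have "vec2 1 0 \<noteq> 0" by (simp add: vec_eq_iff forall_2)
  then show c: "cov p 1 1 > 0" using var_form_pos[OF d, of "vec2 1 0"] var_form_eq[OF d, of "vec2 1 0"] by simp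
  \<comment> \<open>At this vector the form equals the determinant times
    \<open>cov p 1 1\<close>.\<close>
  have "vec2 (- cov p 1 2) (cov p 1 1) \<noteq> 0" using c by (auto simp: vec_eq_iff forall_2)
  from var_form_pos[OF d this] have "cov p 1 1 * cov_det p > 0"
    unfolding var_form_eq[OF d] cov_det_def by (simp add: power2_eq_square algebra_simps)
  then show "cov_det p > 0" using c by (simp add: zero_less_mult_iff)
qed

text \<open>Multiplying by the phase of the mean centres \<xi>, so the linear term disappears and
  the error is a third moment.\<close>

lemma L0_taylor:
  assumes d: "dist p p\<^sub>0 \<le> \<rho> / 4" and p1: "psi0 p = 1"
  shows "cmod (L\<^sub>0 p w * iexp (- (w \<bullet> mean p)) - of_real (1 - var_form p w / 2))
    \<le> mom M \<xi> (\<lambda>\<omega>. \<bar>w \<bullet> (\<xi> \<omega> - mean p)\<bar> ^ 3) p / 6"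
proof -
  have "L\<^sub>0 p w * iexp (- (w \<bullet> mean p)) = (CLINT \<omega>|M. exp (p \<bullet> \<xi> \<omega>) *\<^sub>R iexp (w \<bullet> (\<xi> \<omega> - mean p)))"
    unfolding L\<^sub>0_def mom_def integral_mult_left_zero[symmetric]
    by (intro Bochner_Integration.integral_cong refl) (simp add: exp_add[symmetric] inner_diff_right algebra_simps)
  moreover have "cmod ((CLINT \<omega>|M. exp (p \<bullet> \<xi> \<omega>) *\<^sub>R iexp (w \<bullet> (\<xi> \<omega> - mean p)))
      - of_real ((\<integral>\<omega>. exp (p \<bullet> \<xi> \<omega>) \<partial>M) - (\<integral>\<omega>. exp (p \<bullet> \<xi> \<omega>) * (w \<bullet> (\<xi> \<omega> - mean p))\<^sup>2 \<partial>M) / 2))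
    \<le> (\<integral>\<omega>. exp (p \<bullet> \<xi> \<omega>) * \<bar>w \<bullet> (\<xi> \<omega> - mean p)\<bar> ^ 3 \<partial>M) / 6"
  proof (rule weighted_iexp_taylor2)
    show "integrable M (\<lambda>\<omega>. exp (p \<bullet> \<xi> \<omega>) * (w \<bullet> (\<xi> \<omega> - mean p))\<^sup>2)"
      using integrable_power_form[OF d, of w "mean p" 2] by (simp only: power2_abs)
  qed (use integrable_exp_xi[OF d] integrable_linear_form[OF d] integrable_power_form[OF d] mean_zero[OF d p1] in auto)
  ultimately show ?thesis using p1 by (simp only: var_form_def mom_def psi0_def real_scaleR_def mult_1_right)
qed

lemma var_form_scale: "var_form p (s *\<^sub>R w) = s\<^sup>2 * var_form p w"
  unfolding var_form_def mom_def integral_mult_right_zero[symmetric]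
  by (intro Bochner_Integration.integral_cong refl) (simp add: power_mult_distrib)

lemma var_form_tendsto:
  assumes p: "p \<longlonglongrightarrow> p\<^sub>0" and d: "\<And>j. dist (p j) p\<^sub>0 \<le> \<rho> / 4"
  shows "(\<lambda>j. var_form (p j) w) \<longlonglongrightarrow> var_form p\<^sub>0 w"
proof -
  have r: "\<rho> / 2 > 0" using rho_pos by simp
  obtain K where K: "K \<ge> 0" "\<And>p. dist p p\<^sub>0 \<le> \<rho> / 4 \<Longrightarrow> norm (mean p) \<le> K" using psi0_quadratic by metis
  obtain C where C: "\<And>\<omega> (w::real^2) a. norm a \<le> K \<Longrightarrow> \<bar>w \<bullet> (\<xi> \<omega> - a)\<bar> ^ 2 \<le> norm w ^ 2 * C * exp (\<rho> / 2 * norm (\<xi> \<omega>))"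
    using growth_xi[OF r K(1), of 2] by metis
  show ?thesis unfolding var_form_def
  proof (rule mom_tendsto[OF xi_meas _ _ exp_int_xi, where \<sigma> = "\<rho> / 2" and C = "norm w ^ 2 * C"])
    show "norm ((w \<bullet> (\<xi> \<omega> - mean (p j)))\<^sup>2) \<le> norm w ^ 2 * C * exp (\<rho> / 2 * norm (\<xi> \<omega>))" for j \<omega>
      using C[OF K(2)[OF d]] by simp
    show "(\<lambda>j. (w \<bullet> (\<xi> \<omega> - mean (p j)))\<^sup>2) \<longlonglongrightarrow> (w \<bullet> (\<xi> \<omega> - mean p\<^sub>0))\<^sup>2" for \<omega>
      by (intro tendsto_intros mean_tendsto p)
  qed (use rho_pos p in auto)
qed

text \<open>Centring uses N steps although the sum has N + 1 vectors: the first step contributes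
  only the factor \<open>psi1 p\<^sub>0\<close>, its displacement being negligible on the scale sqrt
  N. The quadratic form in the exponent is that of the inverse covariance.\<close>

lemma local_limit:
  fixes p y :: "nat \<Rightarrow> real^2" and N :: "nat \<Rightarrow> nat"
  assumes p: "p \<longlonglongrightarrow> p\<^sub>0" and d: "\<And>j. dist (p j) p\<^sub>0 \<le> \<rho> / 4" and p1: "\<And>j. psi0 (p j) = 1"
    and N: "filterlim N at_top sequentially" and y: "\<And>j. y j \<in> int_lattice"
    and v: "(\<lambda>j. (1 / sqrt (N j)) *\<^sub>R (y j - real (N j) *\<^sub>R mean (p j))) \<longlonglongrightarrow> v"
  shows "(\<lambda>j. real (N j) * point_mass (p j) (N j) (y j)) \<longlonglongrightarrow> psi1 p\<^sub>0 / (2 * pi * sqrt (cov_det p\<^sub>0)) *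
      exp (- (cov p\<^sub>0 2 2 * (v $ 1)\<^sup>2 - 2 * cov p\<^sub>0 1 2 * v $ 1 * v $ 2 + cov p\<^sub>0 1 1 * (v $ 2)\<^sup>2) / (2 * cov_det p\<^sub>0))"
proof -
  have d0: "dist p\<^sub>0 p\<^sub>0 \<le> \<rho> / 4" using rho_pos by simp
  have dr: "dist (p j) p\<^sub>0 \<le> \<rho>" for j using d[of j] rho_pos by simp
  define \<beta> where "\<beta> w = var_form p\<^sub>0 (pvec w)" for w
  have \<beta>_eq: "\<beta> w = cov p\<^sub>0 1 1 * (fst w)\<^sup>2 + 2 * cov p\<^sub>0 1 2 * fst w * snd w + cov p\<^sub>0 2 2 * (snd w)\<^sup>2" for w
    unfolding \<beta>_def var_form_eq[OF d0] by simp
  obtain c where c: "c > 0" "\<And>p z. dist p p\<^sub>0 \<le> \<rho> \<Longrightarrow> z \<in> torus \<Longrightarrow> cmod (L\<^sub>0 p (pvec z)) \<le> psi0 p * exp (- c * (norm z)\<^sup>2)"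
    by (rule L0_bound) (rule that)
  define s where "s j = 1 / sqrt (N j)" for j
  have NR: "filterlim (\<lambda>j. real (N j)) at_top sequentially" by (rule filterlim_compose[OF filterlim_real_sequentially N])
  have s0: "s \<longlonglongrightarrow> 0" unfolding s_def
    by (rule tendsto_divide_0[OF tendsto_const]) (rule filterlim_at_top_imp_at_infinity[OF filterlim_compose[OF sqrt_at_top NR]])
  have pos: "eventually (\<lambda>j. N j > 0) sequentially" by (rule eventually_compose_filterlim[OF eventually_gt_at_top N])
  have "(\<lambda>j. real (N j) *\<^sub>R (CLINT z|lborel. indicator torus z *\<^sub>R (L\<^sub>1 (p j) (pvec z) * L\<^sub>0 (p j) (pvec z) ^ N j * iexp (- (z \<bullet> (y j $ 1, y j $ 2))))))
    \<longlonglongrightarrow> (CLINT w|lborel. of_real (psi1 p\<^sub>0) * (exp (- \<beta> w / 2) *\<^sub>R iexp (- (w \<bullet> (v $ 1, v $ 2)))))"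
  proof (rule fourier_local_limit[where c = c and A = "\<lambda>j. (mean (p j) $ 1, mean (p j) $ 2)"])
    show "\<beta> \<in> borel_measurable borel" unfolding \<beta>_eq[abs_def]
      by (intro borel_measurable_continuous_onI continuous_intros)
    show "cmod (L\<^sub>1 (p j) (pvec z)) \<le> psi_max" for j z by (rule cmod_L1_le[OF dr])
    show "cmod (L\<^sub>0 (p j) (pvec z)) \<le> exp (- c * (norm z)\<^sup>2)" if "z \<in> torus" for j z
      using c(2)[OF dr that] p1 by simp
    show "\<beta> w \<ge> 0" for w unfolding \<beta>_def var_form_def mom_def by (auto intro: Bochner_Integration.integral_nonneg)
    have "(\<lambda>j. s j *\<^sub>R (y j - real (N j) *\<^sub>R mean (p j))) \<longlonglongrightarrow> v" using v by (simp add: s_def)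
    from tendsto_Pair[OF tendsto_vec_nth[OF this, of 1] tendsto_vec_nth[OF this, of 2]]
    show "(\<lambda>j. (1 / sqrt (real (N j))) *\<^sub>R ((y j $ 1, y j $ 2) - real (N j) *\<^sub>R (mean (p j) $ 1, mean (p j) $ 2))) \<longlonglongrightarrow> (v $ 1, v $ 2)"
      by (simp add: s_def)
    show "(\<lambda>j. L\<^sub>1 (p j) (pvec ((1 / sqrt (real (N j))) *\<^sub>R w))) \<longlonglongrightarrow> of_real (psi1 p\<^sub>0)" for w
    proof -
      have "(\<lambda>j. mom M (X 1) (\<lambda>\<omega>. iexp (pvec (s j *\<^sub>R w) \<bullet> X 1 \<omega>)) (p j)) \<longlonglongrightarrow> mom M (X 1) (\<lambda>\<omega>. 1) p\<^sub>0"
      proof (rule mom_tendsto[OF _ _ _ exp_int_X1, where \<sigma> = 0 and C = 1])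
        fix \<omega>
        have "(\<lambda>j. iexp (s j * (pvec w \<bullet> X 1 \<omega>))) \<longlonglongrightarrow> iexp (0 * (pvec w \<bullet> X 1 \<omega>))" by (intro tendsto_intros s0)
        then show "(\<lambda>j. iexp (pvec (s j *\<^sub>R w) \<bullet> X 1 \<omega>)) \<longlonglongrightarrow> 1" unfolding pvec_scaleR by simp
      qed (use rho_pos p in auto)
      moreover have "mom M (X 1) (\<lambda>\<omega>. 1) p\<^sub>0 = complex_of_real (psi1 p\<^sub>0)"
        unfolding psi1_def mom_def by (simp add: scaleR_conv_of_real integral_complex_of_real)
      ultimately show ?thesis by (simp add: L\<^sub>1_def s_def)
    qed
    show "(\<lambda>j. of_nat (N j) * (L\<^sub>0 (p j) (pvec ((1 / sqrt (real (N j))) *\<^sub>R w)) *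
            iexp (- ((1 / sqrt (real (N j))) *\<^sub>R w \<bullet> (mean (p j) $ 1, mean (p j) $ 2))) - 1)) \<longlonglongrightarrow> of_real (- \<beta> w / 2)" for w
    proof -
      have r: "\<rho> / 2 > 0" using rho_pos by simp
      obtain K where K: "K \<ge> 0" "\<And>p. dist p p\<^sub>0 \<le> \<rho> / 4 \<Longrightarrow> norm (mean p) \<le> K" using psi0_quadratic by metis
      obtain C where C: "C \<ge> 0" "\<And>\<omega> (w::real^2) a. norm a \<le> K \<Longrightarrow> \<bar>w \<bullet> (\<xi> \<omega> - a)\<bar> ^ 3 \<le> norm w ^ 3 * C * exp (\<rho> / 2 * norm (\<xi> \<omega>))"
        using growth_xi[OF r K(1), of 3] by metis
      define T where "T = norm (pvec w) ^ 3 * C * psi_max"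
      have T: "mom M \<xi> (\<lambda>\<omega>. \<bar>pvec w \<bullet> (\<xi> \<omega> - mean (p j))\<bar> ^ 3) (p j) \<le> T" for j
      proof -
        have "norm (mom M \<xi> (\<lambda>\<omega>. \<bar>pvec w \<bullet> (\<xi> \<omega> - mean (p j))\<bar> ^ 3) (p j)) \<le> T"
          unfolding T_def using d[of j] rho_pos C(1) C(2)[OF K(2)[OF d[of j]], of "pvec w"]
          by (intro mom_le_psi_max[where \<sigma> = "\<rho> / 2"]) auto
        then show ?thesis by simp
      qed
      define z where "z j = L\<^sub>0 (p j) (pvec (s j *\<^sub>R w)) * iexp (- (pvec (s j *\<^sub>R w) \<bullet> mean (p j)))" for j
      \<comment> \<open>The Taylor error is of order s^3 with s = 1 / sqrt N; multiplied by N it is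
        of order s.\<close>
      have zb: "cmod (of_nat (N j) * (z j - 1) - of_real (- var_form (p j) (pvec w) / 2)) \<le> s j * T / 6" if "N j > 0" for j
      proof -
        have sN: "s j > 0" "real (N j) * (s j)\<^sup>2 = 1" using that by (auto simp: s_def power_divide)
        have cs: "mom M \<xi> (\<lambda>\<omega>. \<bar>pvec (s j *\<^sub>R w) \<bullet> (\<xi> \<omega> - mean (p j))\<bar> ^ 3) (p j) = (s j) ^ 3 * mom M \<xi> (\<lambda>\<omega>. \<bar>pvec w \<bullet> (\<xi> \<omega> - mean (p j))\<bar> ^ 3) (p j)"
          unfolding mom_def integral_mult_right_zero[symmetric] using sN
          unfolding pvec_scaleR inner_scaleR_left
          by (intro Bochner_Integration.integral_cong refl) (simp add: abs_mult power_mult_distrib)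
        have "cmod (z j - of_real (1 - (s j)\<^sup>2 * var_form (p j) (pvec w) / 2)) \<le> (s j) ^ 3 * mom M \<xi> (\<lambda>\<omega>. \<bar>pvec w \<bullet> (\<xi> \<omega> - mean (p j))\<bar> ^ 3) (p j) / 6"
          using L0_taylor[OF d[of j] p1, of "pvec (s j *\<^sub>R w)"] unfolding cs unfolding pvec_scaleR var_form_scale z_def .
        also have "\<dots> \<le> (s j) ^ 3 * T / 6" using T sN by (intro divide_right_mono mult_left_mono) auto
        finally have "real (N j) * cmod (z j - of_real (1 - (s j)\<^sup>2 * var_form (p j) (pvec w) / 2)) \<le> real (N j) * ((s j) ^ 3 * T / 6)"
          by (rule mult_left_mono) simp
        also have "\<dots> = (real (N j) * (s j)\<^sup>2) * (s j * T / 6)" by (simp add: power2_eq_square power3_eq_cube)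
        also have "\<dots> = s j * T / 6" by (simp add: sN)
        also have "real (N j) * cmod (z j - of_real (1 - (s j)\<^sup>2 * var_form (p j) (pvec w) / 2))
          = cmod (of_nat (N j) * (z j - of_real (1 - (s j)\<^sup>2 * var_form (p j) (pvec w) / 2)))" by (simp add: norm_mult)
        also have "of_nat (N j) * (z j - of_real (1 - (s j)\<^sup>2 * var_form (p j) (pvec w) / 2))
          = of_nat (N j) * (z j - 1) + of_real ((real (N j) * (s j)\<^sup>2) * var_form (p j) (pvec w) / 2)"
          by (simp add: algebra_simps)
        finally show ?thesis by (simp add: sN)
      qed
      have "(\<lambda>j. of_nat (N j) * (z j - 1) - of_real (- var_form (p j) (pvec w) / 2)) \<longlonglongrightarrow> 0"
      proof (rule Lim_null_comparison)
        show "\<forall>\<^sub>F j in sequentially. cmod (of_nat (N j) * (z j - 1) - of_real (- var_form (p j) (pvec w) / 2)) \<le> s j * T / 6"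
          using pos by eventually_elim (rule zb)
        have "(\<lambda>j. s j * T / 6) \<longlonglongrightarrow> 0 * T / 6" by (intro tendsto_intros s0) simp
        then show "(\<lambda>j. s j * T / 6) \<longlonglongrightarrow> 0" by simp
      qed
      moreover have "(\<lambda>j. complex_of_real (- var_form (p j) (pvec w) / 2)) \<longlonglongrightarrow> of_real (- var_form p\<^sub>0 (pvec w) / 2)"
        by (intro tendsto_intros var_form_tendsto p d) simp
      ultimately have "(\<lambda>j. (of_nat (N j) * (z j - 1) - of_real (- var_form (p j) (pvec w) / 2)) + of_real (- var_form (p j) (pvec w) / 2))
        \<longlonglongrightarrow> 0 + of_real (- var_form p\<^sub>0 (pvec w) / 2)"
        by (rule tendsto_add)
      then have "(\<lambda>j. of_nat (N j) * (z j - 1)) \<longlonglongrightarrow> of_real (- var_form p\<^sub>0 (pvec w) / 2)"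
        by (simp only: diff_add_cancel add_0_left)
      then show ?thesis unfolding z_def s_def \<beta>_def pvec_inner by simp
    qed
  qed (use N c L_pvec_measurable in auto)
  \<comment> \<open>The Gaussian integral contributes 2 pi over the root of the determinant;
    dividing by the (2 pi)^2 of the inversion formula leaves 1 / (2 pi) over that root.\<close>
  also have "(CLINT w|lborel. of_real (psi1 p\<^sub>0) * (exp (- \<beta> w / 2) *\<^sub>R iexp (- (w \<bullet> (v $ 1, v $ 2)))))
    = of_real (psi1 p\<^sub>0) * of_real (2 * pi / sqrt (cov_det p\<^sub>0) * exp (- (cov p\<^sub>0 2 2 * (v $ 1)\<^sup>2 - 2 * cov p\<^sub>0 1 2 * v $ 1 * v $ 2 + cov p\<^sub>0 1 1 * (v $ 2)\<^sup>2) / (2 * cov_det p\<^sub>0)))"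
    using gauss2_char(1)[of "cov p\<^sub>0 1 1" "cov p\<^sub>0 2 2" "cov p\<^sub>0 1 2" "v $ 1" "v $ 2"] cov_pos[OF d0]
    unfolding integral_mult_right_zero \<beta>_eq by (simp add: inner_prod_def cov_det_def)
  finally have "(\<lambda>j. complex_of_real (real (N j) * ((2 * pi)\<^sup>2 * point_mass (p j) (N j) (y j)))) \<longlonglongrightarrow>
    of_real (psi1 p\<^sub>0 * (2 * pi / sqrt (cov_det p\<^sub>0) * exp (- (cov p\<^sub>0 2 2 * (v $ 1)\<^sup>2 - 2 * cov p\<^sub>0 1 2 * v $ 1 * v $ 2 + cov p\<^sub>0 1 1 * (v $ 2)\<^sup>2) / (2 * cov_det p\<^sub>0))))"
    unfolding point_mass_fourier[OF exp_int_near(1)[of _ 0, unfolded add_0_right, OF dr] exp_int_near(2)[of _ 0, unfolded add_0_right, OF dr] y, symmetric]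
    by (simp add: scaleR_conv_of_real)
  then have "(\<lambda>j. real (N j) * ((2 * pi)\<^sup>2 * point_mass (p j) (N j) (y j))) \<longlonglongrightarrow>
    psi1 p\<^sub>0 * (2 * pi / sqrt (cov_det p\<^sub>0) * exp (- (cov p\<^sub>0 2 2 * (v $ 1)\<^sup>2 - 2 * cov p\<^sub>0 1 2 * v $ 1 * v $ 2 + cov p\<^sub>0 1 1 * (v $ 2)\<^sup>2) / (2 * cov_det p\<^sub>0)))"
    by (simp only: tendsto_of_real_iff)
  from tendsto_mult[OF tendsto_const[of "1 / (2 * pi)\<^sup>2"] this] show ?thesis
    by (simp add: power2_eq_square mult.assoc)
qed

end

section \<open>The tilted renewal mass\<close>

context tilted_renewal begin

lemma line_var_eq:
  "dist p p\<^sub>0 \<le> \<rho> / 4 \<Longrightarrow> line_var p = var_form p (vec2 (- mean p $ 2) (mean p $ 1))"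
  by (simp add: var_form_eq line_var_def)

lemma line_var_pos: "dist p p\<^sub>0 \<le> \<rho> / 4 \<Longrightarrow> mean p $ 1 > 0 \<Longrightarrow> line_var p > 0"
  unfolding line_var_eq by (rule var_form_pos) (auto simp: vec_eq_iff forall_2)

text \<open>Trades the factor 1/(N + 1) for 1/n. Where n / (N + 1) is large, the deviation is large
  too, so half of the exponential rate pays for the ratio. The shift m between the time coordinate
  and n costs exp (\<eta> m), so the constant depends on m.\<close>

lemma point_mass_scaled_bound:
  assumes m: "m \<ge> 0"
  shows "\<exists>C \<eta>. C \<ge> 0 \<and> \<eta> > 0 \<and> (\<forall>p N y n. dist p p\<^sub>0 \<le> \<rho> / 4 \<longrightarrow> psi0 p = 1 \<longrightarrow> y \<in> int_lattice \<longrightarrow>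
     n \<ge> 0 \<longrightarrow> y $ 1 = n - m \<longrightarrow>
     n * point_mass p N y \<le> C * exp (- \<eta> * (\<bar>n - real (Suc N) * mean p $ 1\<bar> / sqrt (Suc N))))"
proof -
  obtain C0 \<eta> where C0: "C0 \<ge> 0" "\<eta> > 0" "\<And>p N y. dist p p\<^sub>0 \<le> \<rho> / 4 \<Longrightarrow> psi0 p = 1 \<Longrightarrow> y \<in> int_lattice \<Longrightarrow>
     point_mass p N y \<le> C0 / real (Suc N) * exp (- \<eta> * (\<bar>y $ 1 - real (Suc N) * mean p $ 1\<bar> / sqrt (Suc N)))"
    by (rule point_mass_exp_bound) (rule that)
  obtain K where K: "K \<ge> 0" "\<And>p. dist p p\<^sub>0 \<le> \<rho> / 4 \<Longrightarrow> norm (mean p) \<le> K" using psi0_quadratic by metis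
  define C where "C = C0 * (exp (\<eta> * m) * (K + 1 / (\<eta> / 2)))"
  show ?thesis
  proof (intro exI conjI allI impI)
    show "C \<ge> 0" using C0 K by (simp add: C_def)
    show "\<eta> / 2 > 0" using C0 by simp
    fix p N y and n :: real
    assume d: "dist p p\<^sub>0 \<le> \<rho> / 4" and p1: "psi0 p = 1" and y: "y \<in> int_lattice" and n: "n \<ge> 0" and yn: "y $ 1 = n - m"
    define k where "k = real (Suc N)"
    have k: "k \<ge> 1" "sqrt k \<ge> 1" by (auto simp: k_def)
    define a where "a = mean p $ 1"
    have a: "\<bar>a\<bar> \<le> K" using component_le_norm_cart[of "mean p" 1] K(2)[OF d] by (simp add: a_def)
    define t where "t = \<bar>n - k * a\<bar> / sqrt k"
    have t: "t \<ge> 0" using k by (simp add: t_def)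
    have kk: "sqrt k \<le> k" using k by (simp add: real_le_lsqrt power2_eq_square mult_le_cancel_left1)
    \<comment> \<open>n is at most k a plus the deviation, hence n / k is at most K + t.\<close>
    have nk: "n / k \<le> (K + 1 / (\<eta> / 2)) * exp (\<eta> / 2 * t)"
    proof -
      have "n \<le> k * a + \<bar>n - k * a\<bar>" by linarith
      then have "n / k \<le> (k * a + \<bar>n - k * a\<bar>) / k" using k by (intro divide_right_mono) auto
      also have "\<dots> = a + \<bar>n - k * a\<bar> / k" using k by (simp add: add_divide_distrib)
      also have "\<dots> \<le> K * 1 + t" using a kk k unfolding t_def by (intro add_mono divide_left_mono) auto
      also have "\<dots> \<le> K * exp (\<eta> / 2 * t) + exp (\<eta> / 2 * t) / (\<eta> / 2)"
        using t C0 K by (intro add_mono mult_left_mono le_exp_div) auto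
      finally show ?thesis by (simp add: distrib_right mult.commute)
    qed
    have tm: "- \<eta> * (\<bar>(n - m) - k * a\<bar> / sqrt k) \<le> \<eta> * m - \<eta> * t"
    proof -
      have "t = \<bar>n - k * a\<bar> / sqrt k" by (simp add: t_def)
      also have "\<dots> \<le> (\<bar>(n - m) - k * a\<bar> + m) / sqrt k" using m k by (intro divide_right_mono) auto
      also have "\<dots> = \<bar>(n - m) - k * a\<bar> / sqrt k + m / sqrt k" by (rule add_divide_distrib)
      also have "\<dots> \<le> \<bar>(n - m) - k * a\<bar> / sqrt k + m / 1" using m k by (intro add_left_mono divide_left_mono) auto
      finally have "\<eta> * t \<le> \<eta> * (\<bar>(n - m) - k * a\<bar> / sqrt k + m)" using C0 by (intro mult_left_mono) auto
      then show ?thesis by (simp add: distrib_left)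
    qed
    have "n * point_mass p N y \<le> n * (C0 / k * exp (- \<eta> * (\<bar>(n - m) - k * a\<bar> / sqrt k)))"
      using C0(3)[OF d p1 y, of N] n unfolding yn k_def a_def by (rule mult_left_mono)
    also have "\<dots> \<le> n * (C0 / k * exp (\<eta> * m - \<eta> * t))"
      using tm n C0 k by (intro mult_left_mono) auto
    also have "exp (\<eta> * m - \<eta> * t) = exp (\<eta> * m) * exp (- \<eta> * t)" by (simp add: exp_add[symmetric])
    also have "n * (C0 / k * (exp (\<eta> * m) * exp (- \<eta> * t))) = C0 * exp (\<eta> * m) * ((n / k) * exp (- \<eta> * t))" by simp
    also have "\<dots> \<le> C0 * exp (\<eta> * m) * (((K + 1 / (\<eta> / 2)) * exp (\<eta> / 2 * t)) * exp (- \<eta> * t))"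
      using nk C0 by (intro mult_left_mono mult_right_mono) auto
    also have "\<dots> = C * (exp (\<eta> / 2 * t) * exp (- \<eta> * t))" by (simp add: C_def mult_ac)
    also have "exp (\<eta> / 2 * t) * exp (- \<eta> * t) = exp (- (\<eta> / 2) * t)" by (simp add: exp_add[symmetric])
    finally show "n * point_mass p N y \<le> C * exp (- (\<eta> / 2) * (\<bar>n - real (Suc N) * mean p $ 1\<bar> / sqrt (Suc N)))"
      by (simp add: t_def k_def a_def)
  qed
qed

text \<open>The scaled bound is taken with m = 1 and n = \<open>y $ 1 + 1\<close>, so that n \<ge> 1
  even at time coordinate 0; this is the source of the + 1 under the root.\<close>

lemma renewal_mass_bound:
  assumes l: "l > 0"
  obtains C where "C \<ge> 0" "\<And>p y t. dist p p\<^sub>0 \<le> \<rho> / 4 \<Longrightarrow> psi0 p = 1 \<Longrightarrow> l \<le> mean p $ 1 \<Longrightarrow> y \<in> int_lattice \<Longrightarrow> y $ 1 \<ge> 0 \<Longrightarrow>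
    summable (\<lambda>N. point_mass p N y) \<and> sqrt (y $ 1 + 1) * renewal_mass p y \<le> C"
proof -
  obtain C \<eta> where C: "C \<ge> 0" "\<eta> > 0" and C3: "\<forall>p N y n. dist p p\<^sub>0 \<le> \<rho> / 4 \<longrightarrow> psi0 p = 1 \<longrightarrow> y \<in> int_lattice \<longrightarrow>
     n \<ge> 0 \<longrightarrow> y $ 1 = n - 1 \<longrightarrow>
     n * point_mass p N y \<le> C * exp (- \<eta> * (\<bar>n - real (Suc N) * mean p $ 1\<bar> / sqrt (Suc N)))"
    using point_mass_scaled_bound[OF zero_le_one] by (elim exE conjE) (rule that)
  obtain K where K: "K > 0" and K2: "\<forall>q n a C. n \<ge> 1 \<longrightarrow> l \<le> a \<longrightarrow> C \<ge> 0 \<longrightarrow> (\<forall>k. q k \<ge> 0) \<longrightarrow>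
      (\<forall>k. n * q k \<le> C * exp (- \<eta> * (\<bar>n - real (Suc k) * a\<bar> / sqrt (Suc k)))) \<longrightarrow>
      summable q \<and> sqrt n * suminf q \<le> C * K"
    using renewal_sum_bound[OF C(2) l] by (elim exE conjE) (rule that)
  show ?thesis
  proof (rule that[of "C * K"])
    show "C * K \<ge> 0" using C K by simp
    fix p y assume A: "dist p p\<^sub>0 \<le> \<rho> / 4" "psi0 p = 1" "l \<le> mean p $ 1" "y \<in> int_lattice" "y $ 1 \<ge> 0"
    have "(y $ 1 + 1) * point_mass p k y \<le> C * exp (- \<eta> * (\<bar>(y $ 1 + 1) - real (Suc k) * mean p $ 1\<bar> / sqrt (Suc k)))" for k
      by (rule C3[rule_format, OF A(1,2,4)]) (use A(5) in auto)
    moreover have "y $ 1 + 1 \<ge> 1" using A(5) by simp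
    ultimately show "summable (\<lambda>N. point_mass p N y) \<and> sqrt (y $ 1 + 1) * renewal_mass p y \<le> C * K"
      unfolding renewal_mass_def
      using K2[rule_format, of "y $ 1 + 1" "mean p $ 1" C "\<lambda>N. point_mass p N y"] A(3) C(1) point_mass_nonneg by simp
  qed
qed

text \<open>Hypothesis \<open>x\<close> says that (n, x) lies on the ray of
  \<open>mean (p j)\<close>. Up to the fixed shift m the displacement from N mean steps is then a
  multiple of the mean; the shift is negligible on the scale sqrt N, and so the limit does not
  depend on m.\<close>

lemma renewal_mass_limit:
  fixes p :: "nat \<Rightarrow> real^2" and n :: "nat \<Rightarrow> nat" and x :: "nat \<Rightarrow> int"
  assumes p: "p \<longlonglongrightarrow> p\<^sub>0" and d: "\<And>j. dist (p j) p\<^sub>0 \<le> \<rho> / 4" and p1: "\<And>j. psi0 (p j) = 1"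
    and l: "l > 0" "\<And>j. l \<le> mean (p j) $ 1"
    and n: "filterlim n at_top sequentially" "\<And>j. n j \<ge> 1"
    and x: "\<And>j. real_of_int (x j) = real (n j) * (mean (p j) $ 2 / mean (p j) $ 1)"
  shows "(\<lambda>j. sqrt (n j) * renewal_mass (p j) (vec2 (real (n j) - real m) (x j)))
    \<longlonglongrightarrow> psi1 p\<^sub>0 * sqrt (mean p\<^sub>0 $ 1 / (2 * pi * line_var p\<^sub>0))"
proof -
  have d0: "dist p\<^sub>0 p\<^sub>0 \<le> \<rho> / 4" using rho_pos by simp
  define a where "a j = mean (p j) $ 1" for j
  define a0 where "a0 = mean p\<^sub>0 $ 1"
  define y where "y j = vec2 (real (n j) - real m) (x j)" for j
  have mt: "(\<lambda>j. mean (p j)) \<longlonglongrightarrow> mean p\<^sub>0" by (rule mean_tendsto[OF p])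
  have at: "a \<longlonglongrightarrow> a0" unfolding a_def a0_def by (rule tendsto_vec_nth[OF mt])
  have a0: "a0 \<ge> l" by (rule LIMSEQ_le_const[OF at]) (use l in \<open>auto simp: a_def\<close>)
  then have a0p: "a0 > 0" using l by simp
  have aj: "a j \<ge> l" "a j > 0" for j using l(2)[of j] l(1) by (auto simp: a_def)
  have y_lat: "y j \<in> int_lattice" for j by (simp add: y_def int_lattice_def forall_2)
  have nR: "filterlim (\<lambda>j. real (n j)) at_top sequentially" by (rule filterlim_compose[OF filterlim_real_sequentially n(1)])
  have sq: "filterlim (\<lambda>j. sqrt (real (n j))) at_top sequentially" by (rule filterlim_compose[OF sqrt_at_top nR])
  have q: "line_var p\<^sub>0 > 0" using a0p by (intro line_var_pos d0) (simp add: a0_def)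
  have D: "cov_det p\<^sub>0 > 0" by (rule cov_pos(2)[OF d0])
  \<comment> \<open>The prefactor \<open>a0\<close> is the limit of n / N, which converts the scale
    N of the local limit theorem into n; the \<open>a0\<close> in the exponent comes from passing
    from sqrt N to sqrt n.\<close>
  define G where "G s = a0 * (psi1 p\<^sub>0 / (2 * pi * sqrt (cov_det p\<^sub>0))) * exp (- ((a0 * line_var p\<^sub>0 / cov_det p\<^sub>0) * s\<^sup>2) / 2)" for s
  obtain C \<eta> where C: "C \<ge> 0" "\<eta> > 0" and C3: "\<forall>p N y n'. dist p p\<^sub>0 \<le> \<rho> / 4 \<longrightarrow> psi0 p = 1 \<longrightarrow> y \<in> int_lattice \<longrightarrow>
     n' \<ge> 0 \<longrightarrow> y $ 1 = n' - real m \<longrightarrow>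
     n' * point_mass p N y \<le> C * exp (- \<eta> * (\<bar>n' - real (Suc N) * mean p $ 1\<bar> / sqrt (Suc N)))"
    using point_mass_scaled_bound[OF of_nat_0_le_iff[of m]] by (elim exE conjE) (rule that)
  have "(\<lambda>j. sqrt (real (n j)) * (\<Sum>N. point_mass (p j) N (y j))) \<longlonglongrightarrow> (\<integral>s. G s \<partial>lborel)"
  proof (rule renewal_sum_tendsto[OF C(2) l(1) C(1), where a = a])
    show "real (n j) \<ge> 1" for j using n(2)[of j] by simp
    show "real (n j) * point_mass (p j) k (y j) \<le> C * exp (- \<eta> * (\<bar>real (n j) - real (Suc k) * a j\<bar> / sqrt (Suc k)))" for j k
      unfolding a_def by (rule C3[rule_format, OF d p1 y_lat]) (auto simp: y_def)
    show "G \<in> borel_measurable borel" unfolding G_def[abs_def] by measurable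
    fix s :: real
    define r where "r j = real (n j) / a j + s * sqrt (real (n j))" for j
    define N where "N j = nat \<lfloor>r j\<rfloor>" for j
    \<comment> \<open>Written as a product in which both factors tend to infinity.\<close>
    have r_eq: "r j = sqrt (real (n j)) * (s + sqrt (real (n j)) * (1 / a j))" for j
      by (simp add: r_def distrib_left)
    have "(\<lambda>j. 1 / a j) \<longlonglongrightarrow> 1 / a0" using a0p by (intro tendsto_intros at) auto
    then have "filterlim (\<lambda>j. sqrt (real (n j)) * (1 / a j)) at_top sequentially"
      by (rule filterlim_at_top_mult_tendsto_pos[OF _ _ sq]) (use a0p in simp)
    then have "filterlim (\<lambda>j. s + sqrt (real (n j)) * (1 / a j)) at_top sequentially"
      by (rule filterlim_tendsto_add_at_top[OF tendsto_const])
    then have r_top: "filterlim r at_top sequentially"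
      unfolding r_eq[abs_def] by (rule filterlim_at_top_mult_at_top[OF sq])
    have N_top: "filterlim N at_top sequentially" unfolding N_def
      by (rule filterlim_compose[OF filterlim_nat_sequentially]) (rule filterlim_compose[OF filterlim_floor_sequentially r_top])
    have r0: "eventually (\<lambda>j. r j \<ge> 0) sequentially" by (rule eventually_compose_filterlim[OF eventually_ge_at_top r_top])
    have Npos: "eventually (\<lambda>j. N j > 0) sequentially" by (rule eventually_compose_filterlim[OF eventually_gt_at_top N_top])
    have NR: "filterlim (\<lambda>j. real (N j)) at_top sequentially" by (rule filterlim_compose[OF filterlim_real_sequentially N_top])
    have Nfrac: "\<bar>real (N j) - r j\<bar> \<le> 1" if "r j \<ge> 0" for j using that unfolding N_def by linarith
    have inv_n: "(\<lambda>j. 1 / real (n j)) \<longlonglongrightarrow> 0" "(\<lambda>j. 1 / sqrt (real (n j))) \<longlonglongrightarrow> 0" "(\<lambda>j. 1 / sqrt (real (N j))) \<longlonglongrightarrow> 0"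
      by (rule tendsto_divide_0[OF tendsto_const filterlim_at_top_imp_at_infinity], fact nR)
        (rule tendsto_divide_0[OF tendsto_const filterlim_at_top_imp_at_infinity], fact sq,
         rule tendsto_divide_0[OF tendsto_const filterlim_at_top_imp_at_infinity], rule filterlim_compose[OF sqrt_at_top NR])
    have r_n: "(\<lambda>j. r j / real (n j)) \<longlonglongrightarrow> 1 / a0"
    proof -
      have "(\<lambda>j. 1 / a j + s * (1 / sqrt (real (n j)))) \<longlonglongrightarrow> 1 / a0 + s * 0"
        using a0p by (intro tendsto_intros at inv_n) auto
      moreover have "1 / a j + s * (1 / sqrt (real (n j))) = r j / real (n j)" for j
      proof -
        define u where "u = sqrt (real (n j))"
        have u: "real (n j) = u * u" "u > 0" using n(2)[of j] by (auto simp: u_def)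
        show ?thesis unfolding r_eq u_def[symmetric] unfolding u(1) using u(2) aj(2)[of j] by (simp add: field_simps)
      qed
      ultimately show ?thesis by simp
    qed
    have N_n: "(\<lambda>j. real (N j) / real (n j)) \<longlonglongrightarrow> 1 / a0"
    proof -
      have "(\<lambda>j. (real (N j) - r j) / real (n j)) \<longlonglongrightarrow> 0"
      proof (rule Lim_null_comparison[OF _ inv_n(1)])
        show "\<forall>\<^sub>F j in sequentially. norm ((real (N j) - r j) / real (n j)) \<le> 1 / real (n j)"
          using r0 by eventually_elim (use Nfrac in \<open>auto intro!: divide_right_mono\<close>)
      qed
      from tendsto_add[OF this r_n] show ?thesis by (simp add: add_divide_distrib[symmetric])
    qed
    have n_N: "(\<lambda>j. real (n j) / real (N j)) \<longlonglongrightarrow> a0"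
      using tendsto_inverse[OF N_n] a0p by (simp add: divide_inverse mult.commute)
    \<comment> \<open>Taking the floor changes r by at most 1, which is negligible against sqrt N;
      what remains is - s sqrt n / sqrt N.\<close>
    have dev: "(\<lambda>j. (real (n j) / a j - real (N j)) / sqrt (real (N j))) \<longlonglongrightarrow> - s * sqrt a0"
    proof -
      have "(\<lambda>j. (r j - real (N j)) / sqrt (real (N j))) \<longlonglongrightarrow> 0"
      proof (rule Lim_null_comparison[OF _ inv_n(3)])
        show "\<forall>\<^sub>F j in sequentially. norm ((r j - real (N j)) / sqrt (real (N j))) \<le> 1 / sqrt (real (N j))"
          using r0 by eventually_elim (use Nfrac in \<open>auto intro!: divide_right_mono simp: abs_minus_commute\<close>)
      qed
      moreover have "(\<lambda>j. s * sqrt (real (n j) / real (N j))) \<longlonglongrightarrow> s * sqrt a0" by (intro tendsto_intros n_N)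
      ultimately have "(\<lambda>j. (r j - real (N j)) / sqrt (real (N j)) - s * sqrt (real (n j) / real (N j))) \<longlonglongrightarrow> 0 - s * sqrt a0"
        by (rule tendsto_diff)
      moreover have "(r j - real (N j)) / sqrt (real (N j)) - s * sqrt (real (n j) / real (N j)) = (real (n j) / a j - real (N j)) / sqrt (real (N j))" for j
        by (simp add: r_def real_sqrt_divide diff_divide_distrib add_divide_distrib)
      ultimately show ?thesis by simp
    qed
    have y_dev: "(1 / sqrt (real (N j))) *\<^sub>R (y j - real (N j) *\<^sub>R mean (p j))
      = ((real (n j) / a j - real (N j)) / sqrt (real (N j))) *\<^sub>R mean (p j) - (1 / sqrt (real (N j))) *\<^sub>R vec2 (real m) 0" for j
    proof -
      have y_eq: "y j = (real (n j) / a j) *\<^sub>R mean (p j) - vec2 (real m) 0"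
        using aj(2)[of j] x[of j] by (simp add: y_def vec_eq_iff forall_2 a_def)
      have aux: "c *\<^sub>R ((r *\<^sub>R A - e) - N' *\<^sub>R A) = (c * r - c * N') *\<^sub>R A - c *\<^sub>R e" for c r N' and A e :: "real^2"
        by (simp add: scaleR_right_diff_distrib scaleR_left_diff_distrib)
      have "(1 / sqrt (real (N j))) * (real (n j) / a j) - (1 / sqrt (real (N j))) * real (N j) = (real (n j) / a j - real (N j)) / sqrt (real (N j))"
        by (simp add: diff_divide_distrib)
      then show ?thesis unfolding y_eq aux by (rule arg_cong)
    qed
    have v: "(\<lambda>j. (1 / sqrt (real (N j))) *\<^sub>R (y j - real (N j) *\<^sub>R mean (p j))) \<longlonglongrightarrow> (- s * sqrt a0) *\<^sub>R mean p\<^sub>0 - 0 *\<^sub>R vec2 (real m) 0"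
      unfolding y_dev by (intro tendsto_intros dev mt inv_n)
    have "(\<lambda>j. (real (n j) / real (N j)) * (real (N j) * point_mass (p j) (N j) (y j))) \<longlonglongrightarrow> a0 * (psi1 p\<^sub>0 / (2 * pi * sqrt (cov_det p\<^sub>0)) *
      exp (- (cov p\<^sub>0 2 2 * (((- s * sqrt a0) *\<^sub>R mean p\<^sub>0 - 0 *\<^sub>R vec2 (real m) 0) $ 1)\<^sup>2 -
         2 * cov p\<^sub>0 1 2 * ((- s * sqrt a0) *\<^sub>R mean p\<^sub>0 - 0 *\<^sub>R vec2 (real m) 0) $ 1 * ((- s * sqrt a0) *\<^sub>R mean p\<^sub>0 - 0 *\<^sub>R vec2 (real m) 0) $ 2
         + cov p\<^sub>0 1 1 * (((- s * sqrt a0) *\<^sub>R mean p\<^sub>0 - 0 *\<^sub>R vec2 (real m) 0) $ 2)\<^sup>2) / (2 * cov_det p\<^sub>0)))" (is "_ \<longlonglongrightarrow> ?l")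
      by (intro tendsto_mult n_N local_limit[OF p d p1 N_top y_lat v])
    also have "?l = G s"
    proof -
      \<comment> \<open>On multiples of the mean the numerator of the quadratic form collapses to a
        multiple of \<open>line_var\<close>.\<close>
      have hh: "(cov p\<^sub>0 2 2 * ((h *\<^sub>R mean p\<^sub>0 - 0 *\<^sub>R vec2 (real m) 0) $ 1)\<^sup>2 -
         2 * cov p\<^sub>0 1 2 * (h *\<^sub>R mean p\<^sub>0 - 0 *\<^sub>R vec2 (real m) 0) $ 1 * (h *\<^sub>R mean p\<^sub>0 - 0 *\<^sub>R vec2 (real m) 0) $ 2
         + cov p\<^sub>0 1 1 * ((h *\<^sub>R mean p\<^sub>0 - 0 *\<^sub>R vec2 (real m) 0) $ 2)\<^sup>2) = h\<^sup>2 * line_var p\<^sub>0" for h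
        by (simp add: line_var_def power2_eq_square algebra_simps)
      have "(- s * sqrt a0)\<^sup>2 = s\<^sup>2 * a0" using a0p by (simp add: power_mult_distrib)
      then show ?thesis unfolding G_def hh by (simp add: mult_ac)
    qed
    finally have lim: "(\<lambda>j. (real (n j) / real (N j)) * (real (N j) * point_mass (p j) (N j) (y j))) \<longlonglongrightarrow> G s" .
    show "(\<lambda>j. centred_term (\<lambda>N. point_mass (p j) N (y j)) (real (n j)) (a j) s) \<longlonglongrightarrow> G s"
    proof (rule Lim_transform_eventually[OF lim])
      show "\<forall>\<^sub>F j in sequentially. (real (n j) / real (N j)) * (real (N j) * point_mass (p j) (N j) (y j))
          = centred_term (\<lambda>N. point_mass (p j) N (y j)) (real (n j)) (a j) s"
        using r0 Npos
      proof eventually_elim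
        case (elim j)
        have "centred_term (\<lambda>N. point_mass (p j) N (y j)) (real (n j)) (a j) s = real (n j) * point_mass (p j) (N j) (y j)"
          using elim(1) unfolding centred_term_def N_def r_def by simp
        then show ?case using elim(2) by simp
      qed
    qed
  qed (rule aj point_mass_nonneg)+
  also have "(\<integral>s. G s \<partial>lborel) = psi1 p\<^sub>0 * sqrt (mean p\<^sub>0 $ 1 / (2 * pi * line_var p\<^sub>0))"
  proof -
    have b: "a0 * line_var p\<^sub>0 / cov_det p\<^sub>0 > 0" using a0p q D by simp
    have "(\<integral>s. G s \<partial>lborel) = a0 * (psi1 p\<^sub>0 / (2 * pi * sqrt (cov_det p\<^sub>0))) * sqrt (2 * pi / (a0 * line_var p\<^sub>0 / cov_det p\<^sub>0))"
      unfolding G_def integral_mult_right_zero gauss_total[OF b] ..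
    also have "\<dots> = (sqrt a0 * sqrt a0) * (psi1 p\<^sub>0 / (sqrt (2 * pi) * sqrt (2 * pi) * sqrt (cov_det p\<^sub>0)))
        * (sqrt (2 * pi) * sqrt (cov_det p\<^sub>0) / (sqrt a0 * sqrt (line_var p\<^sub>0)))"
    proof -
      have 1: "sqrt a0 * sqrt a0 = a0" "sqrt (2 * pi) * sqrt (2 * pi) = 2 * pi" using a0p by simp_all
      have 2: "sqrt (2 * pi / (a0 * line_var p\<^sub>0 / cov_det p\<^sub>0)) = sqrt (2 * pi) * sqrt (cov_det p\<^sub>0) / (sqrt a0 * sqrt (line_var p\<^sub>0))"
        by (simp add: real_sqrt_divide real_sqrt_mult)
      show ?thesis unfolding 1 2 ..
    qed
    also have "\<dots> = psi1 p\<^sub>0 * (sqrt a0 / (sqrt (2 * pi) * sqrt (line_var p\<^sub>0)))"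
    proof -
      have aux: "(u * u) * (c / (S * S * d)) * (S * d / (u * e)) = c * (u / (S * e))" if "u \<noteq> 0" "S \<noteq> 0" "d \<noteq> 0" for u c S d e :: real
        using that by simp
      show ?thesis by (rule aux) (use a0p D in auto)
    qed
    also have "\<dots> = psi1 p\<^sub>0 * sqrt (a0 / (2 * pi * line_var p\<^sub>0))" by (simp add: real_sqrt_divide real_sqrt_mult)
    finally show ?thesis by (simp add: a0_def)
  qed
  finally show ?thesis by (simp add: renewal_mass_def y_def)
qed

end

section \<open>Decomposition at the last renewal before \<open>n\<close>\<close>

context arithmetic_compound_renewal begin

lemma T_sum_V_sum: "T_sum X k \<omega> = V_sum X k \<omega> $ 1" and Z_sum_V_sum: "Z_sum X k \<omega> = V_sum X k \<omega> $ 2"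
  by (simp_all add: T_sum_def Z_sum_def V_sum_def)

lemma V_sum_Suc: "V_sum X (Suc k) \<omega> = V_sum X k \<omega> + X (Suc k) \<omega>"
  by (simp add: V_sum_def)

lemma T_sum_measurable [measurable]: "T_sum X k \<in> borel_measurable M"
  and Z_sum_measurable [measurable]: "Z_sum X k \<in> borel_measurable M"
  unfolding T_sum_V_sum[abs_def] Z_sum_V_sum[abs_def] by measurable

lemma renewal_count_measurable [measurable]: "renewal_count X t \<in> measurable M (count_space UNIV)"
  unfolding renewal_count_def[abs_def] by measurable

text \<open>Positive integer steps are at least 1. The almost sure facts used pathwise are gathered
  in one event.\<close>

lemma renewal_steps: "AE \<omega> in M. X 1 \<omega> $ 1 \<ge> 0 \<and> (\<forall>k\<ge>2. X k \<omega> $ 1 \<ge> 1) \<and> (\<forall>k. V_sum X k \<omega> \<in> int_lattice)"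
proof -
  have xi: "AE \<omega> in M. \<xi> \<omega> $ 1 \<ge> 1"
    using tau_pos xi_lattice
  proof eventually_elim
    case (elim \<omega>)
    then obtain k :: int where k: "\<xi> \<omega> $ 1 = of_int k" unfolding int_lattice_def by (auto elim: Ints_cases)
    then have "k > 0" using elim by simp
    then show ?case using k by simp
  qed
  have "AE \<omega> in M. \<forall>k. k \<ge> 2 \<longrightarrow> X k \<omega> $ 1 \<ge> 1"
    unfolding AE_all_countable
  proof
    fix k :: nat
    show "AE \<omega> in M. k \<ge> 2 \<longrightarrow> X k \<omega> $ 1 \<ge> 1"
    proof (cases "k \<ge> 2")
      case True
      have "AE \<omega> in M. X k \<omega> $ 1 \<ge> 1" by (rule AE_law_transfer[OF True _ xi]) measurable
      then show ?thesis by simp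
    qed simp
  qed
  moreover have "AE \<omega> in M. \<forall>k. V_sum X k \<omega> \<in> int_lattice"
    unfolding AE_all_countable using V_sum_lattice by blast
  ultimately show ?thesis using tau1_nonneg by eventually_elim simp
qed

text \<open>The partial sums are nondecreasing and eventually exceed t, so the indices with sum
  below t form a finite initial segment, whose maximum is k exactly when k belongs to it and k + 1
  does not.\<close>

lemma renewal_count_eq_iff:
  assumes "X 1 \<omega> $ 1 \<ge> 0" "\<And>k. k \<ge> 2 \<Longrightarrow> X k \<omega> $ 1 \<ge> 1" and t: "t > 0"
  shows "renewal_count X t \<omega> = k \<longleftrightarrow> T_sum X k \<omega> < t \<and> T_sum X (Suc k) \<omega> \<ge> t"
proof -
  define S where "S = {k. T_sum X k \<omega> < t}"
  have step: "T_sum X k \<omega> \<le> T_sum X (Suc k) \<omega>" for k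
    using assms(1) assms(2)[of "Suc k"] by (cases k) (auto simp: T_sum_def)
  have mono: "T_sum X i \<omega> \<le> T_sum X k \<omega>" if "i \<le> k" for i k
    by (rule lift_Suc_mono_le[of "\<lambda>k. T_sum X k \<omega>", OF step that])
  \<comment> \<open>The first step may be 0, so k + 1 steps guarantee only k.\<close>
  have ge: "T_sum X (Suc k) \<omega> \<ge> real k" for k
    using assms(1) assms(2) by (induction k) (auto simp: T_sum_def, smt (verit) le_add1 numeral_2_eq_2 Suc_le_mono le0)
  have "S \<subseteq> {..Suc (nat \<lceil>t\<rceil>)}"
  proof
    fix k assume "k \<in> S"
    then have k: "T_sum X k \<omega> < t" by (simp add: S_def)
    show "k \<in> {..Suc (nat \<lceil>t\<rceil>)}"
    proof (cases k)
      case (Suc i)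
      then have "real i < t" using ge[of i] k by simp
      then show ?thesis using Suc by (simp add: le_nat_iff) linarith
    qed simp
  qed
  then have fin: "finite S" by (rule finite_subset) simp
  have S0: "0 \<in> S" using t by (simp add: S_def T_sum_def)
  have down: "i \<in> S" if "k \<in> S" "i \<le> k" for i k using mono[OF that(2)] that(1) by (simp add: S_def)
  have rc: "renewal_count X t \<omega> = Max S" using t by (simp add: renewal_count_def S_def)
  have "Max S = k \<longleftrightarrow> k \<in> S \<and> Suc k \<notin> S"
  proof
    assume "Max S = k"
    then show "k \<in> S \<and> Suc k \<notin> S" using Max_in[OF fin] S0 Max_ge[OF fin, of "Suc k"] by auto
  next
    assume k: "k \<in> S \<and> Suc k \<notin> S"
    show "Max S = k"
    proof (rule Max_eqI[OF fin])
      fix i assume "i \<in> S"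
      show "i \<le> k"
      proof (rule ccontr)
        assume "\<not> i \<le> k"
        then have "Suc k \<in> S" using down[OF \<open>i \<in> S\<close>, of "Suc k"] by simp
        then show False using k by simp
      qed
    qed (use k in simp)
  qed
  then show ?thesis by (simp add: rc S_def not_less)
qed

text \<open>The partial sum and the next vector are functions of disjoint blocks of an independent
  family; k \<ge> 1 ensures that the next vector has the law of \<xi>.\<close>

lemma indep_V_sum:
  assumes k: "k \<ge> 1" and B: "B \<in> sets borel" "C \<in> sets borel"
  shows "prob {\<omega>\<in>space M. V_sum X k \<omega> \<in> B \<and> X (Suc k) \<omega> \<in> C}
    = prob {\<omega>\<in>space M. V_sum X k \<omega> \<in> B} * prob {\<omega>\<in>space M. \<xi> \<omega> \<in> C}"
proof -
  have "indep_var
    borel ((\<lambda>f. f (Suc k)) \<circ> (\<lambda>\<omega>. restrict (\<lambda>i. X i \<omega>) {Suc k}))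
    borel ((\<lambda>f. \<Sum>i\<in>{1..k}. f i) \<circ> (\<lambda>\<omega>. restrict (\<lambda>i. X i \<omega>) {1..k}))"
    by (intro indep_var_compose[OF indep_var_restrict[OF indep]]) auto
  also have "((\<lambda>f. f (Suc k)) \<circ> (\<lambda>\<omega>. restrict (\<lambda>i. X i \<omega>) {Suc k})) = X (Suc k)" by auto
  also have "((\<lambda>f. \<Sum>i\<in>{1..k}. f i) \<circ> (\<lambda>\<omega>. restrict (\<lambda>i. X i \<omega>) {1..k})) = V_sum X k"
    by (auto simp: V_sum_def fun_eq_iff)
  finally have "indep_var borel (X (Suc k)) borel (V_sum X k)" .
  from indep_varD[OF this B(2,1)]
  have "prob {\<omega>\<in>space M. V_sum X k \<omega> \<in> B \<and> X (Suc k) \<omega> \<in> C}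
    = prob {\<omega>\<in>space M. X (Suc k) \<omega> \<in> C} * prob {\<omega>\<in>space M. V_sum X k \<omega> \<in> B}"
    by (simp add: vimage_def Int_def conj_commute)
  then show ?thesis using law_transfer(3)[of "Suc k" C] k B by simp
qed

text \<open>On the event, m = n - T_k is an integer between 1 and n, since T_k < n is strict and T_k
  is nonnegative. The condition T_(k+1) \<ge> n then says that the next step is at least m, and that
  step is independent of the first k.\<close>

lemma prob_last_renewal:
  assumes n: "n > 0" and k: "k \<ge> 1"
  shows "prob {\<omega>\<in>space M. renewal_count X (real n) \<omega> = k \<and> Z_sum X k \<omega> = real_of_int x}
    = (\<Sum>m=1..n. prob {\<omega>\<in>space M. V_sum X k \<omega> = vec2 (real n - real m) x} * prob {\<omega>\<in>space M. \<xi> \<omega> $ 1 \<ge> real m})"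
proof -
  define F where "F m = {\<omega>\<in>space M. V_sum X k \<omega> \<in> {vec2 (real n - real m) x} \<and> X (Suc k) \<omega> \<in> {v. v $ 1 \<ge> real m}}" for m
  have [measurable]: "{v :: real^2. v $ 1 \<ge> real m} \<in> sets borel" for m by measurable
  have [measurable]: "X (Suc k) \<in> borel_measurable M" by (rule X_measurable) simp
  have F_sets: "F m \<in> events" for m unfolding F_def by measurable
  have "prob {\<omega>\<in>space M. renewal_count X (real n) \<omega> = k \<and> Z_sum X k \<omega> = real_of_int x} = prob (\<Union>m\<in>{1..n}. F m)"
  proof (rule finite_measure_eq_AE)
    show "AE \<omega> in M. (\<omega> \<in> {\<omega>\<in>space M. renewal_count X (real n) \<omega> = k \<and> Z_sum X k \<omega> = real_of_int x}) = (\<omega> \<in> (\<Union>m\<in>{1..n}. F m))"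
      using renewal_steps AE_space
    proof eventually_elim
      case (elim \<omega>)
      have iff: "renewal_count X (real n) \<omega> = k \<longleftrightarrow> T_sum X k \<omega> < real n \<and> T_sum X (Suc k) \<omega> \<ge> real n"
        by (rule renewal_count_eq_iff) (use elim n in auto)
      have "V_sum X k \<omega> $ 1 \<in> \<int>" using elim by (auto simp: int_lattice_def)
      then obtain i :: int where i: "V_sum X k \<omega> $ 1 = of_int i" by (auto elim: Ints_cases)
      have "T_sum X k \<omega> \<ge> 0" unfolding T_sum_def
      proof (rule sum_nonneg)
        fix j assume j: "j \<in> {1..k}"
        show "0 \<le> X j \<omega> $ 1"
        proof (cases "j = 1")
          case False
          then have "1 \<le> X j \<omega> $ 1" using elim(1) j by auto
          then show ?thesis by simp
        qed (use elim(1) in simp)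
      qed
      then have i0: "i \<ge> 0" using i by (simp add: T_sum_V_sum)
      show ?case
      proof
        assume A: "\<omega> \<in> {\<omega>\<in>space M. renewal_count X (real n) \<omega> = k \<and> Z_sum X k \<omega> = real_of_int x}"
        then have T: "T_sum X k \<omega> < real n" "T_sum X (Suc k) \<omega> \<ge> real n" "Z_sum X k \<omega> = x" using iff by auto
        define m where "m = n - nat i"
        have "i < int n" using T(1) i by (simp add: T_sum_V_sum)
        then have m: "m \<in> {1..n}" "real m = real n - of_int i" using i0 by (auto simp: m_def of_nat_diff)
        have "V_sum X k \<omega> = vec2 (real n - real m) x"
          using i m(2) T(3) by (simp add: vec_eq_iff forall_2 Z_sum_V_sum)
        moreover have "X (Suc k) \<omega> $ 1 \<ge> real m" using T(2) i m(2) by (simp add: T_sum_V_sum V_sum_Suc)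
        ultimately show "\<omega> \<in> (\<Union>m\<in>{1..n}. F m)" using m(1) elim by (auto simp: F_def)
      next
        assume "\<omega> \<in> (\<Union>m\<in>{1..n}. F m)"
        then obtain m where m: "m \<in> {1..n}" "V_sum X k \<omega> = vec2 (real n - real m) x" "X (Suc k) \<omega> $ 1 \<ge> real m"
          by (auto simp: F_def)
        then show "\<omega> \<in> {\<omega>\<in>space M. renewal_count X (real n) \<omega> = k \<and> Z_sum X k \<omega> = real_of_int x}"
          using elim by (simp add: iff T_sum_V_sum Z_sum_V_sum V_sum_Suc)
      qed
    qed
  qed (use F_sets in auto)
  also have "\<dots> = (\<Sum>m=1..n. prob (F m))"
  proof (rule finite_measure_finite_Union)
    show "disjoint_family_on F {1..n}"
      unfolding disjoint_family_on_def F_def by (auto simp: vec_eq_iff forall_2)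
  qed (use F_sets in auto)
  also have "\<dots> = (\<Sum>m=1..n. prob {\<omega>\<in>space M. V_sum X k \<omega> = vec2 (real n - real m) x} * prob {\<omega>\<in>space M. \<xi> \<omega> $ 1 \<ge> real m})"
    unfolding F_def by (intro sum.cong refl, subst indep_V_sum[OF k]) auto
  finally show ?thesis .
qed

text \<open>The case k = 0 is separate because the waiting time is then the first step with its own
  law; the position is 0, so only x = 0 contributes.\<close>

lemma prob_no_renewal:
  assumes n: "n > 0"
  shows "prob {\<omega>\<in>space M. renewal_count X (real n) \<omega> = 0 \<and> Z_sum X 0 \<omega> = real_of_int x}
    = (if x = 0 then prob {\<omega>\<in>space M. X 1 \<omega> $ 1 \<ge> real n} else 0)"
proof -
  have [measurable]: "X 1 \<in> borel_measurable M" by (rule X_measurable) simp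
  have "prob {\<omega>\<in>space M. renewal_count X (real n) \<omega> = 0 \<and> Z_sum X 0 \<omega> = real_of_int x}
    = prob {\<omega>\<in>space M. x = 0 \<and> X 1 \<omega> $ 1 \<ge> real n}"
  proof (rule finite_measure_eq_AE)
    show "AE \<omega> in M. (\<omega> \<in> {\<omega>\<in>space M. renewal_count X (real n) \<omega> = 0 \<and> Z_sum X 0 \<omega> = real_of_int x}) = (\<omega> \<in> {\<omega>\<in>space M. x = 0 \<and> X 1 \<omega> $ 1 \<ge> real n})"
      using renewal_steps AE_space
    proof eventually_elim
      case (elim \<omega>)
      have iff: "renewal_count X (real n) \<omega> = 0 \<longleftrightarrow> T_sum X 0 \<omega> < real n \<and> T_sum X (Suc 0) \<omega> \<ge> real n"
        by (rule renewal_count_eq_iff) (use elim n in auto)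
      show ?case using n by (auto simp: iff T_sum_def Z_sum_def)
    qed
  qed measurable
  then show ?thesis by simp
qed

lemma prob_Z_process:
  assumes n: "n > 0"
  shows "(\<lambda>N. \<Sum>m=1..n. prob {\<omega>\<in>space M. V_sum X (Suc N) \<omega> = vec2 (real n - real m) x} * prob {\<omega>\<in>space M. \<xi> \<omega> $ 1 \<ge> real m})
    sums (prob {\<omega>\<in>space M. Z_process X (real n) \<omega> = real_of_int x} - (if x = 0 then prob {\<omega>\<in>space M. X 1 \<omega> $ 1 \<ge> real n} else 0))"
proof -
  define A where "A k = {\<omega>\<in>space M. renewal_count X (real n) \<omega> = k \<and> Z_sum X k \<omega> = real_of_int x}" for k
  have "A k \<in> events" for k unfolding A_def by measurable
  then have "range A \<subseteq> events" by auto
  moreover have "disjoint_family A" by (auto simp: disjoint_family_on_def A_def)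
  ultimately have "(\<lambda>k. prob (A k)) sums prob (\<Union>k. A k)" by (rule finite_measure_UNION)
  also have "(\<Union>k. A k) = {\<omega>\<in>space M. Z_process X (real n) \<omega> = real_of_int x}" by (auto simp: A_def Z_process_def)
  finally have "(\<lambda>k. prob (A (Suc k))) sums (prob {\<omega>\<in>space M. Z_process X (real n) \<omega> = real_of_int x} - prob (A 0))"
    by (subst sums_Suc_iff) simp
  then show ?thesis unfolding A_def prob_no_renewal[OF n] by (subst (asm) prob_last_renewal[OF n]) auto
qed

text \<open>The factor exp (l n + \<mu> x) splits into exp (l m), which joins the tail of \<tau>,
  and the weight of the point (n - m, x), which completes a \<open>point_mass\<close>.\<close>

lemma tilted_prob_Z_process:
  assumes n: "n > 0" and sm: "\<And>m. m \<in> {1..n} \<Longrightarrow> summable (\<lambda>N. point_mass (vec2 l \<mu>) N (vec2 (real n - real m) x))"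
  shows "exp (l * n + \<mu> * x) * prob {\<omega>\<in>space M. Z_process X (real n) \<omega> = real_of_int x}
    = (if x = 0 then exp (l * n) * prob {\<omega>\<in>space M. X 1 \<omega> $ 1 \<ge> real n} else 0)
      + (\<Sum>m=1..n. exp (l * m) * prob {\<omega>\<in>space M. \<xi> \<omega> $ 1 \<ge> real m} * renewal_mass (vec2 l \<mu>) (vec2 (real n - real m) x))"
proof -
  define E where "E = exp (l * n + \<mu> * x)"
  define Q where "Q = prob {\<omega>\<in>space M. Z_process X (real n) \<omega> = real_of_int x}"
  define P0 where "P0 = (if x = 0 then prob {\<omega>\<in>space M. X 1 \<omega> $ 1 \<ge> real n} else 0)"
  have "(\<lambda>N. E * (\<Sum>m=1..n. prob {\<omega>\<in>space M. V_sum X (Suc N) \<omega> = vec2 (real n - real m) x} * prob {\<omega>\<in>space M. \<xi> \<omega> $ 1 \<ge> real m})) sums (E * (Q - P0))"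
    unfolding Q_def P0_def by (rule sums_mult[OF prob_Z_process[OF n]])
  moreover have "E * (\<Sum>m=1..n. prob {\<omega>\<in>space M. V_sum X (Suc N) \<omega> = vec2 (real n - real m) x} * prob {\<omega>\<in>space M. \<xi> \<omega> $ 1 \<ge> real m})
      = (\<Sum>m=1..n. exp (l * m) * prob {\<omega>\<in>space M. \<xi> \<omega> $ 1 \<ge> real m} * point_mass (vec2 l \<mu>) N (vec2 (real n - real m) x))" for N
    unfolding sum_distrib_left
  proof (intro sum.cong refl)
    fix m assume "m \<in> {1..n}"
    have "E = exp (l * m) * exp (vec2 l \<mu> \<bullet> vec2 (real n - real m) x)"
      by (simp add: E_def vec2_inner exp_add[symmetric] algebra_simps)
    then show "E * (prob {\<omega>\<in>space M. V_sum X (Suc N) \<omega> = vec2 (real n - real m) x} * prob {\<omega>\<in>space M. \<xi> \<omega> $ 1 \<ge> real m})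
       = exp (l * m) * prob {\<omega>\<in>space M. \<xi> \<omega> $ 1 \<ge> real m} * point_mass (vec2 l \<mu>) N (vec2 (real n - real m) x)"
      by (simp add: point_mass_def)
  qed
  moreover have "(\<lambda>N. \<Sum>m=1..n. exp (l * m) * prob {\<omega>\<in>space M. \<xi> \<omega> $ 1 \<ge> real m} * point_mass (vec2 l \<mu>) N (vec2 (real n - real m) x))
      sums (\<Sum>m=1..n. exp (l * m) * prob {\<omega>\<in>space M. \<xi> \<omega> $ 1 \<ge> real m} * renewal_mass (vec2 l \<mu>) (vec2 (real n - real m) x))"
    unfolding renewal_mass_def by (intro sums_sum sums_mult summable_sums sm)
  ultimately have "E * (Q - P0) = (\<Sum>m=1..n. exp (l * m) * prob {\<omega>\<in>space M. \<xi> \<omega> $ 1 \<ge> real m} * renewal_mass (vec2 l \<mu>) (vec2 (real n - real m) x))"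
    by (simp add: sums_unique2)
  moreover have "E * P0 = (if x = 0 then exp (l * n) * prob {\<omega>\<in>space M. X 1 \<omega> $ 1 \<ge> real n} else 0)"
    by (simp add: E_def P0_def)
  ultimately show ?thesis by (simp add: E_def Q_def right_diff_distrib)
qed

end

section \<open>The domain of the Laplace transform\<close>

text \<open>\<open>psi\<close> is an extended nonnegative integral; its finiteness amounts to
  Bochner integrability, which links it to \<open>mom\<close>.\<close>

lemma psi_dom_iff:
  assumes [measurable]: "Y \<in> borel_measurable M"
  shows "w \<in> psi_dom M Y \<longleftrightarrow> integrable M (\<lambda>\<omega>. exp (w \<bullet> Y \<omega>))"
  unfolding psi_dom_def psi_def inner_real2[symmetric] mem_Collect_eq
  by (subst integrable_iff_bounded) (auto simp: top_unique less_top)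

lemma psi_dom_eq:
  assumes "Y \<in> borel_measurable M"
  shows "psi_dom M Y = {w. integrable M (\<lambda>\<omega>. exp (w \<bullet> Y \<omega>))}"
  using psi_dom_iff[OF assms] by blast

lemma psi_eq_mom:
  assumes "Y \<in> borel_measurable M" "w \<in> psi_dom M Y"
  shows "psi M Y w = ennreal (mom M Y (\<lambda>_. 1) w)" "enn2real (psi M Y w) = mom M Y (\<lambda>_. 1) w"
proof -
  have i: "integrable M (\<lambda>\<omega>. exp (w \<bullet> Y \<omega>))" using assms psi_dom_iff by blast
  show 1: "psi M Y w = ennreal (mom M Y (\<lambda>_. 1) w)"
    unfolding psi_def mom_def inner_real2[symmetric] using nn_integral_eq_integral[OF i] by simp
  show "enn2real (psi M Y w) = mom M Y (\<lambda>_. 1) w"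
    unfolding 1 mom_def by (rule enn2real_ennreal) (auto intro: Bochner_Integration.integral_nonneg)
qed

context arithmetic_compound_renewal begin

abbreviation dom :: "(real^2) set" where "dom \<equiv> psi_dom M \<xi>"

lemma dom_iff: "w \<in> dom \<longleftrightarrow> integrable M (\<lambda>\<omega>. exp (w \<bullet> \<xi> \<omega>))"
  by (rule psi_dom_iff[OF xi_meas])

lemma xi_ge_1: "AE \<omega> in M. \<xi> \<omega> $ 1 \<ge> 1"
  using tau_pos xi_lattice
proof eventually_elim
  case (elim \<omega>)
  then obtain k :: int where k: "\<xi> \<omega> $ 1 = of_int k" unfolding int_lattice_def by (auto elim: Ints_cases)
  then have "k > 0" using elim by simp
  then show ?case using k by simp
qed

lemma interior_dom_exp_int:
  assumes "p \<in> interior dom"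
  obtains \<rho> where "\<rho> > 0" "exp_int M \<xi> p \<rho>"
  using exp_int_interior[OF xi_meas, of p] assms unfolding psi_dom_eq[OF xi_meas] by blast

lemma exp_int_interior_dom: "exp_int M \<xi> p \<rho> \<Longrightarrow> \<rho> > 0 \<Longrightarrow> p \<in> interior dom"
  unfolding psi_dom_eq[OF xi_meas] by (rule exp_int_imp_interior[OF xi_meas])

lemma psi0_pos_dom: "p \<in> dom \<Longrightarrow> psi0 p > 0"
proof -
  assume "p \<in> dom"
  then have i: "integrable M (\<lambda>\<omega>. exp (p \<bullet> \<xi> \<omega>))" by (simp add: dom_iff)
  have "psi0 p \<noteq> 0" unfolding psi0_def mom_def
    using integral_nonneg_eq_0_iff_AE[OF i] by auto
  moreover have "psi0 p \<ge> 0" unfolding psi0_def mom_def by (auto intro: Bochner_Integration.integral_nonneg)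
  ultimately show ?thesis by simp
qed

lemma A2_eq: "A2 M \<xi> w = (if w \<in> dom then ereal (ln (psi0 w)) else \<infinity>)"
  using psi_eq_mom(2)[OF xi_meas, of w] by (auto simp: A2_def psi_dom_def psi0_def)

lemma A2_le_0_iff: "A2 M \<xi> w \<le> 0 \<longleftrightarrow> w \<in> dom \<and> psi0 w \<le> 1"
  using psi0_pos_dom[of w] by (auto simp: A2_eq zero_ereal_def)

lemma A2_finite_iff: "A2 M \<xi> w < \<infinity> \<longleftrightarrow> w \<in> dom"
  by (auto simp: A2_eq)

lemma vec2_add: "vec2 a b + vec2 c d = vec2 (a + c) (b + d)" by (simp add: vec_eq_iff forall_2)
lemma vec2_diff: "vec2 a b - vec2 c d = vec2 (a - c) (b - d)" by (simp add: vec_eq_iff forall_2)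
lemma vec2_scaleR: "r *\<^sub>R vec2 a b = vec2 (r * a) (r * b)" by (simp add: vec_eq_iff forall_2)

text \<open>Since \<open>\<tau> \<ge> 1\<close>, the transform grows at least like \<open>exp\<close> in its first argument.\<close>

lemma dom_down:
  assumes "vec2 l \<mu> \<in> dom" "l' \<le> l"
  shows "vec2 l' \<mu> \<in> dom" "exp (l - l') * psi0 (vec2 l' \<mu>) \<le> psi0 (vec2 l \<mu>)"
proof -
  have i: "integrable M (\<lambda>\<omega>. exp (vec2 l \<mu> \<bullet> \<xi> \<omega>))" using assms by (simp add: dom_iff)
  have le: "AE \<omega> in M. exp (l - l') * exp (vec2 l' \<mu> \<bullet> \<xi> \<omega>) \<le> exp (vec2 l \<mu> \<bullet> \<xi> \<omega>)"
    using xi_ge_1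
  proof eventually_elim
    case (elim \<omega>)
    have "(l - l') * 1 \<le> (l - l') * \<xi> \<omega> $ 1" using assms elim by (intro mult_left_mono) auto
    then show ?case by (simp add: vec2_inner exp_add[symmetric] algebra_simps)
  qed
  have e1: "exp (l - l') \<ge> 1" using assms by simp
  have i': "integrable M (\<lambda>\<omega>. exp (vec2 l' \<mu> \<bullet> \<xi> \<omega>))"
  proof (rule Bochner_Integration.integrable_bound[OF i])
    show "AE \<omega> in M. norm (exp (vec2 l' \<mu> \<bullet> \<xi> \<omega>)) \<le> norm (exp (vec2 l \<mu> \<bullet> \<xi> \<omega>))"
      using le
    proof eventually_elim
      case (elim \<omega>)
      have "1 * exp (vec2 l' \<mu> \<bullet> \<xi> \<omega>) \<le> exp (l - l') * exp (vec2 l' \<mu> \<bullet> \<xi> \<omega>)" using e1 by (intro mult_right_mono) auto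
      then have "exp (vec2 l' \<mu> \<bullet> \<xi> \<omega>) \<le> exp (vec2 l \<mu> \<bullet> \<xi> \<omega>)" using elim by linarith
      then show ?case by simp
    qed
  qed simp
  then show "vec2 l' \<mu> \<in> dom" by (simp add: dom_iff)
  have "(\<integral>\<omega>. exp (l - l') * exp (vec2 l' \<mu> \<bullet> \<xi> \<omega>) \<partial>M) \<le> (\<integral>\<omega>. exp (vec2 l \<mu> \<bullet> \<xi> \<omega>) \<partial>M)"
    by (rule integral_mono_AE) (use i i' le in auto)
  then show "exp (l - l') * psi0 (vec2 l' \<mu>) \<le> psi0 (vec2 l \<mu>)" by (simp add: psi0_def mom_def)
qed

text \<open>Pointwise convexity of the exponential, integrated.\<close>

lemma dom_convex:
  assumes "p \<in> dom" "q \<in> dom" "0 \<le> t" "t \<le> 1"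
  shows "(1 - t) *\<^sub>R p + t *\<^sub>R q \<in> dom" "psi0 ((1 - t) *\<^sub>R p + t *\<^sub>R q) \<le> (1 - t) * psi0 p + t * psi0 q"
proof -
  have i: "integrable M (\<lambda>\<omega>. (1 - t) * exp (p \<bullet> \<xi> \<omega>) + t * exp (q \<bullet> \<xi> \<omega>))"
    using assms by (intro Bochner_Integration.integrable_add integrable_mult_right) (auto simp: dom_iff)
  have le: "exp (((1 - t) *\<^sub>R p + t *\<^sub>R q) \<bullet> \<xi> \<omega>) \<le> (1 - t) * exp (p \<bullet> \<xi> \<omega>) + t * exp (q \<bullet> \<xi> \<omega>)" for \<omega>
    using convex_onD[OF exp_convex, of t "p \<bullet> \<xi> \<omega>" "q \<bullet> \<xi> \<omega>"] assms by (simp add: inner_add_left)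
  have i': "integrable M (\<lambda>\<omega>. exp (((1 - t) *\<^sub>R p + t *\<^sub>R q) \<bullet> \<xi> \<omega>))"
    by (rule Bochner_Integration.integrable_bound[OF i])
      (simp, intro AE_I2, simp only: real_norm_def abs_exp_cancel, rule order_trans[OF le abs_ge_self])
  then show "(1 - t) *\<^sub>R p + t *\<^sub>R q \<in> dom" by (simp add: dom_iff)
  have "psi0 ((1 - t) *\<^sub>R p + t *\<^sub>R q) \<le> (\<integral>\<omega>. (1 - t) * exp (p \<bullet> \<xi> \<omega>) + t * exp (q \<bullet> \<xi> \<omega>) \<partial>M)"
    unfolding psi0_def mom_def using i' by (simp, intro integral_mono i le) 
  also have "\<dots> = (1 - t) * psi0 p + t * psi0 q"
    using assms by (simp add: dom_iff psi0_def mom_def)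
  finally show "psi0 ((1 - t) *\<^sub>R p + t *\<^sub>R q) \<le> (1 - t) * psi0 p + t * psi0 q" .
qed

lemma psi0_isCont: "p \<in> interior dom \<Longrightarrow> isCont psi0 p"
proof -
  assume "p \<in> interior dom"
  then obtain \<rho> where r: "\<rho> > 0" "exp_int M \<xi> p \<rho>" by (rule interior_dom_exp_int)
  show ?thesis unfolding psi0_def by (rule mom_isCont[OF xi_meas _ r(2), of _ 0 1]) (use r in auto)
qed

lemma xi_exp_bound: "\<sigma> > 0 \<Longrightarrow> norm (\<xi> \<omega>) \<le> (1 / \<sigma>) * exp (\<sigma> * norm (\<xi> \<omega>))"
  using le_exp_div[of \<sigma> "norm (\<xi> \<omega>)"] by simp

lemma mean_isCont: "p \<in> interior dom \<Longrightarrow> isCont mean p"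
proof -
  assume "p \<in> interior dom"
  then obtain \<rho> where r: "\<rho> > 0" "exp_int M \<xi> p \<rho>" by (rule interior_dom_exp_int)
  show ?thesis unfolding mean_def
    by (rule mom_isCont[OF xi_meas _ r(2), of _ "\<rho> / 2" "1 / (\<rho> / 2)"]) (use r xi_exp_bound[of "\<rho> / 2"] in auto)
qed

lemma integrable_exp_scale_xi: "p \<in> interior dom \<Longrightarrow> integrable M (\<lambda>\<omega>. exp (p \<bullet> \<xi> \<omega>) *\<^sub>R \<xi> \<omega>)"
proof -
  assume "p \<in> interior dom"
  then obtain \<rho> where r: "\<rho> > 0" "exp_int M \<xi> p \<rho>" by (rule interior_dom_exp_int)
  show ?thesis by (rule mom_integrable[OF xi_meas _ r(2), of _ "1 / \<rho>"]) (use r xi_exp_bound[of "\<rho>"] in auto)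
qed

lemma mean_inner: "p \<in> interior dom \<Longrightarrow> h \<bullet> mean p = (\<integral>\<omega>. exp (p \<bullet> \<xi> \<omega>) * (h \<bullet> \<xi> \<omega>) \<partial>M)"
  using integral_inner_right[OF integrable_exp_scale_xi[of p], of h] by (simp add: mean_def mom_def)

lemma integrable_exp_inner: "p \<in> interior dom \<Longrightarrow> integrable M (\<lambda>\<omega>. exp (p \<bullet> \<xi> \<omega>) * (h \<bullet> \<xi> \<omega>))"
  using integrable_inner_right[OF integrable_exp_scale_xi[of p], of h] by simp

lemma interior_domD: "p \<in> interior dom \<Longrightarrow> p \<in> dom" using interior_subset by blast

text \<open>From \<tau> \<ge> 1. On the curve it bounds the mean time below by 1, a bound
  independent of the tilt, as the renewal estimates require.\<close>

lemma mean_1_ge: "p \<in> interior dom \<Longrightarrow> mean p $ 1 \<ge> psi0 p"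
proof -
  assume p: "p \<in> interior dom"
  have "psi0 p \<le> (\<integral>\<omega>. exp (p \<bullet> \<xi> \<omega>) * (axis 1 1 \<bullet> \<xi> \<omega>) \<partial>M)"
    unfolding psi0_def mom_def using xi_ge_1 interior_domD[OF p]
    by (simp, intro integral_mono_AE integrable_exp_inner[OF p]) (auto simp: dom_iff inner_axis' elim!: eventually_mono)
  then show ?thesis using mean_inner[OF p, of "axis 1 1"] by (simp add: inner_axis')
qed

text \<open>The inequality 1 + t \<le> exp t integrated against the weight at p; strictness follows
  because equality holds only at t = 0 and \<xi> is nondegenerate.\<close>

lemma psi0_support:
  assumes p: "p \<in> interior dom" and q: "q \<in> dom"
  shows "psi0 q \<ge> psi0 p + (q - p) \<bullet> mean p" "q \<noteq> p \<Longrightarrow> psi0 q > psi0 p + (q - p) \<bullet> mean p"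
proof -
  define f where "f \<omega> = exp (q \<bullet> \<xi> \<omega>) - exp (p \<bullet> \<xi> \<omega>) - exp (p \<bullet> \<xi> \<omega>) * ((q - p) \<bullet> \<xi> \<omega>)" for \<omega>
  have f_eq: "f \<omega> = exp (p \<bullet> \<xi> \<omega>) * (exp ((q - p) \<bullet> \<xi> \<omega>) - (1 + (q - p) \<bullet> \<xi> \<omega>))" for \<omega>
    by (simp add: f_def inner_diff_left exp_diff algebra_simps)
  have f0: "f \<omega> \<ge> 0" for \<omega>
    unfolding f_eq using exp_ge_add_one_self[of "(q - p) \<bullet> \<xi> \<omega>"] by (intro mult_nonneg_nonneg) auto
  have i: "integrable M f" unfolding f_def
    using p q interior_domD[OF p] integrable_exp_inner[OF p] by (auto simp: dom_iff)
  have eq: "(\<integral>\<omega>. f \<omega> \<partial>M) = psi0 q - psi0 p - (q - p) \<bullet> mean p"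
    unfolding f_def using p q interior_domD[OF p] integrable_exp_inner[OF p] mean_inner[OF p, of "q - p"]
    by (simp add: dom_iff psi0_def mom_def)
  have "(\<integral>\<omega>. f \<omega> \<partial>M) \<ge> 0" by (intro Bochner_Integration.integral_nonneg f0)
  then show "psi0 q \<ge> psi0 p + (q - p) \<bullet> mean p" using eq by simp
  assume ne: "q \<noteq> p"
  have "(\<integral>\<omega>. f \<omega> \<partial>M) \<noteq> 0"
  proof
    assume "(\<integral>\<omega>. f \<omega> \<partial>M) = 0"
    then have "AE \<omega> in M. f \<omega> = 0" using integral_nonneg_eq_0_iff_AE[OF i] f0 by auto
    then have "AE \<omega> in M. (q - p) \<bullet> \<xi> \<omega> = 0"
    proof eventually_elim
      case (elim \<omega>)
      then have "exp ((q - p) \<bullet> \<xi> \<omega>) = 1 + (q - p) \<bullet> \<xi> \<omega>" unfolding f_eq by simp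
      then show ?case using exp_minus_greater[of "- ((q - p) \<bullet> \<xi> \<omega>)"] by auto
    qed
    then show False using aperiodic_nondegenerate[OF xi_meas char_less_1, of "q - p" 0] ne by simp
  qed
  then have "(\<integral>\<omega>. f \<omega> \<partial>M) > 0" using \<open>(\<integral>\<omega>. f \<omega> \<partial>M) \<ge> 0\<close> by simp
  then show "psi0 q > psi0 p + (q - p) \<bullet> mean p" using eq by simp
qed

section \<open>The curve \<open>\<psi> = 1\<close>\<close>

definition on_curve :: "real^2 \<Rightarrow> bool" where "on_curve p \<longleftrightarrow> p \<in> interior dom \<and> psi0 p = 1"

text \<open>Minus the derivative of \<lambda> along the curve by implicit differentiation, hence the
  candidate for A'(\<mu>).\<close>

definition slope :: "real^2 \<Rightarrow> real" where "slope p = mean p $ 2 / mean p $ 1"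

lemma on_curve_mean_pos: "on_curve p \<Longrightarrow> mean p $ 1 \<ge> 1"
  using mean_1_ge[of p] by (simp add: on_curve_def)

text \<open>The tangent line at a point of the curve supports the convex set where \<psi> \<le> 1;
  its normal is the mean, normalised to (1, slope) by its positive first coordinate.\<close>

lemma curve_support:
  assumes p: "on_curve (vec2 l \<mu>)" and q: "vec2 l' \<mu>' \<in> dom" "psi0 (vec2 l' \<mu>') \<le> 1"
  shows "l' + slope (vec2 l \<mu>) * \<mu>' \<le> l + slope (vec2 l \<mu>) * \<mu>"
    and "(l', \<mu>') \<noteq> (l, \<mu>) \<Longrightarrow> l' + slope (vec2 l \<mu>) * \<mu>' < l + slope (vec2 l \<mu>) * \<mu>"
proof -
  define a where "a = mean (vec2 l \<mu>)"
  have a1: "a $ 1 > 0" using on_curve_mean_pos[OF p] by (simp add: a_def)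
  have pi: "vec2 l \<mu> \<in> interior dom" "psi0 (vec2 l \<mu>) = 1" using p by (auto simp: on_curve_def)
  have inn: "(vec2 l' \<mu>' - vec2 l \<mu>) \<bullet> a = a $ 1 * ((l' + slope (vec2 l \<mu>) * \<mu>') - (l + slope (vec2 l \<mu>) * \<mu>))"
    using a1 by (simp add: slope_def a_def[symmetric] vec2_diff vec2_inner field_simps)
  have "(vec2 l' \<mu>' - vec2 l \<mu>) \<bullet> a \<le> 0" using psi0_support(1)[OF pi(1) q(1)] q(2) pi(2) by (simp add: a_def)
  then show "l' + slope (vec2 l \<mu>) * \<mu>' \<le> l + slope (vec2 l \<mu>) * \<mu>" unfolding inn using a1 by (simp add: mult_le_0_iff)
  assume "(l', \<mu>') \<noteq> (l, \<mu>)"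
  then have "vec2 l' \<mu>' \<noteq> vec2 l \<mu>" by (auto simp: vec_eq_iff forall_2)
  then have "(vec2 l' \<mu>' - vec2 l \<mu>) \<bullet> a < 0" using psi0_support(2)[OF pi(1) q(1)] q(2) pi(2) by (simp add: a_def)
  then show "l' + slope (vec2 l \<mu>) * \<mu>' < l + slope (vec2 l \<mu>) * \<mu>" unfolding inn using a1 by (simp add: mult_less_0_iff)
qed

definition sublevel :: "real \<Rightarrow> real set" where "sublevel \<mu> = {l. vec2 l \<mu> \<in> dom \<and> psi0 (vec2 l \<mu>) \<le> 1}"

lemma A1_inner_eq: "A1_inner M \<xi> \<mu> = - (SUP l\<in>sublevel \<mu>. ereal l)"
  by (simp add: A1_inner_def sublevel_def A2_le_0_iff)

lemma A1_infty_eq: "A1_infty M \<xi> \<mu> = - (SUP l\<in>A_section M \<xi> \<mu>. ereal l)"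
  by (simp only: A1_infty_def A_section_def A2_finite_iff)

text \<open>Since the transform grows at least exponentially in l, lowering l by the logarithm of a
  value above 1 brings it down to at most 1.\<close>

lemma sublevel_nonempty: "A_section M \<xi> \<mu> \<noteq> {} \<Longrightarrow> sublevel \<mu> \<noteq> {}"
proof -
  assume "A_section M \<xi> \<mu> \<noteq> {}"
  then obtain l where l: "vec2 l \<mu> \<in> dom" by (auto simp: A_section_def)
  define s where "s = max 0 (ln (psi0 (vec2 l \<mu>)))"
  have s: "s \<ge> 0" "psi0 (vec2 l \<mu>) \<le> exp s" using psi0_pos_dom[OF l] by (auto simp: s_def max_def)
  have "exp s * psi0 (vec2 (l - s) \<mu>) \<le> psi0 (vec2 l \<mu>)" using dom_down(2)[OF l, of "l - s"] s by simp
  also have "\<dots> \<le> exp s * 1" using s by simp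
  finally have "psi0 (vec2 (l - s) \<mu>) \<le> 1" by (simp only: mult_le_cancel_left_pos[OF exp_gt_zero])
  then show ?thesis using dom_down(1)[OF l, of "l - s"] s by (auto simp: sublevel_def)
qed

text \<open>The same exponential growth: above any one point of the set the transform must soon
  exceed 1.\<close>

lemma sublevel_bdd: "bdd_above (sublevel \<mu>)"
proof (cases "sublevel \<mu> = {}")
  case False
  then obtain l0 where l0: "l0 \<in> sublevel \<mu>" by auto
  have p0: "psi0 (vec2 l0 \<mu>) > 0" using l0 by (auto simp: sublevel_def psi0_pos_dom)
  show ?thesis
  proof (rule bdd_aboveI)
    fix l assume l: "l \<in> sublevel \<mu>"
    show "l \<le> max l0 (l0 - ln (psi0 (vec2 l0 \<mu>)))"
    proof (cases "l \<le> l0")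
      case False
      then have "exp (l - l0) * psi0 (vec2 l0 \<mu>) \<le> 1" using dom_down(2)[of l \<mu> l0] l by (auto simp: sublevel_def)
      then have "exp (l - l0) \<le> 1 / psi0 (vec2 l0 \<mu>)" using p0 by (simp add: field_simps)
      then have "l - l0 \<le> ln (1 / psi0 (vec2 l0 \<mu>))" using p0 by (metis ln_exp ln_mono exp_gt_zero divide_pos_pos zero_less_one)
      then show ?thesis using p0 by (simp add: ln_div)
    qed simp
  qed
qed simp

lemma A1_inner_Sup:
  assumes ne: "sublevel \<mu> \<noteq> {}"
  shows "A1_inner M \<xi> \<mu> = ereal (- Sup (sublevel \<mu>))"
proof -
  have "(SUP l\<in>sublevel \<mu>. ereal l) = ereal (Sup (sublevel \<mu>))"
  proof (rule SUP_eqI)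
    show "ereal l \<le> ereal (Sup (sublevel \<mu>))" if "l \<in> sublevel \<mu>" for l
      using cSup_upper[OF that sublevel_bdd] by simp
    fix y assume y: "\<And>l. l \<in> sublevel \<mu> \<Longrightarrow> ereal l \<le> y"
    show "ereal (Sup (sublevel \<mu>)) \<le> y"
    proof (cases y)
      case (real r)
      then have "Sup (sublevel \<mu>) \<le> r" using y by (intro cSup_least[OF ne]) auto
      then show ?thesis by (simp add: real)
    qed (use y ne in auto)
  qed
  then show ?thesis by (simp add: A1_inner_eq)
qed

definition in_range :: "real \<Rightarrow> bool" where "in_range \<mu> \<longleftrightarrow> mu_inf M \<xi> < ereal \<mu> \<and> ereal \<mu> < mu_sup M \<xi>"

lemma in_range_iff: "in_range \<mu> \<longleftrightarrow> (\<exists>\<mu>1 \<mu>2. \<mu>1 < \<mu> \<and> \<mu> < \<mu>2 \<and> A_section M \<xi> \<mu>1 \<noteq> {} \<and> A_section M \<xi> \<mu>2 \<noteq> {})"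
  unfolding in_range_def mu_inf_def mu_sup_def less_SUP_iff INF_less_iff by auto

lemma in_range_section: "in_range \<mu> \<Longrightarrow> A_section M \<xi> \<mu> \<noteq> {}"
proof -
  assume "in_range \<mu>"
  then obtain \<mu>1 \<mu>2 l1 l2 where m: "\<mu>1 < \<mu>" "\<mu> < \<mu>2" "vec2 l1 \<mu>1 \<in> dom" "vec2 l2 \<mu>2 \<in> dom"
    unfolding in_range_iff A_section_def by auto
  define t where "t = (\<mu> - \<mu>1) / (\<mu>2 - \<mu>1)"
  have "(1 - t) * \<mu>1 + t * \<mu>2 = \<mu>1 + t * (\<mu>2 - \<mu>1)" by (simp add: algebra_simps)
  also have "t * (\<mu>2 - \<mu>1) = \<mu> - \<mu>1" using m by (simp add: t_def)
  finally have t: "0 \<le> t" "t \<le> 1" "(1 - t) * \<mu>1 + t * \<mu>2 = \<mu>" using m by (auto simp: t_def)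
  have "vec2 ((1 - t) * l1 + t * l2) \<mu> \<in> dom" using dom_convex(1)[OF m(3,4) t(1,2)] by (simp add: vec2_scaleR vec2_add t(3))
  then show ?thesis by (auto simp: A_section_def)
qed

lemma A1_in_range: "in_range \<mu> \<Longrightarrow> A1 M \<xi> \<mu> = ereal (- Sup (sublevel \<mu>))"
  using A1_inner_Sup[OF sublevel_nonempty[OF in_range_section]] by (simp add: A1_def in_range_def)

lemma on_curve_Sup:
  assumes "on_curve (vec2 l \<mu>)"
  shows "Sup (sublevel \<mu>) = l" "l \<in> sublevel \<mu>"
proof -
  show l: "l \<in> sublevel \<mu>" using assms interior_domD by (auto simp: sublevel_def on_curve_def)
  show "Sup (sublevel \<mu>) = l"
  proof (rule cSup_eq_maximum[OF l])
    fix l' assume "l' \<in> sublevel \<mu>"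
    then show "l' \<le> l" using curve_support(1)[OF assms, of l' \<mu>] by (auto simp: sublevel_def)
  qed
qed

lemma interior_box:
  assumes "vec2 l \<mu> \<in> interior dom"
  obtains r where "r > 0" "\<And>l' \<mu>'. \<bar>l' - l\<bar> \<le> r \<Longrightarrow> \<bar>\<mu>' - \<mu>\<bar> \<le> r \<Longrightarrow> vec2 l' \<mu>' \<in> interior dom"
proof -
  have "open (interior dom)" by simp
  then obtain e where e: "e > 0" "ball (vec2 l \<mu>) e \<subseteq> interior dom" using assms openE by blast
  show ?thesis
  proof (rule that[of "e / 3"])
    fix l' \<mu>' assume "\<bar>l' - l\<bar> \<le> e / 3" "\<bar>\<mu>' - \<mu>\<bar> \<le> e / 3"
    then have "norm (vec2 (l' - l) (\<mu>' - \<mu>)) < e"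
      using norm_le_l1_cart[of "vec2 (l' - l) (\<mu>' - \<mu>)"] e(1) by (simp add: sum_2)
    then show "vec2 l' \<mu>' \<in> interior dom" using e(2) by (auto simp: dist_norm vec2_diff norm_minus_commute subset_iff)
  qed (use e in simp)
qed

lemma on_curve_in_range:
  assumes "on_curve (vec2 l \<mu>)"
  shows "in_range \<mu>" "A1_infty M \<xi> \<mu> < A1 M \<xi> \<mu>"
proof -
  obtain r where r: "r > 0" "\<And>l' \<mu>'. \<bar>l' - l\<bar> \<le> r \<Longrightarrow> \<bar>\<mu>' - \<mu>\<bar> \<le> r \<Longrightarrow> vec2 l' \<mu>' \<in> interior dom"
    using interior_box assms unfolding on_curve_def by blast
  have "vec2 l (\<mu> - r) \<in> dom" "vec2 l (\<mu> + r) \<in> dom" "vec2 (l + r) \<mu> \<in> dom" using r by (auto intro!: interior_domD)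
  then have s: "A_section M \<xi> (\<mu> - r) \<noteq> {}" "A_section M \<xi> (\<mu> + r) \<noteq> {}" "l + r \<in> A_section M \<xi> \<mu>"
    by (auto simp: A_section_def)
  show ir: "in_range \<mu>" unfolding in_range_iff using s r(1) by (intro exI[of _ "\<mu> - r"] exI[of _ "\<mu> + r"]) auto
  have "ereal l < ereal (l + r)" using r by simp
  also have "\<dots> \<le> (SUP l\<in>A_section M \<xi> \<mu>. ereal l)" using s(3) by (rule SUP_upper)
  finally have "- (SUP l\<in>A_section M \<xi> \<mu>. ereal l) < - ereal l" by (simp only: ereal_minus_less_minus)
  then show "A1_infty M \<xi> \<mu> < A1 M \<xi> \<mu>" unfolding A1_in_range[OF ir] on_curve_Sup(1)[OF assms] A1_infty_eq by simp
qed

text \<open>The strict inequality provides a point of the domain above (l, \<mu>), and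
  \<open>in_range\<close> provides points on both sides. By convexity the domain contains (l +
  \<rho>, \<mu> - \<rho>) and (l + \<rho>, \<mu> + \<rho>) for small \<rho>, and as \<tau> is
  positive these two control \<rho> |\<xi>|. So (l, \<mu>) is interior, and continuity from below
  and from above gives \<psi> = 1.\<close>

lemma in_range_on_curve:
  assumes ir: "in_range \<mu>" and less: "A1_infty M \<xi> \<mu> < A1 M \<xi> \<mu>"
  shows "on_curve (vec2 (Sup (sublevel \<mu>)) \<mu>)"
proof -
  define l where "l = Sup (sublevel \<mu>)"
  have ne: "sublevel \<mu> \<noteq> {}" by (rule sublevel_nonempty[OF in_range_section[OF ir]])
  have "- (SUP l\<in>A_section M \<xi> \<mu>. ereal l) < - ereal l"
    using less unfolding A1_in_range[OF ir] A1_infty_eq l_def[symmetric] by simp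
  then have "ereal l < (SUP l\<in>A_section M \<xi> \<mu>. ereal l)" by (simp only: ereal_minus_less_minus)
  then obtain l' where l': "l' > l" "vec2 l' \<mu> \<in> dom" by (auto simp: less_SUP_iff A_section_def)
  obtain \<mu>1 \<mu>2 l1 l2 where m: "\<mu>1 < \<mu>" "\<mu> < \<mu>2" "vec2 l1 \<mu>1 \<in> dom" "vec2 l2 \<mu>2 \<in> dom"
    using ir unfolding in_range_iff A_section_def by auto
  have near: "\<exists>\<rho>0>0. \<forall>\<rho>. 0 \<le> \<rho> \<and> \<rho> \<le> \<rho>0 \<longrightarrow> vec2 (l + \<rho>) (\<mu> + \<rho> * sgn (\<nu> - \<mu>)) \<in> dom"
    if n: "vec2 k \<nu> \<in> dom" "\<nu> \<noteq> \<mu>" for k \<nu>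
  proof -
    define c where "c = \<bar>\<nu> - \<mu>\<bar>"
    have c: "c > 0" using n by (simp add: c_def)
    \<comment> \<open>Moving from (l', \<mu>) a horizontal distance \<rho> towards (k, \<nu>) lowers
      the height by at most \<rho> |l' - k| / c; this \<open>\<rho>0\<close> leaves room for the
      further \<rho> above l.\<close>
    define \<rho>0 where "\<rho>0 = min c ((l' - l) / (1 + \<bar>l' - k\<bar> / c))"
    have den: "1 + \<bar>l' - k\<bar> / c > 0" using c by (simp add: add_pos_nonneg)
    show ?thesis
    proof (intro exI[of _ \<rho>0] conjI allI impI)
      show "\<rho>0 > 0" using c l' den by (simp add: \<rho>0_def)
      fix \<rho> assume \<rho>: "0 \<le> \<rho> \<and> \<rho> \<le> \<rho>0"
      define t where "t = \<rho> / c"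
      have t: "0 \<le> t" "t \<le> 1" using \<rho> c by (auto simp: t_def \<rho>0_def)
      have "(1 - t) * \<mu> + t * \<nu> = \<mu> + t * (\<nu> - \<mu>)" by (simp add: algebra_simps)
      also have "t * (\<nu> - \<mu>) = \<rho> * sgn (\<nu> - \<mu>)" using n(2) by (cases "\<nu> > \<mu>") (auto simp: t_def c_def sgn_if abs_if field_simps)
      finally have mu: "(1 - t) * \<mu> + t * \<nu> = \<mu> + \<rho> * sgn (\<nu> - \<mu>)" .
      have d: "vec2 ((1 - t) * l' + t * k) (\<mu> + \<rho> * sgn (\<nu> - \<mu>)) \<in> dom"
        using dom_convex(1)[OF l'(2) n(1) t] by (simp add: vec2_scaleR vec2_add mu)
      have "\<rho> \<le> (l' - l) / (1 + \<bar>l' - k\<bar> / c)" using \<rho> by (simp add: \<rho>0_def)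
      then have "\<rho> * (1 + \<bar>l' - k\<bar> / c) \<le> l' - l" using den by (simp add: pos_le_divide_eq)
      then have "\<rho> + t * \<bar>l' - k\<bar> \<le> l' - l" by (simp add: t_def distrib_left)
      moreover have "t * (l' - k) \<le> t * \<bar>l' - k\<bar>" using t by (intro mult_left_mono) auto
      ultimately have "l + \<rho> \<le> (1 - t) * l' + t * k" by (simp add: algebra_simps)
      then show "vec2 (l + \<rho>) (\<mu> + \<rho> * sgn (\<nu> - \<mu>)) \<in> dom" by (rule dom_down(1)[OF d])
    qed
  qed
  obtain ra where ra: "ra > 0" "\<And>\<rho>. 0 \<le> \<rho> \<Longrightarrow> \<rho> \<le> ra \<Longrightarrow> vec2 (l + \<rho>) (\<mu> - \<rho>) \<in> dom"
    using near[OF m(3)] m(1) by auto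
  obtain rb where rb: "rb > 0" "\<And>\<rho>. 0 \<le> \<rho> \<Longrightarrow> \<rho> \<le> rb \<Longrightarrow> vec2 (l + \<rho>) (\<mu> + \<rho>) \<in> dom"
    using near[OF m(4)] m(2) by auto
  define \<rho> where "\<rho> = min ra rb"
  have \<rho>: "\<rho> > 0" using ra rb by (simp add: \<rho>_def)
  have "exp_int M \<xi> (vec2 l \<mu>) \<rho>"
    unfolding exp_int_def
  proof (rule Bochner_Integration.integrable_bound)
    show "integrable M (\<lambda>\<omega>. exp (vec2 (l + \<rho>) (\<mu> - \<rho>) \<bullet> \<xi> \<omega>) + exp (vec2 (l + \<rho>) (\<mu> + \<rho>) \<bullet> \<xi> \<omega>))"
      using ra(2)[of \<rho>] rb(2)[of \<rho>] \<rho> by (intro Bochner_Integration.integrable_add) (auto simp: dom_iff \<rho>_def)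
    show "AE \<omega> in M. norm (exp (vec2 l \<mu> \<bullet> \<xi> \<omega> + \<rho> * norm (\<xi> \<omega>)))
        \<le> norm (exp (vec2 (l + \<rho>) (\<mu> - \<rho>) \<bullet> \<xi> \<omega>) + exp (vec2 (l + \<rho>) (\<mu> + \<rho>) \<bullet> \<xi> \<omega>))"
      using xi_ge_1
    proof eventually_elim
      case (elim \<omega>)
      \<comment> \<open>The first coordinate is positive, so only the sign of the second is open and
        two exponentials suffice.\<close>
      have "norm (\<xi> \<omega>) \<le> \<xi> \<omega> $ 1 + \<bar>\<xi> \<omega> $ 2\<bar>" using norm_le_l1_cart[of "\<xi> \<omega>"] elim by (simp add: sum_2)
      then have "\<rho> * norm (\<xi> \<omega>) \<le> \<rho> * (\<xi> \<omega> $ 1 + \<bar>\<xi> \<omega> $ 2\<bar>)" using \<rho> by (intro mult_left_mono) auto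
      then have "exp (vec2 l \<mu> \<bullet> \<xi> \<omega> + \<rho> * norm (\<xi> \<omega>)) \<le> exp (vec2 l \<mu> \<bullet> \<xi> \<omega> + \<rho> * (\<xi> \<omega> $ 1 + \<bar>\<xi> \<omega> $ 2\<bar>))" by simp
      also have "\<dots> \<le> exp (vec2 (l + \<rho>) (\<mu> - \<rho>) \<bullet> \<xi> \<omega>) + exp (vec2 (l + \<rho>) (\<mu> + \<rho>) \<bullet> \<xi> \<omega>)"
        by (cases "\<xi> \<omega> $ 2 \<ge> 0") (auto simp: vec2_inner algebra_simps)
      finally show ?case by simp
    qed
  qed measurable
  then have int: "vec2 l \<mu> \<in> interior dom" using \<rho> by (rule exp_int_interior_dom)
  obtain r where r: "r > 0" "\<And>l' \<mu>'. \<bar>l' - l\<bar> \<le> r \<Longrightarrow> \<bar>\<mu>' - \<mu>\<bar> \<le> r \<Longrightarrow> vec2 l' \<mu>' \<in> interior dom"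
    using interior_box[OF int] by blast
  have "isCont (\<lambda>k. vec2 k \<mu>) l"
  proof -
    have "(\<lambda>k. vec2 k \<mu>) = (\<lambda>k. k *\<^sub>R axis 1 1 + \<mu> *\<^sub>R axis 2 1)" by (simp add: fun_eq_iff vec_eq_iff forall_2 axis_def)
    then show ?thesis by (simp add: continuous_intros)
  qed
  then have cont: "isCont (\<lambda>k. psi0 (vec2 k \<mu>)) l" using psi0_isCont[OF int] by (rule isCont_o2)
  have "psi0 (vec2 l \<mu>) \<le> 1"
  proof (rule tendsto_upperbound)
    show "((\<lambda>k. psi0 (vec2 k \<mu>)) \<longlongrightarrow> psi0 (vec2 l \<mu>)) (at_left l)"
      using cont by (simp add: isCont_def filterlim_at_split)
    show "eventually (\<lambda>k. psi0 (vec2 k \<mu>) \<le> 1) (at_left l)"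
    proof (rule eventually_at_leftI[of "l - 1"])
      fix k assume "k \<in> {l - 1<..<l}"
      then obtain j where j: "j \<in> sublevel \<mu>" "k < j" using less_cSup_iff[OF ne sublevel_bdd] by (auto simp: l_def)
      then have jd: "vec2 j \<mu> \<in> dom" "psi0 (vec2 j \<mu>) \<le> 1" by (auto simp: sublevel_def)
      have "1 * psi0 (vec2 k \<mu>) \<le> exp (j - k) * psi0 (vec2 k \<mu>)"
        using j psi0_pos_dom[OF dom_down(1)[OF jd(1), of k]] by (intro mult_right_mono) auto
      then show "psi0 (vec2 k \<mu>) \<le> 1" using dom_down(2)[OF jd(1), of k] j jd(2) by simp
    qed simp
  qed simp
  moreover have "psi0 (vec2 l \<mu>) \<ge> 1"
  proof (rule tendsto_lowerbound)
    show "((\<lambda>k. psi0 (vec2 k \<mu>)) \<longlongrightarrow> psi0 (vec2 l \<mu>)) (at_right l)"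
      using cont by (simp add: isCont_def filterlim_at_split)
    show "eventually (\<lambda>k. 1 \<le> psi0 (vec2 k \<mu>)) (at_right l)"
    proof (rule eventually_at_rightI[of _ "l + r"])
      fix k assume k: "k \<in> {l<..<l + r}"
      have "k \<notin> sublevel \<mu>" using cSup_upper[OF _ sublevel_bdd, of k \<mu>] k by (auto simp: l_def)
      moreover have "vec2 k \<mu> \<in> dom" using r k by (intro interior_domD) auto
      ultimately show "1 \<le> psi0 (vec2 k \<mu>)" by (simp add: sublevel_def)
    qed (use r in simp)
  qed simp
  ultimately show ?thesis using int by (simp add: on_curve_def l_def)
qed

end

lemma vec2_conv_axis: "vec2 a b = a *\<^sub>R axis 1 1 + b *\<^sub>R axis 2 1"
  by (simp add: vec_eq_iff forall_2 axis_def)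

lemma tendsto_vec2 [tendsto_intros]:
  "(f \<longlongrightarrow> a) F \<Longrightarrow> (g \<longlongrightarrow> b) F \<Longrightarrow> ((\<lambda>x. vec2 (f x) (g x)) \<longlongrightarrow> vec2 a b) F"
  unfolding vec2_conv_axis by (intro tendsto_intros)

lemma isCont_vec2: "isCont f x \<Longrightarrow> isCont g x \<Longrightarrow> isCont (\<lambda>x. vec2 (f x) (g x)) x"
  unfolding isCont_def by (rule tendsto_vec2)

context arithmetic_compound_renewal begin

text \<open>An elementary implicit function argument: \<open>psi0\<close> is above 1 at l + \<delta>
  and below 1 at l - \<delta>, both persist for nearby \<mu>', and the intermediate value theorem
  gives a solution in between.\<close>

lemma on_curve_near:
  assumes c: "on_curve (vec2 l \<mu>)" and e: "e > 0"
  shows "\<exists>d>0. \<forall>\<mu>'. \<bar>\<mu>' - \<mu>\<bar> < d \<longrightarrow> (\<exists>l'. \<bar>l' - l\<bar> < e \<and> on_curve (vec2 l' \<mu>'))"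
proof -
  obtain r where r: "r > 0" "\<And>l' \<mu>'. \<bar>l' - l\<bar> \<le> r \<Longrightarrow> \<bar>\<mu>' - \<mu>\<bar> \<le> r \<Longrightarrow> vec2 l' \<mu>' \<in> interior dom"
    using interior_box c unfolding on_curve_def by blast
  define \<delta> where "\<delta> = min r e / 2"
  have \<delta>: "\<delta> > 0" "\<delta> \<le> r" "\<delta> < e" using r e by (auto simp: \<delta>_def)
  have p1: "psi0 (vec2 l \<mu>) = 1" using c by (simp add: on_curve_def)
  have int: "vec2 (l + \<delta>) \<mu> \<in> interior dom" "vec2 (l - \<delta>) \<mu> \<in> interior dom" "vec2 l \<mu> \<in> interior dom"
    using r \<delta> by auto
  \<comment> \<open>The exponential growth in l separates the values at l + \<delta> and l -
    \<delta> strictly from 1.\<close>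
  have "1 < exp \<delta>" using \<delta> by simp
  also have "\<dots> \<le> psi0 (vec2 (l + \<delta>) \<mu>)" using dom_down(2)[OF interior_domD[OF int(1)], of l] \<delta> p1 by simp
  finally have up: "psi0 (vec2 (l + \<delta>) \<mu>) > 1" .
  have "exp \<delta> * psi0 (vec2 (l - \<delta>) \<mu>) \<le> 1" using dom_down(2)[OF interior_domD[OF int(3)], of "l - \<delta>"] \<delta> p1 by simp
  moreover have "1 * psi0 (vec2 (l - \<delta>) \<mu>) < exp \<delta> * psi0 (vec2 (l - \<delta>) \<mu>)"
    using \<open>1 < exp \<delta>\<close> psi0_pos_dom[OF interior_domD[OF int(2)]] by (intro mult_strict_right_mono)
  ultimately have low: "psi0 (vec2 (l - \<delta>) \<mu>) < 1" by simp
  have cont: "((\<lambda>m. psi0 (vec2 k m)) \<longlongrightarrow> psi0 (vec2 k \<mu>)) (at \<mu>)" if "vec2 k \<mu> \<in> interior dom" for k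
    using isCont_o2[OF isCont_vec2[of \<mu> "\<lambda>_. k" "\<lambda>m. m"] psi0_isCont[OF that]] by (simp add: isCont_def)
  have "eventually (\<lambda>m. psi0 (vec2 (l + \<delta>) m) > 1 \<and> psi0 (vec2 (l - \<delta>) m) < 1) (at \<mu>)"
    by (rule eventually_conj[OF order_tendstoD(1)[OF cont[OF int(1)] up] order_tendstoD(2)[OF cont[OF int(2)] low]])
  then obtain d0 where d0: "d0 > 0" "\<And>m. m \<noteq> \<mu> \<Longrightarrow> dist m \<mu> < d0 \<Longrightarrow> psi0 (vec2 (l + \<delta>) m) > 1 \<and> psi0 (vec2 (l - \<delta>) m) < 1"
    unfolding eventually_at by blast
  show ?thesis
  proof (rule exI[of _ "min d0 r"], intro conjI allI impI)
    show "min d0 r > 0" using d0 r by simp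
    fix m assume m: "\<bar>m - \<mu>\<bar> < min d0 r"
    have up': "psi0 (vec2 (l + \<delta>) m) > 1" and low': "psi0 (vec2 (l - \<delta>) m) < 1"
      using d0(2)[of m] m up low by (cases "m = \<mu>"; auto simp: dist_real_def)+
    have "\<exists>k\<ge>l - \<delta>. k \<le> l + \<delta> \<and> psi0 (vec2 k m) = 1"
    proof (rule IVT)
      show "\<forall>k. l - \<delta> \<le> k \<and> k \<le> l + \<delta> \<longrightarrow> isCont (\<lambda>k. psi0 (vec2 k m)) k"
      proof (intro allI impI)
        fix k assume "l - \<delta> \<le> k \<and> k \<le> l + \<delta>"
        then have i: "vec2 k m \<in> interior dom" using r \<delta> m by (intro r(2)) auto
        have "isCont (\<lambda>k. vec2 k m) k" by (rule isCont_vec2) simp_all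
        then show "isCont (\<lambda>k. psi0 (vec2 k m)) k" using psi0_isCont[OF i] by (rule isCont_o2[where f = "\<lambda>k. vec2 k m" and g = psi0])
      qed
    qed (use up' low' \<delta> in auto)
    then obtain k where k: "l - \<delta> \<le> k" "k \<le> l + \<delta>" "psi0 (vec2 k m) = 1" by blast
    then have "on_curve (vec2 k m)" unfolding on_curve_def using r \<delta> m by (intro conjI r(2)) auto
    moreover have "\<bar>k - l\<bar> < e" using k \<delta> by auto
    ultimately show "\<exists>l'. \<bar>l' - l\<bar> < e \<and> on_curve (vec2 l' m)" by blast
  qed
qed

definition lam :: "real \<Rightarrow> real" where "lam \<mu> = Sup (sublevel \<mu>)"

definition curve_set :: "real set" where "curve_set = {\<mu>. on_curve (vec2 (lam \<mu>) \<mu>)}"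

lemma on_curve_lam: "on_curve (vec2 l \<mu>) \<Longrightarrow> lam \<mu> = l" "on_curve (vec2 l \<mu>) \<Longrightarrow> \<mu> \<in> curve_set"
  using on_curve_Sup(1) by (auto simp: lam_def curve_set_def)

text \<open>Connects the condition on A and its companion in the definition of
  \<open>mu_interval\<close> with solvability of \<psi> = 1 in the interior of the domain.\<close>

lemma curve_set_iff: "\<mu> \<in> curve_set \<longleftrightarrow> in_range \<mu> \<and> A1_infty M \<xi> \<mu> < A1 M \<xi> \<mu>"
  using on_curve_in_range in_range_on_curve by (auto simp: curve_set_def lam_def)

lemma A1_curve: "\<mu> \<in> curve_set \<Longrightarrow> A1 M \<xi> \<mu> = ereal (- lam \<mu>)"
  using A1_in_range by (simp add: curve_set_iff lam_def)

text \<open>The solution found by \<open>on_curve_near\<close> over a nearby abscissa must be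
  \<open>lam\<close>, since a point of the curve is the top of its section of the sublevel
  set.\<close>

lemma lam_isCont: "\<mu> \<in> curve_set \<Longrightarrow> isCont lam \<mu>"
  unfolding continuous_at_eps_delta
proof (intro allI impI)
  fix e :: real assume m: "\<mu> \<in> curve_set" and e: "e > 0"
  obtain d where d: "d > 0" "\<And>\<mu>'. \<bar>\<mu>' - \<mu>\<bar> < d \<Longrightarrow> \<exists>l'. \<bar>l' - lam \<mu>\<bar> < e \<and> on_curve (vec2 l' \<mu>')"
    using on_curve_near[OF _ e] m unfolding curve_set_def by blast
  show "\<exists>d>0. \<forall>x'. dist x' \<mu> < d \<longrightarrow> dist (lam x') (lam \<mu>) < e"
    using d on_curve_lam(1) by (intro exI[of _ d]) (auto simp: dist_real_def)
qed

lemma open_curve_set: "open curve_set"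
  unfolding open_dist
proof
  fix \<mu> assume "\<mu> \<in> curve_set"
  then obtain d where "d > 0" "\<And>\<mu>'. \<bar>\<mu>' - \<mu>\<bar> < d \<Longrightarrow> \<exists>l'. \<bar>l' - lam \<mu>\<bar> < 1 \<and> on_curve (vec2 l' \<mu>')"
    using on_curve_near[of "lam \<mu>" \<mu> 1] unfolding curve_set_def by auto
  then show "\<exists>e>0. \<forall>y. dist y \<mu> < e \<longrightarrow> y \<in> curve_set"
    using on_curve_lam(2) by (intro exI[of _ d]) (auto simp: dist_real_def)
qed

text \<open>Cramer's condition gives slack at the origin, where the transform is the total mass
  1.\<close>

lemma zero_on_curve: "on_curve (vec2 0 0)"
proof -
  obtain \<delta> where d: "\<delta> > 0" "integrable M (\<lambda>\<omega>. exp (\<delta> * norm (\<xi> \<omega>)))" using cramer by blast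
  have v0: "vec2 0 0 = (0 :: real^2)" by (simp add: vec_eq_iff forall_2)
  have "exp_int M \<xi> (vec2 0 0) \<delta>" unfolding v0 exp_int_def using d(2) by simp
  then have "vec2 0 0 \<in> interior dom" using d(1) by (rule exp_int_interior_dom)
  moreover have "psi0 (vec2 0 0) = 1" by (simp add: v0 psi0_def mom_def prob_space)
  ultimately show ?thesis by (simp add: on_curve_def)
qed

section \<open>The interval of admissible \<mu> and the range of slopes\<close>

abbreviation J :: "real set" where "J \<equiv> mu_interval M \<xi>"

lemma mu_interval_eq: "J = \<Union>{I. open I \<and> is_interval I \<and> 0 \<in> I \<and> I \<subseteq> curve_set}"
  unfolding mu_interval_def by (intro arg_cong[where f = Union] Collect_cong) (auto simp: curve_set_iff in_range_def)

lemma J_props: "open J" "is_interval J" "0 \<in> J" "J \<subseteq> curve_set"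
proof -
  show "open J" unfolding mu_interval_eq by (intro open_Union) auto
  show "J \<subseteq> curve_set" unfolding mu_interval_eq by auto
  show "is_interval J" unfolding mu_interval_eq is_interval_connected_1
    by (rule connected_Union) (auto simp: is_interval_connected_1)
  have "0 \<in> curve_set" using on_curve_lam(2)[OF zero_on_curve] .
  then obtain e where e: "e > 0" "\<And>y. dist y 0 < e \<Longrightarrow> y \<in> curve_set" using open_curve_set unfolding open_dist by blast
  have "{- e<..<e} \<in> {I. open I \<and> is_interval I \<and> 0 \<in> I \<and> I \<subseteq> curve_set}"
    using e by (auto simp: is_interval_oo dist_real_def abs_less_iff)
  moreover have "0 \<in> {- e<..<e}" using e by simp
  ultimately show "0 \<in> J" unfolding mu_interval_eq by blast
qed

definition curve_slope :: "real \<Rightarrow> real" where "curve_slope \<mu> = slope (vec2 (lam \<mu>) \<mu>)"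

lemma curve_slope_isCont: "\<mu> \<in> curve_set \<Longrightarrow> isCont curve_slope \<mu>"
proof -
  assume m: "\<mu> \<in> curve_set"
  then have oc: "on_curve (vec2 (lam \<mu>) \<mu>)" by (simp add: curve_set_def)
  have "isCont (\<lambda>m. vec2 (lam m) m) \<mu>" by (rule isCont_vec2[OF lam_isCont[OF m]]) simp
  then have "isCont (\<lambda>m. mean (vec2 (lam m) m)) \<mu>" by (rule isCont_o2) (use oc in \<open>auto simp: on_curve_def intro: mean_isCont\<close>)
  then have "((\<lambda>m. mean (vec2 (lam m) m) $ i) \<longlongrightarrow> mean (vec2 (lam \<mu>) \<mu>) $ i) (at \<mu>)" for i
    unfolding isCont_def by (rule tendsto_vec_nth)
  from tendsto_divide[OF this[of 2] this[of 1]] show ?thesis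
    unfolding isCont_def curve_slope_def slope_def using on_curve_mean_pos[OF oc] by auto
qed

text \<open>Says that \<open>lam\<close> is concave with supergradient \<open>- curve_slope\<close>,
  strictly away from the point of contact.\<close>

lemma curve_chord:
  assumes "\<mu> \<in> curve_set" "\<mu>' \<in> curve_set"
  shows "lam \<mu>' + curve_slope \<mu> * \<mu>' \<le> lam \<mu> + curve_slope \<mu> * \<mu>"
    and "\<mu>' \<noteq> \<mu> \<Longrightarrow> lam \<mu>' + curve_slope \<mu> * \<mu>' < lam \<mu> + curve_slope \<mu> * \<mu>"
proof -
  have o: "on_curve (vec2 (lam \<mu>) \<mu>)" "on_curve (vec2 (lam \<mu>') \<mu>')" using assms by (auto simp: curve_set_def)
  have s: "vec2 (lam \<mu>') \<mu>' \<in> dom" "psi0 (vec2 (lam \<mu>') \<mu>') \<le> 1" using o(2) interior_domD by (auto simp: on_curve_def)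
  show "lam \<mu>' + curve_slope \<mu> * \<mu>' \<le> lam \<mu> + curve_slope \<mu> * \<mu>"
    unfolding curve_slope_def by (rule curve_support(1)[OF o(1) s])
  show "\<mu>' \<noteq> \<mu> \<Longrightarrow> lam \<mu>' + curve_slope \<mu> * \<mu>' < lam \<mu> + curve_slope \<mu> * \<mu>"
    unfolding curve_slope_def by (rule curve_support(2)[OF o(1) s]) simp
qed

lemma curve_slope_strict_mono:
  assumes "\<mu> \<in> curve_set" "\<mu>' \<in> curve_set" "\<mu> < \<mu>'"
  shows "curve_slope \<mu> < curve_slope \<mu>'"
proof -
  have "lam \<mu>' + curve_slope \<mu> * \<mu>' < lam \<mu> + curve_slope \<mu> * \<mu>" "lam \<mu> + curve_slope \<mu>' * \<mu> < lam \<mu>' + curve_slope \<mu>' * \<mu>'"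
    using curve_chord(2)[OF assms(1,2)] curve_chord(2)[OF assms(2,1)] assms(3) by auto
  then have "(curve_slope \<mu>' - curve_slope \<mu>) * (\<mu>' - \<mu>) > 0" by (simp add: algebra_simps)
  then show ?thesis using assms(3) by (simp add: zero_less_mult_iff)
qed

text \<open>The chord inequalities at both ends squeeze the difference quotient between the slopes
  at \<mu> and at y, so the derivative follows from continuity of the slope.\<close>

lemma A1_has_derivative:
  assumes m: "\<mu> \<in> curve_set"
  shows "((\<lambda>\<mu>. real_of_ereal (A1 M \<xi> \<mu>)) has_field_derivative curve_slope \<mu>) (at \<mu>)"
  unfolding has_field_derivative_iff
proof -
  let ?f = "\<lambda>\<mu>. real_of_ereal (A1 M \<xi> \<mu>)"
  have "((\<lambda>y. (?f y - ?f \<mu>) / (y - \<mu>) - curve_slope \<mu>) \<longlongrightarrow> 0) (at \<mu>)"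
  proof (rule Lim_null_comparison)
    have "((\<lambda>y. \<bar>curve_slope y - curve_slope \<mu>\<bar>) \<longlongrightarrow> \<bar>curve_slope \<mu> - curve_slope \<mu>\<bar>) (at \<mu>)"
      using curve_slope_isCont[OF m] unfolding isCont_def by (intro tendsto_intros)
    then show "((\<lambda>y. \<bar>curve_slope y - curve_slope \<mu>\<bar>) \<longlongrightarrow> 0) (at \<mu>)" by simp
    have "eventually (\<lambda>y. y \<in> curve_set \<and> y \<noteq> \<mu>) (at \<mu>)"
      using eventually_at_in_open[OF open_curve_set m] by eventually_elim auto
    then show "\<forall>\<^sub>F y in at \<mu>. norm ((?f y - ?f \<mu>) / (y - \<mu>) - curve_slope \<mu>) \<le> \<bar>curve_slope y - curve_slope \<mu>\<bar>"
    proof eventually_elim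
      case (elim y)
      have fy: "?f y = - lam y" "?f \<mu> = - lam \<mu>" using A1_curve elim m by auto
      have c: "lam y + curve_slope \<mu> * y \<le> lam \<mu> + curve_slope \<mu> * \<mu>" "lam \<mu> + curve_slope y * \<mu> \<le> lam y + curve_slope y * y"
        using curve_chord(1)[OF m, of y] curve_chord(1)[OF _ m, of y] elim by auto
      have "\<bar>(?f y - ?f \<mu>) - curve_slope \<mu> * (y - \<mu>)\<bar> \<le> \<bar>(curve_slope y - curve_slope \<mu>) * (y - \<mu>)\<bar>"
        unfolding fy using c by (simp add: algebra_simps abs_le_iff)
      then have "\<bar>(?f y - ?f \<mu>) - curve_slope \<mu> * (y - \<mu>)\<bar> / \<bar>y - \<mu>\<bar> \<le> \<bar>(curve_slope y - curve_slope \<mu>) * (y - \<mu>)\<bar> / \<bar>y - \<mu>\<bar>"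
        by (rule divide_right_mono) simp
      also have "\<dots> = \<bar>curve_slope y - curve_slope \<mu>\<bar>" using elim by (simp add: abs_mult)
      also have "\<bar>(?f y - ?f \<mu>) - curve_slope \<mu> * (y - \<mu>)\<bar> / \<bar>y - \<mu>\<bar> = \<bar>(?f y - ?f \<mu>) / (y - \<mu>) - curve_slope \<mu>\<bar>"
        using elim by (simp add: abs_divide[symmetric] diff_divide_distrib)
      finally show ?case by simp
    qed
  qed
  then show "((\<lambda>y. (?f y - ?f \<mu>) / (y - \<mu>)) \<longlongrightarrow> curve_slope \<mu>) (at \<mu>)" by (simp add: LIM_zero_iff)
qed

lemma A1_deriv_eq: "\<mu> \<in> curve_set \<Longrightarrow> A1_deriv M \<xi> \<mu> = curve_slope \<mu>"
  unfolding A1_deriv_def using A1_has_derivative by (rule DERIV_imp_deriv)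

lemma J_between: "a \<in> J \<Longrightarrow> b \<in> J \<Longrightarrow> a \<le> x \<Longrightarrow> x \<le> b \<Longrightarrow> x \<in> J"
  using J_props(2) unfolding is_interval_1 by blast

lemma J_beyond:
  assumes "a \<in> J"
  obtains b c where "b \<in> J" "c \<in> J" "b < a" "a < c"
proof -
  obtain e where e: "e > 0" "\<And>y. dist y a < e \<Longrightarrow> y \<in> J" using J_props(1) assms unfolding open_dist by blast
  show ?thesis by (rule that[of "a - e / 2" "a + e / 2"]) (use e in \<open>auto simp: dist_real_def\<close>)
qed

text \<open>A' is increasing, so its limit at the right end is a supremum. The end point is an
  extended real, and the limit there is unique because \<open>mu_plus\<close> can be approached from
  the left.\<close>

lemma alpha_plus_eq: "alpha_plus M \<xi> = (SUP \<mu>\<in>J. ereal (curve_slope \<mu>))"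
proof -
  let ?f = "\<lambda>m. ereal (A1_deriv M \<xi> (real_of_ereal m))"
  have less: "ereal a < mu_plus M \<xi>" if aJ: "a \<in> J" for a
  proof -
    obtain b c where "c \<in> J" "a < c" by (rule J_beyond[OF aJ])
    then show ?thesis unfolding mu_plus_def less_SUP_iff by (intro bexI[of _ c]) simp_all
  qed
  have inJ: "\<exists>r. m = ereal r \<and> r \<in> J" if m: "ereal a < m" "m < mu_plus M \<xi>" "a \<in> J" for a m
  proof -
    obtain b where b: "b \<in> J" "m < ereal b" using m(2) unfolding mu_plus_def less_SUP_iff by blast
    show ?thesis
    proof (cases m)
      case (real r)
      then show ?thesis using m b J_between[of a b r] by simp
    qed (use m b in simp_all)
  qed
  have ev: "eventually P (at_left (mu_plus M \<xi>))" if aJ: "a \<in> J" and P: "\<And>r. r \<in> J \<Longrightarrow> a < r \<Longrightarrow> P (ereal r)" for P a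
    unfolding eventually_at_left[OF less[OF aJ]]
  proof (intro exI[of _ "ereal a"] conjI allI impI less aJ)
    fix m assume m: "ereal a < m" "m < mu_plus M \<xi>"
    then obtain r where "m = ereal r" "r \<in> J" using inJ aJ by blast
    then show "P m" using P[of r] m(1) by simp
  qed
  have "(?f \<longlongrightarrow> (SUP \<mu>\<in>J. ereal (curve_slope \<mu>))) (at_left (mu_plus M \<xi>))"
  proof (rule increasing_tendsto)
    show "\<forall>\<^sub>F m in at_left (mu_plus M \<xi>). ?f m \<le> (SUP \<mu>\<in>J. ereal (curve_slope \<mu>))"
    proof (rule ev[OF J_props(3)])
      fix r assume r: "r \<in> J"
      then have "A1_deriv M \<xi> r = curve_slope r" using J_props(4) A1_deriv_eq by blast
      then show "?f (ereal r) \<le> (SUP \<mu>\<in>J. ereal (curve_slope \<mu>))" using SUP_upper[OF r, of "\<lambda>\<mu>. ereal (curve_slope \<mu>)"] by simp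
    qed
    fix x assume "x < (SUP \<mu>\<in>J. ereal (curve_slope \<mu>))"
    then obtain a where a: "a \<in> J" "x < ereal (curve_slope a)" unfolding less_SUP_iff by blast
    show "\<forall>\<^sub>F m in at_left (mu_plus M \<xi>). x < ?f m"
    proof (rule ev[OF a(1)])
      fix r assume r: "r \<in> J" "a < r"
      have "curve_slope a < curve_slope r" using curve_slope_strict_mono J_props(4) a r by blast
      then have "x < ereal (curve_slope r)" using a(2) by (auto intro: less_trans)
      moreover have "A1_deriv M \<xi> r = curve_slope r" using r J_props(4) A1_deriv_eq by blast
      ultimately show "x < ?f (ereal r)" by simp
    qed
  qed
  moreover have "at_left (mu_plus M \<xi>) \<noteq> bot"
  proof
    assume "at_left (mu_plus M \<xi>) = bot"
    then have "eventually (\<lambda>_. False) (at_left (mu_plus M \<xi>))" by simp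
    then obtain b where "b < mu_plus M \<xi>" "\<forall>y>b. y < mu_plus M \<xi> \<longrightarrow> False"
      unfolding eventually_at_left[OF less[OF J_props(3)]] by blast
    then show False using dense by blast
  qed
  ultimately show ?thesis unfolding alpha_plus_def by (intro tendsto_Lim)
qed

lemma alpha_minus_eq: "alpha_minus M \<xi> = (INF \<mu>\<in>J. ereal (curve_slope \<mu>))"
proof -
  let ?f = "\<lambda>m. ereal (A1_deriv M \<xi> (real_of_ereal m))"
  have less: "mu_minus M \<xi> < ereal a" if aJ: "a \<in> J" for a
  proof -
    obtain b c where "b \<in> J" "b < a" by (rule J_beyond[OF aJ])
    then show ?thesis unfolding mu_minus_def INF_less_iff by (intro bexI[of _ b]) simp_all
  qed
  have inJ: "\<exists>r. m = ereal r \<and> r \<in> J" if m: "m < ereal a" "mu_minus M \<xi> < m" "a \<in> J" for a m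
  proof -
    obtain b where b: "b \<in> J" "ereal b < m" using m(2) unfolding mu_minus_def INF_less_iff by blast
    show ?thesis
    proof (cases m)
      case (real r)
      then show ?thesis using m b J_between[of b a r] by simp
    qed (use m b in simp_all)
  qed
  have ev: "eventually P (at_right (mu_minus M \<xi>))" if aJ: "a \<in> J" and P: "\<And>r. r \<in> J \<Longrightarrow> r < a \<Longrightarrow> P (ereal r)" for P a
    unfolding eventually_at_right[OF less[OF aJ]]
  proof (intro exI[of _ "ereal a"] conjI allI impI less aJ)
    fix m assume m: "mu_minus M \<xi> < m" "m < ereal a"
    then obtain r where "m = ereal r" "r \<in> J" using inJ aJ by blast
    then show "P m" using P[of r] m(2) by simp
  qed
  have "(?f \<longlongrightarrow> (INF \<mu>\<in>J. ereal (curve_slope \<mu>))) (at_right (mu_minus M \<xi>))"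
  proof (rule decreasing_tendsto)
    show "\<forall>\<^sub>F m in at_right (mu_minus M \<xi>). (INF \<mu>\<in>J. ereal (curve_slope \<mu>)) \<le> ?f m"
    proof (rule ev[OF J_props(3)])
      fix r assume r: "r \<in> J"
      then have "A1_deriv M \<xi> r = curve_slope r" using J_props(4) A1_deriv_eq by blast
      then show "(INF \<mu>\<in>J. ereal (curve_slope \<mu>)) \<le> ?f (ereal r)" using INF_lower[OF r, of "\<lambda>\<mu>. ereal (curve_slope \<mu>)"] by simp
    qed
    fix x assume "(INF \<mu>\<in>J. ereal (curve_slope \<mu>)) < x"
    then obtain a where a: "a \<in> J" "ereal (curve_slope a) < x" unfolding INF_less_iff by blast
    show "\<forall>\<^sub>F m in at_right (mu_minus M \<xi>). ?f m < x"
    proof (rule ev[OF a(1)])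
      fix r assume r: "r \<in> J" "r < a"
      have "curve_slope r < curve_slope a" using curve_slope_strict_mono J_props(4) a r by blast
      then have "ereal (curve_slope r) < x" using a(2) less_trans[of "ereal (curve_slope r)" "ereal (curve_slope a)" x] by simp
      moreover have "A1_deriv M \<xi> r = curve_slope r" using r J_props(4) A1_deriv_eq by blast
      ultimately show "?f (ereal r) < x" by simp
    qed
  qed
  moreover have "at_right (mu_minus M \<xi>) \<noteq> bot"
  proof
    assume "at_right (mu_minus M \<xi>) = bot"
    then have "eventually (\<lambda>_. False) (at_right (mu_minus M \<xi>))" by simp
    then obtain b where "b > mu_minus M \<xi>" "\<forall>y>mu_minus M \<xi>. y < b \<longrightarrow> False"
      unfolding eventually_at_right[OF less[OF J_props(3)]] by blast
    then show False using dense by blast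
  qed
  ultimately show ?thesis unfolding alpha_minus_def by (intro tendsto_Lim)
qed

lemma slope_solution:
  assumes "alpha_minus M \<xi> < ereal \<alpha>" "ereal \<alpha> < alpha_plus M \<xi>"
  shows "mu_of M \<xi> \<alpha> \<in> J" "curve_slope (mu_of M \<xi> \<alpha>) = \<alpha>" "lambda_of M \<xi> \<alpha> = lam (mu_of M \<xi> \<alpha>)"
proof -
  obtain a where a: "a \<in> J" "curve_slope a < \<alpha>" using assms(1) unfolding alpha_minus_eq INF_less_iff by auto
  obtain b where b: "b \<in> J" "\<alpha> < curve_slope b" using assms(2) unfolding alpha_plus_eq less_SUP_iff by auto
  have cs: "x \<in> curve_set" if "x \<in> J" for x using that J_props(4) by blast
  have ab: "a \<le> b" using curve_slope_strict_mono[of b a] cs a b by force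
  have "\<exists>x\<ge>a. x \<le> b \<and> curve_slope x = \<alpha>"
    by (rule IVT) (use a b ab cs J_between[OF a(1) b(1)] curve_slope_isCont in auto)
  then obtain \<mu> where m: "\<mu> \<in> J" "curve_slope \<mu> = \<alpha>" using J_between[OF a(1) b(1)] by blast
  have "mu_of M \<xi> \<alpha> = \<mu>" unfolding mu_of_def
  proof (rule the_equality)
    show "\<mu> \<in> J \<and> A1_deriv M \<xi> \<mu> = \<alpha>" using m cs by (simp add: A1_deriv_eq)
    fix x assume "x \<in> J \<and> A1_deriv M \<xi> x = \<alpha>"
    then have x: "x \<in> curve_set" "curve_slope x = curve_slope \<mu>" using cs m by (auto simp: A1_deriv_eq)
    show "x = \<mu>" using curve_slope_strict_mono[of x \<mu>] curve_slope_strict_mono[of \<mu> x] x cs[OF m(1)] by (metis less_irrefl linorder_less_linear)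
  qed
  then show "mu_of M \<xi> \<alpha> \<in> J" "curve_slope (mu_of M \<xi> \<alpha>) = \<alpha>" "lambda_of M \<xi> \<alpha> = lam (mu_of M \<xi> \<alpha>)"
    using m cs by (auto simp: lambda_of_def A1_curve)
qed

definition curve_point :: "real \<Rightarrow> real^2" where "curve_point \<alpha> = vec2 (lambda_of M \<xi> \<alpha>) (mu_of M \<xi> \<alpha>)"

lemma regular_rangeD:
  assumes "\<alpha> \<in> regular_range M \<xi>"
  shows "mu_of M \<xi> \<alpha> \<in> J" "curve_slope (mu_of M \<xi> \<alpha>) = \<alpha>" "lambda_of M \<xi> \<alpha> = lam (mu_of M \<xi> \<alpha>)"
    "on_curve (curve_point \<alpha>)" "slope (curve_point \<alpha>) = \<alpha>" "ereal (lambda_of M \<xi> \<alpha>) < lambda_plus M \<xi>"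
proof -
  show *: "mu_of M \<xi> \<alpha> \<in> J" "curve_slope (mu_of M \<xi> \<alpha>) = \<alpha>" "lambda_of M \<xi> \<alpha> = lam (mu_of M \<xi> \<alpha>)"
    using slope_solution[of \<alpha>] assms by (auto simp: regular_range_def)
  show "on_curve (curve_point \<alpha>)" using * J_props(4) by (auto simp: curve_point_def curve_set_def)
  show "slope (curve_point \<alpha>) = \<alpha>" using * by (simp add: curve_point_def curve_slope_def)
  show "ereal (lambda_of M \<xi> \<alpha>) < lambda_plus M \<xi>" using assms by (simp add: regular_range_def)
qed

text \<open>\<open>mu_of\<close> inverts a strictly increasing function, so its values are confined
  on either side of the limit by comparing slopes.\<close>

lemma curve_point_tendsto:
  assumes a: "\<And>j. a j \<in> regular_range M \<xi>" "\<alpha> \<in> regular_range M \<xi>" and lim: "a \<longlonglongrightarrow> \<alpha>"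
  shows "(\<lambda>j. curve_point (a j)) \<longlonglongrightarrow> curve_point \<alpha>"
proof -
  have cs: "x \<in> curve_set" if "x \<in> J" for x using that J_props(4) by blast
  note A = regular_rangeD[OF a(2)] and Aj = regular_rangeD[OF a(1)]
  have mu: "(\<lambda>j. mu_of M \<xi> (a j)) \<longlonglongrightarrow> mu_of M \<xi> \<alpha>"
  proof (rule order_tendstoI)
    fix x assume x: "x < mu_of M \<xi> \<alpha>"
    obtain b where b: "b \<in> J" "b < mu_of M \<xi> \<alpha>" by (rule J_beyond[OF A(1)])
    \<comment> \<open>\<open>x\<close> may lie outside \<open>J\<close>, where the slope carries no
      information; \<open>max b x\<close> lies in \<open>J\<close>, is at least x and still below
      the limit.\<close>
    have y: "max b x \<in> J" "max b x < mu_of M \<xi> \<alpha>" using J_between[OF b(1) A(1), of "max b x"] b x by auto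
    have "curve_slope (max b x) < \<alpha>" using curve_slope_strict_mono[OF cs cs, OF y(1) A(1) y(2)] A(2) by simp
    then have "eventually (\<lambda>j. curve_slope (max b x) < a j) sequentially" by (rule order_tendstoD(1)[OF lim])
    then show "\<forall>\<^sub>F j in sequentially. x < mu_of M \<xi> (a j)"
    proof eventually_elim
      case (elim j)
      have "\<not> mu_of M \<xi> (a j) \<le> max b x"
        using curve_slope_strict_mono[OF cs cs, OF Aj(1)[of j] y(1)] elim Aj(2)[of j] by (auto simp: le_less)
      then show ?case by simp
    qed
  next
    fix x assume x: "x > mu_of M \<xi> \<alpha>"
    obtain b where b: "b \<in> J" "b > mu_of M \<xi> \<alpha>" by (rule J_beyond[OF A(1)])
    have y: "min b x \<in> J" "min b x > mu_of M \<xi> \<alpha>" using J_between[OF A(1) b(1), of "min b x"] b x by auto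
    have "curve_slope (min b x) > \<alpha>" using curve_slope_strict_mono[OF cs cs, OF A(1) y(1) y(2)] A(2) by simp
    then have "eventually (\<lambda>j. a j < curve_slope (min b x)) sequentially" by (rule order_tendstoD(2)[OF lim])
    then show "\<forall>\<^sub>F j in sequentially. mu_of M \<xi> (a j) < x"
    proof eventually_elim
      case (elim j)
      have "\<not> min b x \<le> mu_of M \<xi> (a j)"
        using curve_slope_strict_mono[OF cs cs, OF y(1) Aj(1)[of j]] elim Aj(2)[of j] by (auto simp: le_less)
      then show ?case by simp
    qed
  qed
  have "(\<lambda>j. lam (mu_of M \<xi> (a j))) \<longlonglongrightarrow> lam (mu_of M \<xi> \<alpha>)"
    by (rule isCont_tendsto_compose[OF lam_isCont[OF cs[OF A(1)]] mu])
  then show ?thesis unfolding curve_point_def Aj(3) A(3) by (intro tendsto_vec2 mu)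
qed

section \<open>The Legendre transform of \<open>A(\<mu>)\<close>\<close>

lemma monotone_ereal_limit:
  fixes h :: "'b \<Rightarrow> real"
  assumes "eventually (\<lambda>x. x \<in> N) F" "\<And>y. y \<in> N \<Longrightarrow> eventually (\<lambda>x. h y \<le> h x) F"
  shows "((\<lambda>x. ereal (h x)) \<longlongrightarrow> (SUP x\<in>N. ereal (h x))) F"
proof (rule increasing_tendsto)
  show "\<forall>\<^sub>F x in F. ereal (h x) \<le> (SUP x\<in>N. ereal (h x))"
    using assms(1) by eventually_elim (rule SUP_upper)
  fix z assume "z < (SUP x\<in>N. ereal (h x))"
  then obtain y where y: "y \<in> N" "z < ereal (h y)" unfolding less_SUP_iff by blast
  show "\<forall>\<^sub>F x in F. z < ereal (h x)"
    using assms(2)[OF y(1)] by eventually_elim (use y(2) in \<open>auto intro: less_le_trans\<close>)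
qed

lemma Sup_sublevel_support:
  assumes "on_curve (vec2 l \<mu>)" "in_range \<nu>"
  shows "Sup (sublevel \<nu>) + slope (vec2 l \<mu>) * \<nu> \<le> l + slope (vec2 l \<mu>) * \<mu>"
proof -
  have "Sup (sublevel \<nu>) \<le> l + slope (vec2 l \<mu>) * \<mu> - slope (vec2 l \<mu>) * \<nu>"
  proof (rule cSup_least[OF sublevel_nonempty[OF in_range_section[OF assms(2)]]])
    fix k assume "k \<in> sublevel \<nu>"
    then show "k \<le> l + slope (vec2 l \<mu>) * \<mu> - slope (vec2 l \<mu>) * \<nu>"
      using curve_support(1)[OF assms(1), of k \<nu>] by (simp add: sublevel_def)
  qed
  then show ?thesis by simp
qed

text \<open>As a function of \<nu>, \<open>Sup (sublevel \<nu>)\<close> plus the linear term is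
  concave with its maximum at \<mu>, hence does not increase when \<nu> moves away from \<mu>;
  \<nu>1 is the nearer point.\<close>

lemma Sup_sublevel_mono:
  assumes c: "on_curve (vec2 l \<mu>)" and r: "in_range \<nu>2" and t: "0 \<le> t" "t \<le> 1"
    and \<nu>1: "\<nu>1 = (1 - t) * \<mu> + t * \<nu>2"
  shows "Sup (sublevel \<nu>2) + slope (vec2 l \<mu>) * \<nu>2 \<le> Sup (sublevel \<nu>1) + slope (vec2 l \<mu>) * \<nu>1"
proof -
  define s where "s = slope (vec2 l \<mu>)"
  have "Sup (sublevel \<nu>2) \<le> Sup (sublevel \<nu>1) + s * \<nu>1 - s * \<nu>2"
  proof (rule cSup_least[OF sublevel_nonempty[OF in_range_section[OF r]]])
    fix k assume k: "k \<in> sublevel \<nu>2"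
    then have kd: "vec2 k \<nu>2 \<in> dom" "psi0 (vec2 k \<nu>2) \<le> 1" by (auto simp: sublevel_def)
    have ld: "vec2 l \<mu> \<in> dom" "psi0 (vec2 l \<mu>) = 1" using c interior_domD by (auto simp: on_curve_def)
    have eq: "(1 - t) *\<^sub>R vec2 l \<mu> + t *\<^sub>R vec2 k \<nu>2 = vec2 ((1 - t) * l + t * k) \<nu>1"
      by (simp add: vec2_scaleR vec2_add \<nu>1)
    have "psi0 (vec2 ((1 - t) * l + t * k) \<nu>1) \<le> (1 - t) * 1 + t * psi0 (vec2 k \<nu>2)"
      using dom_convex(2)[OF ld(1) kd(1) t] ld(2) by (simp add: eq)
    also have "\<dots> \<le> (1 - t) * 1 + t * 1" using kd t by (intro add_left_mono mult_left_mono) auto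
    finally have "(1 - t) * l + t * k \<in> sublevel \<nu>1"
      using dom_convex(1)[OF ld(1) kd(1) t] by (simp add: eq sublevel_def)
    then have 1: "(1 - t) * l + t * k \<le> Sup (sublevel \<nu>1)" by (rule cSup_upper[OF _ sublevel_bdd])
    have "k + s * \<nu>2 \<le> l + s * \<mu>" unfolding s_def by (rule curve_support(1)[OF c kd])
    then have "(1 - t) * (k + s * \<nu>2) \<le> (1 - t) * (l + s * \<mu>)" using t by (intro mult_left_mono) auto
    moreover have "(1 - t) * (l + s * \<mu>) + t * (k + s * \<nu>2) = ((1 - t) * l + t * k) + s * \<nu>1"
      by (simp add: \<nu>1 algebra_simps)
    ultimately have "k + s * \<nu>2 \<le> ((1 - t) * l + t * k) + s * \<nu>1" by (simp add: algebra_simps)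
    then show "k \<le> Sup (sublevel \<nu>1) + s * \<nu>1 - s * \<nu>2" using 1 by simp
  qed
  then show ?thesis by (simp add: s_def)
qed

text \<open>\<open>Lim\<close> has the intended value only when the limit exists. Subtracting the
  supporting line leaves a function \<open>h\<close> that is nondecreasing towards the end point, so
  the limit exists, possibly infinite, and inherits the lower bound. A general filter serves both
  ends.\<close>

lemma Lim_A1_inner_ge:
  fixes F :: "real filter"
  assumes c: "on_curve (vec2 l \<mu>)" and F: "F \<noteq> bot" "F \<le> nhds b"
    and N: "eventually (\<lambda>x. x \<in> N) F" "\<And>x. x \<in> N \<Longrightarrow> in_range x"
    and betw: "\<And>y. y \<in> N \<Longrightarrow> eventually (\<lambda>x. \<exists>t. 0 \<le> t \<and> t \<le> 1 \<and> y = (1 - t) * \<mu> + t * x) F"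
  shows "Lim F (A1_inner M \<xi>) \<ge> ereal (- l + slope (vec2 l \<mu>) * (b - \<mu>))"
proof -
  define s where "s = slope (vec2 l \<mu>)"
  define h where "h x = - (Sup (sublevel x) + s * x)" for x
  have A: "A1_inner M \<xi> x = ereal (h x) + ereal (s * x)" if "x \<in> N" for x
    using A1_inner_Sup[OF sublevel_nonempty[OF in_range_section[OF N(2)[OF that]]]] by (simp add: h_def)
  have hl: "((\<lambda>x. ereal (h x)) \<longlongrightarrow> (SUP x\<in>N. ereal (h x))) F"
  proof (rule monotone_ereal_limit[OF N(1)])
    fix y assume y: "y \<in> N"
    show "eventually (\<lambda>x. h y \<le> h x) F"
      using betw[OF y] N(1)
    proof eventually_elim
      case (elim x)
      then obtain t where "0 \<le> t" "t \<le> 1" "y = (1 - t) * \<mu> + t * x" by blast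
      then show ?case using Sup_sublevel_mono[OF c N(2)[OF elim(2)], of t y] by (simp add: h_def s_def)
    qed
  qed
  have sl: "((\<lambda>x. s * x) \<longlongrightarrow> s * b) F" using F(2) by (intro tendsto_intros) (simp add: filterlim_def)
  define S where "S = (SUP x\<in>N. ereal (h x))"
  have Sl: "S \<ge> ereal (- l - s * \<mu>)"
  proof -
    obtain x where x: "x \<in> N" using eventually_happens'[OF F(1) N(1)] by blast
    have "ereal (- l - s * \<mu>) \<le> ereal (h x)" using Sup_sublevel_support[OF c N(2)[OF x]] by (simp add: h_def s_def)
    also have "\<dots> \<le> S" unfolding S_def using x by (rule SUP_upper)
    finally show ?thesis .
  qed
  have "((\<lambda>x. ereal (h x) + ereal (s * x)) \<longlongrightarrow> S + ereal (s * b)) F"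
    by (rule tendsto_add_ereal_general) (use hl sl Sl in \<open>auto simp: S_def\<close>)
  then have "(A1_inner M \<xi> \<longlongrightarrow> S + ereal (s * b)) F"
    by (rule Lim_transform_eventually) (use N(1) in \<open>eventually_elim, simp add: A\<close>)
  then have "Lim F (A1_inner M \<xi>) = S + ereal (s * b)" by (rule tendsto_Lim[OF F(1)])
  moreover have "ereal (- l + s * (b - \<mu>)) \<le> S + ereal (s * b)"
    using add_right_mono[OF Sl, of "ereal (s * b)"] by (simp add: algebra_simps)
  ultimately show ?thesis by (simp add: s_def)
qed

text \<open>The supremum defining D runs over all real \<mu>, so the supporting line must be
  compared with A also at the end points, where A is a limit, and beyond them, where it is
  infinite.\<close>

lemma A1_support:
  assumes c: "on_curve (vec2 l \<mu>)"
  shows "A1 M \<xi> \<nu> \<ge> ereal (- l + slope (vec2 l \<mu>) * (\<nu> - \<mu>))"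
proof -
  have rm: "in_range \<mu>" by (rule on_curve_in_range(1)[OF c])
  consider "in_range \<nu>" | "\<not> in_range \<nu>" "ereal \<nu> = mu_sup M \<xi>"
    | "\<not> in_range \<nu>" "ereal \<nu> \<noteq> mu_sup M \<xi>" "ereal \<nu> = mu_inf M \<xi>"
    | "\<not> in_range \<nu>" "ereal \<nu> \<noteq> mu_sup M \<xi>" "ereal \<nu> \<noteq> mu_inf M \<xi>" by blast
  then show ?thesis
  proof cases
    case 1
    then show ?thesis using Sup_sublevel_support[OF c 1] by (simp add: A1_in_range algebra_simps)
  next
    case 2
    have mn: "\<mu> < \<nu>" using rm unfolding in_range_def 2(2)[symmetric] by simp
    have N: "in_range x" if "x \<in> {\<mu><..<\<nu>}" for x
      using rm that unfolding in_range_def 2(2)[symmetric] by (auto intro: less_trans)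
    have "Lim (at_left \<nu>) (A1_inner M \<xi>) \<ge> ereal (- l + slope (vec2 l \<mu>) * (\<nu> - \<mu>))"
    proof (rule Lim_A1_inner_ge[OF c _ _ _ N])
      show "at_left \<nu> \<le> nhds \<nu>" by (simp add: at_within_def)
      show "eventually (\<lambda>x. x \<in> {\<mu><..<\<nu>}) (at_left \<nu>)" by (rule eventually_at_leftI[OF _ mn]) auto
      fix y assume y: "y \<in> {\<mu><..<\<nu>}"
      show "eventually (\<lambda>x. \<exists>t. 0 \<le> t \<and> t \<le> 1 \<and> y = (1 - t) * \<mu> + t * x) (at_left \<nu>)"
      proof (rule eventually_at_leftI[of y])
        fix x assume x: "x \<in> {y<..<\<nu>}"
        have "0 \<le> (y - \<mu>) / (x - \<mu>)" "(y - \<mu>) / (x - \<mu>) \<le> 1" using x y by auto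
        moreover have "y = (1 - (y - \<mu>) / (x - \<mu>)) * \<mu> + (y - \<mu>) / (x - \<mu>) * x"
        proof -
          have eq: "(1 - t) * \<mu> + t * x = \<mu> + t * (x - \<mu>)" for t by (simp add: algebra_simps)
          show ?thesis unfolding eq using x y by simp
        qed
        ultimately show "\<exists>t. 0 \<le> t \<and> t \<le> 1 \<and> y = (1 - t) * \<mu> + t * x" by blast
      qed (use y in auto)
    qed simp_all
    then show ?thesis using 2 by (simp add: A1_def in_range_def)
  next
    case 3
    have mn: "\<nu> < \<mu>" using rm unfolding in_range_def 3(3)[symmetric] by simp
    have N: "in_range x" if "x \<in> {\<nu><..<\<mu>}" for x
      using rm that unfolding in_range_def 3(3)[symmetric] by (auto intro: less_trans[of "ereal x" "ereal \<mu>"])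
    have "Lim (at_right \<nu>) (A1_inner M \<xi>) \<ge> ereal (- l + slope (vec2 l \<mu>) * (\<nu> - \<mu>))"
    proof (rule Lim_A1_inner_ge[OF c _ _ _ N])
      show "at_right \<nu> \<le> nhds \<nu>" by (simp add: at_within_def)
      show "eventually (\<lambda>x. x \<in> {\<nu><..<\<mu>}) (at_right \<nu>)" by (rule eventually_at_rightI[OF _ mn]) auto
      fix y assume y: "y \<in> {\<nu><..<\<mu>}"
      show "eventually (\<lambda>x. \<exists>t. 0 \<le> t \<and> t \<le> 1 \<and> y = (1 - t) * \<mu> + t * x) (at_right \<nu>)"
      proof (rule eventually_at_rightI[of _ y])
        fix x assume x: "x \<in> {\<nu><..<y}"
        have "0 \<le> (\<mu> - y) / (\<mu> - x)" "(\<mu> - y) / (\<mu> - x) \<le> 1" using x y by auto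
        moreover have "y = (1 - (\<mu> - y) / (\<mu> - x)) * \<mu> + (\<mu> - y) / (\<mu> - x) * x"
        proof -
          have eq: "(1 - t) * \<mu> + t * x = \<mu> - t * (\<mu> - x)" for t by (simp add: algebra_simps)
          show ?thesis unfolding eq using x y by simp
        qed
        ultimately show "\<exists>t. 0 \<le> t \<and> t \<le> 1 \<and> y = (1 - t) * \<mu> + t * x" by blast
      qed (use y in auto)
    qed simp_all
    then show ?thesis using 3 by (simp add: A1_def in_range_def)
  next
    case 4
    then show ?thesis by (auto simp: A1_def in_range_def)
  qed
qed

text \<open>The supporting line of slope \<alpha> shows that the supremum is attained at
  \<open>mu_of M \<xi> \<alpha>\<close>.\<close>

lemma D_fun_eq:
  assumes "\<alpha> \<in> regular_range M \<xi>"
  shows "D_fun M \<xi> \<alpha> = ereal (lambda_of M \<xi> \<alpha> + \<alpha> * mu_of M \<xi> \<alpha>)"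
proof -
  note A = regular_rangeD[OF assms]
  define l \<mu> where "l = lambda_of M \<xi> \<alpha>" and "\<mu> = mu_of M \<xi> \<alpha>"
  have c: "on_curve (vec2 l \<mu>)" "slope (vec2 l \<mu>) = \<alpha>" using A(4,5) by (auto simp: curve_point_def l_def \<mu>_def)
  have A1m: "A1 M \<xi> \<mu> = ereal (- l)" using A1_curve[of \<mu>] A J_props(4) by (auto simp: l_def \<mu>_def)
  show ?thesis unfolding D_fun_def
  proof (rule SUP_eqI)
    fix \<nu>
    have "ereal (- l + \<alpha> * (\<nu> - \<mu>)) \<le> A1 M \<xi> \<nu>" using A1_support[OF c(1), of \<nu>] c(2) by simp
    then show "ereal (\<nu> * \<alpha>) - A1 M \<xi> \<nu> \<le> ereal (lambda_of M \<xi> \<alpha> + \<alpha> * mu_of M \<xi> \<alpha>)"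
      unfolding l_def[symmetric] \<mu>_def[symmetric] by (cases "A1 M \<xi> \<nu>") (auto simp: algebra_simps)
  next
    fix y assume "\<And>\<nu>. \<nu> \<in> UNIV \<Longrightarrow> ereal (\<nu> * \<alpha>) - A1 M \<xi> \<nu> \<le> y"
    from this[of \<mu>] show "ereal (lambda_of M \<xi> \<alpha> + \<alpha> * mu_of M \<xi> \<alpha>) \<le> y"
      unfolding A1m l_def[symmetric] \<mu>_def[symmetric] by (simp add: algebra_simps)
  qed
qed

end

section \<open>The Hessian of the deviation function\<close>

lemma gradient_eq:
  assumes "(f has_derivative (\<lambda>h. h \<bullet> D)) (at x)"
  shows "gradient f x = D"
  unfolding gradient_def gderiv_def
proof (rule the_equality)
  fix g assume "(f has_derivative (\<lambda>h. h \<bullet> g)) (at x)"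
  then have "(\<lambda>h. h \<bullet> g) = (\<lambda>h. h \<bullet> D)" using assms by (rule has_derivative_unique)
  then show "g = D" by (metis vector_eq_ldot)
qed (rule assms)

context arithmetic_compound_renewal begin

definition grad_A :: "real^2 \<Rightarrow> real^2" where "grad_A p = mean p /\<^sub>R psi0 p"

lemma psi0_has_derivative: "p \<in> interior dom \<Longrightarrow> (psi0 has_derivative (\<lambda>h. h \<bullet> mean p)) (at p)"
proof -
  assume p: "p \<in> interior dom"
  then obtain \<rho> where r: "\<rho> > 0" "exp_int M \<xi> p \<rho>" by (rule interior_dom_exp_int)
  have "(mom M \<xi> (\<lambda>_. 1::real) has_derivative (\<lambda>h. mom M \<xi> (\<lambda>\<omega>. (h \<bullet> \<xi> \<omega>) *\<^sub>R 1) p)) (at p)"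
    by (rule mom_deriv[OF xi_meas _ r(2), of _ 0 1]) (use r in auto)
  then show ?thesis unfolding psi0_def mean_inner[OF p] by (simp add: mom_def)
qed

lemma A2_has_derivative:
  assumes p: "p \<in> interior dom"
  shows "((\<lambda>w. real_of_ereal (A2 M \<xi> w)) has_derivative (\<lambda>h. h \<bullet> grad_A p)) (at p)"
proof -
  have "((\<lambda>w. ln (psi0 w)) has_derivative (\<lambda>h. h \<bullet> grad_A p)) (at p)"
    using psi0_pos_dom[OF interior_domD[OF p]]
    by (auto intro!: derivative_eq_intros psi0_has_derivative[OF p] simp: grad_A_def divide_inverse mult.commute)
  then show ?thesis
    by (rule has_derivative_transform_within_open[OF _ open_interior p]) (use interior_domD in \<open>simp add: A2_eq\<close>)
qed

text \<open>Jensen's inequality for the law tilted by p, whose mean is \<open>grad_A p\<close>. It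
  is obtained from 1 + t \<le> exp t at t = (q - p) \<xi> - c, with c the tilted mean of (q - p)
  \<xi>; nondegeneracy gives strictness.\<close>

lemma psi0_jensen:
  assumes p: "p \<in> interior dom" and q: "q \<in> dom"
  shows "psi0 q \<ge> exp ((q - p) \<bullet> grad_A p) * psi0 p" "q \<noteq> p \<Longrightarrow> psi0 q > exp ((q - p) \<bullet> grad_A p) * psi0 p"
proof -
  define c where "c = (q - p) \<bullet> grad_A p"
  have pp: "psi0 p > 0" using psi0_pos_dom[OF interior_domD[OF p]] .
  have cm: "(q - p) \<bullet> mean p = c * psi0 p" using pp by (simp add: c_def grad_A_def)
  define f where "f \<omega> = exp (q \<bullet> \<xi> \<omega>) - exp c * (exp (p \<bullet> \<xi> \<omega>) * (1 - c) + exp (p \<bullet> \<xi> \<omega>) * ((q - p) \<bullet> \<xi> \<omega>))" for \<omega>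
  have f_eq: "f \<omega> = exp c * exp (p \<bullet> \<xi> \<omega>) * (exp ((q - p) \<bullet> \<xi> \<omega> - c) - (1 + ((q - p) \<bullet> \<xi> \<omega> - c)))" for \<omega>
  proof -
    have e: "exp c * exp (p \<bullet> \<xi> \<omega>) * exp ((q - p) \<bullet> \<xi> \<omega> - c) = exp (q \<bullet> \<xi> \<omega>)"
      unfolding exp_add[symmetric] by (simp add: inner_diff_left)
    show ?thesis unfolding f_def right_diff_distrib[of "exp c * exp (p \<bullet> \<xi> \<omega>)"] e by (simp add: algebra_simps)
  qed
  have f0: "f \<omega> \<ge> 0" for \<omega>
    unfolding f_eq using exp_ge_add_one_self[of "(q - p) \<bullet> \<xi> \<omega> - c"] by (intro mult_nonneg_nonneg) auto
  have i: "integrable M f" unfolding f_def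
    using p q interior_domD[OF p] integrable_exp_inner[OF p] by (auto simp: dom_iff)
  have "(\<integral>\<omega>. f \<omega> \<partial>M) = psi0 q - exp c * (psi0 p * (1 - c) + (q - p) \<bullet> mean p)"
    unfolding f_def using p q interior_domD[OF p] integrable_exp_inner[OF p] mean_inner[OF p, of "q - p"]
    by (simp add: dom_iff psi0_def mom_def)
  also have "psi0 p * (1 - c) + (q - p) \<bullet> mean p = psi0 p" unfolding cm by (simp add: algebra_simps)
  finally have eq: "(\<integral>\<omega>. f \<omega> \<partial>M) = psi0 q - exp c * psi0 p" .
  have nn: "(\<integral>\<omega>. f \<omega> \<partial>M) \<ge> 0" by (intro Bochner_Integration.integral_nonneg f0)
  then show "psi0 q \<ge> exp ((q - p) \<bullet> grad_A p) * psi0 p" using eq by (simp add: c_def)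
  assume ne: "q \<noteq> p"
  have "(\<integral>\<omega>. f \<omega> \<partial>M) \<noteq> 0"
  proof
    assume "(\<integral>\<omega>. f \<omega> \<partial>M) = 0"
    then have "AE \<omega> in M. f \<omega> = 0" using integral_nonneg_eq_0_iff_AE[OF i] f0 by auto
    then have "AE \<omega> in M. (q - p) \<bullet> \<xi> \<omega> = c"
    proof eventually_elim
      case (elim \<omega>)
      then have "exp ((q - p) \<bullet> \<xi> \<omega> - c) = 1 + ((q - p) \<bullet> \<xi> \<omega> - c)" unfolding f_eq by simp
      then show ?case using exp_minus_greater[of "- ((q - p) \<bullet> \<xi> \<omega> - c)"] by auto
    qed
    then show False using aperiodic_nondegenerate[OF xi_meas char_less_1, of "q - p" c] ne by simp
  qed
  then show "psi0 q > exp ((q - p) \<bullet> grad_A p) * psi0 p" using eq nn by (simp add: c_def)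
qed

lemma A2_support:
  assumes p: "p \<in> interior dom" and q: "q \<in> dom"
  shows "ln (psi0 q) \<ge> ln (psi0 p) + (q - p) \<bullet> grad_A p" "q \<noteq> p \<Longrightarrow> ln (psi0 q) > ln (psi0 p) + (q - p) \<bullet> grad_A p"
proof -
  have pos: "psi0 p > 0" "psi0 q > 0" using psi0_pos_dom interior_domD p q by auto
  have e: "ln (exp ((q - p) \<bullet> grad_A p) * psi0 p) = ln (psi0 p) + (q - p) \<bullet> grad_A p" using pos by (simp add: ln_mult)
  show "ln (psi0 q) \<ge> ln (psi0 p) + (q - p) \<bullet> grad_A p"
    unfolding e[symmetric] using psi0_jensen(1)[OF p q] pos by (subst ln_le_cancel_iff) auto
  assume "q \<noteq> p"
  then show "ln (psi0 q) > ln (psi0 p) + (q - p) \<bullet> grad_A p"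
    unfolding e[symmetric] using psi0_jensen(2)[OF p q] pos by (subst ln_less_cancel_iff) auto
qed

text \<open>Strict convexity: the strict support inequalities at p and at q contradict each other
  when the gradients agree.\<close>

lemma grad_A_inj: "inj_on grad_A (interior dom)"
proof (rule inj_onI, rule ccontr)
  fix p q assume A: "p \<in> interior dom" "q \<in> interior dom" "grad_A p = grad_A q" "p \<noteq> q"
  have "ln (psi0 q) > ln (psi0 p) + (q - p) \<bullet> grad_A p" "ln (psi0 p) > ln (psi0 q) + (p - q) \<bullet> grad_A q"
    using A2_support(2)[OF A(1) interior_domD[OF A(2)]] A2_support(2)[OF A(2) interior_domD[OF A(1)]] A(4) by auto
  then show False unfolding A(3) by (simp add: inner_diff_left)
qed

lemma grad_A_isCont: "p \<in> interior dom \<Longrightarrow> isCont grad_A p"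
  unfolding grad_A_def[abs_def] using psi0_pos_dom[OF interior_domD]
  by (intro continuous_intros mean_isCont psi0_isCont) (auto simp: less_le)

definition grad_set :: "(real^2) set" where "grad_set = grad_A ` interior dom"

definition inv_grad :: "real^2 \<Rightarrow> real^2" where "inv_grad = inv_into (interior dom) grad_A"

lemma inv_grad: "p \<in> interior dom \<Longrightarrow> inv_grad (grad_A p) = p"
  unfolding inv_grad_def by (rule inv_into_f_f[OF grad_A_inj])

lemma inv_grad': "y \<in> grad_set \<Longrightarrow> inv_grad y \<in> interior dom \<and> grad_A (inv_grad y) = y"
  unfolding inv_grad_def grad_set_def by (auto intro: inv_into_into f_inv_into_f)

lemma grad_A_continuous_on: "continuous_on (interior dom) grad_A"
  by (intro continuous_at_imp_continuous_on ballI grad_A_isCont)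

text \<open>Invariance of domain gives openness from continuity and injectivity, before anything is
  known about the derivative of the inverse.\<close>

lemma open_grad_set: "open grad_set"
  unfolding grad_set_def by (rule invariance_of_domain[OF grad_A_continuous_on open_interior grad_A_inj])

lemma inv_grad_isCont: "y \<in> grad_set \<Longrightarrow> isCont inv_grad y"
proof -
  assume y: "y \<in> grad_set"
  have "continuous_on grad_set inv_grad"
    unfolding grad_set_def by (rule continuous_on_inverse_open[OF open_interior grad_A_continuous_on _ inv_grad]) simp
  then show ?thesis using y open_grad_set by (simp add: continuous_on_eq_continuous_at)
qed

lemma Lambda_grad:
  assumes p: "p \<in> interior dom"
  shows "Lambda M \<xi> (grad_A p) = ereal (p \<bullet> grad_A p - ln (psi0 p))"
  unfolding Lambda_def
proof (rule SUP_eqI)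
  fix w
  show "ereal (w $ 1 * grad_A p $ 1 + w $ 2 * grad_A p $ 2) - A2 M \<xi> w \<le> ereal (p \<bullet> grad_A p - ln (psi0 p))"
  proof (cases "w \<in> dom")
    case True
    then show ?thesis using A2_support(1)[OF p True] by (simp add: A2_eq inner_real2[symmetric] inner_diff_left)
  qed (simp add: A2_eq)
next
  fix y assume "\<And>w. w \<in> UNIV \<Longrightarrow> ereal (w $ 1 * grad_A p $ 1 + w $ 2 * grad_A p $ 2) - A2 M \<xi> w \<le> y"
  from this[of p] show "ereal (p \<bullet> grad_A p - ln (psi0 p)) \<le> y"
    using interior_domD[OF p] by (simp add: A2_eq inner_real2[symmetric])
qed

text \<open>The support inequalities at \<open>inv_grad y\<close> and \<open>inv_grad z\<close>
  enclose the remainder, which is at most |z - y| times the change of \<open>inv_grad\<close>; so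
  continuity of \<open>inv_grad\<close> suffices.\<close>

lemma Lambda_has_derivative:
  assumes y: "y \<in> grad_set"
  shows "((\<lambda>y. real_of_ereal (Lambda M \<xi> y)) has_derivative (\<lambda>h. h \<bullet> inv_grad y)) (at y)"
proof -
  let ?L = "\<lambda>y. real_of_ereal (Lambda M \<xi> y)"
  have L: "?L z = inv_grad z \<bullet> z - ln (psi0 (inv_grad z))" if "z \<in> grad_set" for z
    using Lambda_grad[of "inv_grad z"] inv_grad'[OF that] by simp
  obtain e where e: "e > 0" "ball y e \<subseteq> grad_set" using open_grad_set y openE by blast
  show ?thesis
  proof (rule has_derivativeI_sandwich[OF e(1)])
    show "bounded_linear (\<lambda>h. h \<bullet> inv_grad y)" by (rule bounded_linear_inner_left)
    fix z assume z: "z \<noteq> y" "dist z y < e"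
    then have zg: "z \<in> grad_set" using e by (auto simp: dist_commute)
    define p q where "p = inv_grad y" and "q = inv_grad z"
    have pq: "p \<in> interior dom" "grad_A p = y" "q \<in> interior dom" "grad_A q = z"
      using inv_grad'[OF y] inv_grad'[OF zg] by (auto simp: p_def q_def)
    have 1: "ln (psi0 q) \<ge> ln (psi0 p) + (q - p) \<bullet> y" using A2_support(1)[OF pq(1) interior_domD[OF pq(3)]] pq by simp
    have 2: "ln (psi0 p) \<ge> ln (psi0 q) + (p - q) \<bullet> z" using A2_support(1)[OF pq(3) interior_domD[OF pq(1)]] pq by simp
    have eq: "(?L z - ?L y) - (z - y) \<bullet> p = (q - p) \<bullet> z - ln (psi0 q) + ln (psi0 p)"
      unfolding L[OF zg] L[OF y] p_def[symmetric] q_def[symmetric]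
      by (simp add: inner_diff_left inner_diff_right inner_commute)
    have "\<bar>(?L z - ?L y) - (z - y) \<bullet> p\<bar> \<le> \<bar>(q - p) \<bullet> (z - y)\<bar>"
      unfolding eq using 1 2 by (simp add: inner_diff_left inner_diff_right)
    also have "\<dots> \<le> norm (q - p) * norm (z - y)" by (rule Cauchy_Schwarz_ineq2)
    finally show "norm (?L z - ?L y - (z - y) \<bullet> inv_grad y) / norm (z - y) \<le> norm (inv_grad z - inv_grad y)"
      using z by (simp add: pos_divide_le_eq p_def q_def)
  next
    have "((\<lambda>z. norm (inv_grad z - inv_grad y)) \<longlongrightarrow> norm (inv_grad y - inv_grad y)) (at y)"
      using inv_grad_isCont[OF y] unfolding isCont_def by (intro tendsto_intros)
    then show "((\<lambda>z. norm (inv_grad z - inv_grad y)) \<longlongrightarrow> 0) (at y)" by simp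
  qed
qed

lemma tilted_at:
  assumes "p \<in> interior dom" "p \<in> interior (psi_dom M (X 1))"
  shows "\<exists>\<rho>. tilted_renewal M \<xi> X p \<rho>"
proof -
  have X1: "X 1 \<in> borel_measurable M" by (rule X_measurable) simp
  obtain r1 where r1: "r1 > 0" "exp_int M \<xi> p r1" using interior_dom_exp_int[OF assms(1)] by blast
  obtain r2 where r2: "r2 > 0" "exp_int M (X 1) p r2"
    using exp_int_interior[OF X1, of p] assms(2) unfolding psi_dom_eq[OF X1] by blast
  have "tilted_renewal M \<xi> X p (min r1 r2)"
  proof (intro tilted_renewal.intro tilted_renewal_axioms.intro)
    show "arithmetic_compound_renewal M \<xi> X" by unfold_locales
    show "exp_int M \<xi> p (min r1 r2)" by (rule exp_int_mono[OF xi_meas r1(2)]) simp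
    show "exp_int M (X 1) p (min r1 r2)" by (rule exp_int_mono[OF X1 r2(2)]) simp
  qed (use r1 r2 in simp)
  then show ?thesis by blast
qed

definition cov_mat :: "real^2 \<Rightarrow> real^2^2" where "cov_mat p = (\<chi> i k. cov p i k)"

definition cov_inv :: "real^2 \<Rightarrow> real^2^2" where
  "cov_inv p = vector [vec2 (cov p 2 2 / cov_det p) (- cov p 1 2 / cov_det p), vec2 (- cov p 1 2 / cov_det p) (cov p 1 1 / cov_det p)]"

lemma cov_sym: "cov p 2 1 = cov p 1 2" by (simp add: cov_def mult.commute)

lemma cov_mat_inv:
  assumes "cov_det p \<noteq> 0"
  shows "cov_mat p *v (cov_inv p *v y) = y"
proof -
  have 1: "(cov_mat p *v (cov_inv p *v y)) $ 1 = ((cov p 1 1 * cov p 2 2 - (cov p 1 2)\<^sup>2) / cov_det p) * y $ 1"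
    by (simp add: matrix_vector_mult_def sum_2 cov_mat_def cov_inv_def cov_sym add_divide_distrib diff_divide_distrib power2_eq_square algebra_simps)
  have 2: "(cov_mat p *v (cov_inv p *v y)) $ 2 = ((cov p 1 1 * cov p 2 2 - (cov p 1 2)\<^sup>2) / cov_det p) * y $ 2"
    by (simp add: matrix_vector_mult_def sum_2 cov_mat_def cov_inv_def cov_sym add_divide_distrib diff_divide_distrib power2_eq_square algebra_simps)
  show ?thesis using assms unfolding vec_eq_iff forall_2 1 2 cov_det_def[symmetric] by simp
qed

end

context tilted_renewal begin

lemma p0_interior: "p\<^sub>0 \<in> interior dom"
  by (rule exp_int_interior_dom[OF exp_int_xi rho_pos])

lemma mean_has_derivative:
  "(mean has_derivative (\<lambda>h. mom M \<xi> (\<lambda>\<omega>. (h \<bullet> \<xi> \<omega>) *\<^sub>R \<xi> \<omega>) p\<^sub>0)) (at p\<^sub>0)"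
  unfolding mean_def
  by (rule mom_deriv[OF xi_meas xi_meas exp_int_xi, of "\<rho> / 2" "1 / (\<rho> / 2)"]) (use rho_pos xi_exp_bound[of "\<rho> / 2"] in auto)

lemma cov_eq:
  assumes p1: "psi0 p\<^sub>0 = 1"
  shows "cov p\<^sub>0 i k = (\<integral>\<omega>. exp (p\<^sub>0 \<bullet> \<xi> \<omega>) * (\<xi> \<omega> $ i * \<xi> \<omega> $ k) \<partial>M) - mean p\<^sub>0 $ i * mean p\<^sub>0 $ k"
proof -
  have d0: "dist p\<^sub>0 p\<^sub>0 \<le> \<rho> / 4" using rho_pos by simp
  let ?m = "mean p\<^sub>0"
  have i2: "integrable M (\<lambda>\<omega>. exp (p\<^sub>0 \<bullet> \<xi> \<omega>) * (\<xi> \<omega> $ i * \<xi> \<omega> $ k))" using integrable_cov[OF d0, of 0 i k] by simp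
  have i1: "integrable M (\<lambda>\<omega>. exp (p\<^sub>0 \<bullet> \<xi> \<omega>) * \<xi> \<omega> $ j)" for j
    using integrable_exp_inner[OF p0_interior, of "axis j 1"] by (simp add: inner_axis')
  have m: "(\<integral>\<omega>. exp (p\<^sub>0 \<bullet> \<xi> \<omega>) * \<xi> \<omega> $ j \<partial>M) = ?m $ j" for j
    using mean_inner[OF p0_interior, of "axis j 1"] by (simp add: inner_axis')
  have i0: "integrable M (\<lambda>\<omega>. exp (p\<^sub>0 \<bullet> \<xi> \<omega>))" by (rule integrable_exp_xi[OF d0])
  have m0: "(\<integral>\<omega>. exp (p\<^sub>0 \<bullet> \<xi> \<omega>) \<partial>M) = 1" using p1 by (simp add: psi0_def mom_def)
  have "cov p\<^sub>0 i k = (\<integral>\<omega>. (exp (p\<^sub>0 \<bullet> \<xi> \<omega>) * (\<xi> \<omega> $ i * \<xi> \<omega> $ k) - ?m $ k * (exp (p\<^sub>0 \<bullet> \<xi> \<omega>) * \<xi> \<omega> $ i))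
      - (?m $ i * (exp (p\<^sub>0 \<bullet> \<xi> \<omega>) * \<xi> \<omega> $ k) - (?m $ i * ?m $ k) * exp (p\<^sub>0 \<bullet> \<xi> \<omega>)) \<partial>M)"
    unfolding cov_def mom_def by (intro Bochner_Integration.integral_cong refl) (simp add: algebra_simps)
  also have "\<dots> = ((\<integral>\<omega>. exp (p\<^sub>0 \<bullet> \<xi> \<omega>) * (\<xi> \<omega> $ i * \<xi> \<omega> $ k) \<partial>M) - ?m $ k * ?m $ i) - (?m $ i * ?m $ k - (?m $ i * ?m $ k) * 1)"
  proof -
    have a: "integrable M (\<lambda>\<omega>. ?m $ k * (exp (p\<^sub>0 \<bullet> \<xi> \<omega>) * \<xi> \<omega> $ i))" "integrable M (\<lambda>\<omega>. ?m $ i * (exp (p\<^sub>0 \<bullet> \<xi> \<omega>) * \<xi> \<omega> $ k))"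
      "integrable M (\<lambda>\<omega>. (?m $ i * ?m $ k) * exp (p\<^sub>0 \<bullet> \<xi> \<omega>))"
      using i1 i0 by (intro integrable_mult_right; blast)+
    show ?thesis
      by (simp only: Bochner_Integration.integral_diff[OF Bochner_Integration.integrable_diff[OF i2 a(1)] Bochner_Integration.integrable_diff[OF a(2,3)]]
          Bochner_Integration.integral_diff[OF i2 a(1)] Bochner_Integration.integral_diff[OF a(2,3)] integral_mult_right_zero m m0)
  qed
  finally show ?thesis by (simp add: mult.commute)
qed

text \<open>The derivative of the quotient of \<open>mean\<close> by \<open>psi0\<close> is, once
  \<open>psi0 p\<^sub>0 = 1\<close>, the second moment minus the product of the means, that is, the
  covariance matrix.\<close>

lemma grad_A_has_derivative:
  assumes p1: "psi0 p\<^sub>0 = 1"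
  shows "(grad_A has_derivative (\<lambda>h. cov_mat p\<^sub>0 *v h)) (at p\<^sub>0)"
proof -
  have d0: "dist p\<^sub>0 p\<^sub>0 \<le> \<rho> / 4" using rho_pos by simp
  let ?M2 = "\<lambda>h. mom M \<xi> (\<lambda>\<omega>. (h \<bullet> \<xi> \<omega>) *\<^sub>R \<xi> \<omega>) p\<^sub>0"
  have "((\<lambda>p. inverse (psi0 p) *\<^sub>R mean p) has_derivative (\<lambda>h. inverse (psi0 p\<^sub>0) *\<^sub>R ?M2 h + (- (inverse (psi0 p\<^sub>0) * (h \<bullet> mean p\<^sub>0) * inverse (psi0 p\<^sub>0))) *\<^sub>R mean p\<^sub>0)) (at p\<^sub>0)"
    by (rule has_derivative_scaleR[OF Deriv.has_derivative_inverse[OF _ psi0_has_derivative[OF p0_interior]] mean_has_derivative]) (simp add: p1)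
  then have "(grad_A has_derivative (\<lambda>h. ?M2 h - (h \<bullet> mean p\<^sub>0) *\<^sub>R mean p\<^sub>0)) (at p\<^sub>0)"
    unfolding grad_A_def[abs_def] p1 by simp
  moreover have "?M2 h - (h \<bullet> mean p\<^sub>0) *\<^sub>R mean p\<^sub>0 = cov_mat p\<^sub>0 *v h" for h
  proof -
    have i2: "integrable M (\<lambda>\<omega>. exp (p\<^sub>0 \<bullet> \<xi> \<omega>) * (\<xi> \<omega> $ i * \<xi> \<omega> $ k))" for i k using integrable_cov[OF d0, of 0 i k] by simp
    have iM: "integrable M (\<lambda>\<omega>. exp (p\<^sub>0 \<bullet> \<xi> \<omega>) *\<^sub>R (h \<bullet> \<xi> \<omega>) *\<^sub>R \<xi> \<omega>)"
    proof -
      have r: "\<rho> / 2 > 0" using rho_pos by simp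
      have nb: "norm ((h \<bullet> \<xi> \<omega>) *\<^sub>R \<xi> \<omega>) \<le> (norm h * (1 / (\<rho> / 2))\<^sup>2) * exp (\<rho> * norm (\<xi> \<omega>))" for \<omega>
      proof -
        have "norm ((h \<bullet> \<xi> \<omega>) *\<^sub>R \<xi> \<omega>) \<le> (norm h * norm (\<xi> \<omega>)) * norm (\<xi> \<omega>)"
          by (simp add: mult_right_mono Cauchy_Schwarz_ineq2)
        also have "\<dots> = norm h * (norm (\<xi> \<omega>))\<^sup>2" by (simp add: power2_eq_square)
        also have "\<dots> \<le> norm h * ((1 / (\<rho> / 2)) * exp (\<rho> / 2 * norm (\<xi> \<omega>)))\<^sup>2"
          by (intro mult_left_mono power_mono xi_exp_bound r) auto
        also have "\<dots> = (norm h * (1 / (\<rho> / 2))\<^sup>2) * exp (\<rho> * norm (\<xi> \<omega>))"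
          unfolding power_mult_distrib exp_double[symmetric] by simp
        finally show ?thesis .
      qed
      show ?thesis by (rule mom_integrable[OF xi_meas _ exp_int_xi nb]) measurable
    qed
    have M2i: "?M2 h $ i = h $ 1 * (\<integral>\<omega>. exp (p\<^sub>0 \<bullet> \<xi> \<omega>) * (\<xi> \<omega> $ i * \<xi> \<omega> $ 1) \<partial>M) + h $ 2 * (\<integral>\<omega>. exp (p\<^sub>0 \<bullet> \<xi> \<omega>) * (\<xi> \<omega> $ i * \<xi> \<omega> $ 2) \<partial>M)" for i
    proof -
      have "?M2 h $ i = axis i 1 \<bullet> ?M2 h" by (simp add: inner_axis')
      also have "\<dots> = (\<integral>\<omega>. axis i 1 \<bullet> (exp (p\<^sub>0 \<bullet> \<xi> \<omega>) *\<^sub>R (h \<bullet> \<xi> \<omega>) *\<^sub>R \<xi> \<omega>) \<partial>M)"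
        unfolding mom_def by (rule integral_inner_right[symmetric]) (rule iM)
      also have "\<dots> = (\<integral>\<omega>. h $ 1 * (exp (p\<^sub>0 \<bullet> \<xi> \<omega>) * (\<xi> \<omega> $ i * \<xi> \<omega> $ 1)) + h $ 2 * (exp (p\<^sub>0 \<bullet> \<xi> \<omega>) * (\<xi> \<omega> $ i * \<xi> \<omega> $ 2)) \<partial>M)"
        by (intro Bochner_Integration.integral_cong refl) (simp add: inner_axis' inner_real2[of h] algebra_simps)
      also have "\<dots> = h $ 1 * (\<integral>\<omega>. exp (p\<^sub>0 \<bullet> \<xi> \<omega>) * (\<xi> \<omega> $ i * \<xi> \<omega> $ 1) \<partial>M) + h $ 2 * (\<integral>\<omega>. exp (p\<^sub>0 \<bullet> \<xi> \<omega>) * (\<xi> \<omega> $ i * \<xi> \<omega> $ 2) \<partial>M)"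
        by (simp only: Bochner_Integration.integral_add[OF integrable_mult_right[OF i2] integrable_mult_right[OF i2]] integral_mult_right_zero)
      finally show ?thesis .
    qed
    show ?thesis
      unfolding vec_eq_iff
    proof
      fix i
      define A where "A k = (\<integral>\<omega>. exp (p\<^sub>0 \<bullet> \<xi> \<omega>) * (\<xi> \<omega> $ i * \<xi> \<omega> $ k) \<partial>M)" for k
      have "(?M2 h - (h \<bullet> mean p\<^sub>0) *\<^sub>R mean p\<^sub>0) $ i = ?M2 h $ i - (h \<bullet> mean p\<^sub>0) * mean p\<^sub>0 $ i" by simp
      also have "\<dots> = (h $ 1 * A 1 + h $ 2 * A 2) - (h $ 1 * mean p\<^sub>0 $ 1 + h $ 2 * mean p\<^sub>0 $ 2) * mean p\<^sub>0 $ i"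
        unfolding M2i A_def inner_real2[of h "mean p\<^sub>0"] ..
      also have "\<dots> = (A 1 - mean p\<^sub>0 $ i * mean p\<^sub>0 $ 1) * h $ 1 + (A 2 - mean p\<^sub>0 $ i * mean p\<^sub>0 $ 2) * h $ 2"
        by (simp add: algebra_simps)
      also have "\<dots> = cov p\<^sub>0 i 1 * h $ 1 + cov p\<^sub>0 i 2 * h $ 2" unfolding cov_eq[OF p1] A_def ..
      also have "\<dots> = (cov_mat p\<^sub>0 *v h) $ i" by (simp add: matrix_vector_mult_def sum_2 cov_mat_def)
      finally show "(?M2 h - (h \<bullet> mean p\<^sub>0) *\<^sub>R mean p\<^sub>0) $ i = (cov_mat p\<^sub>0 *v h) $ i" .
    qed
  qed
  ultimately show ?thesis by (simp only:)
qed

text \<open>On the open set of gradients the gradient of \<Lambda> is the inverse of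
  \<open>grad_A\<close>, so the inverse function theorem gives the inverse covariance matrix. Since
  \<open>psi0 p\<^sub>0 = 1\<close>, the point \<open>grad_A p\<^sub>0\<close> is the mean
  itself.\<close>

lemma hessian_Lambda:
  assumes p1: "psi0 p\<^sub>0 = 1"
  shows "hessian (\<lambda>y. real_of_ereal (Lambda M \<xi> y)) (mean p\<^sub>0) = cov_inv p\<^sub>0"
proof -
  have d0: "dist p\<^sub>0 p\<^sub>0 \<le> \<rho> / 4" using rho_pos by simp
  let ?L = "\<lambda>y. real_of_ereal (Lambda M \<xi> y)"
  have gm: "grad_A p\<^sub>0 = mean p\<^sub>0" by (simp add: grad_A_def p1)
  have y: "mean p\<^sub>0 \<in> grad_set" unfolding grad_set_def gm[symmetric] using p0_interior by blast
  have "(inv_grad has_derivative (\<lambda>y. cov_inv p\<^sub>0 *v y)) (at (grad_A p\<^sub>0))"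
  proof (rule has_derivative_inverse_strong[OF open_interior p0_interior grad_A_continuous_on])
    show "(grad_A has_derivative (\<lambda>h. cov_mat p\<^sub>0 *v h)) (at p\<^sub>0)" by (rule grad_A_has_derivative[OF p1])
    show "(\<lambda>h. cov_mat p\<^sub>0 *v h) \<circ> (\<lambda>y. cov_inv p\<^sub>0 *v y) = id"
    proof -
      have "cov_det p\<^sub>0 \<noteq> 0" using cov_pos(2)[OF d0] by simp
      then show ?thesis by (simp add: fun_eq_iff cov_mat_inv)
    qed
  qed (rule inv_grad)
  then have "(inv_grad has_derivative (\<lambda>y. cov_inv p\<^sub>0 *v y)) (at (mean p\<^sub>0))" unfolding gm .
  then have "(gradient ?L has_derivative (\<lambda>y. cov_inv p\<^sub>0 *v y)) (at (mean p\<^sub>0))"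
  proof (rule has_derivative_transform_within_open[OF _ open_grad_set y])
    fix z assume "z \<in> grad_set"
    then show "inv_grad z = gradient ?L z" by (rule gradient_eq[OF Lambda_has_derivative, symmetric])
  qed
  then have "frechet_derivative (gradient ?L) (at (mean p\<^sub>0)) = (\<lambda>y. cov_inv p\<^sub>0 *v y)"
    by (rule frechet_derivative_at[symmetric])
  then show ?thesis unfolding hessian_def jacobian_def by (simp only: matrix_of_matrix_vector_mul)
qed

end

context arithmetic_compound_renewal begin

text \<open>Matches the constant C with the Gaussian integral: (1, \<alpha>) is the mean divided by
  its first coordinate, so the quadratic form is \<open>line_var\<close> over that coordinate
  squared and over the determinant. The determinants cancel, and r, the reciprocal of the
  coordinate, removes one power of it.\<close>

lemma C_fun_eq:
  assumes a: "\<alpha> \<in> regular_range M \<xi>" and X1: "curve_point \<alpha> \<in> interior (psi_dom M (X 1))"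
  defines "p \<equiv> curve_point \<alpha>"
  shows "C_fun M \<xi> \<alpha> = sqrt (mean p $ 1 / (2 * pi * line_var p))" "line_var p > 0"
proof -
  note A = regular_rangeD[OF a]
  have p: "p \<in> interior dom" "psi0 p = 1" using A(4) by (auto simp: on_curve_def p_def)
  obtain \<rho> where "tilted_renewal M \<xi> X p \<rho>" using tilted_at[OF p(1)] X1 unfolding p_def by blast
  then interpret T: tilted_renewal M \<xi> X p \<rho> .
  have d0: "dist p p \<le> \<rho> / 4" using T.rho_pos by simp
  define m where "m = mean p"
  have m1: "m $ 1 > 0" using on_curve_mean_pos[OF A(4)] by (simp add: m_def p_def)
  have al: "\<alpha> = m $ 2 / m $ 1" using A(5) by (simp add: slope_def m_def p_def)
  have D: "cov_det p > 0" by (rule T.cov_pos(2)[OF d0])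
  show lv: "line_var p > 0" by (rule T.line_var_pos[OF d0]) (use m1 in \<open>simp add: m_def\<close>)
  have g: "gradient (\<lambda>w. real_of_ereal (A2 M \<xi> w)) p = m"
    using gradient_eq[OF A2_has_derivative[OF p(1)]] by (simp add: grad_A_def p(2) m_def)
  have h: "hessian (\<lambda>y. real_of_ereal (Lambda M \<xi> y)) m = cov_inv p" unfolding m_def by (rule T.hessian_Lambda[OF p(2)])
  have det: "det (cov_inv p) = 1 / cov_det p"
  proof -
    have "det (cov_inv p) = (cov p 1 1 * cov p 2 2 - (cov p 1 2)\<^sup>2) / (cov_det p * cov_det p)"
      by (simp add: det_2 cov_inv_def power2_eq_square diff_divide_distrib mult.commute)
    then show ?thesis using D by (simp add: cov_det_def[symmetric])
  qed
  have quad: "vec2 1 \<alpha> \<bullet> (cov_inv p *v vec2 1 \<alpha>) = line_var p / ((m $ 1)\<^sup>2 * cov_det p)"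
  proof -
    have "vec2 1 \<alpha> \<bullet> (cov_inv p *v vec2 1 \<alpha>) = (cov p 2 2 - 2 * cov p 1 2 * \<alpha> + cov p 1 1 * \<alpha>\<^sup>2) / cov_det p"
      by (simp add: inner_real2 matrix_vector_mult_def sum_2 cov_inv_def add_divide_distrib diff_divide_distrib power2_eq_square algebra_simps)
    also have "cov p 2 2 - 2 * cov p 1 2 * \<alpha> + cov p 1 1 * \<alpha>\<^sup>2 = line_var p / (m $ 1)\<^sup>2"
      using m1 by (simp add: al line_var_def m_def[symmetric] field_simps power2_eq_square)
    finally show ?thesis by simp
  qed
  have "C_fun M \<xi> \<alpha> = sqrt ((1 / m $ 1) / (2 * pi) * (det (cov_inv p) / (vec2 1 \<alpha> \<bullet> (cov_inv p *v vec2 1 \<alpha>))))"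
    using g h unfolding C_fun_def C_H_def Let_def by (simp add: p_def curve_point_def)
  also have "(1 / m $ 1) / (2 * pi) * (det (cov_inv p) / (vec2 1 \<alpha> \<bullet> (cov_inv p *v vec2 1 \<alpha>))) = m $ 1 / (2 * pi * line_var p)"
    unfolding det quad using m1 D lv by (simp add: power2_eq_square)
  finally show "C_fun M \<xi> \<alpha> = sqrt (mean p $ 1 / (2 * pi * line_var p))" by (simp add: m_def)
qed

end

section \<open>Asymptotics along sequences\<close>

text \<open>Splits sqrt n between the renewal mass at time n - m, which is of order 1 / sqrt (n - m
  + 1), and the weight of m, whose geometric decay absorbs sqrt (m + 1).\<close>

lemma sqrt_le_sqrt_mult:
  fixes n m :: nat
  assumes "m \<le> n"
  shows "sqrt (real n) \<le> sqrt (real n - real m + 1) * sqrt (real m + 1)"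
proof -
  have "0 \<le> (real n - real m) * real m + 1" using assms by (intro add_nonneg_nonneg mult_nonneg_nonneg) auto
  then have "real n \<le> (real n - real m + 1) * (real m + 1)" by (simp add: algebra_simps)
  then show ?thesis unfolding real_sqrt_mult[symmetric] by simp
qed

context arithmetic_compound_renewal begin

text \<open>Markov's inequality at some l above the given value where the transform of \<tau> is
  finite. For l \<le> 0 Markov's inequality is of no use, but then the right-hand side is at least
  1.\<close>

lemma exp_tail_bound:
  assumes "ereal l0 < lambda_plus M \<xi>"
  obtains l C where "l0 < l" "C \<ge> 0" "\<And>m. prob {\<omega>\<in>space M. \<xi> \<omega> $ 1 \<ge> real m} \<le> C * exp (- l * real m)"
proof -
  obtain l where l: "l0 < l" "(\<integral>\<^sup>+ \<omega>. ennreal (exp (l * \<xi> \<omega> $ 1)) \<partial>M) < \<infinity>"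
    using assms unfolding lambda_plus_def less_SUP_iff by auto
  have i: "integrable M (\<lambda>\<omega>. exp (l * \<xi> \<omega> $ 1))"
    using l(2) by (intro integrableI_bounded) auto
  define E where "E = (\<integral>\<omega>. exp (l * \<xi> \<omega> $ 1) \<partial>M)"
  have E: "E \<ge> 0" unfolding E_def by (auto intro: Bochner_Integration.integral_nonneg)
  have "prob {\<omega>\<in>space M. \<xi> \<omega> $ 1 \<ge> real m} \<le> (1 + E) * exp (- l * real m)" for m
  proof (cases "l > 0")
    case True
    have "prob {\<omega>\<in>space M. \<xi> \<omega> $ 1 \<ge> real m} \<le> prob {\<omega>\<in>space M. exp (l * \<xi> \<omega> $ 1) \<ge> exp (l * real m)}"
      using True by (intro finite_measure_mono) auto
    also have "\<dots> \<le> E / exp (l * real m)" unfolding E_def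
      by (rule integral_Markov_inequality_measure[OF i, of "{}"]) auto
    also have "\<dots> = E * exp (- l * real m)" by (simp add: exp_minus divide_inverse)
    also have "\<dots> \<le> (1 + E) * exp (- l * real m)" by (intro mult_right_mono) auto
    finally show ?thesis .
  next
    case False
    have "prob {\<omega>\<in>space M. \<xi> \<omega> $ 1 \<ge> real m} \<le> 1" by simp
    also have "\<dots> \<le> exp (- l * real m)" using False by (simp add: mult_nonpos_nonneg)
    also have "\<dots> \<le> (1 + E) * exp (- l * real m)" using E by (simp add: mult_le_cancel_right1)
    finally show ?thesis .
  qed
  then show ?thesis using that[of l "1 + E"] l(1) E by auto
qed

definition I_term :: "real \<Rightarrow> nat \<Rightarrow> real" where
  "I_term l i = exp (l * real (Suc i)) * prob {\<omega>\<in>space M. \<xi> \<omega> $ 1 \<ge> real (Suc i)}"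

lemma I_fun_eq: "I_fun M \<xi> \<alpha> = (\<Sum>i. I_term (lambda_of M \<xi> \<alpha>) i)"
  by (simp add: I_fun_def I_term_def)

text \<open>\<open>l1\<close> lies strictly between \<open>l0\<close> and the decay rate of the
  tail, so the bound holds for all l near \<open>l0\<close>; half of the remaining gap absorbs the
  root, the other half is the geometric ratio.\<close>

lemma weighted_I_bound:
  assumes "ereal l0 < lambda_plus M \<xi>"
  obtains K q l1 where "0 < q" "q < 1" "l0 < l1" "K \<ge> 0" "\<And>l i. l \<le> l1 \<Longrightarrow> I_term l i * sqrt (real (Suc i) + 1) \<le> K * q ^ Suc i"
proof -
  obtain l' C where l': "l0 < l'" "C \<ge> 0" "\<And>m. prob {\<omega>\<in>space M. \<xi> \<omega> $ 1 \<ge> real m} \<le> C * exp (- l' * real m)"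
    by (rule exp_tail_bound[OF assms]) (rule that)
  define l1 where "l1 = (l0 + l') / 2"
  define \<delta> where "\<delta> = l' - l1"
  have \<delta>: "\<delta> > 0" "l0 < l1" using l'(1) by (auto simp: \<delta>_def l1_def)
  define K where "K = C * (exp (\<delta> / 2) / (\<delta> / 2))"
  show ?thesis
  proof (rule that[of "exp (- \<delta> / 2)" l1 K])
    fix l i assume l: "l \<le> l1"
    define m where "m = real (Suc i)"
    have m: "m \<ge> 1" by (simp add: m_def)
    have "exp (l * m) \<le> exp (l1 * m)" using l m by (simp add: mult_right_mono)
    moreover have "prob {\<omega>\<in>space M. \<xi> \<omega> $ 1 \<ge> m} \<le> C * exp (- l' * m)" unfolding m_def by (rule l'(3))
    moreover have "sqrt (m + 1) \<le> exp (\<delta> / 2 * (m + 1)) / (\<delta> / 2)"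
    proof -
      have "sqrt (m + 1) \<le> m + 1" using m by (simp add: real_le_lsqrt power2_eq_square mult_le_cancel_left1)
      also have "\<dots> \<le> exp (\<delta> / 2 * (m + 1)) / (\<delta> / 2)" by (rule le_exp_div) (use \<delta> in simp)
      finally show ?thesis .
    qed
    ultimately have "exp (l * m) * prob {\<omega>\<in>space M. \<xi> \<omega> $ 1 \<ge> m} * sqrt (m + 1)
        \<le> exp (l1 * m) * (C * exp (- l' * m)) * (exp (\<delta> / 2 * (m + 1)) / (\<delta> / 2))"
      using m l'(2) by (intro mult_mono) auto
    also have "\<dots> = C / (\<delta> / 2) * (exp (l1 * m) * exp (- l' * m) * exp (\<delta> / 2 * (m + 1)))" by simp
    also have "exp (l1 * m) * exp (- l' * m) * exp (\<delta> / 2 * (m + 1)) = exp (\<delta> / 2) * exp (- \<delta> / 2 * m)"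
      unfolding exp_add[symmetric] by (simp add: \<delta>_def field_simps)
    also have "exp (- \<delta> / 2 * m) = exp (- \<delta> / 2) ^ Suc i" unfolding m_def by (subst mult.commute) (rule exp_of_nat_mult)
    finally show "I_term l i * sqrt (real (Suc i) + 1) \<le> K * exp (- \<delta> / 2) ^ Suc i"
      by (simp add: I_term_def m_def K_def mult_ac)
  qed (use \<delta> l' in \<open>auto simp: K_def\<close>)
qed

lemma I_term_nonneg: "I_term l i \<ge> 0" by (simp add: I_term_def)

text \<open>Tannery's theorem: each weight tends to the same v, and the geometric bound dominates
  once \<open>l j \<le> l1\<close>.\<close>

lemma weighted_I_tendsto:
  fixes l :: "nat \<Rightarrow> real" and w :: "nat \<Rightarrow> nat \<Rightarrow> real"
  assumes l0: "ereal l0 < lambda_plus M \<xi>" and l: "l \<longlonglongrightarrow> l0"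
    and w: "\<And>j i. \<bar>w j i\<bar> \<le> C * sqrt (real (Suc i) + 1)" and wl: "\<And>i. (\<lambda>j. w j i) \<longlonglongrightarrow> v"
  shows "(\<lambda>j. \<Sum>i. I_term (l j) i * w j i) \<longlonglongrightarrow> (\<Sum>i. I_term l0 i * v)" "summable (\<lambda>i. I_term l0 i * v)"
proof -
  obtain K q l1 where K: "0 < q" "q < 1" "l0 < l1" "K \<ge> 0" "\<And>l i. l \<le> l1 \<Longrightarrow> I_term l i * sqrt (real (Suc i) + 1) \<le> K * q ^ Suc i"
    by (rule weighted_I_bound[OF l0]) (rule that)
  have C: "C \<ge> 0" using order_trans[OF abs_ge_zero w[of 0 0]] by (simp add: zero_le_mult_iff)
  have sm: "summable (\<lambda>i. C * (K * q ^ Suc i))"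
    using K by (intro summable_mult) (subst summable_Suc_iff, simp)
  have ev: "eventually (\<lambda>j. l j \<le> l1) sequentially"
    using order_tendstoD(2)[OF l K(3)] by eventually_elim simp
  have lim: "(\<lambda>j. I_term (l j) i * w j i) \<longlonglongrightarrow> I_term l0 i * v" for i
    unfolding I_term_def by (intro tendsto_intros l wl)
  have bnd: "norm (I_term (l j) i * w j i) \<le> C * (K * q ^ Suc i)" if "l j \<le> l1" for i j
  proof -
    have "norm (I_term (l j) i * w j i) \<le> I_term (l j) i * (C * sqrt (real (Suc i) + 1))"
      unfolding norm_mult using w[of j i] I_term_nonneg[of "l j" i] by (simp add: mult_left_mono)
    also have "\<dots> = C * (I_term (l j) i * sqrt (real (Suc i) + 1))" by simp
    also have "\<dots> \<le> C * (K * q ^ Suc i)" by (intro mult_left_mono K(5) C that)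
    finally show ?thesis .
  qed
  have "eventually (\<lambda>(i, j). norm (I_term (l j) i * w j i) \<le> C * (K * q ^ Suc i)) (at_top \<times>\<^sub>F sequentially)"
    unfolding eventually_prod_filter
  proof (rule exI, rule exI, intro conjI)
    show "eventually (\<lambda>_. True) at_top" by (rule eventually_True)
    show "eventually (\<lambda>j. l j \<le> l1) sequentially" by (rule ev)
    show "\<forall>i j. True \<longrightarrow> l j \<le> l1 \<longrightarrow> (case (i, j) of (i, j) \<Rightarrow> norm (I_term (l j) i * w j i) \<le> C * (K * q ^ Suc i))"
      unfolding prod.case by (intro allI impI) (rule bnd)
  qed
  note T = tannerys_theorem[OF lim this sm trivial_limit_sequentially]
  show "(\<lambda>j. \<Sum>i. I_term (l j) i * w j i) \<longlonglongrightarrow> (\<Sum>i. I_term l0 i * v)" by (rule T[THEN conjunct2, THEN conjunct2])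
  show "summable (\<lambda>i. I_term l0 i * v)" by (rule summable_norm_cancel[OF T[THEN conjunct2, THEN conjunct1]])
qed

lemma I_term_summable: "ereal l0 < lambda_plus M \<xi> \<Longrightarrow> summable (I_term l0)"
  by (drule weighted_I_tendsto(2)[of l0 "\<lambda>_. l0" "\<lambda>_ _. 1" 1 1]) simp_all

lemma I_fun_pos:
  assumes "\<alpha> \<in> regular_range M \<xi>"
  shows "I_fun M \<xi> \<alpha> > 0"
  unfolding I_fun_eq
proof (rule suminf_pos2)
  show "summable (I_term (lambda_of M \<xi> \<alpha>))" by (rule I_term_summable[OF regular_rangeD(6)[OF assms]])
  have "prob {\<omega>\<in>space M. \<xi> \<omega> $ 1 \<ge> real (Suc 0)} = 1"
    by (rule prob_eq_1[THEN iffD2]) (use xi_ge_1 in auto)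
  then show "0 < I_term (lambda_of M \<xi> \<alpha>) 0" by (simp add: I_term_def)
qed (rule I_term_nonneg)

lemma I_fun_tendsto:
  assumes "\<alpha> \<in> regular_range M \<xi>" "(\<lambda>j. lambda_of M \<xi> (a j)) \<longlonglongrightarrow> lambda_of M \<xi> \<alpha>"
  shows "(\<lambda>j. I_fun M \<xi> (a j)) \<longlonglongrightarrow> I_fun M \<xi> \<alpha>"
  using weighted_I_tendsto(1)[OF regular_rangeD(6)[OF assms(1)] assms(2), of "\<lambda>_ _. 1" 1 1] by (simp add: I_fun_eq)

end

context tilted_renewal begin

lemma psi1_tendsto: "p \<longlonglongrightarrow> p\<^sub>0 \<Longrightarrow> (\<lambda>j. psi1 (p j)) \<longlonglongrightarrow> psi1 p\<^sub>0"
  unfolding psi1_def by (rule mom_tendsto[OF X1_measurable(1) _ _ exp_int_X1, where \<sigma> = 0 and C = 1]) (use rho_pos in auto)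

lemma psi1_pos: "psi1 p\<^sub>0 > 0"
proof -
  have i: "integrable M (\<lambda>\<omega>. exp (p\<^sub>0 \<bullet> X 1 \<omega>))" using exp_int_near(2)[of p\<^sub>0 0] rho_pos by (simp add: exp_int_def)
  have "psi1 p\<^sub>0 \<noteq> 0" unfolding psi1_def mom_def
    using integral_nonneg_eq_0_iff_AE[OF i] by auto
  moreover have "psi1 p\<^sub>0 \<ge> 0" unfolding psi1_def mom_def by (auto intro: Bochner_Integration.integral_nonneg)
  ultimately show ?thesis by simp
qed

lemma line_var_tendsto:
  assumes p: "p \<longlonglongrightarrow> p\<^sub>0" and d: "\<And>j. dist (p j) p\<^sub>0 \<le> \<rho> / 4"
  shows "(\<lambda>j. line_var (p j)) \<longlonglongrightarrow> line_var p\<^sub>0"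
proof -
  have d0: "dist p\<^sub>0 p\<^sub>0 \<le> \<rho> / 4" using rho_pos by simp
  have c11: "cov q 1 1 = var_form q (vec2 1 0)" and c22: "cov q 2 2 = var_form q (vec2 0 1)"
    and c12: "cov q 1 2 = (var_form q (vec2 1 1) - var_form q (vec2 1 0) - var_form q (vec2 0 1)) / 2"
    if "dist q p\<^sub>0 \<le> \<rho> / 4" for q
    using var_form_eq[OF that] by simp_all
  note vt = var_form_tendsto[OF p d]
  have m: "(\<lambda>j. mean (p j) $ i) \<longlonglongrightarrow> mean p\<^sub>0 $ i" for i by (rule tendsto_vec_nth[OF mean_tendsto[OF p]])
  show ?thesis
    unfolding line_var_def c11[OF d] c22[OF d] c12[OF d] c11[OF d0] c22[OF d0] c12[OF d0]
    by (intro tendsto_intros vt m) simp_all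
qed

text \<open>The sum over m is written as a full series with weights \<open>w\<close>, which vanish
  for m > n. Each weight tends to the constant of \<open>renewal_mass_limit\<close>, which does not
  depend on m, so it factors out and I(\<alpha>) remains.\<close>

lemma Z_process_limit:
  fixes n :: "nat \<Rightarrow> nat" and x :: "nat \<Rightarrow> int" and a :: "nat \<Rightarrow> real"
  assumes p0: "p\<^sub>0 = curve_point \<alpha>" and \<alpha>: "\<alpha> \<in> regular_range M \<xi>"
    and a: "\<And>j. a j \<in> regular_range M \<xi>" "\<And>j. a j = real_of_int (x j) / real (n j)" "a \<longlonglongrightarrow> \<alpha>"
    and d: "\<And>j. dist (curve_point (a j)) p\<^sub>0 \<le> \<rho> / 4"
    and n: "filterlim n at_top sequentially" "\<And>j. n j \<ge> 1"
    and tail: "(\<lambda>j. if x j = 0 then sqrt (n j) * exp (lambda_of M \<xi> (a j) * n j) * prob {\<omega>\<in>space M. X 1 \<omega> $ 1 \<ge> real (n j)} else 0) \<longlonglongrightarrow> 0"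
  shows "(\<lambda>j. sqrt (n j) * (exp (lambda_of M \<xi> (a j) * n j + mu_of M \<xi> (a j) * x j) * prob {\<omega>\<in>space M. Z_process X (real (n j)) \<omega> = real_of_int (x j)}))
    \<longlonglongrightarrow> psi1 p\<^sub>0 * sqrt (mean p\<^sub>0 $ 1 / (2 * pi * line_var p\<^sub>0)) * I_fun M \<xi> \<alpha>"
proof -
  define p where "p j = curve_point (a j)" for j
  define l where "l j = lambda_of M \<xi> (a j)" for j
  define c where "c = psi1 p\<^sub>0 * sqrt (mean p\<^sub>0 $ 1 / (2 * pi * line_var p\<^sub>0))"
  have pt: "p \<longlonglongrightarrow> p\<^sub>0" unfolding p_def p0 by (rule curve_point_tendsto[OF a(1) \<alpha> a(3)])
  have oc: "on_curve (p j)" "slope (p j) = a j" for j using regular_rangeD(4,5)[OF a(1)] by (auto simp: p_def)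
  have p1: "psi0 (p j) = 1" for j using oc by (simp add: on_curve_def)
  have m1: "1 \<le> mean (p j) $ 1" for j by (rule on_curve_mean_pos[OF oc(1)])
  have dp: "dist (p j) p\<^sub>0 \<le> \<rho> / 4" for j using d by (simp add: p_def)
  have xs: "real_of_int (x j) = real (n j) * (mean (p j) $ 2 / mean (p j) $ 1)" for j
    using oc(2)[of j] a(2)[of j] n(2)[of j] by (simp add: slope_def)
  have lt: "l \<longlonglongrightarrow> lambda_of M \<xi> \<alpha>"
    using tendsto_vec_nth[OF pt, of 1] by (simp add: p_def[abs_def] p0 curve_point_def l_def[abs_def])
  have lat: "vec2 (real (n j) - real m) (x j) \<in> int_lattice" for j m by (simp add: int_lattice_def forall_2)
  obtain C where C: "C \<ge> 0" "\<And>p y. dist p p\<^sub>0 \<le> \<rho> / 4 \<Longrightarrow> psi0 p = 1 \<Longrightarrow> 1 \<le> mean p $ 1 \<Longrightarrow> y \<in> int_lattice \<Longrightarrow> y $ 1 \<ge> 0 \<Longrightarrow>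
    summable (\<lambda>N. point_mass p N y) \<and> sqrt (y $ 1 + 1) * renewal_mass p y \<le> C"
    by (rule renewal_mass_bound[of 1]) (simp, rule that)
  have rm0: "renewal_mass (p j) y \<ge> 0" if "y \<in> int_lattice" "y $ 1 \<ge> 0" for j y
    unfolding renewal_mass_def using C(2)[OF dp p1 m1 that] by (intro suminf_nonneg) (auto simp: point_mass_nonneg)
  define w where "w j i = (if Suc i \<le> n j then sqrt (n j) * renewal_mass (p j) (vec2 (real (n j) - real (Suc i)) (x j)) else 0)" for j i
  have wb: "\<bar>w j i\<bar> \<le> C * sqrt (real (Suc i) + 1)" for j i
  proof (cases "Suc i \<le> n j")
    case True
    let ?y = "vec2 (real (n j) - real (Suc i)) (x j)"
    have y: "?y \<in> int_lattice" "?y $ 1 \<ge> 0" by (rule lat) (use True in simp)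
    have "\<bar>w j i\<bar> = sqrt (n j) * renewal_mass (p j) ?y" using True rm0[OF y, of j] by (simp add: w_def)
    also have "\<dots> \<le> (sqrt (real (n j) - real (Suc i) + 1) * sqrt (real (Suc i) + 1)) * renewal_mass (p j) ?y"
      by (intro mult_right_mono sqrt_le_sqrt_mult True rm0 y)
    also have "\<dots> = (sqrt (?y $ 1 + 1) * renewal_mass (p j) ?y) * sqrt (real (Suc i) + 1)" by simp
    also have "\<dots> \<le> C * sqrt (real (Suc i) + 1)" using C(2)[OF dp p1 m1 y, of j] by (intro mult_right_mono) auto
    finally show ?thesis .
  qed (use C in \<open>simp add: w_def\<close>)
  have wl: "(\<lambda>j. w j i) \<longlonglongrightarrow> c" for i
  proof -
    have "(\<lambda>j. sqrt (n j) * renewal_mass (p j) (vec2 (real (n j) - real (Suc i)) (x j))) \<longlonglongrightarrow> c"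
      unfolding c_def by (rule renewal_mass_limit[OF pt dp p1 zero_less_one m1 n xs])
    moreover have "eventually (\<lambda>j. sqrt (n j) * renewal_mass (p j) (vec2 (real (n j) - real (Suc i)) (x j)) = w j i) sequentially"
      using eventually_compose_filterlim[OF eventually_ge_at_top n(1), of "Suc i"] by eventually_elim (simp add: w_def)
    ultimately show ?thesis by (rule Lim_transform_eventually)
  qed
  have main: "(\<lambda>j. \<Sum>i. I_term (l j) i * w j i) \<longlonglongrightarrow> (\<Sum>i. I_term (lambda_of M \<xi> \<alpha>) i * c)"
    by (rule weighted_I_tendsto(1)[OF regular_rangeD(6)[OF \<alpha>] lt wb wl])
  have sum_eq: "(\<Sum>i. I_term (l j) i * w j i)
      = sqrt (n j) * (\<Sum>m=1..n j. exp (l j * m) * prob {\<omega>\<in>space M. \<xi> \<omega> $ 1 \<ge> real m} * renewal_mass (p j) (vec2 (real (n j) - real m) (x j)))" for j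
  proof -
    have "(\<Sum>i. I_term (l j) i * w j i) = (\<Sum>i<n j. I_term (l j) i * w j i)"
      by (rule suminf_finite) (auto simp: w_def)
    also have "\<dots> = (\<Sum>i<n j. sqrt (n j) * (exp (l j * Suc i) * prob {\<omega>\<in>space M. \<xi> \<omega> $ 1 \<ge> real (Suc i)} * renewal_mass (p j) (vec2 (real (n j) - real (Suc i)) (x j))))"
      by (intro sum.cong refl) (simp add: w_def I_term_def)
    also have "\<dots> = (\<Sum>m=1..n j. sqrt (n j) * (exp (l j * m) * prob {\<omega>\<in>space M. \<xi> \<omega> $ 1 \<ge> real m} * renewal_mass (p j) (vec2 (real (n j) - real m) (x j))))"
      by (rule sum.reindex_bij_witness[of _ "\<lambda>m. m - 1" Suc]) auto
    finally show ?thesis by (simp add: sum_distrib_left)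
  qed
  have pj: "p j = vec2 (l j) (mu_of M \<xi> (a j))" for j by (simp add: p_def curve_point_def l_def)
  have "sqrt (n j) * (exp (l j * n j + mu_of M \<xi> (a j) * x j) * prob {\<omega>\<in>space M. Z_process X (real (n j)) \<omega> = real_of_int (x j)})
    = (if x j = 0 then sqrt (n j) * exp (l j * n j) * prob {\<omega>\<in>space M. X 1 \<omega> $ 1 \<ge> real (n j)} else 0) + (\<Sum>i. I_term (l j) i * w j i)" for j
  proof -
    have sm: "summable (\<lambda>N. point_mass (vec2 (l j) (mu_of M \<xi> (a j))) N (vec2 (real (n j) - real m) (x j)))" if "m \<in> {1..n j}" for m
      unfolding pj[symmetric] using C(2)[OF dp[of j] p1[of j] m1[of j] lat[of j m]] that by simp
    show ?thesis unfolding sum_eq pj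
      by (subst tilted_prob_Z_process[OF _ sm]) (use n(2)[of j] in \<open>auto simp: distrib_left\<close>)
  qed
  then have "(\<lambda>j. sqrt (n j) * (exp (l j * n j + mu_of M \<xi> (a j) * x j) * prob {\<omega>\<in>space M. Z_process X (real (n j)) \<omega> = real_of_int (x j)}))
     \<longlonglongrightarrow> 0 + (\<Sum>i. I_term (lambda_of M \<xi> \<alpha>) i * c)"
    using tendsto_add[OF tail main] unfolding l_def by simp
  moreover have "(\<Sum>i. I_term (lambda_of M \<xi> \<alpha>) i * c) = c * I_fun M \<xi> \<alpha>"
    unfolding I_fun_eq using suminf_mult2[OF I_term_summable[OF regular_rangeD(6)[OF \<alpha>]], of c] by (simp add: mult.commute)
  ultimately show ?thesis by (simp add: c_def l_def)
qed

end

section \<open>Uniformity over compact sets\<close>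

context arithmetic_compound_renewal begin

definition main_term :: "nat \<Rightarrow> int \<Rightarrow> real" where
  "main_term n x = (let \<alpha> = real_of_int x / real n in
     enn2real (psi M (X 1) (curve_point \<alpha>)) * (C_fun M \<xi> \<alpha> / sqrt (real n)) * exp (- real n * real_of_ereal (D_fun M \<xi> \<alpha>)) * I_fun M \<xi> \<alpha>)"

text \<open>From n \<alpha> = x the number n D(\<alpha>) is the exponent \<lambda> n + \<mu> x of
  the tilt. Positivity permits the remainder to be defined through a quotient.\<close>

lemma main_term_eq:
  assumes r: "real_of_int x / real n \<in> regular_range M \<xi>" and X1: "curve_point (real_of_int x / real n) \<in> interior (psi_dom M (X 1))"
    and n: "n > 0"
  defines "\<alpha> \<equiv> real_of_int x / real n"
  shows "main_term n x = psi1 (curve_point \<alpha>) * sqrt (mean (curve_point \<alpha>) $ 1 / (2 * pi * line_var (curve_point \<alpha>))) * I_fun M \<xi> \<alpha>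
      / (sqrt n * exp (lambda_of M \<xi> \<alpha> * n + mu_of M \<xi> \<alpha> * x))" "main_term n x > 0"
proof -
  have X1m: "X 1 \<in> borel_measurable M" by (rule X_measurable) simp
  have e1: "enn2real (psi M (X 1) (curve_point \<alpha>)) = psi1 (curve_point \<alpha>)"
    unfolding psi1_def by (rule psi_eq_mom(2)[OF X1m]) (use X1 interior_subset in \<open>auto simp: \<alpha>_def\<close>)
  have "real n * (lambda_of M \<xi> \<alpha> + \<alpha> * mu_of M \<xi> \<alpha>) = lambda_of M \<xi> \<alpha> * n + mu_of M \<xi> \<alpha> * x"
    using n by (simp add: \<alpha>_def field_simps)
  then have eD: "real n * real_of_ereal (D_fun M \<xi> \<alpha>) = lambda_of M \<xi> \<alpha> * n + mu_of M \<xi> \<alpha> * x"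
    using D_fun_eq[OF r] by (simp add: \<alpha>_def)
  have e2: "exp (- real n * real_of_ereal (D_fun M \<xi> \<alpha>)) = 1 / exp (lambda_of M \<xi> \<alpha> * n + mu_of M \<xi> \<alpha> * x)"
    unfolding mult_minus_left eD exp_minus by (simp only: inverse_eq_divide)
  show eq: "main_term n x = psi1 (curve_point \<alpha>) * sqrt (mean (curve_point \<alpha>) $ 1 / (2 * pi * line_var (curve_point \<alpha>))) * I_fun M \<xi> \<alpha>
      / (sqrt n * exp (lambda_of M \<xi> \<alpha> * n + mu_of M \<xi> \<alpha> * x))"
    using C_fun_eq(1)[OF r X1] unfolding main_term_def Let_def \<alpha>_def[symmetric] e1 e2 by simp
  have oc: "on_curve (curve_point \<alpha>)" using regular_rangeD(4)[OF r] by (simp add: \<alpha>_def)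
  obtain \<rho> where "tilted_renewal M \<xi> X (curve_point \<alpha>) \<rho>"
    using tilted_at[of "curve_point \<alpha>"] X1 oc by (auto simp: on_curve_def \<alpha>_def)
  then interpret T: tilted_renewal M \<xi> X "curve_point \<alpha>" \<rho> .
  show "main_term n x > 0" unfolding eq
    using T.psi1_pos on_curve_mean_pos[OF oc] C_fun_eq(2)[OF r X1] I_fun_pos[OF r] n
    by (intro divide_pos_pos mult_pos_pos) (auto simp: \<alpha>_def)
qed

text \<open>If the claim failed there would be violations with n arbitrarily large; by compactness
  their ratios x / n converge along a subsequence to a point of K, where the asymptotics along
  sequences give quotient 1.\<close>

lemma Z_process_uniform:
  assumes K: "compact K" "K \<subseteq> regular_range M \<xi>" and X1: "curve_point ` K \<subseteq> interior (psi_dom M (X 1))"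
    and tail: "0 \<in> K \<Longrightarrow> (\<lambda>n. sqrt (real n) * exp (lambda_of M \<xi> 0 * real n) * prob {\<omega>\<in>space M. X 1 \<omega> $ 1 \<ge> real n}) \<longlonglongrightarrow> 0"
    and e: "e > 0"
  shows "eventually (\<lambda>n. \<forall>x. real_of_int x / real n \<in> K \<longrightarrow>
      \<bar>prob {\<omega>\<in>space M. Z_process X (real n) \<omega> = real_of_int x} / main_term n x - 1\<bar> \<le> e) sequentially"
proof (rule ccontr)
  define P where "P n x = prob {\<omega>\<in>space M. Z_process X (real n) \<omega> = real_of_int x}" for n :: nat and x :: int
  assume "\<not> ?thesis"
  then have "\<forall>j. \<exists>n x. n \<ge> Suc j \<and> real_of_int x / real n \<in> K \<and> \<bar>P n x / main_term n x - 1\<bar> > e"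
    unfolding eventually_sequentially P_def by (auto simp: not_le)
  then obtain n x where nx: "\<And>j. n j \<ge> Suc j" "\<And>j. real_of_int (x j) / real (n j) \<in> K" "\<And>j. \<bar>P (n j) (x j) / main_term (n j) (x j) - 1\<bar> > e"
    by metis
  define b where "b j = real_of_int (x j) / real (n j)" for j
  obtain \<alpha> r where r: "\<alpha> \<in> K" "strict_mono r" "(b \<circ> r) \<longlonglongrightarrow> \<alpha>"
    using K(1) nx(2) unfolding compact_def b_def[symmetric] by metis
  have \<alpha>: "\<alpha> \<in> regular_range M \<xi>" using r(1) K(2) by blast
  have bK: "b j \<in> regular_range M \<xi>" for j using nx(2) K(2) by (auto simp: b_def)
  have oc: "on_curve (curve_point \<alpha>)" by (rule regular_rangeD(4)[OF \<alpha>])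
  obtain \<rho> where "tilted_renewal M \<xi> X (curve_point \<alpha>) \<rho>"
    using tilted_at[of "curve_point \<alpha>"] X1 r(1) oc by (auto simp: on_curve_def)
  then interpret T: tilted_renewal M \<xi> X "curve_point \<alpha>" \<rho> .
  have "(\<lambda>j. curve_point ((b \<circ> r) j)) \<longlonglongrightarrow> curve_point \<alpha>"
    by (rule curve_point_tendsto[OF _ \<alpha> r(3)]) (simp add: bK)
  then have "eventually (\<lambda>j. dist (curve_point ((b \<circ> r) j)) (curve_point \<alpha>) < \<rho> / 4) sequentially"
    by (rule tendstoD) (use T.rho_pos in simp)
  then obtain j0 where j0: "\<And>j. j \<ge> j0 \<Longrightarrow> dist (curve_point ((b \<circ> r) j)) (curve_point \<alpha>) < \<rho> / 4"
    unfolding eventually_sequentially by blast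
  \<comment> \<open>The estimates around the base point are required at every index, so the
    subsequence starts once the tilts are within \<rho>/4.\<close>
  define s where "s j = r (j + j0)" for j
  define N where "N j = n (s j)" for j
  define Y where "Y j = x (s j)" for j
  define a where "a j = b (s j)" for j
  have sj: "s j \<ge> j" for j using seq_suble[OF r(2), of "j + j0"] by (simp add: s_def)
  have N: "N j \<ge> Suc j" for j using nx(1)[of "s j"] sj[of j] by (simp add: N_def)
  have N1: "N j \<ge> 1" for j using N[of j] by simp
  have Ntop: "filterlim N at_top sequentially"
    unfolding filterlim_at_top eventually_sequentially
    using N by (metis Suc_leD le_trans)
  have a_eq: "a j = real_of_int (Y j) / real (N j)" for j by (simp add: a_def b_def Y_def N_def)
  have at: "a \<longlonglongrightarrow> \<alpha>" using LIMSEQ_ignore_initial_segment[OF r(3), of j0] by (simp add: a_def[abs_def] s_def comp_def)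
  have aK: "a j \<in> K" for j using nx(2)[of "s j"] by (simp add: a_def b_def)
  have ar: "a j \<in> regular_range M \<xi>" for j using aK K(2) by blast
  have d: "dist (curve_point (a j)) (curve_point \<alpha>) \<le> \<rho> / 4" for j using j0[of "j + j0"] by (simp add: a_def s_def less_imp_le)
  \<comment> \<open>Y j = 0 means a j = 0, which happens only if 0 belongs to K; the tail condition
    is therefore called upon in that case alone.\<close>
  have tl: "(\<lambda>j. if Y j = 0 then sqrt (N j) * exp (lambda_of M \<xi> (a j) * N j) * prob {\<omega>\<in>space M. X 1 \<omega> $ 1 \<ge> real (N j)} else 0) \<longlonglongrightarrow> 0"
  proof (cases "0 \<in> K")
    case True
    define u where "u n = sqrt (real n) * exp (lambda_of M \<xi> 0 * real n) * prob {\<omega>\<in>space M. X 1 \<omega> $ 1 \<ge> real n}" for n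
    have "u \<longlonglongrightarrow> 0" using tail[OF True] by (simp add: u_def[abs_def])
    then have u: "(\<lambda>j. u (N j)) \<longlonglongrightarrow> 0" by (rule filterlim_compose[OF _ Ntop])
    show ?thesis
    proof (rule Lim_null_comparison[OF _ u])
      show "\<forall>\<^sub>F j in sequentially. norm (if Y j = 0 then sqrt (N j) * exp (lambda_of M \<xi> (a j) * N j) * prob {\<omega>\<in>space M. X 1 \<omega> $ 1 \<ge> real (N j)} else 0) \<le> u (N j)"
        by (intro always_eventually allI) (simp add: u_def a_eq)
    qed
  next
    case False
    then have "Y j \<noteq> 0" for j using aK[of j] by (auto simp: a_eq)
    then show ?thesis by simp
  qed
  define c where "c p = psi1 p * sqrt (mean p $ 1 / (2 * pi * line_var p))" for p
  have lim1: "(\<lambda>j. sqrt (N j) * (exp (lambda_of M \<xi> (a j) * N j + mu_of M \<xi> (a j) * Y j) * P (N j) (Y j))) \<longlonglongrightarrow> c (curve_point \<alpha>) * I_fun M \<xi> \<alpha>"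
    unfolding P_def c_def by (rule T.Z_process_limit[OF refl \<alpha> ar a_eq at d Ntop N1 tl])
  have pt: "(\<lambda>j. curve_point (a j)) \<longlonglongrightarrow> curve_point \<alpha>" by (rule curve_point_tendsto[OF ar \<alpha> at])
  have X1\<alpha>: "curve_point \<alpha> \<in> interior (psi_dom M (X 1))" using X1 r(1) by blast
  have lv: "line_var (curve_point \<alpha>) > 0" by (rule C_fun_eq(2)[OF \<alpha> X1\<alpha>])
  have lt: "(\<lambda>j. lambda_of M \<xi> (a j)) \<longlonglongrightarrow> lambda_of M \<xi> \<alpha>"
    using tendsto_vec_nth[OF pt, of 1] by (simp add: curve_point_def)
  have ct: "(\<lambda>j. c (curve_point (a j))) \<longlonglongrightarrow> c (curve_point \<alpha>)" unfolding c_def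
    using lv by (intro tendsto_intros T.psi1_tendsto T.line_var_tendsto tendsto_vec_nth[OF T.mean_tendsto] pt d) auto
  have lim2: "(\<lambda>j. c (curve_point (a j)) * I_fun M \<xi> (a j)) \<longlonglongrightarrow> c (curve_point \<alpha>) * I_fun M \<xi> \<alpha>"
    by (intro tendsto_mult ct I_fun_tendsto[OF \<alpha> lt])
  have "c (curve_point \<alpha>) > 0" unfolding c_def using T.psi1_pos lv on_curve_mean_pos[OF oc] by (intro mult_pos_pos) auto
  then have cI: "c (curve_point \<alpha>) * I_fun M \<xi> \<alpha> \<noteq> 0" using I_fun_pos[OF \<alpha>] by simp
  have "(\<lambda>j. P (N j) (Y j) / main_term (N j) (Y j)) \<longlonglongrightarrow> (c (curve_point \<alpha>) * I_fun M \<xi> \<alpha>) / (c (curve_point \<alpha>) * I_fun M \<xi> \<alpha>)"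
  proof -
    have eq: "P (N j) (Y j) / main_term (N j) (Y j)
      = (sqrt (N j) * (exp (lambda_of M \<xi> (a j) * N j + mu_of M \<xi> (a j) * Y j) * P (N j) (Y j))) / (c (curve_point (a j)) * I_fun M \<xi> (a j))" for j
    proof -
      have Xa: "curve_point (a j) \<in> interior (psi_dom M (X 1))" using X1 aK by blast
      show ?thesis
        using main_term_eq(1)[of "Y j" "N j"] ar[of j] Xa N1[of j] unfolding a_eq[symmetric] by (simp add: c_def a_eq[symmetric])
    qed
    show ?thesis unfolding eq by (intro tendsto_divide lim1 lim2 cI)
  qed
  then have "(\<lambda>j. P (N j) (Y j) / main_term (N j) (Y j)) \<longlonglongrightarrow> 1" using cI by simp
  then have "eventually (\<lambda>j. dist (P (N j) (Y j) / main_term (N j) (Y j)) 1 < e) sequentially" using e by (simp add: tendsto_iff)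
  then obtain j where "dist (P (N j) (Y j) / main_term (N j) (Y j)) 1 < e" unfolding eventually_sequentially by blast
  then show False using nx(3)[of "s j"] by (simp add: dist_real_def N_def Y_def)
qed

end

text \<open>The supremum is taken in \<open>ennreal\<close>, where an empty index set gives 0;
  values of n without admissible x are thus covered.\<close>

lemma SUP_ennreal_tendsto_0:
  fixes f :: "nat \<Rightarrow> 'b \<Rightarrow> real"
  assumes "\<And>e. e > 0 \<Longrightarrow> eventually (\<lambda>n. \<forall>x\<in>A n. f n x \<le> e) sequentially"
  shows "(\<lambda>n. SUP x\<in>A n. ennreal (f n x)) \<longlonglongrightarrow> 0"
proof (rule order_tendstoI)
  fix y :: ennreal assume "0 < y"
  then obtain z where z: "0 < z" "z < y" using dense by blast
  then obtain e where e: "z = ennreal e" "e > 0" by (cases z) (auto simp: top_unique)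
  show "\<forall>\<^sub>F n in sequentially. (SUP x\<in>A n. ennreal (f n x)) < y"
    using assms[OF e(2)]
  proof eventually_elim
    case (elim n)
    have "(SUP x\<in>A n. ennreal (f n x)) \<le> z" unfolding e(1) using elim by (intro SUP_least ennreal_leI) auto
    then show ?case using z(2) by (rule le_less_trans)
  qed
qed simp

theorem theorem2p1:
  fixes M :: "'a measure" and \<xi> :: "'a \<Rightarrow> real ^ 2" and X :: "nat \<Rightarrow> 'a \<Rightarrow> real ^ 2"
    and K :: "real set"
  assumes "arithmetic_compound_renewal M \<xi> X"
    and "compact K"
    and "K \<subseteq> regular_range M \<xi>"
    and "(\<lambda>\<alpha>. vec2 (lambda_of M \<xi> \<alpha>) (mu_of M \<xi> \<alpha>)) ` K \<subseteq> interior (psi_dom M (X 1))"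
    and "0 \<in> K \<Longrightarrow>
      (\<lambda>n. \<P>(\<omega> in M. X 1 \<omega> $ 1 \<ge> real n))
        \<in> o(\<lambda>n. 1 / sqrt (real n) * exp (- real n * real_of_ereal (D_fun M \<xi> 0)))"
  shows "\<exists>\<epsilon> :: nat \<Rightarrow> int \<Rightarrow> real.
      (\<forall>n x. n > 0 \<longrightarrow> real_of_int x / real n \<in> K \<longrightarrow>
        (let \<alpha> = real_of_int x / real n in
          \<P>(\<omega> in M. Z_process X (real n) \<omega> = real_of_int x) =
            enn2real (psi M (X 1) (vec2 (lambda_of M \<xi> \<alpha>) (mu_of M \<xi> \<alpha>)))
            * (C_fun M \<xi> \<alpha> / sqrt (real n)) * exp (- real n * real_of_ereal (D_fun M \<xi> \<alpha>))
            * I_fun M \<xi> \<alpha> * (1 + \<epsilon> n x)))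
      \<and> (\<lambda>n. SUP x\<in>{x. real_of_int x / real n \<in> K}. ennreal \<bar>\<epsilon> n x\<bar>) \<longlonglongrightarrow> 0"
proof -
  interpret arithmetic_compound_renewal M \<xi> X by fact
  have X1: "curve_point ` K \<subseteq> interior (psi_dom M (X 1))" using assms(4) by (simp add: curve_point_def[abs_def])
  \<comment> \<open>At \<alpha> = 0 the value D(0) is \<lambda>(0), so the little-o condition is the
    required decay after clearing the denominator.\<close>
  have tail: "(\<lambda>n. sqrt (real n) * exp (lambda_of M \<xi> 0 * real n) * prob {\<omega>\<in>space M. X 1 \<omega> $ 1 \<ge> real n}) \<longlonglongrightarrow> 0"
    if "0 \<in> K"
  proof -
    have D0: "real_of_ereal (D_fun M \<xi> 0) = lambda_of M \<xi> 0" using D_fun_eq[of 0] assms(3) that by auto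
    have "(\<lambda>n. prob {\<omega>\<in>space M. X 1 \<omega> $ 1 \<ge> real n} / (1 / sqrt (real n) * exp (- real n * lambda_of M \<xi> 0))) \<longlonglongrightarrow> 0"
      using smalloD_tendsto[OF assms(5)[OF that]] unfolding D0 .
    moreover have "prob {\<omega>\<in>space M. X 1 \<omega> $ 1 \<ge> real n} / (1 / sqrt (real n) * exp (- real n * lambda_of M \<xi> 0))
        = sqrt (real n) * exp (lambda_of M \<xi> 0 * real n) * prob {\<omega>\<in>space M. X 1 \<omega> $ 1 \<ge> real n}" for n
      by (simp add: exp_minus divide_inverse mult_ac)
    ultimately show ?thesis by simp
  qed
  \<comment> \<open>The relative error; for n > 0 and x / n in K the main term is positive, so the
    formula can be solved for the remainder.\<close>
  define \<epsilon> where "\<epsilon> n x = prob {\<omega>\<in>space M. Z_process X (real n) \<omega> = real_of_int x} / main_term n x - 1" for n x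
  show ?thesis
  proof (intro exI[of _ \<epsilon>] conjI allI impI)
    fix n :: nat and x :: int assume n: "n > 0" and xK: "real_of_int x / real n \<in> K"
    have "main_term n x > 0" by (rule main_term_eq(2)) (use n xK assms(3) X1 in auto)
    then have "prob {\<omega>\<in>space M. Z_process X (real n) \<omega> = real_of_int x} = main_term n x * (1 + \<epsilon> n x)"
      by (simp add: \<epsilon>_def)
    then show "let \<alpha> = real_of_int x / real n in
          \<P>(\<omega> in M. Z_process X (real n) \<omega> = real_of_int x) =
            enn2real (psi M (X 1) (vec2 (lambda_of M \<xi> \<alpha>) (mu_of M \<xi> \<alpha>)))
            * (C_fun M \<xi> \<alpha> / sqrt (real n)) * exp (- real n * real_of_ereal (D_fun M \<xi> \<alpha>))
            * I_fun M \<xi> \<alpha> * (1 + \<epsilon> n x)"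
      unfolding main_term_def Let_def curve_point_def .
  next
    show "(\<lambda>n. SUP x\<in>{x. real_of_int x / real n \<in> K}. ennreal \<bar>\<epsilon> n x\<bar>) \<longlonglongrightarrow> 0"
      by (rule SUP_ennreal_tendsto_0) (use Z_process_uniform[OF assms(2,3) X1 tail] in \<open>simp add: \<epsilon>_def\<close>)
  qed
qed

end
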